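(* Let $n\ge1$ be an integer. The set $\{j^{0,k},j^{1,k},j^{+,k},j^{-,k}\mid k=0,1,\dots,n-1\}$ (of $4n$ fields) is a minimal strong generating set for the vertex algebra $\mathcal V_n(\widehat{\mathcal{SD}})$; that is, $\mathcal V_n(\widehat{\mathcal{SD}})$ is spanned by $1$ and the normally ordered monomials $:\partial^{i_1}a_1\cdots\partial^{i_r}a_r:$ with $a_1,\dots,a_r$ in this set and $i_1,\dots,i_r\ge0$, and no proper subset has this property.
   Context: Let $D=t\frac{d}{dt}$. The Lie superalgebra $\mathcal{SD}$ of regular differential operators on the super circle is spanned by the elements $t^rF(D)$, $r\in\mathbb Z$, where $F(D)=\begin{pmatrix} f_0(D)&f_+(D)\\ f_-(D)&f_1(D)\end{pmatrix}$ with $f_a\in\mathbb C[x]$; diagonal entries are even and off-diagonal entries are odd. Its central extension $\widehat{\mathcal{SD}}=\mathcal{SD}\oplus\mathbb C C$ ($C$ central) has bracket $[t^rF(D),t^sG(D)]=t^{r+s}\big(F(D+s)G(D)-(-1)^{|F||G|}F(D)G(D+r)\big)+\Psi(t^rF(D),t^sG(D))\,C$, where $\Psi(t^rF(D),t^sG(D))=\sum_{j=-r}^{-1}\mathrm{Str}(F(j)G(j+r))$ if $r=-s\ge 0$ (extended by super-skew-symmetry) and $\Psi=0$ if $r+s\ne0$; here $\mathrm{Str}\begin{pmatrix}\alpha^0&\alpha^+\\ \alpha^-&\alpha^1\end{pmatrix}=\alpha^0-\alpha^1$. Let $M_0=E_{11}$, $M_1=E_{22}$, $M_+=E_{12}$,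 $M_-=E_{21}$ (matrix units), and for $a\in\{0,1,+,-\}$, $k\in\mathbb Z_{\ge0}$, $n\in\mathbb Z$ put $J^{a,k}_n=-t^{k+n}\partial_t^k M_a$. Let $\widehat{\mathcal{SP}}$ be the span of $C$ and of all $J^{a,k}_n$ with $k+n\ge0$; for $c\in\mathbb C$ let $\mathbb C_c$ be the one-dimensional $\widehat{\mathcal{SP}}$-module on which $C$ acts by $c$ and every $J^{a,k}_n$ acts by $0$. The vacuum module of central charge $c$ is $\mathcal M_c(\widehat{\mathcal{SD}})=U(\widehat{\mathcal{SD}})\otimes_{U(\widehat{\mathcal{SP}})}\mathbb C_c$; it is a vertex superalgebra freely generated by the fields $J^{a,k}(z)=\sum_{n\in\mathbb Z}J^{a,k}_nz^{-n-k-1}$, $k\ge0$, where $J^{0,k},J^{1,k}$ are even of conformal weight $k+1$, $J^{+,k}$ is odd of weight $k+\tfrac12$ and $J^{-,k}$ is odd of weight $k+\tfrac32$. Write $a\circ_m b$ for the $m$-th product of fields. A weight-homogeneous $\omega\in\mathcal M_c(\widehat{\mathcal{SD}})$ is a singular vector if $J^{0,k}\circ_m\omega=J^{1,k}\circ_m\omega=J^{-,k}\circ_m\omega=0$ for all $m>k\ge0$ and $J^{+,k}\circ_r\omega=0$ for all $r\ge k\ge0$. $\mathcal{SI}_c$ denotes the vertex algebra ideal generated by all singular vectors not proportional to the vacuum $1$ (the maximal proper graded submodule). The super $\mathcal W_{1+\infty}$ algebra is $\mathcal V_c(\widehat{\mathcal{SD}})=\mathcal M_c(\widehat{\mathcal{SD}})/\mathcal{SI}_c$,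 and $j^{a,k}$ denotes the image of $J^{a,k}$ in it.
   Formalization: The bracket's second term is taken as G(D+r)F(D), the true supercommutator, in place of the printed F(D)G(D+r), which for matrix-valued F, G is not super-skew-symmetric ([M_+,M_-]=2E_11 but [M_-,M_+]=2E_22). *)

theory Defs
  imports Complex_Main "HOL-Computational_Algebra.Polynomial"
begin

text \<open>Matrix units: M0 = E11, M1 = E22, Mp = E12, Mm = E21.\<close>
datatype mtyp = M0 | M1 | Mp | Mm

text \<open>Basis of the centrally extended Lie superalgebra:
  Mon r a k stands for t^r D^k M_a, and Cen for the central element C.\<close>
datatype sidx = Mon int mtyp nat | Cen

fun mpar :: "mtyp \<Rightarrow> nat" where
  "mpar Mp = 1" | "mpar Mm = 1" | "mpar M0 = 0" | "mpar M1 = 0"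

fun spar :: "sidx \<Rightarrow> nat" where
  "spar (Mon r a k) = mpar a" | "spar Cen = 0"

definition ssign :: "sidx \<Rightarrow> sidx \<Rightarrow> complex" where
  "ssign x y = (-1) ^ (spar x * spar y)"

text \<open>Product of matrix units (None = zero matrix).\<close>
fun mmul :: "mtyp \<Rightarrow> mtyp \<Rightarrow> mtyp option" where
  "mmul M0 M0 = Some M0" | "mmul M0 Mp = Some Mp"
| "mmul Mp Mm = Some M0" | "mmul Mp M1 = Some Mp"
| "mmul Mm M0 = Some Mm" | "mmul Mm Mp = Some M1"
| "mmul M1 Mm = Some Mm" | "mmul M1 M1 = Some M1"
| "mmul _ _ = None"

fun mstr :: "mtyp \<Rightarrow> complex" where
  "mstr M0 = 1" | "mstr M1 = -1" | "mstr Mp = 0" | "mstr Mm = 0"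

definition strprod :: "mtyp \<Rightarrow> mtyp \<Rightarrow> complex" where
  "strprod a b = (case mmul a b of Some c \<Rightarrow> mstr c | None \<Rightarrow> 0)"

definition mcoef :: "mtyp \<Rightarrow> mtyp \<Rightarrow> mtyp \<Rightarrow> complex" where
  "mcoef a b c = (if mmul a b = Some c then 1 else 0)"

definition shpow :: "int \<Rightarrow> nat \<Rightarrow> complex poly" where
  "shpow s k = [:of_int s, 1:] ^ k"

text \<open>Cocycle for r = -s \<ge> 0: sum over j=-r..-1 of Str(F(j) G(j+r)) with F = D^k M_a, G = D^l M_b.\<close>
definition psi0 :: "int \<Rightarrow> mtyp \<Rightarrow> nat \<Rightarrow> int \<Rightarrow> mtyp \<Rightarrow> nat \<Rightarrow> complex" where
  "psi0 r a k s b l = (\<Sum>j\<in>{-r..-1}. strprod a b * (of_int j) ^ k * (of_int (j + r)) ^ l)"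

definition psi :: "int \<Rightarrow> mtyp \<Rightarrow> nat \<Rightarrow> int \<Rightarrow> mtyp \<Rightarrow> nat \<Rightarrow> complex" where
  "psi r a k s b l =
     (if r + s \<noteq> 0 then 0
      else if r \<ge> 0 then psi0 r a k s b l
      else - ((-1) ^ (mpar a * mpar b)) * psi0 s b l r a k)"

text \<open>Structure constants: brk x y z is the coefficient of the basis element z in the
  supercommutator [x,y] = x y - (-1)^(|x||y|) y x (including the central term).
  [t^r D^k M_a, t^s D^l M_b] = t^(r+s) ((D+s)^k D^l M_a M_b - sign (D+r)^l D^k M_b M_a) + psi C.\<close>
fun brk :: "sidx \<Rightarrow> sidx \<Rightarrow> sidx \<Rightarrow> complex" where
  "brk (Mon r a k) (Mon s b l) (Mon q c j) =
     (if q = r + s then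
        mcoef a b c * coeff (shpow s k * monom 1 l) j
        - (-1) ^ (mpar a * mpar b) * mcoef b a c * coeff (shpow r l * monom 1 k) j
      else 0)"
| "brk (Mon r a k) (Mon s b l) Cen = psi r a k s b l"
| "brk _ _ _ = 0"

section \<open>Tensor algebra of the Lie superalgebra (words in basis letters)\<close>

type_synonym telt = "sidx list \<Rightarrow> complex"

definition wd :: "sidx list \<Rightarrow> telt" where
  "wd u = (\<lambda>w. if w = u then 1 else 0)"

definition conv :: "telt \<Rightarrow> telt \<Rightarrow> telt" (infixl "\<star>" 70) where
  "conv f g = (\<lambda>w. \<Sum>i\<le>length w. f (take i w) * g (drop i w))"

definition tadd :: "telt \<Rightarrow> telt \<Rightarrow> telt" (infixl "\<oplus>" 65) where
  "tadd f g = (\<lambda>w. f w + g w)"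

definition tsub :: "telt \<Rightarrow> telt \<Rightarrow> telt" (infixl "\<ominus>" 65) where
  "tsub f g = (\<lambda>w. f w - g w)"

definition scl :: "complex \<Rightarrow> telt \<Rightarrow> telt" where
  "scl c f = (\<lambda>w. c * f w)"

definition letters :: "(sidx \<Rightarrow> complex) \<Rightarrow> telt" where
  "letters h = (\<lambda>w. case w of [z] \<Rightarrow> h z | _ \<Rightarrow> 0)"

definition Tfin :: "telt set" where
  "Tfin = {f. finite {w. f w \<noteq> 0}}"

inductive_set lspan :: "telt set \<Rightarrow> telt set" for S where
  zero: "(\<lambda>w. 0) \<in> lspan S"
| base: "f \<in> S \<Longrightarrow> f \<in> lspan S"
| add: "f \<in> lspan S \<Longrightarrow> g \<in> lspan S \<Longrightarrow> f \<oplus> g \<in> lspan S"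
| scale: "f \<in> lspan S \<Longrightarrow> scl c f \<in> lspan S"

text \<open>The falling factorial D(D-1)...(D-k+1), so that t^(k+n) d_t^k = t^n [D]_k.\<close>
definition ffp :: "nat \<Rightarrow> complex poly" where
  "ffp k = (\<Prod>i<k. [:- of_nat i, 1:])"

text \<open>J^{a,k}_n = - t^(k+n) d_t^k M_a = - t^n [D]_k M_a, as an element of the tensor algebra.\<close>
definition Jel :: "mtyp \<Rightarrow> nat \<Rightarrow> int \<Rightarrow> telt" where
  "Jel a k n = letters (\<lambda>z. case z of
       Mon q b j \<Rightarrow> (if q = n \<and> b = a then - coeff (ffp k) j else 0)
     | Cen \<Rightarrow> 0)"

section \<open>The vacuum module M_c = U(SD^) \<otimes>_{U(SP^)} C_c as a quotient of the tensor algebra\<close>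

text \<open>Relations: the two-sided ideal defining U from the tensor algebra, plus the left ideal
  generated by SP^ acting as the character of C_c.\<close>
definition Rgen :: "complex \<Rightarrow> telt set" where
  "Rgen c =
     {wd u \<star> (wd [x, y] \<ominus> scl (ssign x y) (wd [y, x]) \<ominus> letters (brk x y)) \<star> wd v | u v x y. True}
   \<union> {wd u \<star> Jel a k n | u a k n. n + int k \<ge> 0}
   \<union> {wd u \<star> (wd [Cen] \<ominus> scl c (wd [])) | u. True}"

definition Krel :: "complex \<Rightarrow> telt set" where
  "Krel c = lspan (Rgen c)"

text \<open>Doubled conformal weight of a letter (J^{a,k}_n has degree -n, -(n+1/2), 1/2-n for
  a even, a = +, a = - respectively) and of a word.\<close>
fun lwt :: "sidx \<Rightarrow> int" where
  "lwt (Mon r Mp k) = - 2 * r - 1"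
| "lwt (Mon r Mm k) = 1 - 2 * r"
| "lwt (Mon r M0 k) = - 2 * r"
| "lwt (Mon r M1 k) = - 2 * r"
| "lwt Cen = 0"

definition wwt :: "sidx list \<Rightarrow> int" where
  "wwt w = sum_list (map lwt w)"

definition wcomp :: "int \<Rightarrow> telt \<Rightarrow> telt" where
  "wcomp d f = (\<lambda>w. if wwt w = d then f w else 0)"

text \<open>Graded submodules of M_c, represented by their preimages N (containing Krel c) in the tensor algebra.\<close>
definition graded_submod :: "complex \<Rightarrow> telt set \<Rightarrow> bool" where
  "graded_submod c N \<longleftrightarrow>
     N \<subseteq> Tfin \<and> Krel c \<subseteq> N
     \<and> (\<forall>f\<in>N. \<forall>g\<in>N. f \<oplus> g \<in> N)
     \<and> (\<forall>f\<in>N. \<forall>a. scl a f \<in> N)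
     \<and> (\<forall>f\<in>N. \<forall>x. wd [x] \<star> f \<in> N)
     \<and> (\<forall>f\<in>N. \<forall>d. wcomp d f \<in> N)"

text \<open>Preimage of SI_c, the maximal proper graded submodule of M_c.\<close>
definition SI :: "complex \<Rightarrow> telt set" where
  "SI c = \<Union>{N. graded_submod c N \<and> wd [] \<notin> N}"

text \<open>For the field J^{a,k}(z) = sum_n J^{a,k}_n z^(-n-k-1), the m-th product mode is J^{a,k}_{m-k},
  and (d^i a)_{(-1)} = i! a_{(-1-i)}.  A triple (a,k,i) stands for d^i j^{a,k}; the state of
  :d^{i1}a1 ... d^{ir}ar: is (d^{i1}a1)_{(-1)} ... (d^{ir}ar)_{(-1)} 1.\<close>
fun nmono :: "(mtyp \<times> nat \<times> nat) list \<Rightarrow> telt" where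
  "nmono [] = wd []"
| "nmono ((a, k, i) # ms) = scl (fact i) (Jel a k (- 1 - int i - int k)) \<star> nmono ms"

definition nmonos :: "(mtyp \<times> nat) set \<Rightarrow> telt set" where
  "nmonos S = {nmono ms | ms. \<forall>(a, k, i) \<in> set ms. (a, k) \<in> S}"

text \<open>S strongly generates V_c = M_c / SI_c: every element of V_c is a linear combination of 1
  and normally ordered monomials in the images of the fields from S.\<close>
definition strongly_generates :: "complex \<Rightarrow> (mtyp \<times> nat) set \<Rightarrow> bool" where
  "strongly_generates c S \<longleftrightarrow>
     (\<forall>f\<in>Tfin. \<exists>g\<in>lspan ({wd []} \<union> nmonos S). f \<ominus> g \<in> SI c)"

end

theory Submission
  imports Defs "HOL-Library.Function_Algebras"
begin

text \<open>The algebra of central charge \<open>N\<close> acts on the Fock space of \<open>N\<close> pairs of fermions and \<open>N\<close> pairs of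
  bosons by bilinears summed over the colours, and vacuum expectation values define a functional on words.
  For positive weight reasons a word of weight zero acts by the same scalar on every vacuum vector, so
  the simple quotient is the quotient by the vectors all of whose expectation values vanish.

  Strong generation: for at most \<open>n\<close> colours the \<open>(n+1)\<close>-st power of a fermionic bilinear vanishes. The
  power is a combination of words that does not depend on the number \<open>N\<close> of colours. Applying the
  power of \<open>t\<close> that returns to the vacuum turns it into a polynomial in \<open>N\<close> of degree \<open>n+1\<close> with roots \<open>0, \<dots>, n\<close>.
  Its linear coefficient is therefore nonzero, which means that the relation expresses \<open>j\<^sup>0\<^sup>,\<^sup>n\<close> through
  products and derivatives. Zero modes and one further mode carry this to all \<open>j\<^sup>a\<^sup>,\<^sup>k\<close> with \<open>k \<ge> n\<close>.

  Minimality: a relation expressing a generator of weight \<open>m \<le> n\<close> involves words of length at most \<open>m\<close>.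
  Contracting the supersymmetrized leading tensor, of length \<open>r\<close>, of such a relation with one annihilation
  letter produces \<open>n r\<close> times its slice, from the central term, plus corrections bounded by \<open>r (r - 1)\<close> times
  its supremum norm. For \<open>r \<le> n\<close> the leading tensor therefore vanishes, and the length goes down.\<close>

section \<open>Letters with polynomial coefficients\<close>

text \<open>A vector \<open>w\<close> applied to the vacuum is stored as the functional that sends
  \<open>u\<close> to the expectation value of \<open>u @ w\<close>. Vectors then have equal
  functionals exactly when they agree modulo the radical, so relations in the simple quotient are
  equations between functions. The price is that a vector does not visibly determine its leading
  tensor. Minimality rests on showing that it does, up to supersymmetry, for lengths
  \<open>r \<le> n\<close>: the corrections weigh \<open>r - 1\<close> against a main term of weight
  \<open>n\<close>, and below this threshold an entry of largest modulus dominates. Single letters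
  are not cleanly separated from products either, since brackets of creation letters are single
  letters. Such brackets lose one degree in \<open>D\<close> and are derivatives of generators.
  Hence only the top coefficient of a letter has a meaning modulo products and derivatives, and both
  halves of the proof are statements about this coefficient. They use the grading by the power of
  \<open>t\<close>, in which all four \<open>j^{a,k}\<close> have degree \<open>k + 1\<close>; the
  conformal weight enters only through \<open>SI\<close>.\<close>

text \<open>\<open>(r, a, f)\<close> stands for \<open>t\<^sup>r f(D)\<close> times the matrix unit \<open>a\<close>, whose row and column are \<open>rw a\<close> and \<open>cl a\<close>;
  \<open>br1\<close>, \<open>br2\<close> and \<open>cen\<close> are the two terms and the central term of the bracket.\<close>

type_synonym xl = "int \<times> mtyp \<times> complex poly"

fun rw :: "mtyp \<Rightarrow> bool" where
  "rw M0 = False" | "rw Mp = False" | "rw M1 = True" | "rw Mm = True"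

fun cl :: "mtyp \<Rightarrow> bool" where
  "cl M0 = False" | "cl Mm = False" | "cl M1 = True" | "cl Mp = True"

fun mk :: "bool \<Rightarrow> bool \<Rightarrow> mtyp" where
  "mk False False = M0" | "mk False True = Mp" | "mk True False = Mm" | "mk True True = M1"

lemma rw_mk [simp]: "rw (mk s t) = s" by (cases s; cases t) auto
lemma cl_mk [simp]: "cl (mk s t) = t" by (cases s; cases t) auto
lemma mk_rw_cl [simp]: "mk (rw a) (cl a) = a" by (cases a) auto

definition sgn2 :: "bool \<Rightarrow> bool \<Rightarrow> complex" where
  "sgn2 p q = (if p \<and> q then -1 else 1)"

definition oda :: "mtyp \<Rightarrow> bool" where
  "oda a \<longleftrightarrow> rw a \<noteq> cl a"

fun odx :: "xl \<Rightarrow> bool" where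
  "odx (r, a, f) = oda a"

definition psh :: "int \<Rightarrow> complex poly \<Rightarrow> complex poly" where
  "psh s f = pcompose f [:of_int s, 1:]"

lemma poly_psh [simp]: "poly (psh s f) x = poly f (x + of_int s)"
  by (simp add: psh_def poly_pcompose add.commute)

lemma psh_add: "psh s (f + g) = psh s f + psh s g"
  by (simp add: psh_def pcompose_add)

lemma psh_smult: "psh s (smult c f) = smult c (psh s f)"
  by (simp add: psh_def pcompose_smult)

text \<open>\<open>stra\<close> is the sign of the supertrace on the two diagonal entries.\<close>

definition stra :: "bool \<Rightarrow> complex" where
  "stra s = (if s then -1 else 1)"

fun br1 :: "xl \<Rightarrow> xl \<Rightarrow> xl" where
  "br1 (r, a, f) (s, b, g) = (r + s, mk (rw a) (cl b), if cl a = rw b then psh s f * g else 0)"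

fun br2 :: "xl \<Rightarrow> xl \<Rightarrow> xl" where
  "br2 (r, a, f) (s, b, g) = (r + s, mk (rw b) (cl a),
     if cl b = rw a then smult (- sgn2 (oda a) (oda b)) (psh r g * f) else 0)"

definition trp :: "int \<Rightarrow> mtyp \<Rightarrow> complex poly \<Rightarrow> int \<Rightarrow> mtyp \<Rightarrow> complex poly \<Rightarrow> complex" where
  "trp r a f s b g = (if cl a = rw b \<and> cl b = rw a
     then stra (rw a) * (\<Sum>j\<in>{-r..-1}. poly f (of_int j) * poly g (of_int (j + r))) else 0)"

fun cen :: "xl \<Rightarrow> xl \<Rightarrow> complex" where
  "cen (r, a, f) (s, b, g) = (if r + s \<noteq> 0 then 0
     else if r \<ge> 0 then trp r a f s b g else - sgn2 (oda a) (oda b) * trp s b g r a f)"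

section \<open>Free fields\<close>

text \<open>\<open>Ps i s j\<close> and \<open>Pd i s j\<close> are the modes of the \<open>i\<close>-th pair of conjugate fields, fermionic for
  \<open>s = False\<close> and bosonic for \<open>s = True\<close>; vectors of the Fock space are represented by the linear
  functionals (on words in the modes) that respect the relations of the modes.\<close>

datatype osc = Ps nat bool int | Pd nat bool int

fun fo :: "osc \<Rightarrow> bool" where
  "fo (Ps i s j) = (\<not> s)" | "fo (Pd i s j) = (\<not> s)"

fun ann :: "osc \<Rightarrow> bool" where
  "ann (Ps i s j) = (j \<ge> 0)" | "ann (Pd i s j) = (j < 0)"

text \<open>The vacuum expectation value of a two-letter word: nonzero only for an annihilator to
  the left of its conjugate creator.\<close>

fun ctr :: "osc \<Rightarrow> osc \<Rightarrow> complex" where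
  "ctr (Pd i s j) (Ps i' s' j') = (if i = i' \<and> s = s' \<and> j = j' \<and> j < 0 then 1 else 0)"
| "ctr (Ps i s j) (Pd i' s' j') = (if i = i' \<and> s = s' \<and> j = j' \<and> j \<ge> 0 then stra s else 0)"
| "ctr _ _ = 0"

definition so :: "osc \<Rightarrow> osc \<Rightarrow> complex" where
  "so a b = sgn2 (fo a) (fo b)"

text \<open>The scalar supercommutator of two modes, recovered from the expectation values of both
  orders.\<close>

definition cc :: "osc \<Rightarrow> osc \<Rightarrow> complex" where
  "cc a b = ctr a b - so a b * ctr b a"

lemma so_sq [simp]: "so a b * so a b = 1" "so a b * (so a b * x) = x"
  by (simp_all add: so_def sgn2_def)

lemma so_commute: "so a b = so b a"
  by (auto simp: so_def sgn2_def)

lemma ctr_so: "ctr o1 a \<noteq> 0 \<Longrightarrow> fo o1 = fo a"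
  by (cases o1; cases a) (auto split: if_splits)

lemma ctr_ann: "ann a \<Longrightarrow> ctr o1 a = 0"
  by (cases o1; cases a) auto

section \<open>The Wick functional\<close>

fun Con :: "osc \<Rightarrow> (osc list \<Rightarrow> complex) \<Rightarrow> osc list \<Rightarrow> complex" where
  "Con x \<Phi> [] = 0"
| "Con x \<Phi> (p # w) = ctr x p * \<Phi> w + so x p * Con x (\<lambda>v. \<Phi> (p # v)) w"

text \<open>\<open>Con\<close> evaluates its functional on words shortened by several layers, so the
  recursion is made primitive by a depth bound \<open>n\<close>; \<open>Wick\<close> supplies the
  length of the word, which suffices.\<close>

fun Wk :: "nat \<Rightarrow> osc list \<Rightarrow> complex" where
  "Wk n [] = 1"
| "Wk 0 (x # w) = 0"
| "Wk (Suc n) (x # w) = Con x (Wk n) w"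

definition Wick :: "osc list \<Rightarrow> complex" where
  "Wick w = Wk (length w) w"

text \<open>Such functionals are those that factor through the Clifford-Weyl algebra of the
  modes.\<close>

definition exch :: "(osc list \<Rightarrow> complex) \<Rightarrow> bool" where
  "exch \<Phi> \<longleftrightarrow> (\<forall>u a b v. \<Phi> (u @ a # b # v) = so a b * \<Phi> (u @ b # a # v) + cc a b * \<Phi> (u @ v))"

fun col :: "osc \<Rightarrow> nat" where
  "col (Ps i s j) = i" | "col (Pd i s j) = i"

text \<open>Words act on a vacuum standing to their right, so together with \<open>exch\<close> this
  describes a linear form on the Fock space. Only the \<open>N\<close> colours summed over in the
  bilinears have to annihilate.\<close>

definition rvac :: "nat \<Rightarrow> (osc list \<Rightarrow> complex) \<Rightarrow> bool" where
  "rvac N \<Phi> \<longleftrightarrow> (\<forall>u a. ann a \<and> col a < N \<longrightarrow> \<Phi> (u @ [a]) = 0)"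

lemma exchD: "exch \<Phi> \<Longrightarrow> \<Phi> (u @ a # b # v) = so a b * \<Phi> (u @ b # a # v) + cc a b * \<Phi> (u @ v)"
  unfolding exch_def by blast

lemma exchI: "(\<And>u a b v. \<Phi> (u @ a # b # v) = so a b * \<Phi> (u @ b # a # v) + cc a b * \<Phi> (u @ v)) \<Longrightarrow> exch \<Phi>"
  unfolding exch_def by blast

lemma exch_Cons:
  assumes "exch \<Phi>"
  shows "exch (\<lambda>v. \<Phi> (p # v))"
proof (rule exchI)
  fix u a b v
  show "\<Phi> (p # u @ a # b # v) = so a b * \<Phi> (p # u @ b # a # v) + cc a b * \<Phi> (p # u @ v)"
    using exchD[OF assms, of "p # u" a b v] by (simp only: append_Cons)
qed

lemma Con_cong: "(\<And>v. length v < length w \<Longrightarrow> \<Phi> v = \<Psi> v) \<Longrightarrow> Con x \<Phi> w = Con x \<Psi> w"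
proof (induction w arbitrary: \<Phi> \<Psi>)
  case (Cons p w)
  have "Con x (\<lambda>v. \<Phi> (p # v)) w = Con x (\<lambda>v. \<Psi> (p # v)) w"
    by (rule Cons.IH) (simp add: Cons.prems)
  then show ?case using Cons.prems[of w] by simp
qed simp

lemma Wk_enough: "length w \<le> n \<Longrightarrow> Wk n w = Wick w"
proof (induction "length w" arbitrary: w n rule: less_induct)
  case less
  show ?case
  proof (cases w)
    case (Cons x v)
    then obtain m where n: "n = Suc m" using less.prems by (cases n) auto
    have "Con x (Wk m) v = Con x (Wk (length v)) v"
    proof (rule Con_cong)
      fix u :: "osc list" assume u: "length u < length v"
      then have "Wk m u = Wick u" "Wk (length v) u = Wick u"
        using less.hyps[of u] less.prems Cons n by auto
      then show "Wk m u = Wk (length v) u" by simp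
    qed
    then show ?thesis using Cons n by (simp add: Wick_def)
  qed (simp add: Wick_def)
qed

lemma Wick_Nil [simp]: "Wick [] = 1" by (simp add: Wick_def)

lemma Wick_Cons: "Wick (x # w) = Con x Wick w"
proof -
  have "Con x (Wk (length w)) w = Con x Wick w"
    by (rule Con_cong) (simp add: Wk_enough)
  then show ?thesis by (simp add: Wick_def)
qed

lemma Con_lin: "Con x (\<lambda>v. c * \<Phi> v + d * \<Psi> v) w = c * Con x \<Phi> w + d * Con x \<Psi> w"
  by (induction w arbitrary: \<Phi> \<Psi>) (auto simp: algebra_simps)

lemma so_ctr: "so a p * ctr b p = so a b * ctr b p" "so p a * ctr b p = so a b * ctr b p"
  using ctr_so[of b p] by (auto simp: so_def sgn2_def)

text \<open>Both orders select the same two contracted partners; only the sign of the two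
  contracting letters passing each other differs. \<open>so_ctr\<close> trades the sign of a
  contracted partner for the sign of the letter that contracts it, since they have equal
  parity.\<close>

lemma Con_Con: "Con a (Con b \<Phi>) w = so a b * Con b (Con a \<Phi>) w"
proof (induction w arbitrary: \<Phi>)
  case (Cons p w)
  have e: "(\<lambda>v. Con b \<Phi> (p # v)) = (\<lambda>v. ctr b p * \<Phi> v + so b p * Con b (\<lambda>v. \<Phi> (p # v)) v)" for b
    by simp
  have "Con a (Con b \<Phi>) (p # w) = ctr a p * Con b \<Phi> w
      + so a p * (ctr b p * Con a \<Phi> w + so b p * Con a (Con b (\<lambda>v. \<Phi> (p # v))) w)"
    by (simp add: Con_lin)
  moreover have "Con b (Con a \<Phi>) (p # w) = ctr b p * Con a \<Phi> w
      + so b p * (ctr a p * Con b \<Phi> w + so a p * Con b (Con a (\<lambda>v. \<Phi> (p # v))) w)"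
    by (simp add: Con_lin)
  moreover have k: "so a p * ctr b p = so a b * ctr b p" "so b p * ctr a p = so a b * ctr a p"
    using so_ctr(1)[of a p b] so_ctr(1)[of b p a] by (simp_all add: so_commute)
  ultimately have "Con a (Con b \<Phi>) (p # w) = ctr a p * Con b \<Phi> w + so a b * ctr b p * Con a \<Phi> w
      + so a p * so b p * so a b * Con b (Con a (\<lambda>v. \<Phi> (p # v))) w"
    and "Con b (Con a \<Phi>) (p # w) = ctr b p * Con a \<Phi> w + so a b * ctr a p * Con b \<Phi> w
      + so a p * so b p * Con b (Con a (\<lambda>v. \<Phi> (p # v))) w"
    using Cons.IH[of "\<lambda>v. \<Phi> (p # v)"] by (simp_all add: distrib_left flip: k)
  then show ?case by (simp add: distrib_left mult.assoc mult.left_commute[of "so a b"])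
qed simp

text \<open>The exchange relation is assumed only below the length \<open>n\<close>, because
  \<open>exch_Wick\<close> is an induction on the length and has no more at hand.\<close>

lemma Con_exch:
  assumes "\<And>u v. length (u @ v) + 2 < n \<Longrightarrow>
      \<Phi> (u @ a # b # v) = so a b * \<Phi> (u @ b # a # v) + cc a b * \<Phi> (u @ v)"
    and "length (u @ v) + 2 \<le> n"
  shows "Con x \<Phi> (u @ a # b # v) = so a b * Con x \<Phi> (u @ b # a # v) + cc a b * Con x \<Phi> (u @ v)"
  using assms
proof (induction u arbitrary: \<Phi> n)
  case Nil
  have 1: "Con x (\<lambda>w. \<Phi> (a # b # w)) v = so a b * Con x (\<lambda>w. \<Phi> (b # a # w)) v + cc a b * Con x \<Phi> v"
  proof -
    have "Con x (\<lambda>w. \<Phi> (a # b # w)) v = Con x (\<lambda>w. so a b * \<Phi> (b # a # w) + cc a b * \<Phi> w) v"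
      by (rule Con_cong) (use Nil.prems(1)[of "[]"] Nil.prems(2) in auto)
    then show ?thesis by (simp add: Con_lin)
  qed
  have f: "so x a * so x b * cc a b = cc a b"
    by (cases a; cases b) (auto simp: cc_def so_def sgn2_def split: if_splits)
  have g1: "so x b * ctr x a = so a b * ctr x a" and g2: "so a b * ctr x b = so x a * ctr x b"
    using so_ctr(1)[of b a x] so_ctr(1)[of a b x] so_commute[of b a] so_commute[of b x] so_commute[of a x]
    by auto
  have g: "so a b * so x b * ctr x a = ctr x a"
    unfolding mult.assoc g1 by simp
  have "Con x \<Phi> (a # b # v) = ctr x a * \<Phi> (b # v) + so x a * (ctr x b * \<Phi> (a # v))
      + so x a * so x b * (so a b * Con x (\<lambda>w. \<Phi> (b # a # w)) v + cc a b * Con x \<Phi> v)"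
    using 1 by (simp add: algebra_simps)
  also have "\<dots> = (so a b * so x b * ctr x a) * \<Phi> (b # v) + so a b * ctr x b * \<Phi> (a # v)
      + so a b * so x a * so x b * Con x (\<lambda>w. \<Phi> (b # a # w)) v + (so x a * so x b * cc a b) * Con x \<Phi> v"
    unfolding g g2 by (simp add: algebra_simps)
  also have "\<dots> = so a b * Con x \<Phi> (b # a # v) + cc a b * Con x \<Phi> v"
    unfolding f by (simp add: algebra_simps)
  finally show ?case by simp
next
  case (Cons p u)
  have "Con x (\<lambda>w. \<Phi> (p # w)) (u @ a # b # v) = so a b * Con x (\<lambda>w. \<Phi> (p # w)) (u @ b # a # v)
      + cc a b * Con x (\<lambda>w. \<Phi> (p # w)) (u @ v)"
  proof (rule Cons.IH[where n="n - 1"])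
    fix u v :: "osc list" assume "length (u @ v) + 2 < n - 1"
    then show "\<Phi> (p # u @ a # b # v) = so a b * \<Phi> (p # u @ b # a # v) + cc a b * \<Phi> (p # u @ v)"
      using Cons.prems(1)[of "p # u" v] by simp
  qed (use Cons.prems(2) in auto)
  moreover have "\<Phi> (u @ a # b # v) = so a b * \<Phi> (u @ b # a # v) + cc a b * \<Phi> (u @ v)"
    using Cons.prems by auto
  ultimately show ?case by (simp add: algebra_simps)
qed

lemma exch_Wick: "exch Wick"
proof -
  have "Wick (u @ a # b # v) = so a b * Wick (u @ b # a # v) + cc a b * Wick (u @ v)" for u a b v
  proof (induction "length (u @ v)" arbitrary: u v rule: less_induct)
    case less
    show ?case
    proof (cases u)
      case Nil
      have e: "(\<lambda>w. Wick (b # w)) = Con b Wick" for b by (simp add: Wick_Cons fun_eq_iff)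
      have "Wick (a # b # v) = ctr a b * Wick v + so a b * Con a (Con b Wick) v"
        by (simp add: Wick_Cons[of a] e)
      moreover have "Wick (b # a # v) = ctr b a * Wick v + so a b * Con b (Con a Wick) v"
        by (simp add: Wick_Cons[of b] e so_commute)
      ultimately show ?thesis using Con_Con[of a b Wick v] Nil
        by (simp add: cc_def algebra_simps)
    next
      case (Cons p u')
      have "Con p Wick (u' @ a # b # v) = so a b * Con p Wick (u' @ b # a # v) + cc a b * Con p Wick (u' @ v)"
        by (rule Con_exch[where n="length (u @ v) + 2"]) (use less Cons in auto)
      then show ?thesis using Cons by (simp add: Wick_Cons)
    qed
  qed
  then show ?thesis by (rule exchI)
qed

lemma Con_rvac:
  assumes "\<And>u. length u < length w \<Longrightarrow> \<Phi> (u @ [a]) = 0" "ann a"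
  shows "Con x \<Phi> (w @ [a]) = 0"
  using assms
proof (induction w arbitrary: \<Phi>)
  case (Cons p w)
  have "Con x (\<lambda>v. \<Phi> (p # v)) (w @ [a]) = 0"
    by (rule Cons.IH) (use Cons.prems(1)[of "p # u" for u] Cons.prems(2) in auto)
  then show ?case using Cons.prems(1)[of w] by simp
qed (simp add: ctr_ann)

lemma rvac_Wick: "rvac N Wick"
proof -
  have "Wick (u @ [a]) = 0" if "ann a" for u a
  proof (induction "length u" arbitrary: u rule: less_induct)
    case less
    show ?case
    proof (cases u)
      case Nil
      then show ?thesis by (simp add: Wick_Cons)
    next
      case (Cons p v)
      have "Con p Wick (v @ [a]) = 0"
        by (rule Con_rvac) (use less Cons that in auto)
      then show ?thesis using Cons by (simp add: Wick_Cons)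
    qed
  qed
  then show ?thesis by (simp add: rvac_def)
qed

section \<open>Bilinears as derivations plus a vacuum term\<close>

fun cf :: "xl \<Rightarrow> osc \<Rightarrow> complex" where
  "cf (r, a, f) (Ps i s j) = (if s = cl a then poly f (of_int j) else 0)"
| "cf (r, a, f) (Pd i s j) =
     (if s = rw a then - sgn2 (oda a) (\<not> rw a) * poly f (of_int (j - r)) else 0)"

text \<open>The supercommutator of the bilinear of \<open>x\<close> with the mode \<open>p\<close>
  is \<open>cf x p\<close> times the mode \<open>ap x p\<close>. On the modes \<open>Pd\<close> this
  is, up to sign, the transposed operator.\<close>

fun ap :: "xl \<Rightarrow> osc \<Rightarrow> osc" where
  "ap (r, a, f) (Ps i s j) = Ps i (rw a) (j + r)"
| "ap (r, a, f) (Pd i s j) = Pd i (cl a) (j - r)"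

definition sx :: "xl \<Rightarrow> osc \<Rightarrow> complex" where
  "sx x p = sgn2 (odx x) (fo p)"

fun fow :: "osc list \<Rightarrow> bool" where
  "fow [] = False" | "fow (p # w) = (fo p \<noteq> fow w)"

definition sw :: "xl \<Rightarrow> osc list \<Rightarrow> complex" where
  "sw x w = sgn2 (odx x) (fow w)"

fun Dop :: "xl \<Rightarrow> (osc list \<Rightarrow> complex) \<Rightarrow> osc list \<Rightarrow> complex" where
  "Dop x \<Phi> [] = 0"
| "Dop x \<Phi> (p # w) = cf x p * \<Phi> (ap x p # w) + sx x p * Dop x (\<lambda>v. \<Phi> (p # v)) w"

text \<open>What is left of the bilinear when it reaches the vacuum: the terms in which both modes
  create, that is \<open>j \<ge> 0\<close> and \<open>j + r < 0\<close>.\<close>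

fun Qop :: "nat \<Rightarrow> xl \<Rightarrow> (osc list \<Rightarrow> complex) \<Rightarrow> complex" where
  "Qop N (r, a, f) \<Phi> = (\<Sum>i<N. \<Sum>j\<in>{0..<- r}. poly f (of_int j) * \<Phi> [Ps i (rw a) (j + r), Pd i (cl a) j])"

text \<open>The transposed operator: \<open>op N x \<Phi>\<close> applies \<open>\<Phi>\<close>
  after the bilinear of \<open>x\<close> has acted on the vector of the word, first as a derivation
  on its letters and then on the vacuum.\<close>

definition op :: "nat \<Rightarrow> xl \<Rightarrow> (osc list \<Rightarrow> complex) \<Rightarrow> osc list \<Rightarrow> complex" where
  "op N x \<Phi> w = Dop x \<Phi> w + sw x w * Qop N x (\<lambda>v. \<Phi> (w @ v))"

lemma sw_simps [simp]: "sw x [] = 1" "sw x (p # w) = sx x p * sw x w" "sw x (u @ v) = sw x u * sw x v"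
proof -
  show 1: "sw x [] = 1" and 2: "sw x (p # w) = sx x p * sw x w" for p w
    by (auto simp: sw_def sx_def sgn2_def)
  show "sw x (u @ v) = sw x u * sw x v" by (induction u) (auto simp: 1 2)
qed

lemma sx_sq [simp]: "sx x p * sx x p = 1" "sx x p * (sx x p * c) = c"
  by (simp_all add: sx_def sgn2_def)

lemma cf_fo: "cf x p \<noteq> 0 \<Longrightarrow> fo (ap x p) = (odx x \<noteq> fo p)"
  by (cases x; cases p) (auto simp: oda_def split: if_splits)

lemma cc_fo: "cc a b \<noteq> 0 \<Longrightarrow> fo a = fo b"
  by (cases a; cases b) (auto simp: cc_def split: if_splits)

lemma cc_PsPd: "cc (Ps i s j) (Pd i' s' j') = (if i = i' \<and> s = s' \<and> j = j' then stra s else 0)"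
  by (auto simp: cc_def so_def sgn2_def stra_def)

lemma cc_PdPs: "cc (Pd i s j) (Ps i' s' j') = (if i = i' \<and> s = s' \<and> j = j' then 1 else 0)"
  by (auto simp: cc_def so_def sgn2_def stra_def)

lemma cc_same [simp]: "cc (Ps i s j) (Ps i' s' j') = 0" "cc (Pd i s j) (Pd i' s' j') = 0"
  by (auto simp: cc_def)

text \<open>A scalar commutes with the bilinear, so the derivation annihilates the supercommutator
  of two modes.\<close>

lemma cf_inv: "cf x a * cc (ap x a) b + sx x a * cf x b * cc a (ap x b) = 0"
proof -
  obtain r c f where x: "x = (r, c, f)" by (cases x) auto
  show ?thesis
    by (cases a; cases b; cases c) (auto simp: x cc_PsPd cc_PdPs sx_def sgn2_def oda_def stra_def)
qed

lemma Dop_lin: "Dop x (\<lambda>v. c * \<Phi> v + d * \<Psi> v) w = c * Dop x \<Phi> w + d * Dop x \<Psi> w"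
  by (induction w arbitrary: \<Phi> \<Psi>) (auto simp: algebra_simps)

lemma Dop_0: "Dop x (\<lambda>v. 0) w = 0"
  by (induction w) auto

lemma Dop_sum: "Dop x (\<lambda>v. \<Sum>i\<in>I. c i * \<Phi> i v) w = (\<Sum>i\<in>I. c i * Dop x (\<Phi> i) w)"
proof (induction I rule: infinite_finite_induct)
  case (insert i I)
  then show ?case using Dop_lin[of x "c i" "\<Phi> i" 1 "\<lambda>v. \<Sum>i\<in>I. c i * \<Phi> i v" w] by simp
qed (simp_all add: Dop_0)

lemma sx_cc: "sx x a * sx x b * cc a b = cc a b"
  using cc_fo[of a b] by (cases "cc a b = 0") (auto simp: sx_def sgn2_def)

lemma Dop_exch:
  assumes "exch \<Phi>"
  shows "Dop x \<Phi> (u @ a # b # v) = so a b * Dop x \<Phi> (u @ b # a # v) + cc a b * Dop x \<Phi> (u @ v)"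
  using assms
proof (induction u arbitrary: \<Phi>)
  case Nil
  have 1: "cf x a * \<Phi> (ap x a # b # v) = cf x a * (sx x b * so a b * \<Phi> (b # ap x a # v) + cc (ap x a) b * \<Phi> v)"
  proof (cases "cf x a = 0")
    case False
    have "so (ap x a) b = sx x b * so a b"
      using cf_fo[OF False] by (auto simp: so_def sx_def sgn2_def)
    then show ?thesis using exchD[OF Nil, of "[]" "ap x a" b v] by simp
  qed simp
  have 2: "cf x b * \<Phi> (a # ap x b # v) = cf x b * (sx x a * so a b * \<Phi> (ap x b # a # v) + cc a (ap x b) * \<Phi> v)"
  proof (cases "cf x b = 0")
    case False
    have "so a (ap x b) = sx x a * so a b"
      using cf_fo[OF False] by (auto simp: so_def sx_def sgn2_def)
    then show ?thesis using exchD[OF Nil, of "[]" a "ap x b" v] by simp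
  qed simp
  have 3: "(\<lambda>w. \<Phi> (a # b # w)) = (\<lambda>w. so a b * \<Phi> (b # a # w) + cc a b * \<Phi> w)"
    using exchD[OF Nil, of "[]" a b] by simp
  note 4 = sx_cc[of x a b]
  have "Dop x \<Phi> (a # b # v) = cf x a * \<Phi> (ap x a # b # v) + sx x a * (cf x b * \<Phi> (a # ap x b # v))
     + sx x a * sx x b * Dop x (\<lambda>w. \<Phi> (a # b # w)) v"
    by (simp add: algebra_simps)
  also have "\<dots> = so a b * (cf x b * \<Phi> (ap x b # a # v) + sx x b * (cf x a * \<Phi> (b # ap x a # v)))
     + (cf x a * cc (ap x a) b + sx x a * cf x b * cc a (ap x b)) * \<Phi> v
     + so a b * sx x a * sx x b * Dop x (\<lambda>w. \<Phi> (b # a # w)) v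
     + (sx x a * sx x b * cc a b) * Dop x \<Phi> v"
    unfolding 1 2 3 Dop_lin by (simp add: algebra_simps)
  also have "\<dots> = so a b * Dop x \<Phi> (b # a # v) + cc a b * Dop x \<Phi> v"
    unfolding 4 cf_inv by (simp add: algebra_simps)
  finally show ?case by simp
next
  case (Cons p u)
  have "Dop x (\<lambda>v. \<Phi> (p # v)) (u @ a # b # v) = so a b * Dop x (\<lambda>v. \<Phi> (p # v)) (u @ b # a # v)
     + cc a b * Dop x (\<lambda>v. \<Phi> (p # v)) (u @ v)"
    by (rule Cons.IH[OF exch_Cons[OF Cons.prems]])
  moreover have "\<Phi> (ap x p # u @ a # b # v) = so a b * \<Phi> (ap x p # u @ b # a # v) + cc a b * \<Phi> (ap x p # u @ v)"
    using exchD[OF Cons.prems, of "ap x p # u" a b v] by simp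
  ultimately show ?case by (simp only: append_Cons Dop.simps) (simp add: algebra_simps)
qed

lemma Dop_append: "Dop x \<Phi> (u @ v) = Dop x (\<lambda>w. \<Phi> (w @ v)) u + sw x u * Dop x (\<lambda>w. \<Phi> (u @ w)) v"
  by (induction u arbitrary: \<Phi>) (auto simp: algebra_simps)

lemma Qop_lin: "Qop N x (\<lambda>v. c * \<Phi> v + d * \<Psi> v) = c * Qop N x \<Phi> + d * Qop N x \<Psi>"
  by (cases x) (simp add: sum.distrib sum_distrib_left algebra_simps)

lemma op_lin: "op N x (\<lambda>v. c * \<Phi> v + d * \<Psi> v) w = c * op N x \<Phi> w + d * op N x \<Psi> w"
  by (simp add: op_def Dop_lin Qop_lin algebra_simps)

lemma exch_op_aux:
  fixes S :: complex
  assumes "Q = s * Q1 + c * Q2" "S * c = T * c" "S = S'"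
  shows "s * D1 + c * D2 + S * Q = s * (D1 + S' * Q1) + c * (D2 + T * Q2)"
proof -
  have "S * (c * Q2) = c * (T * Q2)" using assms(2) by (metis mult.assoc mult.commute)
  then show ?thesis using assms(1,3) by (simp add: algebra_simps)
qed

lemma exch_op:
  assumes "exch \<Phi>"
  shows "exch (op N x \<Phi>)"
proof (rule exchI)
  fix u a b v
  have 1: "Qop N x (\<lambda>z. \<Phi> ((u @ a # b # v) @ z)) = so a b * Qop N x (\<lambda>z. \<Phi> ((u @ b # a # v) @ z))
      + cc a b * Qop N x (\<lambda>z. \<Phi> ((u @ v) @ z))"
    using exchD[OF assms, of u a b "v @ z" for z] by (simp add: Qop_lin)
  have 2: "sw x (u @ a # b # v) * cc a b = sw x (u @ v) * cc a b"
  proof -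
    have "sw x (u @ a # b # v) * cc a b = sw x u * sw x v * (sx x a * sx x b * cc a b)"
      by (simp only: sw_simps mult_ac)
    then show ?thesis unfolding sx_cc by (simp only: sw_simps)
  qed
  have 3: "sw x (u @ a # b # v) = sw x (u @ b # a # v)"
    by (simp only: sw_simps mult_ac)
  show "op N x \<Phi> (u @ a # b # v) = so a b * op N x \<Phi> (u @ b # a # v) + cc a b * op N x \<Phi> (u @ v)"
    unfolding op_def Dop_exch[OF assms, of x u a b v] by (rule exch_op_aux[OF 1 2 3])
qed

lemma move_right2:
  assumes "exch \<Phi>" "rvac N \<Phi>" "ann a" "col a < N"
  shows "\<Phi> (u @ [a, p, q]) = cc a p * \<Phi> (u @ [q]) + so a p * cc a q * \<Phi> (u @ [p])"
proof -
  have "\<Phi> (u @ [a, p, q]) = so a p * \<Phi> (u @ [p, a, q]) + cc a p * \<Phi> (u @ [q])"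
    using exchD[OF assms(1), of u a p "[q]"] by simp
  moreover have "\<Phi> (u @ [p, a, q]) = so a q * \<Phi> (u @ [p, q, a]) + cc a q * \<Phi> (u @ [p])"
    using exchD[OF assms(1), of "u @ [p]" a q "[]"] by simp
  moreover have "\<Phi> (u @ [p, q, a]) = 0"
    using assms(2-4) by (auto simp: rvac_def dest: spec[of _ "u @ [p, q]"])
  ultimately show ?thesis by (simp add: algebra_simps)
qed

lemma rvacD: "rvac N \<Phi> \<Longrightarrow> ann a \<Longrightarrow> col a < N \<Longrightarrow> \<Phi> (u @ [a]) = 0"
  by (auto simp: rvac_def)

text \<open>An annihilator that is moved to the vacuum meets its conjugate among the creation pairs,
  and what remains is minus its own commutator with the bilinear. This cancellation is why
  \<open>op\<close> respects the vacuum condition.\<close>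

lemma Qop_ann:
  assumes "exch \<Phi>" "rvac N \<Phi>" "ann a" "col a < N"
  shows "Qop N x (\<lambda>v. \<Phi> (u @ a # v)) = - sx x a * cf x a * \<Phi> (u @ [ap x a])"
proof -
  obtain r c f where x: "x = (r, c, f)" by (cases x) auto
  note m = move_right2[OF assms(1-4)]
  show ?thesis
  proof (cases a)
    case (Ps i s j)
    have iN: "i < N" and j: "j \<ge> 0" using Ps assms(3,4) by auto
    have "Qop N x (\<lambda>v. \<Phi> (u @ a # v)) = (\<Sum>i'<N. \<Sum>j'\<in>{0..<- r}. if i' = i then if j' = j then if s = cl c then
        poly f (of_int j) * so a (Ps i (rw c) (j + r)) * stra s * \<Phi> (u @ [Ps i (rw c) (j + r)]) else 0 else 0 else 0)"
      unfolding x Qop.simps m unfolding Ps by (intro sum.cong refl) (auto simp: cc_PsPd)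
    also have "\<dots> = (\<Sum>i'<N. if i' = i then (\<Sum>j'\<in>{0..<- r}. if j' = j then if s = cl c then
        poly f (of_int j) * so a (Ps i (rw c) (j + r)) * stra s * \<Phi> (u @ [Ps i (rw c) (j + r)]) else 0 else 0) else 0)"
      by (intro sum.cong refl) auto
    also have "\<dots> = (if j \<in> {0..<- r} then if s = cl c then
        poly f (of_int j) * so a (Ps i (rw c) (j + r)) * stra s * \<Phi> (u @ [Ps i (rw c) (j + r)]) else 0 else 0)"
      using iN by (simp add: sum.delta)
    also have "\<dots> = - sx x a * cf x a * \<Phi> (u @ [ap x a])"
      using j rvacD[OF assms(2), of "Ps i (rw c) (j + r)" u] iN
      by (cases "j + r < 0") (auto simp: Ps x so_def sx_def sgn2_def stra_def oda_def)
    finally show ?thesis .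
  next
    case (Pd i s j)
    have iN: "i < N" and j: "j < 0" using Pd assms(3,4) by auto
    have "Qop N x (\<lambda>v. \<Phi> (u @ a # v)) = (\<Sum>i'<N. \<Sum>j'\<in>{0..<- r}. if i' = i then if j' = j - r then if s = rw c then
        poly f (of_int (j - r)) * \<Phi> (u @ [Pd i (cl c) (j - r)]) else 0 else 0 else 0)"
      unfolding x Qop.simps m unfolding Pd by (intro sum.cong refl) (auto simp: cc_PdPs)
    also have "\<dots> = (\<Sum>i'<N. if i' = i then (\<Sum>j'\<in>{0..<- r}. if j' = j - r then if s = rw c then
        poly f (of_int (j - r)) * \<Phi> (u @ [Pd i (cl c) (j - r)]) else 0 else 0) else 0)"
      by (intro sum.cong refl) auto
    also have "\<dots> = (if j - r \<in> {0..<- r} then if s = rw c then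
        poly f (of_int (j - r)) * \<Phi> (u @ [Pd i (cl c) (j - r)]) else 0 else 0)"
      using iN by (simp add: sum.delta)
    also have "\<dots> = - sx x a * cf x a * \<Phi> (u @ [ap x a])"
      using j rvacD[OF assms(2), of "Pd i (cl c) (j - r)" u] iN
      by (cases "j - r \<ge> 0") (auto simp: Pd x so_def sx_def sgn2_def stra_def oda_def)
    finally show ?thesis .
  qed
qed

lemma rvac_op:
  assumes "exch \<Phi>" "rvac N \<Phi>"
  shows "rvac N (op N x \<Phi>)"
  unfolding rvac_def
proof (intro allI impI, elim conjE)
  fix u a assume a: "ann a" "col a < N"
  have "(\<lambda>w. \<Phi> (w @ [a])) = (\<lambda>w. 0)"
    using rvacD[OF assms(2) a] by auto
  then have "Dop x (\<lambda>w. \<Phi> (w @ [a])) u = 0"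
    by (simp add: Dop_0)
  then show "op N x \<Phi> (u @ [a]) = 0"
    unfolding op_def Dop_append using Qop_ann[OF assms a, of x u] by (simp add: algebra_simps)
qed

section \<open>The Lie superalgebra relations of the bilinears\<close>

definition s2 :: "xl \<Rightarrow> xl \<Rightarrow> complex" where
  "s2 x y = sgn2 (odx x) (odx y)"

lemma s2_sq [simp]: "s2 x y * s2 x y = 1" "s2 x y * (s2 x y * c) = c"
  by (simp_all add: s2_def sgn2_def)

lemma s2_commute: "s2 x y = s2 y x"
  by (auto simp: s2_def sgn2_def)

lemma sx_ap: "cf y p \<noteq> 0 \<Longrightarrow> sx x (ap y p) = s2 x y * sx x p"
  using cf_fo[of y p] by (auto simp: sx_def s2_def sgn2_def)

lemma Dop_sw: "Dop y (\<lambda>v. sw x v * \<Psi> v) w = s2 x y * sw x w * Dop y \<Psi> w"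
proof (induction w arbitrary: \<Psi>)
  case (Cons p w)
  have "cf y p * sw x (ap y p # w) = cf y p * (s2 x y * sw x (p # w))"
    using sx_ap[of y p x] by (cases "cf y p = 0") auto
  moreover have "Dop y (\<lambda>v. sw x (p # v) * \<Psi> (p # v)) w = sx x p * (s2 x y * sw x w * Dop y (\<lambda>v. \<Psi> (p # v)) w)"
    using Dop_lin[of y "sx x p" "\<lambda>v. sw x v * \<Psi> (p # v)" 0 "\<lambda>v. 0" w] Cons.IH[of "\<lambda>v. \<Psi> (p # v)"]
    by (simp add: mult.assoc)
  ultimately show ?case by (simp only: Dop.simps mult.assoc[symmetric]) (simp add: algebra_simps)
qed simp

fun ql :: "xl \<Rightarrow> nat \<Rightarrow> int \<Rightarrow> osc list" where
  "ql (r, a, f) i j = [Ps i (rw a) (j + r), Pd i (cl a) j]"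

fun qc :: "xl \<Rightarrow> int \<Rightarrow> complex" where
  "qc (r, a, f) j = poly f (of_int j)"

definition qs :: "nat \<Rightarrow> xl \<Rightarrow> (nat \<times> int) set" where
  "qs N x = {..<N} \<times> {0..<- fst x}"

lemma Qop_alt: "Qop N x \<Phi> = (\<Sum>ij\<in>qs N x. qc x (snd ij) * \<Phi> (ql x (fst ij) (snd ij)))"
  by (cases x) (simp add: qs_def sum.cartesian_product case_prod_beta)

lemma sw_ql: "sw x (ql y i j) = s2 x y"
  by (cases y) (auto simp: sx_def s2_def sgn2_def oda_def)

lemma Qop_sw: "Qop N y (\<lambda>v. sw x v * \<Psi> v) = s2 x y * Qop N y \<Psi>"
  by (simp add: Qop_alt sw_ql sum_distrib_left mult.left_commute)

lemma Dop_Qop: "Dop y (\<lambda>v. Qop N x (\<lambda>z. \<Phi> (v @ z))) w = Qop N x (\<lambda>z. Dop y (\<lambda>v. \<Phi> (v @ z)) w)"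
  unfolding Qop_alt by (rule Dop_sum)

lemma pair_swap:
  assumes "exch \<Phi>" "cc q p' = 0" "cc p p' = 0" "cc q q' = 0" "cc p q' = 0"
  shows "\<Phi> [p, q, p', q'] = so q p' * so p p' * so q q' * so p q' * \<Phi> [p', q', p, q]"
  using exchD[OF assms(1), of "[p]" q p' "[q']"] exchD[OF assms(1), of "[]" p p' "[q, q']"]
    exchD[OF assms(1), of "[p', p]" q q' "[]"] exchD[OF assms(1), of "[p']" p q' "[q]"] assms(2-)
  by simp

text \<open>Only creators occur, so no scalar commutator arises and the parity sign is all that
  survives.\<close>

lemma Qop_Qop:
  assumes "exch \<Phi>"
  shows "Qop N y (\<lambda>v. Qop N x (\<lambda>z. \<Phi> (v @ z))) = s2 x y * Qop N x (\<lambda>v. Qop N y (\<lambda>z. \<Phi> (v @ z)))"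
proof -
  have "\<Phi> (ql y i j @ ql x i' j') = s2 x y * \<Phi> (ql x i' j' @ ql y i j)"
    if "(i, j) \<in> qs N y" "(i', j') \<in> qs N x" for i j i' j'
  proof -
    obtain r a f s b g where x: "x = (r, a, f)" "y = (s, b, g)" by (cases x; cases y) auto
    have "so (Pd i (cl b) j) (Ps i' (rw a) (j' + r)) * so (Ps i (rw b) (j + s)) (Ps i' (rw a) (j' + r))
      * so (Pd i (cl b) j) (Pd i' (cl a) j') * so (Ps i (rw b) (j + s)) (Pd i' (cl a) j') = s2 x y"
      by (auto simp: so_def s2_def sgn2_def oda_def x)
    then show ?thesis
      using that pair_swap[OF assms, of "Pd i (cl b) j" "Ps i' (rw a) (j' + r)" "Ps i (rw b) (j + s)" "Pd i' (cl a) j'"]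
      by (auto simp: x qs_def cc_PsPd cc_PdPs)
  qed
  then have "Qop N y (\<lambda>v. Qop N x (\<lambda>z. \<Phi> (v @ z))) = (\<Sum>ij\<in>qs N y. \<Sum>kl\<in>qs N x.
     s2 x y * (qc x (snd kl) * (qc y (snd ij) * \<Phi> (ql x (fst kl) (snd kl) @ ql y (fst ij) (snd ij)))))"
    unfolding Qop_alt sum_distrib_left by (intro sum.cong refl) (auto simp: mult.left_commute)
  also have "\<dots> = s2 x y * Qop N x (\<lambda>v. Qop N y (\<lambda>z. \<Phi> (v @ z)))"
    unfolding Qop_alt sum_distrib_left by (rule sum.swap)
  finally show ?thesis .
qed

lemma Dop_zero: "Dop (r, a, 0) \<Phi> w = 0"
proof (induction w arbitrary: \<Phi>)
  case (Cons p w)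
  then show ?case by (cases p) auto
qed simp

text \<open>On single modes the bilinears represent the matrix differential operators without
  centre; the cocycle appears only where they meet the vacuum.\<close>

lemma ap_comm:
  "cf y p * cf x (ap y p) * \<Phi> (ap x (ap y p) # w) - s2 x y * cf x p * cf y (ap x p) * \<Phi> (ap y (ap x p) # w)
   = cf (br1 x y) p * \<Phi> (ap (br1 x y) p # w) + cf (br2 x y) p * \<Phi> (ap (br2 x y) p # w)"
proof -
  obtain r a f where x: "x = (r, a, f)" by (cases x) auto
  obtain s b g where y: "y = (s, b, g)" by (cases y) auto
  show ?thesis
    unfolding x y
    apply (cases p; cases a; cases b)
    apply (simp_all add: s2_def sgn2_def oda_def split del: if_split)
    apply (simp_all add: add_ac split del: if_split)
    apply (simp_all add: sgn2_def oda_def algebra_simps split: if_split)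
    done
qed

lemma sx_br:
  "cl a = rw b \<Longrightarrow> sx (br1 (r, a, f) (s, b, g)) p = sx (r, a, f) p * sx (s, b, g) p"
  "cl b = rw a \<Longrightarrow> sx (br2 (r, a, f) (s, b, g)) p = sx (r, a, f) p * sx (s, b, g) p"
  by (cases a; cases b; simp add: sx_def sgn2_def oda_def)+

lemma Dop_br: "sx x p * sx y p * Dop (br1 x y) \<Phi> w = sx (br1 x y) p * Dop (br1 x y) \<Phi> w"
  "sx x p * sx y p * Dop (br2 x y) \<Phi> w = sx (br2 x y) p * Dop (br2 x y) \<Phi> w"
proof -
  obtain r a f where x: "x = (r, a, f)" by (cases x) auto
  obtain s b g where y: "y = (s, b, g)" by (cases y) auto
  show "sx x p * sx y p * Dop (br1 x y) \<Phi> w = sx (br1 x y) p * Dop (br1 x y) \<Phi> w"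
    unfolding x y using sx_br(1)[of a b r f s g p] by (cases "cl a = rw b") (simp_all add: Dop_zero)
  show "sx x p * sx y p * Dop (br2 x y) \<Phi> w = sx (br2 x y) p * Dop (br2 x y) \<Phi> w"
    unfolding x y using sx_br(2)[of b a r f s g p] by (cases "cl b = rw a") (simp_all add: Dop_zero)
qed

lemma Dop_Dop:
  "Dop y (Dop x \<Phi>) w = s2 x y * Dop x (Dop y \<Phi>) w + Dop (br1 x y) \<Phi> w + Dop (br2 x y) \<Phi> w"
proof (induction w arbitrary: \<Phi>)
  case (Cons p w)
  have e: "Dop y (Dop x \<Phi>) (p # w) = cf y p * cf x (ap y p) * \<Phi> (ap x (ap y p) # w)
     + cf y p * (s2 x y * sx x p) * Dop x (\<lambda>v. \<Phi> (ap y p # v)) w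
     + sx y p * cf x p * Dop y (\<lambda>v. \<Phi> (ap x p # v)) w
     + sx x p * sx y p * Dop y (Dop x (\<lambda>v. \<Phi> (p # v))) w" for x y
  proof -
    have "cf y p * sx x (ap y p) = cf y p * (s2 x y * sx x p)"
      using sx_ap[of y p x] by (cases "cf y p = 0") auto
    moreover have "Dop y (\<lambda>v. Dop x \<Phi> (p # v)) w = cf x p * Dop y (\<lambda>v. \<Phi> (ap x p # v)) w
       + sx x p * Dop y (Dop x (\<lambda>v. \<Phi> (p # v))) w"
      by (simp add: Dop_lin)
    ultimately show ?thesis by (auto simp: algebra_simps)
  qed
  have "Dop y (Dop x \<Phi>) (p # w) - s2 x y * Dop x (Dop y \<Phi>) (p # w)
     = (cf y p * cf x (ap y p) * \<Phi> (ap x (ap y p) # w) - s2 x y * cf x p * cf y (ap x p) * \<Phi> (ap y (ap x p) # w))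
     + (sx x p * sx y p * Dop (br1 x y) (\<lambda>v. \<Phi> (p # v)) w + sx x p * sx y p * Dop (br2 x y) (\<lambda>v. \<Phi> (p # v)) w)"
    unfolding e Cons.IH[of "\<lambda>v. \<Phi> (p # v)"] s2_commute[of y x] by (simp add: algebra_simps)
  also have "\<dots> = Dop (br1 x y) \<Phi> (p # w) + Dop (br2 x y) \<Phi> (p # w)"
    unfolding ap_comm Dop_br by simp
  finally show ?case by (simp add: algebra_simps)
qed simp

lemma sum_shift_int: "(\<Sum>j\<in>{a..<b}. F (j - s)) = (\<Sum>j\<in>{a - s..<b - s}. F (j :: int))"
  by (rule sum.reindex_bij_witness[of _ "\<lambda>j. j + s" "\<lambda>j. j - s"]) auto

text \<open>With \<open>F\<close> zero on negative indices, the two ranges exceed the range of the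
  commutator by \<open>{max 0 (- r - s)..<- s}\<close>. This excess is the source of the
  cocycle.\<close>

lemma sum_intervals:
  fixes F :: "int \<Rightarrow> complex"
  assumes "\<And>j. j < 0 \<Longrightarrow> F j = 0"
  shows "sum F {0..<- s} + sum F {- s..<- r - s} = sum F {0..<- (r + s)} + sum F {max 0 (- r - s)..<- s}"
proof -
  have z: "sum F {- s..<- r - s} = sum F {max 0 (- s)..<- r - s}"
    by (rule sum.mono_neutral_right) (use assms in auto)
  consider "s < 0" "r \<le> 0" | "s < 0" "r > 0" "- r - s \<ge> 0" | "s < 0" "r > 0" "- r - s < 0" | "s \<ge> 0" by linarith
  then show ?thesis
  proof cases
    case 1
    then have "{0..<- (r + s)} = {0..<- s} \<union> {- s..<- r - s}" by auto
    moreover have "sum F ({0..<- s} \<union> {- s..<- r - s}) = sum F {0..<- s} + sum F {- s..<- r - s}"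
      by (rule sum.union_disjoint) auto
    ultimately show ?thesis using 1 by simp
  next
    case 2
    then have "{0..<- s} = {0..<- (r + s)} \<union> {max 0 (- r - s)..<- s}" by auto
    moreover have "sum F ({0..<- (r + s)} \<union> {max 0 (- r - s)..<- s}) = sum F {0..<- (r + s)} + sum F {max 0 (- r - s)..<- s}"
      by (rule sum.union_disjoint) auto
    ultimately show ?thesis using 2 by simp
  next
    case 3
    then show ?thesis by simp
  next
    case 4
    then show ?thesis unfolding z by (auto simp: algebra_simps max_def)
  qed
qed

text \<open>In the excess range the first mode annihilates, so \<open>P\<close> is the contraction
  \<open>e\<close> on the diagonal and zero elsewhere. The diagonal is met only if
  \<open>r + s = 0\<close>, and its contributions add up to the cocycle.\<close>

lemma one_loop:
  fixes P :: "int \<Rightarrow> int \<Rightarrow> complex"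
  assumes P: "\<And>k l. l < 0 \<Longrightarrow> P k l = 0" "\<And>k l. k \<ge> 0 \<Longrightarrow> l \<ge> 0 \<Longrightarrow> P k l = (if k = l then e else 0)"
  shows "(\<Sum>j\<in>{0..<- s}. f (j + s) * g j * P (j + s + r) j) + (\<Sum>j\<in>{0..<- r}. f j * g (j - s) * P (j + r) (j - s))
    = (\<Sum>j\<in>{0..<- (r + s)}. f (j + s) * g j * P (j + (r + s)) j)
      + (if r + s = 0 then (\<Sum>j\<in>{-r..-1}. f j * g (j + r)) * e else 0)"
proof -
  define F where "F j = f (j + s) * g j * P (j + s + r) j" for j
  have F0: "F j = 0" if "j < 0" for j using P(1)[OF that] by (simp add: F_def)
  have "(\<Sum>j\<in>{0..<- r}. f j * g (j - s) * P (j + r) (j - s)) = (\<Sum>j\<in>{0..<- r}. F (j - s))"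
    by (simp add: F_def)
  also have "\<dots> = sum F {- s..<- r - s}" unfolding sum_shift_int by simp
  finally have 1: "(\<Sum>j\<in>{0..<- r}. f j * g (j - s) * P (j + r) (j - s)) = sum F {- s..<- r - s}" .
  have "sum F {max 0 (- r - s)..<- s} = (if r + s = 0 then (\<Sum>j\<in>{-r..-1}. f j * g (j + r)) * e else 0)"
  proof (cases "r + s = 0")
    case True
    then have s: "s = - r" by simp
    have "sum F {max 0 (- r - s)..<- s} = (\<Sum>j\<in>{0..<r}. f (j - r) * g (j - r + r) * e)"
      by (rule sum.cong) (auto simp: F_def P s)
    also have "\<dots> = (\<Sum>j\<in>{0 - r..<r - r}. f j * g (j + r) * e)"
      by (rule sum_shift_int[of "\<lambda>j. f j * g (j + r) * e"])
    also have "{0 - r..<r - r} = {-r..-1}" by auto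
    finally show ?thesis using True by (simp add: sum_distrib_right)
  next
    case False
    then have "sum F {max 0 (- r - s)..<- s} = 0"
      by (intro sum.neutral) (auto simp: F_def P)
    then show ?thesis using False by simp
  qed
  then show ?thesis using sum_intervals[of F s r, OF F0] 1
    by (simp add: F_def add.assoc add.commute[of s r])
qed

context
  fixes N :: nat and \<Psi> :: "osc list \<Rightarrow> complex"
  assumes ex: "exch \<Psi>" and rv: "rvac N \<Psi>"
begin

private definition P :: "nat \<Rightarrow> bool \<Rightarrow> bool \<Rightarrow> int \<Rightarrow> int \<Rightarrow> complex" where
  "P i c1 c2 k l = \<Psi> [Ps i c1 k, Pd i c2 l]"

private lemma P1: "i < N \<Longrightarrow> l < 0 \<Longrightarrow> P i c1 c2 k l = 0"
  using rvacD[OF rv, of "Pd i c2 l" "[Ps i c1 k]"] by (simp add: P_def)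

private lemma P2:
  assumes "i < N" "k \<ge> 0"
  shows "P i c1 c2 k l = (if k = l then if c1 = c2 then stra c1 * \<Psi> [] else 0 else 0)"
proof -
  have "P i c1 c2 k l = so (Ps i c1 k) (Pd i c2 l) * \<Psi> ([Pd i c2 l] @ [Ps i c1 k]) + cc (Ps i c1 k) (Pd i c2 l) * \<Psi> []"
    using exchD[OF ex, of "[]" "Ps i c1 k" "Pd i c2 l" "[]"] by (simp add: P_def)
  moreover have "\<Psi> ([Pd i c2 l] @ [Ps i c1 k]) = 0"
    by (rule rvacD[OF rv]) (use assms in auto)
  ultimately show ?thesis by (auto simp: cc_PsPd)
qed

text \<open>\<open>A\<close> and \<open>B\<close> collect the terms in which \<open>x\<close> acts
  on the first, respectively the second, mode of the creation pairs of \<open>y\<close>, with the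
  signs stripped so that both can be fed to \<open>one_loop\<close>.\<close>

private definition A :: "nat \<Rightarrow> xl \<Rightarrow> xl \<Rightarrow> complex" where
  "A i = (\<lambda>(r, a, f) (s, b, g). if cl a = rw b then
     (\<Sum>j\<in>{0..<- s}. poly f (of_int (j + s)) * poly g (of_int j) * P i (rw a) (cl b) (j + s + r) j) else 0)"

private definition B :: "nat \<Rightarrow> xl \<Rightarrow> xl \<Rightarrow> complex" where
  "B i = (\<lambda>(r, a, f) (s, b, g). if cl b = rw a then
     (\<Sum>j\<in>{0..<- s}. poly g (of_int j) * poly f (of_int (j - r)) * P i (rw b) (cl a) (j + s) (j - r)) else 0)"

private lemma QD: "Qop N y (Dop x \<Psi>) = (\<Sum>i<N. A i x y) - s2 x y * (\<Sum>i<N. B i x y)"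
proof -
  obtain r a f where x: "x = (r, a, f)" by (cases x) auto
  obtain s b g where y: "y = (s, b, g)" by (cases y) auto
  have sg: "cl b = rw a \<Longrightarrow> sgn2 (oda a) (\<not> cl b) * sgn2 (oda a) (\<not> rw a) = 1"
    by (auto simp: sgn2_def)
  have sg2: "cl b = rw a \<Longrightarrow> sgn2 (oda a) (\<not> rw b) * sgn2 (oda a) (\<not> rw a) = s2 x y"
    by (cases a; cases b) (auto simp: sgn2_def s2_def x y oda_def)
  have "Qop N y (Dop x \<Psi>) = (\<Sum>i<N. (\<Sum>j\<in>{0..<- s}.
      (if cl a = rw b then poly f (of_int (j + s)) * poly g (of_int j) * P i (rw a) (cl b) (j + s + r) j else 0)
     - (if cl b = rw a then s2 x y * (poly g (of_int j) * poly f (of_int (j - r)) * P i (rw b) (cl a) (j + s) (j - r)) else 0)))"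
    unfolding y Qop.simps
  proof (intro sum.cong refl)
    fix i j
    have "(if cl b = rw a then sgn2 (oda a) (\<not> rw b) * (sgn2 (oda a) (\<not> rw a) * c) else 0)
      = (if cl b = rw a then s2 x y * c else 0)" for c
      using sg2 by (simp flip: mult.assoc)
    then show "poly g (of_int j) * Dop x \<Psi> [Ps i (rw b) (j + s), Pd i (cl b) j] =
      (if cl a = rw b then poly f (of_int (j + s)) * poly g (of_int j) * P i (rw a) (cl b) (j + s + r) j else 0)
     - (if cl b = rw a then s2 x (s, b, g) * (poly g (of_int j) * poly f (of_int (j - r)) * P i (rw b) (cl a) (j + s) (j - r)) else 0)"
      using sg2 by (auto simp: x y P_def sx_def algebra_simps)
  qed
  also have "\<dots> = (\<Sum>i<N. A i x y - s2 x y * B i x y)"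
    by (cases "cl a = rw b"; cases "cl b = rw a") (simp_all add: A_def B_def x y sum_subtractf sum_distrib_left sum_negf)
  finally show ?thesis by (simp add: sum_subtractf sum_distrib_left)
qed

private lemma AB:
  assumes "i < N"
  shows "A i (r, a, f) (s, b, g) + B i (s, b, g) (r, a, f) = (if cl a = rw b then
     (\<Sum>j\<in>{0..<- (r + s)}. poly f (of_int (j + s)) * poly g (of_int j) * P i (rw a) (cl b) (j + (r + s)) j) else 0)
     + (if r + s = 0 then trp r a f s b g * \<Psi> [] else 0)"
proof (cases "cl a = rw b")
  case True
  have "A i (r, a, f) (s, b, g) + B i (s, b, g) (r, a, f) =
     (\<Sum>j\<in>{0..<- (r + s)}. poly f (of_int (j + s)) * poly g (of_int j) * P i (rw a) (cl b) (j + (r + s)) j)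
    + (if r + s = 0 then (\<Sum>j\<in>{-r..-1}. poly f (of_int j) * poly g (of_int (j + r))) *
        (if rw a = cl b then stra (rw a) * \<Psi> [] else 0) else 0)"
    unfolding A_def B_def case_prod_conv if_P[OF True]
    by (rule one_loop[of "P i (rw a) (cl b)" _ "\<lambda>j. poly f (of_int j)" s "\<lambda>j. poly g (of_int j)" r])
      (use P1[OF assms] P2[OF assms] in auto)
  then show ?thesis using True by (auto simp: trp_def)
qed (auto simp: A_def B_def trp_def)

lemma Qop_Dop_bracket:
  "Qop N y (Dop x \<Psi>) - s2 x y * Qop N x (Dop y \<Psi>)
    = Qop N (br1 x y) \<Psi> + Qop N (br2 x y) \<Psi> + of_nat N * cen x y * \<Psi> []"
proof -
  obtain r a f where x: "x = (r, a, f)" by (cases x) auto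
  obtain s b g where y: "y = (s, b, g)" by (cases y) auto
  have "Qop N y (Dop x \<Psi>) - s2 x y * Qop N x (Dop y \<Psi>)
     = (\<Sum>i<N. A i x y + B i y x) - s2 x y * (\<Sum>i<N. A i y x + B i x y)"
    unfolding QD s2_commute[of y x] by (simp add: sum.distrib algebra_simps)
  also have "(\<Sum>i<N. A i x y + B i y x) = (\<Sum>i<N. (if cl a = rw b then
     (\<Sum>j\<in>{0..<- (r + s)}. poly f (of_int (j + s)) * poly g (of_int j) * P i (rw a) (cl b) (j + (r + s)) j) else 0)
     + (if r + s = 0 then trp r a f s b g * \<Psi> [] else 0))"
    unfolding x y by (intro sum.cong refl AB) auto
  also have "\<dots> = Qop N (br1 x y) \<Psi> + of_nat N * (if r + s = 0 then trp r a f s b g * \<Psi> [] else 0)"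
    by (simp add: x y P_def sum.distrib)
  also have "(\<Sum>i<N. A i y x + B i x y) = (\<Sum>i<N. (if cl b = rw a then
     (\<Sum>j\<in>{0..<- (s + r)}. poly g (of_int (j + r)) * poly f (of_int j) * P i (rw b) (cl a) (j + (s + r)) j) else 0)
     + (if s + r = 0 then trp s b g r a f * \<Psi> [] else 0))"
    unfolding x y by (intro sum.cong refl AB) auto
  also have "s2 x y * \<dots> = - Qop N (br2 x y) \<Psi> + s2 x y * of_nat N * (if r + s = 0 then trp s b g r a f * \<Psi> [] else 0)"
    by (simp add: x y P_def sum.distrib s2_def sum_distrib_left sum_negf[symmetric] algebra_simps)
  finally have 1: "Qop N y (Dop x \<Psi>) - s2 x y * Qop N x (Dop y \<Psi>) = Qop N (br1 x y) \<Psi> + Qop N (br2 x y) \<Psi>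
     + of_nat N * (if r + s = 0 then (trp r a f s b g - s2 x y * trp s b g r a f) * \<Psi> [] else 0)"
    by (cases "r + s = 0") (simp_all add: algebra_simps)
  have "(if r + s = 0 then (trp r a f s b g - s2 x y * trp s b g r a f) * \<Psi> [] else 0) = cen x y * \<Psi> []"
    by (auto simp: x y trp_def s2_def)
  then show ?thesis unfolding 1 by simp
qed

end

lemma sw_br:
  "sw x w * sw y w * Qop N (br1 x y) \<Phi> = sw (br1 x y) w * Qop N (br1 x y) \<Phi>"
  "sw x w * sw y w * Qop N (br2 x y) \<Phi> = sw (br2 x y) w * Qop N (br2 x y) \<Phi>"
proof -
  obtain r a f where x: "x = (r, a, f)" by (cases x) auto
  obtain s b g where y: "y = (s, b, g)" by (cases y) auto
  have 1: "cl a = rw b \<Longrightarrow> sw x w * sw y w = sw (br1 x y) w"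
    unfolding x y by (cases a; cases b; cases "fow w"; simp add: sw_def sgn2_def oda_def)
  have 2: "cl b = rw a \<Longrightarrow> sw x w * sw y w = sw (br2 x y) w"
    unfolding x y by (cases a; cases b; cases "fow w"; simp add: sw_def sgn2_def oda_def)
  have 3: "cl a \<noteq> rw b \<Longrightarrow> Qop N (br1 x y) \<Phi> = 0" "cl b \<noteq> rw a \<Longrightarrow> Qop N (br2 x y) \<Phi> = 0"
    by (simp_all add: x y)
  show "sw x w * sw y w * Qop N (br1 x y) \<Phi> = sw (br1 x y) w * Qop N (br1 x y) \<Phi>"
    using 1 3 by (cases "cl a = rw b") simp_all
  show "sw x w * sw y w * Qop N (br2 x y) \<Phi> = sw (br2 x y) w * Qop N (br2 x y) \<Phi>"
    using 2 3 by (cases "cl b = rw a") simp_all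
qed

lemma sw_cen: "sw x w * sw y w * cen x y = cen x y"
proof -
  obtain r a f where x: "x = (r, a, f)" by (cases x) auto
  obtain s b g where y: "y = (s, b, g)" by (cases y) auto
  have "cl a = rw b \<Longrightarrow> cl b = rw a \<Longrightarrow> sw x w * sw y w = 1"
    unfolding x y by (cases a; cases b; cases "fow w"; simp add: sw_def sgn2_def oda_def)
  moreover have "\<not> (cl a = rw b \<and> cl b = rw a) \<Longrightarrow> cen x y = 0"
    by (auto simp: x y trp_def)
  ultimately show ?thesis by (cases "cl a = rw b \<and> cl b = rw a") simp_all
qed

lemma exch_append: "exch \<Phi> \<Longrightarrow> exch (\<lambda>v. \<Phi> (w @ v))"
proof (induction w arbitrary: \<Phi>)
  case (Cons p w)
  show ?case using Cons.IH[OF exch_Cons[OF Cons.prems, of p]] by simp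
qed simp

lemma rvac_append: "rvac N \<Phi> \<Longrightarrow> rvac N (\<lambda>v. \<Phi> (w @ v))"
  unfolding rvac_def by (auto simp flip: append_assoc)

text \<open>The cross terms, with one operator on the word and the other on the vacuum, cancel in
  the supercommutator. There remain the derivations, which have no centre, and the vacuum terms,
  each colour of which contributes one cocycle.\<close>

lemma op_op:
  assumes "exch \<Phi>" "rvac N \<Phi>"
  shows "op N y (op N x \<Phi>) w = s2 x y * op N x (op N y \<Phi>) w + op N (br1 x y) \<Phi> w + op N (br2 x y) \<Phi> w
     + of_nat N * cen x y * \<Phi> w"
proof -
  let ?\<Psi> = "\<lambda>v. \<Phi> (w @ v)"
  have ex: "exch ?\<Psi>" and rv: "rvac N ?\<Psi>" by (rule exch_append rvac_append, fact)+
  have e: "op N y (op N x \<Phi>) w = Dop y (Dop x \<Phi>) w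
     + s2 x y * sw x w * Qop N x (\<lambda>z. Dop y (\<lambda>v. \<Phi> (v @ z)) w)
     + sw y w * Qop N y (\<lambda>z. Dop x (\<lambda>v. \<Phi> (v @ z)) w)
     + sw x w * sw y w * (Qop N y (Dop x ?\<Psi>) + s2 x y * Qop N y (\<lambda>v. Qop N x (\<lambda>z. ?\<Psi> (v @ z))))" for x y
  proof -
    have "Dop y (op N x \<Phi>) w = Dop y (Dop x \<Phi>) w + s2 x y * sw x w * Qop N x (\<lambda>z. Dop y (\<lambda>v. \<Phi> (v @ z)) w)"
      using Dop_lin[of y 1 "Dop x \<Phi>" 1 "\<lambda>v. sw x v * Qop N x (\<lambda>z. \<Phi> (v @ z))" w]
      by (simp add: op_def[abs_def] Dop_sw Dop_Qop)
    moreover have "Qop N y (\<lambda>v. op N x \<Phi> (w @ v)) = Qop N y (\<lambda>z. Dop x (\<lambda>v. \<Phi> (v @ z)) w)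
      + sw x w * (Qop N y (Dop x ?\<Psi>) + s2 x y * Qop N y (\<lambda>v. Qop N x (\<lambda>z. ?\<Psi> (v @ z))))"
    proof -
      have "(\<lambda>v. op N x \<Phi> (w @ v)) = (\<lambda>v. 1 * Dop x (\<lambda>u. \<Phi> (u @ v)) w + sw x w *
          (1 * Dop x ?\<Psi> v + 1 * (sw x v * Qop N x (\<lambda>z. ?\<Psi> (v @ z)))))"
        by (simp add: op_def Dop_append algebra_simps)
      then show ?thesis by (simp only: Qop_lin Qop_sw) simp
    qed
    ultimately show ?thesis unfolding op_def[of N y "op N x \<Phi>"] by (simp add: algebra_simps)
  qed
  have s: "s2 x y * Qop N y (\<lambda>v. Qop N x (\<lambda>z. ?\<Psi> (v @ z))) = Qop N x (\<lambda>v. Qop N y (\<lambda>z. ?\<Psi> (v @ z)))"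
    using Qop_Qop[OF ex, of N y x] by simp
  have "op N y (op N x \<Phi>) w - s2 x y * op N x (op N y \<Phi>) w =
     (Dop y (Dop x \<Phi>) w - s2 x y * Dop x (Dop y \<Phi>) w)
     + sw x w * sw y w * (Qop N y (Dop x ?\<Psi>) - s2 x y * Qop N x (Dop y ?\<Psi>))"
    unfolding e s2_commute[of y x] s by (simp add: algebra_simps)
  also have "\<dots> = Dop (br1 x y) \<Phi> w + Dop (br2 x y) \<Phi> w + (sw x w * sw y w * Qop N (br1 x y) ?\<Psi>
     + sw x w * sw y w * Qop N (br2 x y) ?\<Psi> + of_nat N * (sw x w * sw y w * cen x y) * \<Phi> w)"
    unfolding Qop_Dop_bracket[OF ex rv, of y x] Dop_Dop[of y x \<Phi> w] by (simp add: algebra_simps)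
  also have "\<dots> = op N (br1 x y) \<Phi> w + op N (br2 x y) \<Phi> w + of_nat N * cen x y * \<Phi> w"
    unfolding sw_br sw_cen by (simp add: op_def)
  finally show ?thesis by (simp add: algebra_simps)
qed

section \<open>Vacuum expectation values\<close>

definition ow :: "nat \<Rightarrow> (osc list \<Rightarrow> complex) \<Rightarrow> xl list \<Rightarrow> osc list \<Rightarrow> complex" where
  "ow N \<Phi> xs = foldl (\<lambda>\<Phi> x. op N x \<Phi>) \<Phi> xs"

definition vev :: "nat \<Rightarrow> xl list \<Rightarrow> complex" where
  "vev N xs = ow N Wick xs []"

lemma ow_simps [simp]: "ow N \<Phi> [] = \<Phi>" "ow N \<Phi> (x # v) = ow N (op N x \<Phi>) v"
  "ow N \<Phi> (u @ v) = ow N (ow N \<Phi> u) v"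
  by (simp_all add: ow_def)

lemma good_ow: "exch \<Phi> \<Longrightarrow> rvac N \<Phi> \<Longrightarrow> exch (ow N \<Phi> u) \<and> rvac N (ow N \<Phi> u)"
  by (induction u arbitrary: \<Phi>) (auto intro: exch_op rvac_op)

lemma ow_lin: "ow N (\<lambda>w. c * \<Phi> w + d * \<Psi> w) v = (\<lambda>w. c * ow N \<Phi> v w + d * ow N \<Psi> v w)"
proof (induction v arbitrary: \<Phi> \<Psi>)
  case (Cons x v)
  have "op N x (\<lambda>w. c * \<Phi> w + d * \<Psi> w) = (\<lambda>w. c * op N x \<Phi> w + d * op N x \<Psi> w)"
    by (rule ext) (rule op_lin)
  then show ?case by (simp add: Cons.IH)
qed simp

lemma op_poly_lin:
  "op N (r, a, smult c f + smult d g) \<Phi> w = c * op N (r, a, f) \<Phi> w + d * op N (r, a, g) \<Phi> w"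
proof -
  have cf: "cf (r, a, smult c f + smult d g) p = c * cf (r, a, f) p + d * cf (r, a, g) p" for p
    by (cases p) (auto simp: algebra_simps)
  have ap: "ap (r, a, smult c f + smult d g) p = ap (r, a, 0) p" "ap (r, a, f) p = ap (r, a, 0) p"
    "ap (r, a, g) p = ap (r, a, 0) p" for p
    by (cases p; auto)+
  have "Dop (r, a, smult c f + smult d g) \<Phi> w = c * Dop (r, a, f) \<Phi> w + d * Dop (r, a, g) \<Phi> w"
    by (induction w arbitrary: \<Phi>) (simp_all add: cf sx_def ap algebra_simps)
  moreover have "Qop N (r, a, smult c f + smult d g) \<Phi> = c * Qop N (r, a, f) \<Phi> + d * Qop N (r, a, g) \<Phi>" for \<Phi>
    by (simp add: algebra_simps sum.distrib sum_distrib_left)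
  ultimately show ?thesis
    by (simp add: op_def sw_def algebra_simps del: Qop.simps)
qed

lemma vev_Nil [simp]: "vev N [] = 1"
  by (simp add: vev_def)

lemma vev_lin: "vev N (u @ (r, a, smult c f + smult d g) # v) =
   c * vev N (u @ (r, a, f) # v) + d * vev N (u @ (r, a, g) # v)"
proof -
  have "op N (r, a, smult c f + smult d g) \<Phi> = (\<lambda>w. c * op N (r, a, f) \<Phi> w + d * op N (r, a, g) \<Phi> w)" for \<Phi>
    by (rule ext) (rule op_poly_lin)
  then show ?thesis by (simp add: vev_def ow_lin)
qed

lemma vev_bracket: "vev N (u @ x # y # v) = s2 x y * vev N (u @ y # x # v) + vev N (u @ br1 x y # v)
   + vev N (u @ br2 x y # v) + of_nat N * cen x y * vev N (u @ v)"
proof -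
  let ?\<Phi> = "ow N Wick u"
  have g: "exch ?\<Phi>" "rvac N ?\<Phi>" using good_ow[OF exch_Wick rvac_Wick] by auto
  have "op N y (op N x ?\<Phi>) = (\<lambda>w. s2 x y * op N x (op N y ?\<Phi>) w + 1 *
      ((\<lambda>w. 1 * op N (br1 x y) ?\<Phi> w + 1 * (\<lambda>w. 1 * op N (br2 x y) ?\<Phi> w + of_nat N * cen x y * ?\<Phi> w) w) w))"
    using op_op[OF g, of y x] by (simp add: fun_eq_iff)
  then have "ow N (op N y (op N x ?\<Phi>)) v = (\<lambda>w. s2 x y * ow N (op N x (op N y ?\<Phi>)) v w + 1 *
      ((\<lambda>w. 1 * ow N (op N (br1 x y) ?\<Phi>) v w + 1 * (\<lambda>w. 1 * ow N (op N (br2 x y) ?\<Phi>) v w + of_nat N * cen x y * ow N ?\<Phi> v w) w) w))"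
    by (simp only: ow_lin)
  then show ?thesis by (simp add: vev_def)
qed

text \<open>The letters of \<open>SP\<close>: since \<open>t^r f(D)\<close> sends \<open>t^j\<close>
  to \<open>f(j) t^(j + r)\<close>, this says that polynomials in \<open>t\<close> are
  preserved.\<close>

fun spx :: "xl \<Rightarrow> bool" where
  "spx (r, a, f) \<longleftrightarrow> (\<forall>j. 0 \<le> j \<and> j < - r \<longrightarrow> poly f (of_int j) = 0)"

lemma vev_spx: "spx x \<Longrightarrow> vev N (u @ [x]) = 0"
  by (cases x) (auto simp: vev_def op_def)

text \<open>The pair \<open>A, B\<close> selects a combination of the two gradings by the exponent of \<open>t\<close> and by charge.\<close>

definition chg :: "mtyp \<Rightarrow> int" where
  "chg a = (if cl a then 1 else 0) - (if rw a then 1 else 0)"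

fun wx :: "int \<Rightarrow> int \<Rightarrow> xl \<Rightarrow> int" where
  "wx A B (r, a, f) = - A * r + B * chg a"

definition wxs :: "int \<Rightarrow> int \<Rightarrow> xl list \<Rightarrow> int" where
  "wxs A B w = sum_list (map (wx A B) w)"

fun og :: "int \<Rightarrow> int \<Rightarrow> osc \<Rightarrow> int" where
  "og A B (Ps i s j) = - A * j - (if s then B else 0)"
| "og A B (Pd i s j) = A * j + (if s then B else 0)"

definition ogs :: "int \<Rightarrow> int \<Rightarrow> osc list \<Rightarrow> int" where
  "ogs A B w = sum_list (map (og A B) w)"

lemma Con_graded:
  "(\<And>v. \<Phi> v \<noteq> 0 \<Longrightarrow> ogs A B v = e) \<Longrightarrow> Con x \<Phi> w \<noteq> 0 \<Longrightarrow> og A B x + ogs A B w = e"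
proof (induction w arbitrary: \<Phi> e)
  case (Cons p w)
  show ?case
  proof (cases "ctr x p * \<Phi> w = 0")
    case True
    then have "Con x (\<lambda>v. \<Phi> (p # v)) w \<noteq> 0" using Cons.prems by auto
    then have "og A B x + ogs A B w = e - og A B p"
      by (rule Cons.IH[rotated]) (use Cons.prems(1) in \<open>fastforce simp: ogs_def\<close>)
    then show ?thesis by (simp add: ogs_def)
  next
    case False
    then have "ctr x p \<noteq> 0" "ogs A B w = e" using Cons.prems(1) by auto
    then show ?thesis by (cases x; cases p) (auto simp: ogs_def split: if_splits)
  qed
qed simp

lemma Wick_graded: "Wick w \<noteq> 0 \<Longrightarrow> ogs A B w = 0"
proof (induction "length w" arbitrary: w rule: less_induct)
  case less
  show ?case
  proof (cases w)
    case (Cons x v)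
    \<comment> \<open>Truncation to short words turns the induction hypothesis into the unrestricted
      hypothesis of \<open>Con_graded\<close>.\<close>
    let ?\<Phi> = "\<lambda>u. if length u < length w then Wick u else 0"
    have "Con x Wick v = Con x ?\<Phi> v"
      by (rule Con_cong) (use Cons in auto)
    then have "Con x ?\<Phi> v \<noteq> 0" using less.prems Cons by (simp add: Wick_Cons)
    then have "og A B x + ogs A B v = 0"
      by (rule Con_graded[rotated]) (use less.hyps in \<open>auto split: if_splits\<close>)
    then show ?thesis using Cons by (simp add: ogs_def)
  qed (simp add: ogs_def)
qed

lemma og_ap: "cf x p \<noteq> 0 \<Longrightarrow> og A B (ap x p) = og A B p + wx A B x"
  by (cases x; cases p) (auto simp: chg_def algebra_simps split: if_splits)

lemma Dop_graded:
  "(\<And>v. \<Phi> v \<noteq> 0 \<Longrightarrow> ogs A B v = e) \<Longrightarrow> Dop x \<Phi> w \<noteq> 0 \<Longrightarrow> ogs A B w + wx A B x = e"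
proof (induction w arbitrary: \<Phi> e)
  case (Cons p w)
  show ?case
  proof (cases "cf x p * \<Phi> (ap x p # w) = 0")
    case True
    then have "Dop x (\<lambda>v. \<Phi> (p # v)) w \<noteq> 0" using Cons.prems by auto
    then have "ogs A B w + wx A B x = e - og A B p"
      by (rule Cons.IH[rotated]) (use Cons.prems(1) in \<open>fastforce simp: ogs_def\<close>)
    then show ?thesis by (simp add: ogs_def)
  next
    case False
    then have "cf x p \<noteq> 0" "ogs A B (ap x p # w) = e" using Cons.prems(1) by auto
    then show ?thesis by (simp add: ogs_def og_ap)
  qed
qed simp

lemma op_graded:
  assumes "\<And>v. \<Phi> v \<noteq> 0 \<Longrightarrow> ogs A B v = e" "op N x \<Phi> w \<noteq> 0"
  shows "ogs A B w + wx A B x = e"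
proof (cases "Dop x \<Phi> w = 0")
  case True
  obtain r a f where x: "x = (r, a, f)" by (cases x) auto
  from True assms(2) have "Qop N x (\<lambda>v. \<Phi> (w @ v)) \<noteq> 0" by (auto simp: op_def)
  then obtain ij where "\<Phi> (w @ ql x (fst ij) (snd ij)) \<noteq> 0"
    unfolding Qop_alt by (metis (no_types, lifting) mult_zero_right sum.neutral)
  then have "ogs A B (w @ ql x (fst ij) (snd ij)) = e" by (rule assms(1))
  then show ?thesis by (auto simp: ogs_def x chg_def algebra_simps split: if_splits)
qed (use Dop_graded assms(1) in blast)

lemma ow_graded:
  "(\<And>v. \<Phi> v \<noteq> 0 \<Longrightarrow> ogs A B v = e) \<Longrightarrow> ow N \<Phi> xs w \<noteq> 0 \<Longrightarrow> ogs A B w + wxs A B xs = e"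
proof (induction xs arbitrary: \<Phi> e)
  case (Cons x xs)
  have "ogs A B w + wxs A B xs = e - wx A B x"
  proof (rule Cons.IH)
    show "ow N (op N x \<Phi>) xs w \<noteq> 0" using Cons.prems(2) by simp
    show "ogs A B v = e - wx A B x" if "op N x \<Phi> v \<noteq> 0" for v
      using op_graded[OF Cons.prems(1) that] by simp
  qed
  then show ?case by (simp add: wxs_def)
qed (simp add: wxs_def)

lemma vev_graded: "vev N xs \<noteq> 0 \<Longrightarrow> wxs A B xs = 0"
  using ow_graded[of Wick A B 0 N xs "[]", OF Wick_graded] by (simp add: vev_def ogs_def)

section \<open>Vacuum-like functionals\<close>

text \<open>As simplification rules these would rewrite inside the eta-expanded terms that arise from
  instantiating induction rules.\<close>

declare plus_fun_apply [simp del] zero_fun_apply [simp del] minus_apply [simp del]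

definition scV :: "complex \<Rightarrow> ('a \<Rightarrow> complex) \<Rightarrow> 'a \<Rightarrow> complex" where
  "scV c \<phi> = (\<lambda>u. c * \<phi> u)"

lemma scV_apply: "scV c \<phi> u = c * \<phi> u"
  by (simp add: scV_def)

lemmas fun_apply = plus_fun_apply zero_fun_apply minus_apply scV_apply

interpretation vs: vector_space scV
  by unfold_locales (auto simp: fun_apply fun_eq_iff algebra_simps)

definition acts :: "xl list \<Rightarrow> (xl list \<Rightarrow> complex) \<Rightarrow> xl list \<Rightarrow> complex" where
  "acts w \<phi> = (\<lambda>u. \<phi> (u @ w))"

definition act :: "xl \<Rightarrow> (xl list \<Rightarrow> complex) \<Rightarrow> xl list \<Rightarrow> complex" where
  "act x \<phi> = acts [x] \<phi>"

lemma acts_apply: "acts w \<phi> u = \<phi> (u @ w)" and act_apply: "act x \<phi> u = \<phi> (u @ [x])"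
  by (simp_all add: acts_def act_def)

lemma acts_Nil [simp]: "acts [] \<phi> = \<phi>" and acts_Cons: "acts (x # w) \<phi> = act x (acts w \<phi>)"
  by (simp_all add: acts_def act_def)

lemma acts_append: "acts (u @ v) \<phi> = acts u (acts v \<phi>)"
  by (simp add: acts_def)

lemma acts_add: "acts w (\<phi> + \<psi>) = acts w \<phi> + acts w \<psi>"
  and acts_scV: "acts w (scV c \<phi>) = scV c (acts w \<phi>)"
  and acts_0: "acts w 0 = 0"
  and acts_diff: "acts w (\<phi> - \<psi>) = acts w \<phi> - acts w \<psi>"
  by (simp_all add: acts_def fun_eq_iff fun_apply)

lemmas act_add = acts_add[of "[x]" for x, folded act_def]
  and act_scV = acts_scV[of "[x]" for x, folded act_def]
  and act_0 = acts_0[of "[x]" for x, folded act_def]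
  and act_diff = acts_diff[of "[x]" for x, folded act_def]

lemma sum_fun_apply: "(\<Sum>i\<in>I. f i) u = (\<Sum>i\<in>I. f i u)" for f :: "'i \<Rightarrow> 'a \<Rightarrow> complex"
  by (induction I rule: infinite_finite_induct) (simp_all add: fun_apply)

lemma acts_sum: "acts w (\<Sum>i\<in>I. f i) = (\<Sum>i\<in>I. acts w (f i))"
  by (simp add: acts_def fun_eq_iff sum_fun_apply)

lemmas act_sum = acts_sum[of "[x]" for x, folded act_def]

text \<open>The functionals that descend to the enveloping algebra with the centre acting by
  \<open>c\<close>.\<close>

definition lieF :: "complex \<Rightarrow> (xl list \<Rightarrow> complex) set" where
  "lieF c = {\<phi>. (\<forall>u v r a p f q g. \<phi> (u @ (r, a, smult p f + smult q g) # v) =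
        p * \<phi> (u @ (r, a, f) # v) + q * \<phi> (u @ (r, a, g) # v))
    \<and> (\<forall>u v x y. \<phi> (u @ x # y # v) = s2 x y * \<phi> (u @ y # x # v) + \<phi> (u @ br1 x y # v)
       + \<phi> (u @ br2 x y # v) + c * cen x y * \<phi> (u @ v))}"

lemma lieF_lin: "\<phi> \<in> lieF c \<Longrightarrow> \<phi> (u @ (r, a, smult p f + smult q g) # v) =
        p * \<phi> (u @ (r, a, f) # v) + q * \<phi> (u @ (r, a, g) # v)"
  and lieF_br: "\<phi> \<in> lieF c \<Longrightarrow> \<phi> (u @ x # y # v) = s2 x y * \<phi> (u @ y # x # v) + \<phi> (u @ br1 x y # v)
       + \<phi> (u @ br2 x y # v) + c * cen x y * \<phi> (u @ v)"
  unfolding lieF_def by blast+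

lemma lieF_I:
  assumes "\<And>u v r a p f q g. \<phi> (u @ (r, a, smult p f + smult q g) # v) =
        p * \<phi> (u @ (r, a, f) # v) + q * \<phi> (u @ (r, a, g) # v)"
    and "\<And>u v x y. \<phi> (u @ x # y # v) = s2 x y * \<phi> (u @ y # x # v) + \<phi> (u @ br1 x y # v)
       + \<phi> (u @ br2 x y # v) + c * cen x y * \<phi> (u @ v)"
  shows "\<phi> \<in> lieF c"
  unfolding lieF_def using assms by blast

lemma subspace_lieF: "vs.subspace (lieF c)"
proof (rule vs.subspaceI)
  show "0 \<in> lieF c" by (rule lieF_I) (simp_all add: fun_apply)
next
  fix \<phi> \<psi> assume h: "\<phi> \<in> lieF c" "\<psi> \<in> lieF c"
  show "\<phi> + \<psi> \<in> lieF c"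
  proof (rule lieF_I)
    show "(\<phi> + \<psi>) (u @ (r, a, smult p f + smult q g) # v) =
        p * (\<phi> + \<psi>) (u @ (r, a, f) # v) + q * (\<phi> + \<psi>) (u @ (r, a, g) # v)" for u v r a p f q g
      by (simp add: fun_apply lieF_lin[OF h(1)] lieF_lin[OF h(2)] algebra_simps)
    show "(\<phi> + \<psi>) (u @ x # y # v) = s2 x y * (\<phi> + \<psi>) (u @ y # x # v) + (\<phi> + \<psi>) (u @ br1 x y # v)
       + (\<phi> + \<psi>) (u @ br2 x y # v) + c * cen x y * (\<phi> + \<psi>) (u @ v)" for u v x y
      using lieF_br[OF h(1), of u x y v] lieF_br[OF h(2), of u x y v] by (simp add: fun_apply distrib_left)
  qed
next
  fix p \<phi> assume h: "\<phi> \<in> lieF c"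
  show "scV p \<phi> \<in> lieF c"
  proof (rule lieF_I)
    show "scV p \<phi> (u @ (r, a, smult p' f + smult q g) # v) =
        p' * scV p \<phi> (u @ (r, a, f) # v) + q * scV p \<phi> (u @ (r, a, g) # v)" for u v r a p' f q g
      by (simp add: lieF_lin[OF h] fun_apply algebra_simps)
    show "scV p \<phi> (u @ x # y # v) = s2 x y * scV p \<phi> (u @ y # x # v) + scV p \<phi> (u @ br1 x y # v)
       + scV p \<phi> (u @ br2 x y # v) + c * cen x y * scV p \<phi> (u @ v)" for u v x y
      using lieF_br[OF h, of u x y v] by (simp add: fun_apply distrib_left mult.left_commute)
  qed
qed

lemma acts_lieF: assumes "\<phi> \<in> lieF c" shows "acts w \<phi> \<in> lieF c"
proof (rule lieF_I)
  show "acts w \<phi> (u @ (r, a, smult p f + smult q g) # v) =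
        p * acts w \<phi> (u @ (r, a, f) # v) + q * acts w \<phi> (u @ (r, a, g) # v)" for u v r a p f q g
    using lieF_lin[OF assms, of u r a p f q g "v @ w"] by (simp add: acts_def)
  show "acts w \<phi> (u @ x # y # v) = s2 x y * acts w \<phi> (u @ y # x # v) + acts w \<phi> (u @ br1 x y # v)
       + acts w \<phi> (u @ br2 x y # v) + c * cen x y * acts w \<phi> (u @ v)" for u v x y
    using lieF_br[OF assms, of u x y "v @ w"] by (simp add: acts_def)
qed

lemma act_poly:
  assumes "\<phi> \<in> lieF c"
  shows "act (r, a, smult p f + smult q g) \<phi> = scV p (act (r, a, f) \<phi>) + scV q (act (r, a, g) \<phi>)"
  using lieF_lin[OF assms, of _ r a p f q g "[]"] by (simp add: act_apply fun_eq_iff fun_apply)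

lemma act_poly_add:
  assumes "\<phi> \<in> lieF c"
  shows "act (r, a, f + g) \<phi> = act (r, a, f) \<phi> + act (r, a, g) \<phi>"
  using act_poly[OF assms, of r a 1 f 1 g] by simp

lemma act_poly_smult:
  assumes "\<phi> \<in> lieF c"
  shows "act (r, a, smult p f) \<phi> = scV p (act (r, a, f) \<phi>)"
  using act_poly[OF assms, of r a p f 0 f] by simp

lemma act_poly_0:
  assumes "\<phi> \<in> lieF c"
  shows "act (r, a, 0) \<phi> = 0"
  using act_poly_smult[OF assms, of r a 0 0] by simp

lemma act_poly_sum:
  assumes "\<phi> \<in> lieF c"
  shows "act (r, a, \<Sum>i\<in>I. smult (p i) (f i)) \<phi> = (\<Sum>i\<in>I. scV (p i) (act (r, a, f i) \<phi>))"
  by (induction I rule: infinite_finite_induct)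
    (simp_all add: act_poly_0[OF assms] act_poly_add[OF assms] act_poly_smult[OF assms])

lemma act_br:
  assumes "\<phi> \<in> lieF c"
  shows "act x (act y \<phi>) = scV (s2 x y) (act y (act x \<phi>)) + act (br1 x y) \<phi> + act (br2 x y) \<phi> + scV (c * cen x y) \<phi>"
proof
  fix u
  show "act x (act y \<phi>) u = (scV (s2 x y) (act y (act x \<phi>)) + act (br1 x y) \<phi> + act (br2 x y) \<phi> + scV (c * cen x y) \<phi>) u"
    using lieF_br[OF assms, of u x y "[]"] by (simp add: act_apply fun_apply)
qed

text \<open>The letters with \<open>cre\<close> are a complement of \<open>SP\<close>, and those with \<open>der\<close> yield the derivatives of
  the generators.\<close>

fun cre :: "xl \<Rightarrow> bool" where
  "cre (r, a, f) \<longleftrightarrow> int (degree f) < - r"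

fun der :: "xl \<Rightarrow> bool" where
  "der (r, a, f) \<longleftrightarrow> int (degree f) + 1 < - r"

lemma der_cre: "der x \<Longrightarrow> cre x"
  by (cases x) auto

lemma degree_ffp: "degree (ffp k) = k" and ffp_nz: "ffp k \<noteq> 0"
proof -
  show nz: "ffp k \<noteq> 0" for k by (simp add: ffp_def)
  show "degree (ffp k) = k"
  proof (induction k)
    case (Suc k)
    have "ffp (Suc k) = ffp k * [:- of_nat k, 1:]" by (simp add: ffp_def)
    also have "degree \<dots> = degree (ffp k) + degree [:- of_nat k, 1 :: complex:]"
      by (rule degree_mult_eq) (use nz in auto)
    finally show ?case using Suc by simp
  qed (simp add: ffp_def)
qed

lemma poly_ffp_0: "j < k \<Longrightarrow> poly (ffp k) (of_nat j) = 0"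
  by (auto simp: ffp_def poly_prod)

text \<open>Division with remainder by \<open>ffp m\<close> for \<open>m = - r\<close>: its roots
  are the points at which \<open>spx\<close> tests, and the remainder has degree below
  \<open>m\<close>.\<close>

lemma split_letter:
  assumes "r < 0"
  obtains g h where "f = g + h" "cre (r, a, g)" "spx (r, a, h)"
proof
  let ?m = "nat (- r)"
  show "f = f mod ffp ?m + ffp ?m * (f div ffp ?m)" by simp
  show "cre (r, a, f mod ffp ?m)"
    using degree_mod_less'[OF ffp_nz, of f ?m] assms degree_ffp[of ?m]
    by (cases "f mod ffp ?m = 0") auto
  show "spx (r, a, ffp ?m * (f div ffp ?m))"
  proof -
    have "poly (ffp ?m) (of_int j) = 0" if "0 \<le> j" "j < - r" for j
      using poly_ffp_0[of "nat j" ?m] that by simp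
    then show ?thesis by simp
  qed
qed

lemma wx_br1: "cl a = rw b \<Longrightarrow> wx A B (br1 (r, a, f) (s, b, g)) = wx A B (r, a, f) + wx A B (s, b, g)"
  and wx_br2: "cl b = rw a \<Longrightarrow> wx A B (br2 (r, a, f) (s, b, g)) = wx A B (r, a, f) + wx A B (s, b, g)"
  by (simp_all add: chg_def algebra_simps)

lemma wx_cen: "cen x y \<noteq> 0 \<Longrightarrow> wx A B x + wx A B y = 0"
proof -
  obtain r a f where x: "x = (r, a, f)" by (cases x) auto
  obtain s b g where y: "y = (s, b, g)" by (cases y) auto
  assume "cen x y \<noteq> 0"
  then have "r + s = 0" "cl a = rw b" "cl b = rw a"
    by (auto simp: x y trp_def split: if_splits)
  moreover from \<open>r + s = 0\<close> have "s = - r" by simp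
  ultimately show ?thesis by (simp add: x y chg_def algebra_simps)
qed

lemma wxs_simps [simp]: "wxs A B [] = 0" "wxs A B (x # w) = wx A B x + wxs A B w"
  "wxs A B (u @ v) = wxs A B u + wxs A B v"
  by (simp_all add: wxs_def)

section \<open>The length filtration of a vacuum module\<close>

locale vacuum =
  fixes c :: complex and \<phi>0 :: "xl list \<Rightarrow> complex"
  assumes lie: "\<phi>0 \<in> lieF c" and spx_vac: "spx x \<Longrightarrow> \<phi>0 (u @ [x]) = 0"
begin

lemma spx_act [simp]: "spx x \<Longrightarrow> act x \<phi>0 = 0"
  by (simp add: act_apply fun_eq_iff fun_apply spx_vac)

lemma lie_acts [simp]: "acts w \<phi>0 \<in> lieF c"
  by (rule acts_lieF[OF lie])

text \<open>The bound on the length is strict, so that \<open>Ul A B r e\<close> is the space modulo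
  which a combination of words of length \<open>r\<close> is judged by its leading tensor, and
  \<open>Ul A B 0 e\<close> is zero.\<close>

definition CW :: "int \<Rightarrow> int \<Rightarrow> nat \<Rightarrow> int \<Rightarrow> (xl list \<Rightarrow> complex) set" where
  "CW A B r e = {acts w \<phi>0 | w. length w < r \<and> (\<forall>x\<in>set w. cre x) \<and> wxs A B w = e}"

definition Ul :: "int \<Rightarrow> int \<Rightarrow> nat \<Rightarrow> int \<Rightarrow> (xl list \<Rightarrow> complex) set" where
  "Ul A B r e = vs.span (CW A B r e)"

lemma Ul_base: "length w < r \<Longrightarrow> (\<And>x. x \<in> set w \<Longrightarrow> cre x) \<Longrightarrow> wxs A B w = e \<Longrightarrow> acts w \<phi>0 \<in> Ul A B r e"
  unfolding Ul_def CW_def by (rule vs.span_base) blast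

lemma Ul_subspace: "vs.subspace (Ul A B r e)"
  unfolding Ul_def by simp

lemmas Ul_add = vs.subspace_add[OF Ul_subspace]
  and Ul_scale = vs.subspace_scale[OF Ul_subspace]
  and Ul_0 = vs.subspace_0[OF Ul_subspace]
  and Ul_diff = vs.subspace_diff[OF Ul_subspace]
  and Ul_sum = vs.subspace_sum[OF Ul_subspace]

lemma Ul_mono: "r \<le> s \<Longrightarrow> Ul A B r e \<subseteq> Ul A B s e"
  unfolding Ul_def CW_def by (intro vs.span_mono) auto

lemma Ul_up: "\<phi> \<in> Ul A B r e \<Longrightarrow> r \<le> s \<Longrightarrow> \<phi> \<in> Ul A B s e"
  using Ul_mono by blast

lemma Ul_lie: "\<phi> \<in> Ul A B r e \<Longrightarrow> \<phi> \<in> lieF c"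
  unfolding Ul_def CW_def by (rule set_mp[OF vs.span_minimal[OF _ subspace_lieF]]) auto

lemma act_span_into:
  assumes "\<And>\<psi>. \<psi> \<in> X \<Longrightarrow> act x \<psi> \<in> Y" "vs.subspace Y" "\<phi> \<in> vs.span X"
  shows "act x \<phi> \<in> Y"
  using assms(3)
proof (induction rule: vs.span_induct_alt)
  case base
  then show ?case using vs.subspace_0[OF assms(2)] by (simp add: act_0)
next
  case (step p \<psi> \<phi>)
  then show ?case using assms(1) vs.subspace_add[OF assms(2)] vs.subspace_scale[OF assms(2)]
    by (simp add: act_add act_scV)
qed

lemma Ul_act_into:
  assumes "\<And>w. length w < r \<Longrightarrow> (\<And>y. y \<in> set w \<Longrightarrow> cre y) \<Longrightarrow> wxs A B w = e \<Longrightarrow> act x (acts w \<phi>0) \<in> Ul A' B' r' e'"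
    and "\<phi> \<in> Ul A B r e"
  shows "act x \<phi> \<in> Ul A' B' r' e'"
  using assms(2) unfolding Ul_def
  by (rule act_span_into[rotated 2]) (use assms(1) in \<open>auto simp: CW_def Ul_def\<close>)

lemma Ul_cre: "cre x \<Longrightarrow> \<phi> \<in> Ul A B r e \<Longrightarrow> act x \<phi> \<in> Ul A B (Suc r) (wx A B x + e)"
  by (rule Ul_act_into) (auto simp flip: acts_Cons intro!: Ul_base)

text \<open>Both claims need each other. An \<open>SP\<close> letter passes a creation letter at the
  cost of general letters acting on a shorter word, so no length is gained; a general letter is a
  creation letter plus an \<open>SP\<close> letter.\<close>

lemma act_word:
  assumes "\<And>y. y \<in> set w \<Longrightarrow> cre y"
  shows "act x (acts w \<phi>0) \<in> Ul A B (Suc (Suc (length w))) (wx A B x + wxs A B w)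
    \<and> (spx x \<longrightarrow> act x (acts w \<phi>0) \<in> Ul A B (Suc (length w)) (wx A B x + wxs A B w))"
  using assms
proof (induction w arbitrary: x)
  case Nil
  obtain r a f where x: "x = (r, a, f)" by (cases x) auto
  have 1: "act x \<phi>0 \<in> Ul A B (Suc (Suc 0)) (wx A B x)"
  proof (cases "r < 0")
    case True
    obtain g h where g: "f = g + h" "cre (r, a, g)" "spx (r, a, h)"
      using split_letter[OF True, of f a] .
    have "act x \<phi>0 = acts [(r, a, g)] \<phi>0"
      unfolding x g(1) act_poly_add[OF lie] using spx_act[OF g(3)] by (simp add: act_def)
    then show ?thesis using g(2) by (auto simp: x intro!: Ul_base)
  next
    case False
    then have "spx x" by (auto simp: x)
    then show ?thesis by (simp add: Ul_0)
  qed
  then show ?case by (simp add: Ul_0)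
next
  case (Cons y w)
  let ?v = "acts w \<phi>0"
  obtain s b g where y: "y = (s, b, g)" by (cases y) auto
  have w: "\<And>z. z \<in> set w \<Longrightarrow> cre z" and cy: "cre y" using Cons.prems by auto
  have IH: "act x ?v \<in> Ul A B (Suc (Suc (length w))) (wx A B x + wxs A B w)"
    and IHs: "spx x \<Longrightarrow> act x ?v \<in> Ul A B (Suc (length w)) (wx A B x + wxs A B w)" for x
    using Cons.IH[of x] w by auto
  have sp: "act x (acts (y # w) \<phi>0) \<in> Ul A B (Suc (Suc (length w))) (wx A B x + wxs A B (y # w))" if "spx x" for x
  proof -
    obtain r a f where x: "x = (r, a, f)" by (cases x) auto
    have 1: "act y (act x ?v) \<in> Ul A B (Suc (Suc (length w))) (wx A B x + wxs A B (y # w))"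
      using Ul_cre[OF cy IHs[OF that]] by (simp add: algebra_simps)
    have 2: "act (br1 x y) ?v \<in> Ul A B (Suc (Suc (length w))) (wx A B x + wxs A B (y # w))"
    proof (cases "cl a = rw b")
      case True
      then show ?thesis using IH[of "br1 x y"] wx_br1[OF True, of A B r f s g]
        by (simp only: x y wxs_simps) (simp add: add.assoc)
    next
      case False
      then show ?thesis by (simp add: x y act_poly_0[OF lie_acts] Ul_0)
    qed
    have 3: "act (br2 x y) ?v \<in> Ul A B (Suc (Suc (length w))) (wx A B x + wxs A B (y # w))"
    proof (cases "cl b = rw a")
      case True
      then show ?thesis using IH[of "br2 x y"] wx_br2[OF True, of A B r f s g]
        by (simp only: x y wxs_simps) (simp add: add.assoc)
    next
      case False
      then show ?thesis by (simp add: x y act_poly_0[OF lie_acts] Ul_0)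
    qed
    have 4: "scV (c * cen x y) ?v \<in> Ul A B (Suc (Suc (length w))) (wx A B x + wxs A B (y # w))"
    proof (cases "cen x y = 0")
      case False
      have "?v \<in> Ul A B (Suc (Suc (length w))) (wxs A B w)"
        by (rule Ul_base) (use w in auto)
      then show ?thesis using wx_cen[OF False, of A B] by (intro Ul_scale) (simp flip: add.assoc)
    qed (simp add: Ul_0)
    show ?thesis
      unfolding acts_Cons act_br[OF lie_acts, of x y] by (intro Ul_add Ul_scale 1 2 3 4)
  qed
  obtain r a f where x: "x = (r, a, f)" by (cases x) auto
  have "act x (acts (y # w) \<phi>0) \<in> Ul A B (Suc (Suc (length (y # w)))) (wx A B x + wxs A B (y # w))"
  proof (cases "r < 0")
    case True
    obtain g h where g: "f = g + h" "cre (r, a, g)" "spx (r, a, h)"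
      using split_letter[OF True, of f a] .
    have "act (r, a, g) (acts (y # w) \<phi>0) \<in> Ul A B (Suc (Suc (length (y # w)))) (wx A B x + wxs A B (y # w))"
      unfolding acts_Cons[symmetric] by (rule Ul_base) (use g(2) Cons.prems in \<open>auto simp: x\<close>)
    moreover have "act (r, a, h) (acts (y # w) \<phi>0) \<in> Ul A B (Suc (Suc (length (y # w)))) (wx A B x + wxs A B (y # w))"
      using sp[OF g(3)] Ul_mono[of "Suc (Suc (length w))" "Suc (Suc (length (y # w)))"] by (auto simp: x)
    ultimately show ?thesis unfolding x g(1) act_poly_add[OF lie_acts] by (auto simp: g(1) intro: Ul_add)
  next
    case False
    then have "spx x" by (auto simp: x)
    then show ?thesis using sp[of x] Ul_mono[of "Suc (Suc (length w))" "Suc (Suc (length (y # w)))"] by auto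
  qed
  then show ?case using sp[of x] by simp
qed

lemma Ul_any:
  assumes "\<phi> \<in> Ul A B r e"
  shows "act x \<phi> \<in> Ul A B (Suc r) (wx A B x + e)"
proof (rule Ul_act_into[OF _ assms])
  fix w assume w: "length w < r" "\<And>y. y \<in> set w \<Longrightarrow> cre y" "wxs A B w = e"
  show "act x (acts w \<phi>0) \<in> Ul A B (Suc r) (wx A B x + e)"
  proof (rule Ul_up)
    show "act x (acts w \<phi>0) \<in> Ul A B (Suc (Suc (length w))) (wx A B x + e)"
      using act_word[of w x A B] w(2,3) by blast
  qed (use w(1) in simp)
qed

lemma Ul_spx:
  assumes "spx x" "\<phi> \<in> Ul A B r e"
  shows "act x \<phi> \<in> Ul A B r (wx A B x + e)"
proof (rule Ul_act_into[OF _ assms(2)])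
  fix w assume w: "length w < r" "\<And>y. y \<in> set w \<Longrightarrow> cre y" "wxs A B w = e"
  show "act x (acts w \<phi>0) \<in> Ul A B r (wx A B x + e)"
  proof (rule Ul_up)
    show "act x (acts w \<phi>0) \<in> Ul A B (Suc (length w)) (wx A B x + e)"
      using act_word[of w x A B] w(2,3) assms(1) by blast
  qed (use w(1) in simp)
qed

lemma word_Ul: "acts w \<phi>0 \<in> Ul A B (Suc (length w)) (wxs A B w)"
proof (induction w)
  case Nil
  show ?case by (rule Ul_base) auto
next
  case (Cons x w)
  then show ?case using Ul_any[OF Cons, of x] by (simp add: acts_Cons)
qed

text \<open>A creation word of nonpositive weight is empty. For the conformal weight this makes
  every word of weight zero act on the vacuum by a scalar.\<close>

lemma Ul_neg:
  assumes "\<And>x. cre x \<Longrightarrow> wx A B x > 0" "e \<le> 0"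
  shows "Ul A B r e \<subseteq> vs.span {\<phi>0}"
proof -
  have "w = []" if "\<forall>x\<in>set w. cre x" "wxs A B w = e" for w
  proof (rule ccontr)
    assume "w \<noteq> []"
    have "wxs A B w \<ge> 0" if "\<forall>x\<in>set w. cre x" for w
      using that assms(1) by (induction w) (auto simp: less_imp_le add_nonneg_nonneg)
    then have "wxs A B w > 0"
      using \<open>w \<noteq> []\<close> that(1) assms(1) by (cases w) (auto intro: add_pos_nonneg)
    then show False using that(2) assms(2) by simp
  qed
  then have "CW A B r e \<subseteq> {\<phi>0}" unfolding CW_def using acts_Nil by blast
  then show ?thesis unfolding Ul_def by (rule vs.span_mono)
qed

end

lemma vacuum_vev: "vacuum (of_nat N) (vev N)"
proof
  show "vev N \<in> lieF (of_nat N)"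
    by (rule lieF_I) (rule vev_lin vev_bracket)+
qed (rule vev_spx)

section \<open>Matrix units\<close>

text \<open>The Lagrange basis polynomial of the node \<open>j\<close> among the nodes
  \<open>S\<close>.\<close>

definition lagr :: "int set \<Rightarrow> int \<Rightarrow> complex poly" where
  "lagr S j = (\<Prod>l\<in>S - {j}. smult (inverse (of_int (j - l))) [:- of_int l, 1:])"

lemma poly_lagr_same: "poly (lagr S j) (of_int j) = 1"
  unfolding lagr_def poly_prod
proof (intro prod.neutral ballI)
  fix l assume "l \<in> S - {j}"
  then have "(of_int (j - l) :: complex) \<noteq> 0" by simp
  from left_inverse[OF this]
  show "poly (smult (inverse (of_int (j - l))) [:- of_int l, 1:]) (of_int j :: complex) = 1" by (simp add: algebra_simps)
qed

lemma poly_lagr_other: "finite S \<Longrightarrow> l \<in> S \<Longrightarrow> l \<noteq> j \<Longrightarrow> poly (lagr S j) (of_int l) = 0"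
  unfolding lagr_def poly_prod by (intro prod_zero) auto

lemma poly_lagr: "finite S \<Longrightarrow> l \<in> S \<Longrightarrow> poly (lagr S j) (of_int l) = (if l = j then 1 else 0)"
  by (simp add: poly_lagr_same poly_lagr_other)

lemma degree_lagr: "finite S \<Longrightarrow> degree (lagr S j) \<le> card (S - {j})"
proof -
  assume S: "finite S"
  have "degree (lagr S j) \<le> (\<Sum>l\<in>S - {j}. degree (smult (inverse (of_int (j - l))) [:- of_int l, 1 :: complex:]))"
    unfolding lagr_def by (rule degree_prod_sum_le[unfolded comp_def]) (use S in auto)
  also have "\<dots> \<le> (\<Sum>l\<in>S - {j}. 1)"
    by (intro sum_mono) (simp add: degree_smult_le)
  finally show ?thesis by simp
qed

text \<open>The index \<open>(s, i, t, j)\<close> with \<open>i < 0 \<le> j\<close> stands for the matrix unit sending \<open>t\<^sup>j\<close> in the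
  component \<open>t\<close> to \<open>t\<^sup>i\<close> in the component \<open>s\<close>; \<open>yl\<close> is the creation letter and \<open>zl\<close> an annihilation letter
  acting, on a bounded range of exponents, as this matrix unit and its transpose.\<close>

type_synonym pind = "bool \<times> int \<times> bool \<times> int"

fun valid :: "pind \<Rightarrow> bool" where "valid (s, i, t, j) \<longleftrightarrow> i < 0 \<and> 0 \<le> j"
fun dg :: "pind \<Rightarrow> int" where "dg (s, i, t, j) = j - i"
fun pq :: "pind \<Rightarrow> bool" where "pq (s, i, t, j) = (s \<noteq> t)"
definition sgp :: "pind \<Rightarrow> pind \<Rightarrow> complex" where "sgp p q = sgn2 (pq p) (pq q)"

fun yl :: "pind \<Rightarrow> xl" where "yl (s, i, t, j) = (i - j, mk s t, lagr {0..<j - i} j)"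
fun zl :: "int \<Rightarrow> pind \<Rightarrow> xl" where "zl K (s, i, t, j) = (j - i, mk t s, lagr {- K..K} i)"

definition PD :: "int \<Rightarrow> pind set" where "PD D = {q. valid q \<and> dg q \<le> D}"

lemma finite_PD: "finite (PD D)"
proof -
  have "PD D \<subseteq> UNIV \<times> {- D..- 1} \<times> UNIV \<times> {0..D}" by (auto simp: PD_def)
  then show ?thesis by (rule finite_subset) auto
qed

lemma dg_pos: "valid q \<Longrightarrow> dg q > 0" by (cases q) auto

lemma oda_mk: "oda (mk s t) = (s \<noteq> t)" by (simp add: oda_def)

lemma yl_cre: "valid q \<Longrightarrow> cre (yl q)"
proof -
  assume v: "valid q"
  obtain s i t j where q: "q = (s, i, t, j)" by (cases q) auto
  have "degree (lagr {0..<j - i} j) \<le> card ({0..<j - i} - {j})" by (rule degree_lagr) simp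
  also have "\<dots> = card {0..<j - i} - 1" using v by (subst card_Diff_singleton) (auto simp: q)
  finally show ?thesis using v by (auto simp: q)
qed

lemma wx_yl: "wx 1 0 (yl q) = dg q" by (cases q) auto

lemma wx_zl: "wx 1 0 (zl K q) = - dg q" by (cases q) auto

lemma s2_yl: "s2 (yl p) (yl q) = sgp p q" "s2 (zl K p) (yl q) = sgp p q"
  by (cases p; cases q; auto simp: s2_def sgp_def oda_mk sgn2_def)+

text \<open>On exponents of modulus at most \<open>D\<close> such a letter only carries negative
  exponents to nonnegative ones. Polynomial coefficients cannot vanish at all other exponents, hence
  the bounded range.\<close>

fun Zt :: "int \<Rightarrow> xl \<Rightarrow> bool" where
  "Zt D (k, a, f) \<longleftrightarrow> (\<forall>l. - D \<le> l \<and> l \<le> D \<and> \<not> (l < 0 \<and> 0 \<le> l + k) \<longrightarrow> poly f (of_int l) = 0)"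

lemma cre_deg: "cre x \<Longrightarrow> wx 1 0 x > 0" by (cases x) auto

lemma cre_degs: "(\<And>x. x \<in> set w \<Longrightarrow> cre x) \<Longrightarrow> wxs 1 0 w \<ge> 0"
proof (induction w)
  case (Cons x w)
  then show ?case using cre_deg[of x] by fastforce
qed simp

context vacuum
begin

text \<open>The bracket of such a letter with a creation letter lies in \<open>SP\<close> and does
  not raise the length, and the central term drops the creation letter; on its way to the vacuum the
  letter thus shortens the word by one. The degree bounds keep all exponents that occur within the
  range of \<open>Zt\<close>.\<close>

lemma Zt_word:
  assumes "Zt D x" "\<And>y. y \<in> set w \<Longrightarrow> cre y" "wxs 1 0 w \<le> D" "wxs 1 0 w - fst x \<le> D"
  shows "act x (acts w \<phi>0) \<in> Ul 1 0 (length w) (wx 1 0 x + wxs 1 0 w)"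
  using assms(2-)
proof (induction w)
  case Nil
  obtain k a f where x: "x = (k, a, f)" by (cases x) auto
  have "spx x" using assms(1) Nil by (auto simp: x)
  then show ?case by (simp add: Ul_0)
next
  case (Cons y w)
  let ?v = "acts w \<phi>0"
  obtain k a f where x: "x = (k, a, f)" by (cases x) auto
  obtain s b g where y: "y = (s, b, g)" by (cases y) auto
  have w: "\<And>z. z \<in> set w \<Longrightarrow> cre z" and cy: "cre y" using Cons.prems by auto
  have w0: "wxs 1 0 w \<ge> 0" using cre_degs[OF w] .
  have s0: "s < 0" using cy by (auto simp: y)
  have D: "- s \<le> D" "- s - k \<le> D" using Cons.prems(2,3) w0 by (auto simp: x y)
  have vU: "?v \<in> Ul 1 0 (Suc (length w)) (wxs 1 0 w)" by (rule Ul_base) (use w in auto)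
  have "act x ?v \<in> Ul 1 0 (length w) (wx 1 0 x + wxs 1 0 w)"
    by (rule Cons.IH) (use w Cons.prems(2,3) s0 in \<open>auto simp: x y\<close>)
  from Ul_cre[OF cy this]
  have 1: "act y (act x ?v) \<in> Ul 1 0 (Suc (length w)) (wx 1 0 x + wxs 1 0 (y # w))"
    by (simp add: algebra_simps)
  have f0: "poly f (of_int l) = 0" if "- D \<le> l" "l \<le> D" "l \<ge> 0 \<or> l + k < 0" for l
    using assms(1) that by (auto simp: x)
  have sp1: "spx (br1 x y)"
  proof -
    have "poly f (of_int l + of_int s) = 0" if "0 \<le> l" "l < - (k + s)" for l
      using f0[of "l + s"] that D s0 by simp
    then show ?thesis by (auto simp: x y)
  qed
  have sp2: "spx (br2 x y)"
  proof -
    have "poly f (of_int l) = 0" if "0 \<le> l" "l < - (k + s)" for l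
      using f0[of l] that D by simp
    then show ?thesis by (auto simp: x y)
  qed
  have 2: "act (br1 x y) ?v \<in> Ul 1 0 (Suc (length w)) (wx 1 0 x + wxs 1 0 (y # w))"
    using Ul_spx[OF sp1 vU] by (simp add: x y algebra_simps)
  have 3: "act (br2 x y) ?v \<in> Ul 1 0 (Suc (length w)) (wx 1 0 x + wxs 1 0 (y # w))"
    using Ul_spx[OF sp2 vU] by (simp add: x y algebra_simps)
  have 4: "scV (c * cen x y) ?v \<in> Ul 1 0 (Suc (length w)) (wx 1 0 x + wxs 1 0 (y # w))"
  proof (cases "cen x y = 0")
    case False
    then show ?thesis using vU wx_cen[OF False, of 1 0] by (intro Ul_scale) (simp flip: add.assoc)
  qed (simp add: Ul_0)
  show ?case
    unfolding acts_Cons act_br[OF lie_acts, of x y] using 1 2 3 4 by (auto intro!: Ul_add Ul_scale)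
qed

lemma Zt_Ul:
  assumes "Zt D x" "\<phi> \<in> Ul 1 0 (Suc r) e" "e \<le> D" "e - fst x \<le> D"
  shows "act x \<phi> \<in> Ul 1 0 r (wx 1 0 x + e)"
proof (rule Ul_act_into[OF _ assms(2)])
  fix w assume w: "length w < Suc r" "\<And>y. y \<in> set w \<Longrightarrow> cre y" "wxs 1 0 w = e"
  have "act x (acts w \<phi>0) \<in> Ul 1 0 (length w) (wx 1 0 x + wxs 1 0 w)"
    by (rule Zt_word[OF assms(1)]) (use w assms in auto)
  then show "act x (acts w \<phi>0) \<in> Ul 1 0 r (wx 1 0 x + e)"
    using Ul_up[of _ 1 0 "length w" _ r] w by auto
qed

text \<open>Letters with the same values at \<open>0, ..., - k - 1\<close> differ by an
  \<open>SP\<close> letter, which does not raise the length.\<close>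

lemma act_yl_part:
  assumes "\<psi> \<in> Ul 1 0 r e" "j < - k" "0 \<le> j"
    and "\<And>l. 0 \<le> l \<Longrightarrow> l < - k \<Longrightarrow> poly h (of_int l) = (if l = j then \<epsilon> else 0)"
  shows "act (k, mk s t, h) \<psi> - scV \<epsilon> (act (yl (s, k + j, t, j)) \<psi>) \<in> Ul 1 0 r (e - k)"
proof -
  let ?g = "h - smult \<epsilon> (lagr {0..<- k} j)"
  have "spx (k, mk s t, ?g)"
    using assms(2-) by (auto simp: poly_lagr)
  from Ul_spx[OF this assms(1)] have "act (k, mk s t, ?g) \<psi> \<in> Ul 1 0 r (e - k)" by (simp add: algebra_simps)
  moreover have "act (k, mk s t, ?g) \<psi> = act (k, mk s t, h) \<psi> - scV \<epsilon> (act (k, mk s t, lagr {0..<- k} j) \<psi>)"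
    using act_poly[OF Ul_lie[OF assms(1)], of k "mk s t" 1 h "- \<epsilon>" "lagr {0..<- k} j"]
    by simp
  ultimately show ?thesis by (simp add: algebra_simps)
qed

lemma Ul_cen:
  assumes "\<psi> \<in> Ul A B r e"
  shows "scV (c' * cen x y) \<psi> \<in> Ul A B r (wx A B x + (wx A B y + e))"
proof (cases "cen x y = 0")
  case False
  then show ?thesis using assms wx_cen[OF False, of A B] by (intro Ul_scale) (simp flip: add.assoc)
qed (simp add: Ul_0)

text \<open>Letters acting on a bounded range as a matrix unit within the annihilated half, resp. within the
  complementary half.\<close>

lemma one_body_right:
  assumes "\<psi> \<in> Ul 1 0 r e" "valid q" "q = (s, i, t, j)"
    and la: "0 \<le> la" "0 \<le> la + k"
    and f: "\<And>l. - D \<le> l \<Longrightarrow> l \<le> D \<Longrightarrow> poly f (of_int l) = (if l = la then \<epsilon> else 0)"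
    and D: "dg q \<le> D" "dg q - k \<le> D" "- k \<le> D"
  shows "act (k, a, f) (act (yl q) \<psi>) - scV (s2 (k, a, f) (yl q)) (act (yl q) (act (k, a, f) \<psi>))
    - scV (if t = rw a \<and> j = la + k then - s2 (k, a, f) (yl q) * \<epsilon> else 0) (act (yl (s, i, cl a, la)) \<psi>)
    \<in> Ul 1 0 r (dg q - k + e)"
proof -
  let ?x = "(k, a, f)" and ?y = "yl q"
  let ?g = "lagr {0..<j - i} j"
  have ij: "i < 0" "0 \<le> j" using assms(2,3) by auto
  have sp1: "spx (br1 ?x ?y)"
  proof -
    have "poly f (of_int l + of_int (i - j)) = 0" if "0 \<le> l" "l < - (k + (i - j))" for l
      using f[of "l + (i - j)"] that D la ij by (simp add: assms(3))
    then show ?thesis by (auto simp: assms(3))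
  qed
  have 1: "act (br1 ?x ?y) \<psi> \<in> Ul 1 0 r (dg q - k + e)"
    using Ul_spx[OF sp1 assms(1)] by (simp add: assms(3) algebra_simps)
  have 2: "act (br2 ?x ?y) \<psi> - scV (if t = rw a \<and> j = la + k then - s2 (k, a, f) (yl q) * \<epsilon> else 0) (act (yl (s, i, cl a, la)) \<psi>)
     \<in> Ul 1 0 r (dg q - k + e)"
  proof (cases "t = rw a")
    case False
    then show ?thesis using act_poly_0[OF Ul_lie[OF assms(1)]] by (simp add: assms(3) Ul_0)
  next
    case True
    define h where "h = smult (- s2 ?x ?y) (psh k ?g * f)"
    have br: "br2 ?x ?y = (k + (i - j), mk s (cl a), h)"
      using True by (simp add: assms(3) h_def s2_def)
    have h: "poly h (of_int l) = (if l = la then (if j = la + k then - s2 ?x ?y * \<epsilon> else 0) else 0)"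
      if "0 \<le> l" "l < - (k + (i - j))" for l
    proof (cases "l = la")
      case True
      have "poly (lagr {0..<j - i} j) (of_int (la + k)) = (if la + k = j then 1 else 0)"
        by (rule poly_lagr) (use that la True in auto)
      moreover have "poly f (of_int la) = \<epsilon>" using f[of la] that D True ij by (simp add: assms(3))
      ultimately show ?thesis using True by (simp add: h_def)
    next
      case False
      then show ?thesis using f[of l] that D by (simp add: h_def assms(3))
    qed
    show ?thesis
    proof (cases "j = la + k")
      case True
      have "act (k + (i - j), mk s (cl a), h) \<psi> - scV (- s2 ?x ?y * \<epsilon>) (act (yl (s, k + (i - j) + la, cl a, la)) \<psi>)
          \<in> Ul 1 0 r (e - (k + (i - j)))"
        by (rule act_yl_part[OF assms(1)]) (use True la ij h in auto)
      then show ?thesis using True \<open>t = rw a\<close> unfolding br by (simp add: assms(3) algebra_simps)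
    next
      case False
      have "spx (k + (i - j), mk s (cl a), h)" using h False by auto
      from Ul_spx[OF this assms(1)] show ?thesis using False unfolding br by (simp add: assms(3) algebra_simps)
    qed
  qed
  have 3: "scV (c * cen ?x ?y) \<psi> \<in> Ul 1 0 r (dg q - k + e)"
    using Ul_cen[OF assms(1), of c ?x ?y] by (simp add: wx_yl algebra_simps)
  show ?thesis
    using Ul_add[OF Ul_add[OF 1 2] 3] unfolding act_br[OF Ul_lie[OF assms(1)], of ?x ?y]
    by (simp add: algebra_simps)
qed

lemma one_body_left:
  assumes "\<psi> \<in> Ul 1 0 r e" "valid q" "q = (s, i, t, j)"
    and la: "la < 0" "la + k < 0"
    and f: "\<And>l. - D \<le> l \<Longrightarrow> l \<le> D \<Longrightarrow> poly f (of_int l) = (if l = la then \<epsilon> else 0)"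
    and D: "dg q \<le> D" "dg q - k \<le> D"
  shows "act (k, a, f) (act (yl q) \<psi>) - scV (s2 (k, a, f) (yl q)) (act (yl q) (act (k, a, f) \<psi>))
    - scV (if s = cl a \<and> i = la then \<epsilon> else 0) (act (yl (rw a, la + k, t, j)) \<psi>)
    \<in> Ul 1 0 r (dg q - k + e)"
proof -
  let ?x = "(k, a, f)" and ?y = "yl q"
  let ?g = "lagr {0..<j - i} j"
  have ij: "i < 0" "0 \<le> j" using assms(2,3) by auto
  have sp2: "spx (br2 ?x ?y)"
  proof -
    have "poly f (of_int l) = 0" if "0 \<le> l" "l < - (k + (i - j))" for l
      using f[of l] that D la ij by (simp add: assms(3))
    then show ?thesis by (auto simp: assms(3))
  qed
  have 1: "act (br2 ?x ?y) \<psi> \<in> Ul 1 0 r (dg q - k + e)"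
    using Ul_spx[OF sp2 assms(1)] by (simp add: assms(3) algebra_simps)
  have 2: "act (br1 ?x ?y) \<psi> - scV (if s = cl a \<and> i = la then \<epsilon> else 0) (act (yl (rw a, la + k, t, j)) \<psi>)
     \<in> Ul 1 0 r (dg q - k + e)"
  proof (cases "s = cl a")
    case False
    then show ?thesis using act_poly_0[OF Ul_lie[OF assms(1)]] by (auto simp: assms(3) Ul_0)
  next
    case True
    define h where "h = psh (i - j) f * ?g"
    have br: "br1 ?x ?y = (k + (i - j), mk (rw a) t, h)"
      using True by (simp add: assms(3) h_def)
    have h: "poly h (of_int l) = (if l = j then (if i = la then \<epsilon> else 0) else 0)"
      if "0 \<le> l" "l < - (k + (i - j))" for l
    proof (cases "l + (i - j) = la")
      case True
      have "poly (lagr {0..<j - i} j) (of_int l) = (if l = j then 1 else 0)"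
        by (rule poly_lagr) (use that la True in auto)
      moreover have "poly f (of_int l + of_int (i - j)) = \<epsilon>"
      proof -
        have e: "(of_int l + of_int (i - j) :: complex) = of_int la" using True by (metis of_int_add)
        have "- D \<le> la" "la \<le> D" using that D True la ij by (auto simp: assms(3))
        then show ?thesis unfolding e using f[of la] by simp
      qed
      ultimately show ?thesis using True by (auto simp: h_def)
    next
      case False
      then show ?thesis using f[of "l + (i - j)"] that D ij by (auto simp: h_def assms(3))
    qed
    show ?thesis
    proof (cases "i = la")
      case True
      have "act (k + (i - j), mk (rw a) t, h) \<psi> - scV \<epsilon> (act (yl (rw a, k + (i - j) + j, t, j)) \<psi>)
          \<in> Ul 1 0 r (e - (k + (i - j)))"
        by (rule act_yl_part[OF assms(1)]) (use True la ij h in auto)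
      then show ?thesis using True \<open>s = cl a\<close> unfolding br by (simp add: assms(3) algebra_simps)
    next
      case False
      have "spx (k + (i - j), mk (rw a) t, h)" using h False by auto
      from Ul_spx[OF this assms(1)] show ?thesis using False unfolding br by (simp add: assms(3) algebra_simps)
    qed
  qed
  have 3: "scV (c * cen ?x ?y) \<psi> \<in> Ul 1 0 r (dg q - k + e)"
    using Ul_cen[OF assms(1), of c ?x ?y] by (simp add: wx_yl algebra_simps)
  show ?thesis
    using Ul_add[OF Ul_add[OF 1 2] 3] unfolding act_br[OF Ul_lie[OF assms(1)], of ?x ?y]
    by (simp add: algebra_simps)
qed

end

section \<open>Tensors of creation letters\<close>

definition ssym :: "(pind list \<Rightarrow> complex) \<Rightarrow> bool" where
  "ssym b \<longleftrightarrow> (\<forall>u x y v. b (u @ x # y # v) = sgp x y * b (u @ y # x # v))"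

lemma ssymD: "ssym b \<Longrightarrow> b (u @ x # y # v) = sgp x y * b (u @ y # x # v)"
  unfolding ssym_def by blast

lemma ssymI: "(\<And>u x y v. b (u @ x # y # v) = sgp x y * b (u @ y # x # v)) \<Longrightarrow> ssym b"
  unfolding ssym_def by blast

lemma ssym_Cons: assumes "ssym b" shows "ssym (\<lambda>w. b (q # w))"
proof (rule ssymI)
  fix u x y v
  show "b (q # u @ x # y # v) = sgp x y * b (q # u @ y # x # v)"
    using ssymD[OF assms, of "q # u" x y v] by (simp only: append_Cons)
qed

lemma sgp_sq [simp]: "sgp x y * sgp x y = 1" "sgp x y * (sgp x y * z) = z"
  by (simp_all add: sgp_def sgn2_def)

lemma sgp_commute: "sgp x y = sgp y x"
  by (auto simp: sgp_def sgn2_def)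

lemma cmod_sgp [simp]: "cmod (sgp x y) = 1"
  by (simp add: sgp_def sgn2_def)

lemma cmod_s2 [simp]: "cmod (s2 x y) = 1"
  by (simp add: s2_def sgn2_def)

lemma PD_dg: "q \<in> PD D \<Longrightarrow> dg q > 0" "q \<in> PD D \<Longrightarrow> dg q \<le> D" "q \<in> PD D \<Longrightarrow> valid q"
  using dg_pos by (auto simp: PD_def)

definition unc :: "(pind \<Rightarrow> pind list \<Rightarrow> complex) \<Rightarrow> pind list \<Rightarrow> complex" where
  "unc F w = (case w of [] \<Rightarrow> 0 | q # v \<Rightarrow> F q v)"

lemma unc_simps [simp]: "unc F [] = 0" "unc F (q # v) = F q v"
  by (simp_all add: unc_def)

lemma unc_bound: "0 \<le> M \<Longrightarrow> (\<And>q v. cmod (F q v) \<le> M) \<Longrightarrow> cmod (unc F w) \<le> M"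
  by (cases w) auto

context vacuum
begin

text \<open>The vector with tensor \<open>b\<close>: the sum of \<open>b [q1, ..., qr]\<close> times
  \<open>yl q1 ... yl qr\<close> on the vacuum, over indices of total degree \<open>d\<close>. The
  bound \<open>D\<close> keeps the sum finite.\<close>

fun vec :: "int \<Rightarrow> nat \<Rightarrow> int \<Rightarrow> (pind list \<Rightarrow> complex) \<Rightarrow> xl list \<Rightarrow> complex" where
  "vec D 0 d b = (if d = 0 then scV (b []) \<phi>0 else 0)"
| "vec D (Suc r) d b = (\<Sum>q\<in>PD D. act (yl q) (vec D r (d - dg q) (\<lambda>w. b (q # w))))"

lemma vec_Ul: "vec D r d b \<in> Ul 1 0 (Suc r) d"
proof (induction r arbitrary: d b)
  case 0
  show ?case using Ul_base[of "[]" "Suc 0" 1 0 0] by (auto intro: Ul_scale Ul_0)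
next
  case (Suc r)
  show ?case unfolding vec.simps
  proof (rule Ul_sum)
    fix q assume q: "q \<in> PD D"
    show "act (yl q) (vec D r (d - dg q) (\<lambda>w. b (q # w))) \<in> Ul 1 0 (Suc (Suc r)) d"
      using Ul_cre[OF yl_cre[OF PD_dg(3)[OF q]] Suc[of "d - dg q" "\<lambda>w. b (q # w)"]] by (simp add: wx_yl)
  qed
qed

lemma vec_neg: "d < 0 \<Longrightarrow> vec D r d b = 0"
proof (induction r arbitrary: d b)
  case (Suc r)
  have "act (yl q) (vec D r (d - dg q) (\<lambda>w. b (q # w))) = 0" if "q \<in> PD D" for q
    using Suc.IH[of "d - dg q"] Suc.prems PD_dg(1)[OF that] by (simp add: act_0)
  then show ?case by simp
qed simp

lemma vec_lin: "vec D r d (\<lambda>w. p * b w + p' * b' w) = scV p (vec D r d b) + scV p' (vec D r d b')"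
proof (induction r arbitrary: d b b')
  case 0
  then show ?case by (simp add: vs.scale_left_distrib)
next
  case (Suc r)
  then show ?case by (simp add: act_add act_scV sum.distrib vs.scale_sum_right)
qed

lemma vec_scale: "vec D r d (\<lambda>w. p * b w) = scV p (vec D r d b)"
  using vec_lin[of D r d p b 0 b] by simp

lemma vec_add: "vec D r d (\<lambda>w. b w + b' w) = vec D r d b + vec D r d b'"
  using vec_lin[of D r d 1 b 1 b'] by simp

lemma vec_zero: "vec D r d (\<lambda>w. 0) = 0"
  using vec_lin[of D r d 0 "\<lambda>w. 0" 0 "\<lambda>w. 0"] by simp

lemma Ul_sum_diff:
  assumes "\<And>q. q \<in> I \<Longrightarrow> f q - g q \<in> Ul A B r e"
  shows "(\<Sum>q\<in>I. f q) - (\<Sum>q\<in>I. g q) \<in> Ul A B r e"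
  using Ul_sum[of I "\<lambda>q. f q - g q" A B r e] assms by (simp add: sum_subtractf)

text \<open>Only the bound on the resulting tensor matters; this avoids tracking signs.\<close>

lemma one_body_sum:
  fixes X :: "pind \<Rightarrow> xl" and \<rho> :: "pind \<Rightarrow> pind \<Rightarrow> pind" and \<kappa> sg :: "pind \<Rightarrow> pind \<Rightarrow> complex"
  assumes T: "finite T" and sp: "\<And>\<tau>. \<tau> \<in> T \<Longrightarrow> spx (X \<tau>)"
    and comm: "\<And>\<tau> q r e \<psi>. \<tau> \<in> T \<Longrightarrow> q \<in> PD D \<Longrightarrow> \<psi> \<in> Ul 1 0 r e \<Longrightarrow>
       act (X \<tau>) (act (yl q) \<psi>) - scV (sg \<tau> q) (act (yl q) (act (X \<tau>) \<psi>)) - scV (\<kappa> \<tau> q) (act (yl (\<rho> \<tau> q)) \<psi>)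
         \<in> Ul 1 0 r (dg q - fst (X \<tau>) + e)"
    and sg: "\<And>\<tau> q. cmod (sg \<tau> q) \<le> 1" and kap: "\<And>\<tau> q. cmod (\<kappa> \<tau> q) \<le> 1"
    and inj: "\<And>\<tau> q \<tau>' q'. \<tau> \<in> T \<Longrightarrow> \<tau>' \<in> T \<Longrightarrow> q \<in> PD D \<Longrightarrow> q' \<in> PD D \<Longrightarrow> \<kappa> \<tau> q \<noteq> 0 \<Longrightarrow> \<kappa> \<tau>' q' \<noteq> 0
       \<Longrightarrow> \<rho> \<tau> q = \<rho> \<tau>' q' \<Longrightarrow> \<tau> = \<tau>' \<and> q = q'"
    and rho: "\<And>\<tau> q. \<tau> \<in> T \<Longrightarrow> q \<in> PD D \<Longrightarrow> \<kappa> \<tau> q \<noteq> 0 \<Longrightarrow> valid (\<rho> \<tau> q) \<and> dg (\<rho> \<tau> q) = dg q - fst (X \<tau>)"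
    and M: "0 \<le> M" and B: "\<And>\<tau> w. \<tau> \<in> T \<Longrightarrow> cmod (B \<tau> w) \<le> M" and d': "d' \<le> D"
  shows "\<exists>b. (\<forall>w. cmod (b w) \<le> of_nat r * M) \<and>
    (\<Sum>\<tau>\<in>T. act (X \<tau>) (vec D r (d' + fst (X \<tau>)) (B \<tau>))) - vec D r d' b \<in> Ul 1 0 r d'"
  using B d'
proof (induction r arbitrary: B d')
  case 0
  have "act (X \<tau>) (vec D 0 (d' + fst (X \<tau>)) (B \<tau>)) = 0" if "\<tau> \<in> T" for \<tau>
    using sp[OF that] by (simp add: act_scV act_0)
  then show ?case by (intro exI[of _ "\<lambda>w. 0"]) (simp add: vec_zero Ul_0 del: vec.simps)
next
  case (Suc r)
  define V where "V \<tau> q = vec D r (d' + fst (X \<tau>) - dg q) (\<lambda>w. B \<tau> (q # w))" for \<tau> q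
  have VU: "V \<tau> q \<in> Ul 1 0 (Suc r) (d' + fst (X \<tau>) - dg q)" for \<tau> q
    unfolding V_def by (rule vec_Ul)
  have "\<exists>b. (\<forall>w. cmod (b w) \<le> of_nat r * M) \<and>
    (\<Sum>\<tau>\<in>T. act (X \<tau>) (vec D r ((d' - dg q) + fst (X \<tau>)) (\<lambda>w. sg \<tau> q * B \<tau> (q # w)))) - vec D r (d' - dg q) b
      \<in> Ul 1 0 r (d' - dg q)" if q: "q \<in> PD D" for q
  proof (rule Suc.IH)
    show "cmod (sg \<tau> q * B \<tau> (q # w)) \<le> M" if "\<tau> \<in> T" for \<tau> w
      using mult_mono[OF sg[of \<tau> q] Suc.prems(1)[OF that, of "q # w"]] by (simp add: norm_mult)
    show "d' - dg q \<le> D" using Suc.prems(2) PD_dg(1)[OF q] by simp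
  qed
  then have "\<forall>q\<in>PD D. \<exists>b. (\<forall>w. cmod (b w) \<le> of_nat r * M) \<and>
    (\<Sum>\<tau>\<in>T. act (X \<tau>) (vec D r ((d' - dg q) + fst (X \<tau>)) (\<lambda>w. sg \<tau> q * B \<tau> (q # w)))) - vec D r (d' - dg q) b
      \<in> Ul 1 0 r (d' - dg q)" by blast
  from bchoice[OF this] obtain cq where cq': "\<forall>q\<in>PD D. (\<forall>w. cmod (cq q w) \<le> of_nat r * M) \<and>
    (\<Sum>\<tau>\<in>T. act (X \<tau>) (vec D r ((d' - dg q) + fst (X \<tau>)) (\<lambda>w. sg \<tau> q * B \<tau> (q # w)))) - vec D r (d' - dg q) (cq q)
      \<in> Ul 1 0 r (d' - dg q)" ..
  have cq: "\<And>q w. q \<in> PD D \<Longrightarrow> cmod (cq q w) \<le> of_nat r * M"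
    "\<And>q. q \<in> PD D \<Longrightarrow> (\<Sum>\<tau>\<in>T. act (X \<tau>) (vec D r ((d' - dg q) + fst (X \<tau>)) (\<lambda>w. sg \<tau> q * B \<tau> (q # w))))
       - vec D r (d' - dg q) (cq q) \<in> Ul 1 0 r (d' - dg q)"
    using cq' by blast+
  \<comment> \<open>\<open>c1\<close> collects the terms in which the letter passes the first
    factor, \<open>c2\<close> those in which it transforms that factor; the bounds
    \<open>r * M\<close> and \<open>M\<close> add up to the claim.\<close>
  define c1 where "c1 = unc (\<lambda>q v. if q \<in> PD D then cq q v else 0)"
  define S where "S = {p \<in> T \<times> PD D. \<kappa> (fst p) (snd p) \<noteq> 0}"
  define \<rho>' where "\<rho>' p = \<rho> (fst p) (snd p)" for p
  have injS: "inj_on \<rho>' S"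
    by (rule inj_onI) (auto simp: S_def \<rho>'_def dest: inj)
  have finS: "finite S" unfolding S_def using T finite_PD by auto
  \<comment> \<open>By injectivity each new first index has at most one source, so this coefficient
    is a single product bounded by \<open>M\<close>, not a sum whose size would depend on
    \<open>D\<close>.\<close>
  define c2 where "c2 = unc (\<lambda>q v. if q \<in> \<rho>' ` S then
     (let p = inv_into S \<rho>' q in \<kappa> (fst p) (snd p) * B (fst p) (snd p # v)) else 0)"
  have c1b: "cmod (c1 w) \<le> of_nat r * M" for w
    unfolding c1_def using cq(1) M by (intro unc_bound) auto
  have c2b: "cmod (c2 w) \<le> M" for w
    unfolding c2_def
  proof (intro unc_bound M)
    fix q v
    show "cmod (if q \<in> \<rho>' ` S then (let p = inv_into S \<rho>' q in \<kappa> (fst p) (snd p) * B (fst p) (snd p # v)) else 0) \<le> M"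
    proof (cases "q \<in> \<rho>' ` S")
      case True
      then have "inv_into S \<rho>' q \<in> S" by (rule inv_into_into)
      then show ?thesis
        using True mult_mono[OF kap[of "fst (inv_into S \<rho>' q)" "snd (inv_into S \<rho>' q)"]
          Suc.prems(1)[of "fst (inv_into S \<rho>' q)" "snd (inv_into S \<rho>' q) # v"]]
        by (auto simp: S_def norm_mult Let_def)
    qed (use M in auto)
  qed
  have e1: "(\<Sum>\<tau>\<in>T. act (X \<tau>) (vec D (Suc r) (d' + fst (X \<tau>)) (B \<tau>)))
     - ((\<Sum>\<tau>\<in>T. \<Sum>q\<in>PD D. scV (sg \<tau> q) (act (yl q) (act (X \<tau>) (V \<tau> q))))
       + (\<Sum>\<tau>\<in>T. \<Sum>q\<in>PD D. scV (\<kappa> \<tau> q) (act (yl (\<rho> \<tau> q)) (V \<tau> q)))) \<in> Ul 1 0 (Suc r) d'"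
    unfolding vec.simps act_sum V_def[symmetric] sum.distrib[symmetric]
  proof (intro Ul_sum_diff)
    fix \<tau> q assume "\<tau> \<in> T" "q \<in> PD D"
    from comm[OF this VU[of \<tau> q]]
    show "act (X \<tau>) (act (yl q) (V \<tau> q)) - (scV (sg \<tau> q) (act (yl q) (act (X \<tau>) (V \<tau> q)))
      + scV (\<kappa> \<tau> q) (act (yl (\<rho> \<tau> q)) (V \<tau> q))) \<in> Ul 1 0 (Suc r) d'"
      by (simp add: algebra_simps)
  qed
  have e2: "(\<Sum>\<tau>\<in>T. \<Sum>q\<in>PD D. scV (sg \<tau> q) (act (yl q) (act (X \<tau>) (V \<tau> q)))) - vec D (Suc r) d' c1 \<in> Ul 1 0 (Suc r) d'"
  proof -
    have "(\<Sum>\<tau>\<in>T. \<Sum>q\<in>PD D. scV (sg \<tau> q) (act (yl q) (act (X \<tau>) (V \<tau> q))))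
      = (\<Sum>q\<in>PD D. act (yl q) (\<Sum>\<tau>\<in>T. act (X \<tau>) (vec D r ((d' - dg q) + fst (X \<tau>)) (\<lambda>w. sg \<tau> q * B \<tau> (q # w)))))"
      unfolding vec_scale act_scV act_sum by (subst sum.swap) (simp add: V_def algebra_simps)
    moreover have "vec D (Suc r) d' c1 = (\<Sum>q\<in>PD D. act (yl q) (vec D r (d' - dg q) (cq q)))"
      by (simp add: c1_def)
    moreover have "(\<Sum>q\<in>PD D. act (yl q) (\<Sum>\<tau>\<in>T. act (X \<tau>) (vec D r ((d' - dg q) + fst (X \<tau>)) (\<lambda>w. sg \<tau> q * B \<tau> (q # w)))))
      - (\<Sum>q\<in>PD D. act (yl q) (vec D r (d' - dg q) (cq q))) \<in> Ul 1 0 (Suc r) d'"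
    proof (rule Ul_sum_diff)
      fix q assume q: "q \<in> PD D"
      show "act (yl q) (\<Sum>\<tau>\<in>T. act (X \<tau>) (vec D r ((d' - dg q) + fst (X \<tau>)) (\<lambda>w. sg \<tau> q * B \<tau> (q # w))))
        - act (yl q) (vec D r (d' - dg q) (cq q)) \<in> Ul 1 0 (Suc r) d'"
        using Ul_cre[OF yl_cre[OF PD_dg(3)[OF q]] cq(2)[OF q]] by (simp add: act_diff wx_yl)
    qed
    ultimately show ?thesis by simp
  qed
  define G where "G q = act (yl q) (vec D r (d' - dg q) (\<lambda>w. c2 (q # w)))" for q
  have e3: "(\<Sum>\<tau>\<in>T. \<Sum>q\<in>PD D. scV (\<kappa> \<tau> q) (act (yl (\<rho> \<tau> q)) (V \<tau> q))) = vec D (Suc r) d' c2"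
  proof -
    have "(\<Sum>\<tau>\<in>T. \<Sum>q\<in>PD D. scV (\<kappa> \<tau> q) (act (yl (\<rho> \<tau> q)) (V \<tau> q)))
      = (\<Sum>p\<in>T \<times> PD D. scV (\<kappa> (fst p) (snd p)) (act (yl (\<rho>' p)) (V (fst p) (snd p))))"
      by (simp add: sum.cartesian_product case_prod_beta \<rho>'_def)
    also have "\<dots> = (\<Sum>p\<in>S. scV (\<kappa> (fst p) (snd p)) (act (yl (\<rho>' p)) (V (fst p) (snd p))))"
      by (rule sum.mono_neutral_right) (use T finite_PD in \<open>auto simp: S_def\<close>)
    also have "\<dots> = (\<Sum>p\<in>S. G (\<rho>' p))"
    proof (rule sum.cong[OF refl])
      fix p assume p: "p \<in> S"
      have "(\<lambda>w. c2 (\<rho>' p # w)) = (\<lambda>w. \<kappa> (fst p) (snd p) * B (fst p) (snd p # w))"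
        using p inv_into_f_f[OF injS p] by (simp add: c2_def)
      moreover have "d' - dg (\<rho>' p) = d' + fst (X (fst p)) - dg (snd p)"
        using rho[of "fst p" "snd p"] p by (auto simp: S_def \<rho>'_def)
      ultimately show "scV (\<kappa> (fst p) (snd p)) (act (yl (\<rho>' p)) (V (fst p) (snd p))) = G (\<rho>' p)"
        by (simp only: G_def V_def vec_scale act_scV)
    qed
    also have "\<dots> = (\<Sum>q\<in>\<rho>' ` S. G q)"
      by (simp add: sum.reindex[OF injS])
    also have "\<dots> = (\<Sum>q\<in>\<rho>' ` S \<inter> PD D. G q)"
    proof (rule sum.mono_neutral_right)
      show "\<forall>q\<in>\<rho>' ` S - \<rho>' ` S \<inter> PD D. G q = 0"
      proof
        fix q assume q: "q \<in> \<rho>' ` S - \<rho>' ` S \<inter> PD D"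
        then have "valid q" using rho by (auto simp: S_def \<rho>'_def)
        \<comment> \<open>A valid index outside \<open>PD D\<close> has degree above
          \<open>D \<ge> d'\<close>, which leaves a negative degree for the remaining
          factors.\<close>
        then have "d' - dg q < 0" using q Suc.prems(2) by (auto simp: PD_def)
        then show "G q = 0" by (simp add: G_def vec_neg act_0)
      qed
    qed (use finS in auto)
    also have "\<dots> = (\<Sum>q\<in>PD D. G q)"
    proof (rule sum.mono_neutral_left)
      show "\<forall>q\<in>PD D - \<rho>' ` S \<inter> PD D. G q = 0"
      proof
        fix q assume "q \<in> PD D - \<rho>' ` S \<inter> PD D"
        then have "(\<lambda>w. c2 (q # w)) = (\<lambda>w. 0)" by (auto simp: c2_def)
        then show "G q = 0" by (simp add: G_def vec_zero act_0)
      qed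
    qed (use finite_PD in auto)
    finally show ?thesis by (simp add: G_def)
  qed
  let ?b = "\<lambda>w. c1 w + c2 w"
  have "cmod (?b w) \<le> of_nat (Suc r) * M" for w
    using norm_triangle_ineq[of "c1 w" "c2 w"] c1b[of w] c2b[of w] by (simp add: algebra_simps)
  moreover have "(\<Sum>\<tau>\<in>T. act (X \<tau>) (vec D (Suc r) (d' + fst (X \<tau>)) (B \<tau>))) - vec D (Suc r) d' ?b \<in> Ul 1 0 (Suc r) d'"
    using Ul_add[OF e1 e2] unfolding e3 vec_add by (simp add: algebra_simps)
  ultimately show ?case by (intro exI[of _ ?b] conjI allI)
qed

lemma zl_spx: "valid p \<Longrightarrow> spx (zl K p)"
  by (cases p) auto

lemma zl_lagr:
  assumes "- K \<le> l" "l \<le> K"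
  shows "poly (lagr {- K..K} i) (of_int l) = (if l = i then 1 else 0)"
  by (rule poly_lagr) (use assms in auto)

text \<open>Up to the sign of the supertrace, \<open>zl\<close> and \<open>yl\<close> are dual
  families for the cocycle. This produces the main term of the contraction.\<close>

lemma cen_zl_yl:
  assumes "p = (s, i, t, j)" "p \<in> PD D" "q \<in> PD D" "D \<le> K"
  shows "cen (zl K p) (yl q) = (if p = q then stra t else 0)"
proof -
  obtain s' i' t' j' where q: "q = (s', i', t', j')" by (cases q) auto
  have b: "i < 0" "0 \<le> j" "j - i \<le> D" "i' < 0" "0 \<le> j'" "j' - i' \<le> D"
    using assms by (auto simp: q PD_def)
  show ?thesis
  proof (cases "j - i = j' - i' \<and> s = s' \<and> t = t'")
    case False
    then show ?thesis by (auto simp: assms(1) q trp_def)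
  next
    case True
    have "(\<Sum>l\<in>{- (j - i)..- 1}. poly (lagr {- K..K} i) (of_int l) * poly (lagr {0..<j' - i'} j') (of_int (l + (j - i))))
      = (\<Sum>l\<in>{- (j - i)..- 1}. if l = i then (if j = j' then 1 else 0) else 0)"
    proof (rule sum.cong[OF refl])
      fix l assume l: "l \<in> {- (j - i)..- 1}"
      have "poly (lagr {- K..K} i) (of_int l) = (if l = i then 1 else 0)"
        by (rule zl_lagr) (use l b assms(4) in auto)
      moreover have "poly (lagr {0..<j' - i'} j') (of_int (l + (j - i))) = (if l + (j - i) = j' then 1 else 0)"
        by (rule poly_lagr) (use l b True in auto)
      ultimately show "poly (lagr {- K..K} i) (of_int l) * poly (lagr {0..<j' - i'} j') (of_int (l + (j - i)))
         = (if l = i then (if j = j' then 1 else 0) else 0)" by auto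
    qed
    also have "\<dots> = (if j = j' then 1 else 0)" using b by (simp add: sum.delta)
    finally show ?thesis using True b by (auto simp: assms(1) q trp_def)
  qed
qed

end

section \<open>Contraction of a tensor with one annihilation letter\<close>

context vacuum
begin

context
  fixes D K d d' :: int and s t :: bool and i j :: int and b :: "pind list \<Rightarrow> complex" and M :: real and p :: pind and r :: nat
  assumes p: "p = (s, i, t, j)" and pD: "p \<in> PD D" and K: "K = 4 * D" and d: "d \<le> D" "d' = d - dg p"
    and M: "0 \<le> M" "\<And>w. cmod (b w) \<le> M"
begin

private abbreviation (input) "V q \<equiv> vec D r (d - dg q) (\<lambda>w. b (q # w))"

private lemma pij: "i < 0" "0 \<le> j" "j - i \<le> D" "0 \<le> D" "d' \<le> D"
  using pD d by (auto simp: p PD_def)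

text \<open>Brackets are inspected at exponents up to \<open>2 * D\<close>, and a creation letter
  shifts them by at most \<open>D\<close>; \<open>K = 4 * D\<close> leaves room for both.\<close>

private lemma zl_val: "- 3 * D \<le> l \<Longrightarrow> l \<le> 3 * D \<Longrightarrow> poly (lagr {- K..K} i) (of_int l) = (if l = i then 1 else 0)"
  by (rule zl_lagr) (use pij K in auto)

text \<open>\<open>zl p\<close> after \<open>yl q\<close> is a matrix unit on nonnegative exponents,
  from the source of \<open>q\<close> to \<open>(t, j)\<close>, when the target of \<open>q\<close>
  is \<open>(s, i)\<close>. For all other \<open>q\<close> the product is an annihilation block,
  which shortens the word and does not reach the leading tensor.\<close>

lemma contract_right:
  "\<exists>c'. (\<forall>w. cmod (c' w) \<le> of_nat r * M) \<and>
    (\<Sum>q\<in>PD D. act (br1 (zl K p) (yl q)) (V q)) - vec D r d' c' \<in> Ul 1 0 r d'"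
proof -
  define T where "T = {q \<in> PD D. fst q = s \<and> fst (snd q) = i}"
  define X where "X q = br1 (zl K p) (yl q)" for q
  have rest: "act (X q) (V q) \<in> Ul 1 0 r d'" if q: "q \<in> PD D - T" for q
  proof -
    obtain s' i' t' j' where q': "q = (s', i', t', j')" by (cases q) auto
    have b: "i' < 0" "0 \<le> j'" "j' - i' \<le> D" using q by (auto simp: q' PD_def)
    show ?thesis
    proof (cases "s' = s")
      case False
      then show ?thesis using act_poly_0[OF Ul_lie[OF vec_Ul]] by (simp add: X_def p q' Ul_0)
    next
      case True
      then have ne: "i' \<noteq> i" using q by (auto simp: T_def q')
      \<comment> \<open>A nonzero value at \<open>l\<close> forces \<open>l + i' - j' = i\<close>.
        If \<open>l\<close> were nonnegative, it would be a node of the Lagrange polynomial other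
        than \<open>j'\<close>; so \<open>l\<close> is negative and is sent to
        \<open>j \<ge> 0\<close>.\<close>
      have "Zt (2 * D) (X q)"
      proof -
        have "poly (psh (i' - j') (lagr {- K..K} i) * lagr {0..<j' - i'} j') (of_int l) = 0"
          if l: "- (2 * D) \<le> l" "l \<le> 2 * D" "\<not> (l < 0 \<and> 0 \<le> l + (j - i + (i' - j')))" for l
        proof (cases "l + (i' - j') = i")
          case True
          then have "0 \<le> l" "l < j' - i'" "l \<noteq> j'" using l(3) pij ne by auto
          then have "poly (lagr {0..<j' - i'} j') (of_int l) = 0" by (subst poly_lagr) auto
          then show ?thesis by simp
        next
          case False
          have "poly (lagr {- K..K} i) (of_int (l + (i' - j'))) = 0"
            using zl_val[of "l + (i' - j')"] False l b by simp
          then show ?thesis by simp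
        qed
        then show ?thesis using True by (simp add: X_def p q')
      qed
      then have "act (X q) (V q) \<in> Ul 1 0 r (wx 1 0 (X q) + (d - dg q))"
        by (rule Zt_Ul[OF _ vec_Ul]) (use pij b d in \<open>auto simp: X_def p q'\<close>)
      moreover have "wx 1 0 (X q) + (d - dg q) = d'"
        using d by (simp add: X_def p q')
      ultimately show ?thesis by simp
    qed
  qed
  have TP: "T \<subseteq> PD D" "finite T" using finite_PD by (auto simp: T_def)
  have deg: "d' + fst (X q) = d - dg q" if "q \<in> T" for q
    using that d by (cases q) (auto simp: T_def X_def p)
  \<comment> \<open>The source \<open>(t, j)\<close> of \<open>q\<close> is replaced by the source
    of \<open>\<tau>\<close>. All members of \<open>T\<close> have the target \<open>(s, i)\<close>,
    so both \<open>\<tau>\<close> and \<open>q\<close> can be read off from the result.\<close>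
  define \<rho> where "\<rho> \<tau> q = (case q of (s', i', t', j') \<Rightarrow> (s', i', fst (snd (snd \<tau>)), snd (snd (snd \<tau>))))" for \<tau> q :: pind
  define \<kappa> where "\<kappa> \<tau> q = (if fst (snd (snd q)) = t \<and> snd (snd (snd q)) = j then - s2 (X \<tau>) (yl q) else 0)" for \<tau> q
  have "\<exists>c'. (\<forall>w. cmod (c' w) \<le> of_nat r * M) \<and>
    (\<Sum>\<tau>\<in>T. act (X \<tau>) (vec D r (d' + fst (X \<tau>)) (\<lambda>w. b (\<tau> # w)))) - vec D r d' c' \<in> Ul 1 0 r d'"
  proof (rule one_body_sum[where sg = "\<lambda>\<tau> q. s2 (X \<tau>) (yl q)" and \<kappa> = \<kappa> and \<rho> = \<rho>])
    fix \<tau> assume tau: "\<tau> \<in> T"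
    obtain t' j' where \<tau>: "\<tau> = (s, i, t', j')" using tau by (cases \<tau>) (auto simp: T_def)
    have b: "0 \<le> j'" "j' - i \<le> D" using tau by (auto simp: \<tau> T_def PD_def)
    have X: "X \<tau> = (j - j', mk t t', psh (i - j') (lagr {- K..K} i) * lagr {0..<j' - i} j')"
      by (simp add: X_def p \<tau>)
    have val: "poly (psh (i - j') (lagr {- K..K} i) * lagr {0..<j' - i} j') (of_int l) = (if l = j' then 1 else 0)"
      if "- (2 * D) \<le> l" "l \<le> 2 * D" for l
      using zl_val[of "l + (i - j')"] that b pij poly_lagr_same[of "{0..<j' - i}" j'] by auto
    show "spx (X \<tau>)"
      using val b pij unfolding X spx.simps by auto
    fix q e r \<psi> assume q: "q \<in> PD D" and psi: "\<psi> \<in> Ul 1 0 r e"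
    obtain s' i' t'' j'' where q': "q = (s', i', t'', j'')" by (cases q) auto
    have b': "i' < 0" "0 \<le> j''" "j'' - i' \<le> D" using q by (auto simp: q' PD_def)
    have "act (X \<tau>) (act (yl q) \<psi>) - scV (s2 (X \<tau>) (yl q)) (act (yl q) (act (X \<tau>) \<psi>))
      - scV (if t'' = rw (mk t t') \<and> j'' = j' + (j - j') then - s2 (X \<tau>) (yl q) * 1 else 0)
          (act (yl (s', i', cl (mk t t'), j')) \<psi>) \<in> Ul 1 0 r (dg q - (j - j') + e)"
      unfolding X by (rule one_body_right[OF psi, where D = "2 * D"]) (use q' b b' pij val in auto)
    moreover have "\<kappa> \<tau> q = (if t'' = rw (mk t t') \<and> j'' = j' + (j - j') then - s2 (X \<tau>) (yl q) * 1 else 0)"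
      by (simp add: \<kappa>_def q' \<tau>)
    moreover have "\<rho> \<tau> q = (s', i', cl (mk t t'), j')"
      by (simp add: \<rho>_def q' \<tau>)
    moreover have "fst (X \<tau>) = j - j'" by (simp add: X)
    ultimately show "act (X \<tau>) (act (yl q) \<psi>) - scV (s2 (X \<tau>) (yl q)) (act (yl q) (act (X \<tau>) \<psi>))
      - scV (\<kappa> \<tau> q) (act (yl (\<rho> \<tau> q)) \<psi>) \<in> Ul 1 0 r (dg q - fst (X \<tau>) + e)"
      by (simp only:)
  next
    fix \<tau> q \<tau>' q' assume h: "\<tau> \<in> T" "\<tau>' \<in> T" "\<kappa> \<tau> q \<noteq> 0" "\<kappa> \<tau>' q' \<noteq> 0" "\<rho> \<tau> q = \<rho> \<tau>' q'"
    then show "\<tau> = \<tau>' \<and> q = q'"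
      by (cases \<tau>; cases \<tau>'; cases q; cases q') (auto simp: T_def \<kappa>_def \<rho>_def split: if_splits)
  next
    fix \<tau> q assume "\<tau> \<in> T" "q \<in> PD D" "\<kappa> \<tau> q \<noteq> 0"
    then show "valid (\<rho> \<tau> q) \<and> dg (\<rho> \<tau> q) = dg q - fst (X \<tau>)"
      by (cases \<tau>; cases q) (auto simp: T_def \<kappa>_def \<rho>_def X_def p PD_def split: if_splits)
  qed (use TP M pij in \<open>auto simp: \<kappa>_def\<close>)
  then obtain c' where c': "\<forall>w. cmod (c' w) \<le> of_nat r * M"
    "(\<Sum>\<tau>\<in>T. act (X \<tau>) (V \<tau>)) - vec D r d' c' \<in> Ul 1 0 r d'"
    using deg by auto
  have "(\<Sum>q\<in>PD D. act (X q) (V q)) = (\<Sum>q\<in>PD D - T. act (X q) (V q)) + (\<Sum>\<tau>\<in>T. act (X \<tau>) (V \<tau>))"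
    by (rule sum.subset_diff) (use TP finite_PD in auto)
  moreover have "(\<Sum>q\<in>PD D - T. act (X q) (V q)) + ((\<Sum>\<tau>\<in>T. act (X \<tau>) (V \<tau>)) - vec D r d' c') \<in> Ul 1 0 r d'"
    by (rule Ul_add[OF Ul_sum c'(2)]) (rule rest)
  ultimately have "(\<Sum>q\<in>PD D. act (X q) (V q)) - vec D r d' c' \<in> Ul 1 0 r d'"
    by (simp only: add_diff_eq)
  then show ?thesis using c'(1) unfolding X_def by blast
qed

text \<open>The mirror image of \<open>contract_right\<close>: \<open>yl q\<close> after
  \<open>zl p\<close> is a matrix unit on negative exponents, and only the \<open>q\<close> with
  source \<open>(t, j)\<close> reach the leading tensor.\<close>

lemma contract_left:
  "\<exists>c'. (\<forall>w. cmod (c' w) \<le> of_nat r * M) \<and>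
    (\<Sum>q\<in>PD D. act (br2 (zl K p) (yl q)) (V q)) - vec D r d' c' \<in> Ul 1 0 r d'"
proof -
  define T where "T = {q \<in> PD D. fst (snd (snd q)) = t \<and> snd (snd (snd q)) = j}"
  define X where "X q = br2 (zl K p) (yl q)" for q
  define sn where "sn s' t' = - sgn2 (oda (mk t s)) (oda (mk s' t'))" for s' t'
  have sn1: "cmod (sn s' t') \<le> 1" for s' t' by (simp add: sn_def sgn2_def)
  have rest: "act (X q) (V q) \<in> Ul 1 0 r d'" if q: "q \<in> PD D - T" for q
  proof -
    obtain s' i' t' j' where q': "q = (s', i', t', j')" by (cases q) auto
    have b: "i' < 0" "0 \<le> j'" "j' - i' \<le> D" using q by (auto simp: q' PD_def)
    show ?thesis
    proof (cases "t' = t")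
      case False
      then show ?thesis using act_poly_0[OF Ul_lie[OF vec_Ul]] by (simp add: X_def p q' Ul_0)
    next
      case True
      then have ne: "j' \<noteq> j" using q by (auto simp: T_def q')
      have "Zt (2 * D) (X q)"
      proof -
        have "poly (smult (sn s' t') (psh (j - i) (lagr {0..<j' - i'} j') * lagr {- K..K} i)) (of_int l) = 0"
          if l: "- (2 * D) \<le> l" "l \<le> 2 * D" "\<not> (l < 0 \<and> 0 \<le> l + (j - i + (i' - j')))" for l
        proof (cases "l = i")
          case True
          then have "j < j' - i'" using l(3) pij by auto
          then have "poly (lagr {0..<j' - i'} j') (of_int j) = 0" using ne pij by (subst poly_lagr) auto
          then show ?thesis using True by simp
        next
          case False
          have "poly (lagr {- K..K} i) (of_int l) = 0"
            using zl_val[of l] False l pij by simp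
          then show ?thesis by simp
        qed
        then show ?thesis using True by (simp add: X_def p q' sn_def)
      qed
      then have "act (X q) (V q) \<in> Ul 1 0 r (wx 1 0 (X q) + (d - dg q))"
        by (rule Zt_Ul[OF _ vec_Ul]) (use pij b d in \<open>auto simp: X_def p q'\<close>)
      moreover have "wx 1 0 (X q) + (d - dg q) = d'"
        using d by (simp add: X_def p q')
      ultimately show ?thesis by simp
    qed
  qed
  have TP: "T \<subseteq> PD D" "finite T" using finite_PD by (auto simp: T_def)
  have deg: "d' + fst (X q) = d - dg q" if "q \<in> T" for q
    using that d by (cases q) (auto simp: T_def X_def p)
  define \<rho> where "\<rho> \<tau> q = (case q of (s', i', t', j') \<Rightarrow> (fst \<tau>, fst (snd \<tau>), t', j'))" for \<tau> q :: pind
  define \<kappa> where "\<kappa> \<tau> q = (if fst q = s \<and> fst (snd q) = i then sn (fst \<tau>) t else 0)" for \<tau> q :: pind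
  have "\<exists>c'. (\<forall>w. cmod (c' w) \<le> of_nat r * M) \<and>
    (\<Sum>\<tau>\<in>T. act (X \<tau>) (vec D r (d' + fst (X \<tau>)) (\<lambda>w. b (\<tau> # w)))) - vec D r d' c' \<in> Ul 1 0 r d'"
  proof (rule one_body_sum[where sg = "\<lambda>\<tau> q. s2 (X \<tau>) (yl q)" and \<kappa> = \<kappa> and \<rho> = \<rho>])
    fix \<tau> assume tau: "\<tau> \<in> T"
    obtain s' i' where \<tau>: "\<tau> = (s', i', t, j)" using tau by (cases \<tau>) (auto simp: T_def)
    have b: "i' < 0" "j - i' \<le> D" using tau by (auto simp: \<tau> T_def PD_def)
    let ?f = "smult (sn s' t) (psh (j - i) (lagr {0..<j - i'} j) * lagr {- K..K} i)"
    have X: "X \<tau> = (i' - i, mk s' s, ?f)"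
      by (simp add: X_def p \<tau> sn_def)
    have val: "poly ?f (of_int l) = (if l = i then sn s' t else 0)"
      if "- (2 * D) \<le> l" "l \<le> 2 * D" for l
      using zl_val[of l] that b pij poly_lagr_same[of "{0..<j - i'}" j] by auto
    show "spx (X \<tau>)"
      using val b pij unfolding X spx.simps by auto
    fix q e r \<psi> assume q: "q \<in> PD D" and psi: "\<psi> \<in> Ul 1 0 r e"
    obtain s'' i'' t'' j'' where q': "q = (s'', i'', t'', j'')" by (cases q) auto
    have b': "i'' < 0" "0 \<le> j''" "j'' - i'' \<le> D" using q by (auto simp: q' PD_def)
    have "act (X \<tau>) (act (yl q) \<psi>) - scV (s2 (X \<tau>) (yl q)) (act (yl q) (act (X \<tau>) \<psi>))
      - scV (if s'' = cl (mk s' s) \<and> i'' = i then sn s' t else 0)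
          (act (yl (rw (mk s' s), i + (i' - i), t'', j'')) \<psi>) \<in> Ul 1 0 r (dg q - (i' - i) + e)"
      unfolding X by (rule one_body_left[OF psi, where D = "2 * D"]) (use q' b b' pij val in auto)
    moreover have "\<kappa> \<tau> q = (if s'' = cl (mk s' s) \<and> i'' = i then sn s' t else 0)"
      by (simp add: \<kappa>_def q' \<tau>)
    moreover have "\<rho> \<tau> q = (rw (mk s' s), i + (i' - i), t'', j'')"
      by (simp add: \<rho>_def q' \<tau>)
    moreover have "fst (X \<tau>) = i' - i" by (simp add: X)
    ultimately show "act (X \<tau>) (act (yl q) \<psi>) - scV (s2 (X \<tau>) (yl q)) (act (yl q) (act (X \<tau>) \<psi>))
      - scV (\<kappa> \<tau> q) (act (yl (\<rho> \<tau> q)) \<psi>) \<in> Ul 1 0 r (dg q - fst (X \<tau>) + e)"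
      by (simp only:)
  next
    fix \<tau> q \<tau>' q' assume h: "\<tau> \<in> T" "\<tau>' \<in> T" "\<kappa> \<tau> q \<noteq> 0" "\<kappa> \<tau>' q' \<noteq> 0" "\<rho> \<tau> q = \<rho> \<tau>' q'"
    then show "\<tau> = \<tau>' \<and> q = q'"
      by (cases \<tau>; cases \<tau>'; cases q; cases q') (auto simp: T_def \<kappa>_def \<rho>_def split: if_splits)
  next
    fix \<tau> q assume "\<tau> \<in> T" "q \<in> PD D" "\<kappa> \<tau> q \<noteq> 0"
    then show "valid (\<rho> \<tau> q) \<and> dg (\<rho> \<tau> q) = dg q - fst (X \<tau>)"
      by (cases \<tau>; cases q) (auto simp: T_def \<kappa>_def \<rho>_def X_def p PD_def split: if_splits)
  qed (use TP M pij sn1 in \<open>auto simp: \<kappa>_def\<close>)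
  then obtain c' where c': "\<forall>w. cmod (c' w) \<le> of_nat r * M"
    "(\<Sum>\<tau>\<in>T. act (X \<tau>) (V \<tau>)) - vec D r d' c' \<in> Ul 1 0 r d'"
    using deg by auto
  have "(\<Sum>q\<in>PD D. act (X q) (V q)) = (\<Sum>q\<in>PD D - T. act (X q) (V q)) + (\<Sum>\<tau>\<in>T. act (X \<tau>) (V \<tau>))"
    by (rule sum.subset_diff) (use TP finite_PD in auto)
  moreover have "(\<Sum>q\<in>PD D - T. act (X q) (V q)) + ((\<Sum>\<tau>\<in>T. act (X \<tau>) (V \<tau>)) - vec D r d' c') \<in> Ul 1 0 r d'"
    by (rule Ul_add[OF Ul_sum c'(2)]) (rule rest)
  ultimately have "(\<Sum>q\<in>PD D. act (X q) (V q)) - vec D r d' c' \<in> Ul 1 0 r d'"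
    by (simp only: add_diff_eq)
  then show ?thesis using c'(1) unfolding X_def by blast
qed

end

text \<open>Supersymmetry makes each of the \<open>r\<close> central terms yield the same slice of
  \<open>b\<close>. The two halves of a bracket with a letter that has \<open>l\<close> letters
  behind it cost at most \<open>2 * l * M\<close>, and these costs add up to
  \<open>r * (r - 1) * M\<close>.\<close>

lemma contraction:
  assumes p: "p = (s, i, t, j)" and pD: "p \<in> PD D" and K: "K = 4 * D" and d: "d \<le> D"
    and M: "0 \<le> M" "\<And>w. cmod (b w) \<le> M" and b: "ssym b"
  shows "\<exists>c'. (\<forall>w. cmod (c' w) \<le> of_nat r * of_nat (r - 1) * M) \<and>
    act (zl K p) (vec D r d b) - scV (of_nat r * c * stra t) (vec D (r - 1) (d - dg p) (\<lambda>w. b (p # w)))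
      - vec D (r - 1) (d - dg p) c' \<in> Ul 1 0 (r - 1) (d - dg p)"
  using d M b
proof (induction r arbitrary: d b)
  case 0
  have "act (zl K p) (vec D 0 d b) = 0"
    using zl_spx[of p K] pD by (simp add: PD_def act_scV act_0)
  then show ?case
    by (intro exI[of _ "\<lambda>w. 0"]) (simp add: vec_zero Ul_0 del: vec.simps)
next
  case (Suc r)
  define d' where "d' = d - dg p"
  define V where "V q = vec D r (d - dg q) (\<lambda>w. b (q # w))" for q
  let ?z = "zl K p" and ?C = "of_nat r * c * stra t"
  have D0: "0 \<le> D" using pD dg_pos by (fastforce simp: PD_def)
  obtain c1 where c1: "\<And>w. cmod (c1 w) \<le> of_nat r * M"
    "(\<Sum>q\<in>PD D. act (br1 ?z (yl q)) (V q)) - vec D r d' c1 \<in> Ul 1 0 r d'"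
    using contract_right[where b = b and r = r and M = M, OF p pD K Suc.prems(1) d'_def Suc.prems(2,3)] unfolding V_def by blast
  obtain c2 where c2: "\<And>w. cmod (c2 w) \<le> of_nat r * M"
    "(\<Sum>q\<in>PD D. act (br2 ?z (yl q)) (V q)) - vec D r d' c2 \<in> Ul 1 0 r d'"
    using contract_left[where b = b and r = r and M = M, OF p pD K Suc.prems(1) d'_def Suc.prems(2,3)] unfolding V_def by blast
  have "\<exists>c3. (\<forall>w. cmod (c3 w) \<le> of_nat r * of_nat (r - 1) * M) \<and>
     (\<Sum>q\<in>PD D. scV (sgp p q) (act (yl q) (act ?z (V q)))) - scV ?C (vec D r d' (\<lambda>w. b (p # w)))
      - vec D r d' c3 \<in> Ul 1 0 r d'"
  proof (cases r)
    case 0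
    have "act ?z (V q) = 0" for q
      using zl_spx[of p K] pD by (simp add: 0 V_def PD_def act_scV act_0)
    then show ?thesis
      by (intro exI[of _ "\<lambda>w. 0"]) (simp add: 0 vec_zero act_0 Ul_0 del: vec.simps)
  next
    case (Suc r0)
    have "\<forall>q\<in>PD D. \<exists>c'. (\<forall>w. cmod (c' w) \<le> of_nat r * of_nat (r - 1) * M) \<and>
      act ?z (V q) - scV ?C (vec D (r - 1) (d - dg q - dg p) (\<lambda>w. b (q # p # w)))
      - vec D (r - 1) (d - dg q - dg p) c' \<in> Ul 1 0 (r - 1) (d - dg q - dg p)"
    proof
      fix q assume q: "q \<in> PD D"
      show "\<exists>c'. (\<forall>w. cmod (c' w) \<le> of_nat r * of_nat (r - 1) * M) \<and>
        act ?z (V q) - scV ?C (vec D (r - 1) (d - dg q - dg p) (\<lambda>w. b (q # p # w)))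
        - vec D (r - 1) (d - dg q - dg p) c' \<in> Ul 1 0 (r - 1) (d - dg q - dg p)"
        unfolding V_def
        by (rule Suc.IH[OF _ Suc.prems(2)]) (use Suc.prems ssym_Cons PD_dg(1)[OF q] in auto)
    qed
    from bchoice[OF this] obtain cq where cq: "\<forall>q\<in>PD D. (\<forall>w. cmod (cq q w) \<le> of_nat r * of_nat (r - 1) * M) \<and>
      act ?z (V q) - scV ?C (vec D (r - 1) (d - dg q - dg p) (\<lambda>w. b (q # p # w)))
      - vec D (r - 1) (d - dg q - dg p) (cq q) \<in> Ul 1 0 (r - 1) (d - dg q - dg p)" ..
    define c3 where "c3 = unc (\<lambda>q w. if q \<in> PD D then sgp p q * cq q w else 0)"
    have "cmod (c3 w) \<le> of_nat r * of_nat (r - 1) * M" for w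
      unfolding c3_def using cq M(1) by (intro unc_bound) (auto simp: norm_mult)
    moreover have "(\<Sum>q\<in>PD D. scV (sgp p q) (act (yl q) (act ?z (V q)))) - scV ?C (vec D r d' (\<lambda>w. b (p # w)))
      - vec D r d' c3 \<in> Ul 1 0 r d'"
    proof -
      have e: "b (p # q # w) = sgp p q * b (q # p # w)" for q w
        using ssymD[OF Suc.prems(4), of "[]" p q w] by simp
      have "scV ?C (vec D r d' (\<lambda>w. b (p # w))) + vec D r d' c3 =
        (\<Sum>q\<in>PD D. scV (sgp p q) (act (yl q) (scV ?C (vec D (r - 1) (d - dg q - dg p) (\<lambda>w. b (q # p # w)))
          + vec D (r - 1) (d - dg q - dg p) (cq q))))"
        by (simp add: Suc c3_def e vec_scale act_scV act_add vs.scale_right_distrib vs.scale_sum_right sum.distrib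
          d'_def algebra_simps)
      moreover have "(\<Sum>q\<in>PD D. scV (sgp p q) (act (yl q) (act ?z (V q)))) -
        (\<Sum>q\<in>PD D. scV (sgp p q) (act (yl q) (scV ?C (vec D (r - 1) (d - dg q - dg p) (\<lambda>w. b (q # p # w)))
          + vec D (r - 1) (d - dg q - dg p) (cq q)))) \<in> Ul 1 0 r d'"
      proof (rule Ul_sum_diff)
        fix q assume q: "q \<in> PD D"
        let ?u = "act ?z (V q)" and ?v = "scV ?C (vec D (r - 1) (d - dg q - dg p) (\<lambda>w. b (q # p # w)))
          + vec D (r - 1) (d - dg q - dg p) (cq q)"
        have "?u - ?v \<in> Ul 1 0 (r - 1) (d - dg q - dg p)"
          using cq q by (simp add: diff_diff_add)
        from Ul_scale[OF Ul_cre[OF yl_cre[OF PD_dg(3)[OF q]] this], of "sgp p q"]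
        show "scV (sgp p q) (act (yl q) ?u) - scV (sgp p q) (act (yl q) ?v) \<in> Ul 1 0 r d'"
          by (simp add: Suc wx_yl d'_def act_diff vs.scale_right_diff_distrib)
      qed
      ultimately show ?thesis by (simp add: diff_diff_add)
    qed
    ultimately show ?thesis by blast
  qed
  then obtain c3 where c3: "\<And>w. cmod (c3 w) \<le> of_nat r * of_nat (r - 1) * M"
    "(\<Sum>q\<in>PD D. scV (sgp p q) (act (yl q) (act ?z (V q)))) - scV ?C (vec D r d' (\<lambda>w. b (p # w)))
      - vec D r d' c3 \<in> Ul 1 0 r d'" by blast
  have cen: "(\<Sum>q\<in>PD D. scV (c * cen ?z (yl q)) (V q)) = scV (c * stra t) (vec D r d' (\<lambda>w. b (p # w)))"
  proof -
    have "(\<Sum>q\<in>PD D. scV (c * cen ?z (yl q)) (V q)) = (\<Sum>q\<in>PD D. if q = p then scV (c * stra t) (V p) else 0)"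
    proof (rule sum.cong[OF refl])
      fix q assume q: "q \<in> PD D"
      show "scV (c * cen ?z (yl q)) (V q) = (if q = p then scV (c * stra t) (V p) else 0)"
        using cen_zl_yl[OF p pD q, of K] K D0 by simp
    qed
    also have "\<dots> = scV (c * stra t) (V p)" using pD finite_PD by simp
    finally show ?thesis by (simp add: V_def d'_def)
  qed
  have "act ?z (vec D (Suc r) d b) = (\<Sum>q\<in>PD D. scV (sgp p q) (act (yl q) (act ?z (V q))))
     + (\<Sum>q\<in>PD D. act (br1 ?z (yl q)) (V q)) + (\<Sum>q\<in>PD D. act (br2 ?z (yl q)) (V q))
     + (\<Sum>q\<in>PD D. scV (c * cen ?z (yl q)) (V q))"
    unfolding vec.simps act_sum V_def act_br[OF Ul_lie[OF vec_Ul], of ?z] s2_yl by (simp add: sum.distrib)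
  then have e: "act ?z (vec D (Suc r) d b) - scV (of_nat (Suc r) * c * stra t) (vec D r d' (\<lambda>w. b (p # w)))
     - vec D r d' (\<lambda>w. c1 w + (c2 w + c3 w)) \<in> Ul 1 0 r d'"
    using Ul_add[OF c3(2) Ul_add[OF c1(2) c2(2)]] unfolding cen vec_add
    by (simp add: algebra_simps)
  moreover have "cmod (c1 w + (c2 w + c3 w)) \<le> of_nat (Suc r) * of_nat (Suc r - 1) * M" for w
  proof -
    have "cmod (c1 w + (c2 w + c3 w)) \<le> of_nat r * M + (of_nat r * M + of_nat r * of_nat (r - 1) * M)"
      using norm_triangle_ineq[of "c1 w" "c2 w + c3 w"] norm_triangle_ineq[of "c2 w" "c3 w"] c1(1)[of w] c2(1)[of w] c3(1)[of w]
      by linarith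
    also have "\<dots> = of_nat (Suc r) * of_nat (Suc r - 1) * M"
      by (cases r) (auto simp: algebra_simps)
    finally show ?thesis .
  qed
  ultimately show ?case unfolding d'_def
    by (intro exI[of _ "\<lambda>w. c1 w + (c2 w + c3 w)"]) simp
qed

end

section \<open>Supersymmetrization of tensors\<close>

fun pk :: "(pind \<Rightarrow> pind list \<Rightarrow> complex) \<Rightarrow> pind list \<Rightarrow> complex" where
  "pk F [] = 0"
| "pk F (q # w) = F q w + pk (\<lambda>x v. sgp x q * F x (q # v)) w"

text \<open>The signed sum over all orderings, written without permutations: \<open>pk\<close> pulls
  each entry to the front in turn.\<close>

fun sym :: "nat \<Rightarrow> (pind list \<Rightarrow> complex) \<Rightarrow> pind list \<Rightarrow> complex" where
  "sym 0 u w = (if w = [] then u [] else 0)"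
| "sym (Suc r) u w = pk (\<lambda>q. sym r (\<lambda>v. u (q # v))) w"

lemma pk_bound:
  assumes "\<And>x v. length v + 1 = length w \<Longrightarrow> cmod (F x v) \<le> M"
  shows "cmod (pk F w) \<le> of_nat (length w) * M"
  using assms
proof (induction w arbitrary: F)
  case (Cons q w)
  have "cmod (pk (\<lambda>x v. sgp x q * F x (q # v)) w) \<le> of_nat (length w) * M"
    by (rule Cons.IH) (use Cons.prems in \<open>auto simp: norm_mult\<close>)
  moreover have "cmod (F q w) \<le> M" by (rule Cons.prems) simp
  ultimately show ?case
    using norm_triangle_ineq[of "F q w" "pk (\<lambda>x v. sgp x q * F x (q # v)) w"] by (simp add: algebra_simps)
qed simp

lemma pk_lin: "pk (\<lambda>x v. a * F x v + b * G x v) w = a * pk F w + b * pk G w"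
proof (induction w arbitrary: F G)
  case (Cons q w)
  have "(\<lambda>x v. sgp x q * (a * F x (q # v) + b * G x (q # v)))
     = (\<lambda>x v. a * (sgp x q * F x (q # v)) + b * (sgp x q * G x (q # v)))"
    by (simp add: algebra_simps)
  then show ?case using Cons.IH by (simp add: algebra_simps)
qed simp

lemma pk_scale: "pk (\<lambda>x v. a * F x v) w = a * pk F w"
  using pk_lin[of a F 0 F w] by simp

lemma pk_cong: "(\<And>x v. length v + 1 = length w \<Longrightarrow> F x v = G x v) \<Longrightarrow> pk F w = pk G w"
proof (induction w arbitrary: F G)
  case (Cons q w)
  have "pk (\<lambda>x v. sgp x q * F x (q # v)) w = pk (\<lambda>x v. sgp x q * G x (q # v)) w"
    by (rule Cons.IH) (use Cons.prems in auto)
  then show ?case using Cons.prems[of w q] by simp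
qed simp

lemma pk_ssym:
  assumes "\<And>x. ssym (F x)"
  shows "ssym (pk F)"
proof (rule ssymI)
  fix u a b v
  show "pk F (u @ a # b # v) = sgp a b * pk F (u @ b # a # v)"
    using assms
  proof (induction u arbitrary: F)
    case Nil
    have 1: "(\<lambda>x w. sgp x a * (sgp x b * F x (a # b # w))) = (\<lambda>x w. sgp a b * (sgp x a * (sgp x b * F x (b # a # w))))"
      by (intro ext) (use ssymD[OF Nil, of _ "[]" a b] in \<open>simp add: mult.left_commute\<close>)
    have 2: "pk (\<lambda>x v. sgp x a * (sgp x b * F x (a # b # v))) v = sgp a b * pk (\<lambda>x v. sgp x a * (sgp x b * F x (b # a # v))) v"
      unfolding 1 by (rule pk_scale)
    show ?case
      by (simp add: sgp_commute[of b a] algebra_simps 2)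
  next
    case (Cons p u)
    have "ssym (\<lambda>v. sgp x p * F x (p # v))" for x
    proof (rule ssymI)
      fix u c d v
      show "sgp x p * F x (p # u @ c # d # v) = sgp c d * (sgp x p * F x (p # u @ d # c # v))"
        using ssymD[OF Cons.prems, of x "p # u" c d v] by (simp add: mult.left_commute)
    qed
    from Cons.IH[OF this] ssymD[OF Cons.prems, of p u a b v]
    show ?case by (simp add: distrib_left)
  qed
qed

lemma sym_ssym: "ssym (sym r u)"
proof (induction r arbitrary: u)
  case 0
  show ?case by (rule ssymI) simp
next
  case (Suc r)
  have "sym (Suc r) u = pk (\<lambda>q. sym r (\<lambda>v. u (q # v)))" by (simp add: fun_eq_iff)
  then show ?case using pk_ssym[of "\<lambda>q. sym r (\<lambda>v. u (q # v))"] Suc by simp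
qed

lemma sym_bound: "(\<And>v. cmod (u v) \<le> M) \<Longrightarrow> length w = r \<Longrightarrow> cmod (sym r u w) \<le> fact r * M"
proof (induction r arbitrary: u w)
  case (Suc r)
  have "cmod (pk (\<lambda>q. sym r (\<lambda>v. u (q # v))) w) \<le> of_nat (length w) * (fact r * M)"
    by (rule pk_bound) (use Suc in auto)
  then show ?case using Suc.prems(2) by (simp add: algebra_simps)
qed simp

lemma sym_lin: "sym r (\<lambda>w. a * u w + b * u' w) w = a * sym r u w + b * sym r u' w"
proof (induction r arbitrary: u u' w)
  case (Suc r)
  have "pk (\<lambda>q. sym r (\<lambda>v. a * u (q # v) + b * u' (q # v))) w
     = pk (\<lambda>q v. a * sym r (\<lambda>v. u (q # v)) v + b * sym r (\<lambda>v. u' (q # v)) v) w"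
    by (rule pk_cong) (rule Suc)
  then show ?case by (simp add: pk_lin)
qed simp

lemma pk_ssym_eq:
  assumes "ssym b"
  shows "pk (\<lambda>q v. b (q # v)) w = of_nat (length w) * b w"
  using assms
proof (induction w arbitrary: b)
  case (Cons p w)
  have "(\<lambda>x v. sgp x p * b (x # p # v)) = (\<lambda>x v. b (p # x # v))"
    using ssymD[OF Cons.prems, of "[]" p] by (simp add: fun_eq_iff sgp_commute)
  then show ?case using Cons.IH[OF ssym_Cons[OF Cons.prems, of p]] by (simp add: algebra_simps)
qed simp

lemma sym_of_ssym: "ssym b \<Longrightarrow> length w = r \<Longrightarrow> sym r b w = fact r * b w"
proof (induction r arbitrary: b w)
  case (Suc r)
  have "pk (\<lambda>q. sym r (\<lambda>v. b (q # v))) w = pk (\<lambda>q v. fact r * b (q # v)) w"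
    by (rule pk_cong) (use Suc ssym_Cons in auto)
  then show ?case using Suc.prems by (simp add: pk_scale pk_ssym_eq[OF Suc.prems(1)] algebra_simps)
qed simp

lemma degree_psh: "degree (psh s f) = degree f"
  by (simp add: psh_def degree_pcompose)

text \<open>Two creation letters satisfy \<open>degree f \<le> - r - 1\<close> and
  \<open>degree g \<le> - s - 1\<close>, so the product stays two below \<open>- (r + s)\<close>,
  where a creation letter needs only one. Creation letters may therefore be reordered modulo
  decomposable vectors.\<close>

lemma der_br:
  assumes "cre x" "cre y"
  shows "der (br1 x y)" "der (br2 x y)"
proof -
  obtain r a f where x: "x = (r, a, f)" by (cases x) auto
  obtain s b g where y: "y = (s, b, g)" by (cases y) auto
  have d: "degree (psh s f * g) \<le> degree f + degree g" "degree (psh r g * f) \<le> degree f + degree g"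
    using degree_mult_le[of "psh s f" g] degree_mult_le[of "psh r g" f] by (simp_all add: degree_psh)
  have h: "degree (if cl a = rw b then psh s f * g else 0) \<le> degree f + degree g"
    "degree (if cl b = rw a then smult (- sgn2 (oda a) (oda b)) (psh r g * f) else 0) \<le> degree f + degree g"
    using d degree_smult_le[of "- sgn2 (oda a) (oda b)" "psh r g * f"] by auto
  have "int (degree f) < - r" "int (degree g) < - s" using assms by (auto simp: x y)
  then show "der (br1 x y)" "der (br2 x y)"
    unfolding x y br1.simps br2.simps der.simps using h by linarith+
qed

lemma interpolate:
  assumes "int (degree f) < m"
  shows "f = (\<Sum>j\<in>{0..<m}. smult (poly f (of_int j)) (lagr {0..<m} j))" (is "f = ?g")
proof (rule poly_eqI_degree)
  let ?A = "(of_int :: int \<Rightarrow> complex) ` {0..<m}"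
  have cA: "card ?A = nat m" by (subst card_image) (auto simp: inj_on_def)
  show "poly f x = poly ?g x" if xA: "x \<in> ?A" for x
  proof -
    obtain l where l: "x = of_int l" "l \<in> {0..<m}" using xA by blast
    have "poly ?g x = (\<Sum>j\<in>{0..<m}. if j = l then poly f (of_int l) else 0)"
      unfolding poly_sum poly_smult l(1) by (rule sum.cong) (use l in \<open>auto simp: poly_lagr\<close>)
    then show ?thesis using l by simp
  qed
  show "degree f < card ?A" using assms cA by simp
  have "degree ?g \<le> nat m - 1"
  proof (rule degree_sum_le)
    fix j assume j: "j \<in> {0..<m}"
    have "degree (smult (poly f (of_int j)) (lagr {0..<m} j)) \<le> degree (lagr {0..<m} j)" by (rule degree_smult_le)
    also have "\<dots> \<le> card ({0..<m} - {j})" by (rule degree_lagr) simp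
    also have "\<dots> = nat m - 1" using j by simp
    finally show "degree (smult (poly f (of_int j)) (lagr {0..<m} j)) \<le> nat m - 1" .
  qed simp
  then show "degree ?g < card ?A" using assms cA by simp
qed

definition Ls :: "int \<Rightarrow> nat \<Rightarrow> int \<Rightarrow> pind list set" where
  "Ls D r d = {w. length w = r \<and> set w \<subseteq> PD D \<and> sum_list (map dg w) = d}"

lemma finite_Ls: "finite (Ls D r d)"
proof -
  have "Ls D r d \<subseteq> {w. set w \<subseteq> PD D \<and> length w = r}" by (auto simp: Ls_def)
  then show ?thesis by (rule finite_subset) (rule finite_lists_length_eq[OF finite_PD])
qed

lemma Ls_Cons: "q # w \<in> Ls D (Suc r) d \<longleftrightarrow> q \<in> PD D \<and> w \<in> Ls D r (d - dg q)"
  by (auto simp: Ls_def)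

lemma Ls_swap: "u @ x # y # v \<in> Ls D r d \<longleftrightarrow> u @ y # x # v \<in> Ls D r d"
  by (auto simp: Ls_def)

section \<open>Decomposable vectors and the descent in length\<close>

context vacuum
begin

text \<open>The decomposable vectors: proper products, and derivatives, which are what brackets of
  creation letters leave. Derivatives have length one, whence \<open>2 \<le> r\<close>.\<close>

definition CCg :: "nat \<Rightarrow> int \<Rightarrow> (xl list \<Rightarrow> complex) set" where
  "CCg r d = {acts w \<phi>0 | w. 2 \<le> length w \<and> length w < r \<and> (\<forall>x\<in>set w. cre x) \<and> wxs 1 0 w = d}
     \<union> {act x \<phi>0 | x. der x \<and> 2 \<le> r \<and> wx 1 0 x = d}"

definition CC :: "nat \<Rightarrow> int \<Rightarrow> (xl list \<Rightarrow> complex) set" where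
  "CC r d = vs.span (CCg r d)"

lemma CC_subspace: "vs.subspace (CC r d)" unfolding CC_def by simp

lemmas CC_add = vs.subspace_add[OF CC_subspace]
  and CC_scale = vs.subspace_scale[OF CC_subspace]
  and CC_0 = vs.subspace_0[OF CC_subspace]
  and CC_diff = vs.subspace_diff[OF CC_subspace]
  and CC_sum = vs.subspace_sum[OF CC_subspace]

lemma CC_word: "2 \<le> length w \<Longrightarrow> length w < r \<Longrightarrow> (\<And>x. x \<in> set w \<Longrightarrow> cre x) \<Longrightarrow> wxs 1 0 w = d \<Longrightarrow> acts w \<phi>0 \<in> CC r d"
  unfolding CC_def CCg_def by (rule vs.span_base) blast

lemma CC_der: "der x \<Longrightarrow> 2 \<le> r \<Longrightarrow> wx 1 0 x = d \<Longrightarrow> act x \<phi>0 \<in> CC r d"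
  unfolding CC_def CCg_def by (rule vs.span_base) blast

lemma CC_Ul: "CC r d \<subseteq> Ul 1 0 r d"
  unfolding CC_def
proof (rule vs.span_minimal[OF _ Ul_subspace])
  show "CCg r d \<subseteq> Ul 1 0 r d"
  proof
    fix \<psi> assume "\<psi> \<in> CCg r d"
    then consider w where "\<psi> = acts w \<phi>0" "length w < r" "\<forall>x\<in>set w. cre x" "wxs 1 0 w = d"
      | x where "\<psi> = act x \<phi>0" "der x" "2 \<le> r" "wx 1 0 x = d"
      unfolding CCg_def by blast
    then show "\<psi> \<in> Ul 1 0 r d"
    proof cases
      case 1
      then show ?thesis by (auto intro: Ul_base)
    next
      case 2
      then show ?thesis using Ul_base[of "[x]" r 1 0 d] der_cre[of x] by (simp add: act_def)
    qed
  qed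
qed

lemma CC_cre:
  assumes "cre x" "\<phi> \<in> CC r d"
  shows "act x \<phi> \<in> CC (Suc r) (wx 1 0 x + d)"
proof (rule act_span_into[OF _ CC_subspace assms(2)[unfolded CC_def]])
  fix \<psi> assume "\<psi> \<in> CCg r d"
  then consider w where "\<psi> = acts w \<phi>0" "2 \<le> length w" "length w < r" "\<forall>x\<in>set w. cre x" "wxs 1 0 w = d"
      | y where "\<psi> = act y \<phi>0" "der y" "2 \<le> r" "wx 1 0 y = d"
      unfolding CCg_def by blast
  then show "act x \<psi> \<in> CC (Suc r) (wx 1 0 x + d)"
  proof cases
    case 1
    then show ?thesis using CC_word[of "x # w" "Suc r"] assms(1) by (auto simp: acts_Cons)
  next
    case 2
    then show ?thesis using CC_word[of "[x, y]" "Suc r"] assms(1) der_cre[of y] by (auto simp: acts_Cons)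
  qed
qed

lemma vec_exact: "vec D r d b \<in> vs.span {acts w \<phi>0 | w. length w = r \<and> (\<forall>x\<in>set w. cre x) \<and> wxs 1 0 w = d}"
proof (induction r arbitrary: d b)
  case 0
  show ?case
  proof (cases "d = 0")
    case True
    have "\<phi>0 \<in> {acts w \<phi>0 | w. length w = 0 \<and> (\<forall>x\<in>set w. cre x) \<and> wxs 1 0 w = d}"
      using True by auto
    then show ?thesis using True by (auto intro: vs.span_scale vs.span_base)
  qed (simp add: vs.span_zero)
next
  case (Suc r)
  show ?case unfolding vec.simps
  proof (rule vs.span_sum)
    fix q assume q: "q \<in> PD D"
    show "act (yl q) (vec D r (d - dg q) (\<lambda>w. b (q # w)))
       \<in> vs.span {acts w \<phi>0 | w. length w = Suc r \<and> (\<forall>x\<in>set w. cre x) \<and> wxs 1 0 w = d}"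
    proof (rule act_span_into[OF _ vs.subspace_span Suc])
      fix \<psi> assume "\<psi> \<in> {acts w \<phi>0 | w. length w = r \<and> (\<forall>x\<in>set w. cre x) \<and> wxs 1 0 w = d - dg q}"
      then obtain w where w: "\<psi> = acts w \<phi>0" "length w = r" "\<forall>x\<in>set w. cre x" "wxs 1 0 w = d - dg q" by blast
      have "act (yl q) \<psi> = acts (yl q # w) \<phi>0" by (simp add: w acts_Cons)
      moreover have "length (yl q # w) = Suc r" "\<forall>x\<in>set (yl q # w). cre x" "wxs 1 0 (yl q # w) = d"
        using w yl_cre[OF PD_dg(3)[OF q]] wx_yl[of q] by auto
      ultimately show "act (yl q) \<psi> \<in> vs.span {acts w \<phi>0 | w. length w = Suc r \<and> (\<forall>x\<in>set w. cre x) \<and> wxs 1 0 w = d}"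
        by (intro vs.span_base) blast
    qed
  qed
qed

lemma der_vec:
  assumes "der x"
  shows "act x (vec D r d b) \<in> CC (Suc (Suc r)) (wx 1 0 x + d)"
proof (rule act_span_into[OF _ CC_subspace vec_exact])
  fix \<psi> assume "\<psi> \<in> {acts w \<phi>0 | w. length w = r \<and> (\<forall>x\<in>set w. cre x) \<and> wxs 1 0 w = d}"
  then obtain w where w: "\<psi> = acts w \<phi>0" "length w = r" "\<forall>x\<in>set w. cre x" "wxs 1 0 w = d" by blast
  show "act x \<psi> \<in> CC (Suc (Suc r)) (wx 1 0 x + d)"
  proof (cases r)
    case 0
    then show ?thesis using w assms by (auto intro: CC_der)
  next
    case (Suc r')
    then show ?thesis using w assms der_cre[of x] CC_word[of "x # w" "Suc (Suc r)"] by (auto simp: acts_Cons)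
  qed
qed

lemma swap_vec:
  assumes "q \<in> PD D" "x \<in> PD D"
  shows "act (yl q) (act (yl x) (vec D r d b)) - scV (sgp q x) (act (yl x) (act (yl q) (vec D r d b)))
    \<in> CC (Suc (Suc r)) (dg q + dg x + d)"
proof -
  have c: "cre (yl q)" "cre (yl x)" using yl_cre PD_dg(3) assms by auto
  have z: "cen (yl q) (yl x) = 0"
    using wx_cen[of "yl q" "yl x" 1 0] PD_dg(1)[OF assms(1)] PD_dg(1)[OF assms(2)] by (auto simp: wx_yl)
  have w: "wx 1 0 (br1 (yl q) (yl x)) = dg q + dg x" "wx 1 0 (br2 (yl q) (yl x)) = dg q + dg x"
    by (cases q; cases x; simp)+
  have 1: "act (br1 (yl q) (yl x)) (vec D r d b) \<in> CC (Suc (Suc r)) (dg q + dg x + d)"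
    using der_vec[OF der_br(1)[OF c], of D r d b] unfolding w .
  have 2: "act (br2 (yl q) (yl x)) (vec D r d b) \<in> CC (Suc (Suc r)) (dg q + dg x + d)"
    using der_vec[OF der_br(2)[OF c], of D r d b] unfolding w .
  show ?thesis
    using CC_add[OF 1 2] unfolding act_br[OF Ul_lie[OF vec_Ul], of "yl q" "yl x"] s2_yl z by simp
qed

lemma CC_sum_diff:
  assumes "\<And>q. q \<in> I \<Longrightarrow> f q - g q \<in> CC r e"
  shows "(\<Sum>q\<in>I. f q) - (\<Sum>q\<in>I. g q) \<in> CC r e"
  using CC_sum[of I "\<lambda>q. f q - g q" r e] assms by (simp add: sum_subtractf)

lemma CC_yl: "q \<in> PD D \<Longrightarrow> \<phi> \<in> CC r (d - dg q) \<Longrightarrow> act (yl q) \<phi> \<in> CC (Suc r) d"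
  using CC_cre[OF yl_cre[OF PD_dg(3)], of q D \<phi> r "d - dg q"] by (simp add: wx_yl)

text \<open>Each of the \<open>r + 1\<close> ways to pull an entry to the front is undone by
  reordering creation letters, up to decomposable vectors.\<close>

lemma vec_pk:
  assumes "\<And>q. ssym (F q)"
  shows "vec D (Suc r) d (pk F) - scV (of_nat (Suc r)) (vec D (Suc r) d (unc F)) \<in> CC (Suc r) d"
  using assms
proof (induction r arbitrary: d F)
  case 0
  show ?case by (simp add: CC_0 cong: if_cong)
next
  case (Suc r)
  define G where "G q x v = sgp x q * F x (q # v)" for q x v
  have sG: "ssym (G q x)" for q x
  proof (rule ssymI)
    fix u a b v
    show "G q x (u @ a # b # v) = sgp a b * G q x (u @ b # a # v)"
      using ssymD[OF Suc.prems, of x "q # u" a b v] by (simp add: G_def mult.left_commute)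
  qed
  define W where "W q = vec D (Suc r) (d - dg q) (unc (G q))" for q
  have "vec D (Suc (Suc r)) d (pk F) = (\<Sum>q\<in>PD D. act (yl q) (vec D (Suc r) (d - dg q) (\<lambda>w. F q w + pk (G q) w)))"
    by (simp add: G_def[abs_def] del: vec.simps(2) add: vec.simps(2)[of D "Suc r"])
  also have "\<dots> = vec D (Suc (Suc r)) d (unc F) + (\<Sum>q\<in>PD D. act (yl q) (vec D (Suc r) (d - dg q) (pk (G q))))"
    unfolding vec_add act_add sum.distrib by (simp add: vec.simps(2)[of D "Suc r"] del: vec.simps(2))
  finally have 1: "vec D (Suc (Suc r)) d (pk F) = vec D (Suc (Suc r)) d (unc F)
    + (\<Sum>q\<in>PD D. act (yl q) (vec D (Suc r) (d - dg q) (pk (G q))))" .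
  have 2: "(\<Sum>q\<in>PD D. act (yl q) (vec D (Suc r) (d - dg q) (pk (G q))))
    - (\<Sum>q\<in>PD D. act (yl q) (scV (of_nat (Suc r)) (W q))) \<in> CC (Suc (Suc r)) d"
  proof (rule CC_sum_diff)
    fix q assume q: "q \<in> PD D"
    show "act (yl q) (vec D (Suc r) (d - dg q) (pk (G q))) - act (yl q) (scV (of_nat (Suc r)) (W q)) \<in> CC (Suc (Suc r)) d"
      using CC_yl[OF q Suc.IH[of "G q" "d - dg q", OF sG]] by (simp add: act_diff W_def del: vec.simps of_nat_Suc)
  qed
  define U where "U q x = vec D r (d - dg q - dg x) (\<lambda>v. F x (q # v))" for q x
  have W: "act (yl q) (W q) = (\<Sum>x\<in>PD D. scV (sgp x q) (act (yl q) (act (yl x) (U q x))))" for q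
    by (simp add: W_def U_def G_def vec_scale act_scV act_sum)
  have 3: "(\<Sum>q\<in>PD D. act (yl q) (W q)) - vec D (Suc (Suc r)) d (unc F) \<in> CC (Suc (Suc r)) d"
  proof -
    have "vec D (Suc (Suc r)) d (unc F) = (\<Sum>x\<in>PD D. \<Sum>q\<in>PD D. act (yl x) (act (yl q) (U q x)))"
      by (simp add: U_def act_sum diff_diff_eq add.commute)
    also have "\<dots> = (\<Sum>q\<in>PD D. \<Sum>x\<in>PD D. act (yl x) (act (yl q) (U q x)))"
      by (rule sum.swap)
    finally have e: "vec D (Suc (Suc r)) d (unc F) = (\<Sum>q\<in>PD D. \<Sum>x\<in>PD D. act (yl x) (act (yl q) (U q x)))" .
    show ?thesis unfolding e W
    proof (intro CC_sum_diff)
      fix q x assume qx: "q \<in> PD D" "x \<in> PD D"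
      from CC_scale[OF swap_vec[OF qx, of r "d - dg q - dg x" "\<lambda>v. F x (q # v)"], of "sgp x q"]
      show "scV (sgp x q) (act (yl q) (act (yl x) (U q x))) - act (yl x) (act (yl q) (U q x)) \<in> CC (Suc (Suc r)) d"
        by (simp add: vs.scale_right_diff_distrib U_def sgp_commute[of q x])
    qed
  qed
  have "vec D (Suc (Suc r)) d (pk F) - scV (of_nat (Suc (Suc r))) (vec D (Suc (Suc r)) d (unc F))
    = ((\<Sum>q\<in>PD D. act (yl q) (vec D (Suc r) (d - dg q) (pk (G q)))) - (\<Sum>q\<in>PD D. act (yl q) (scV (of_nat (Suc r)) (W q))))
     + scV (of_nat (Suc r)) ((\<Sum>q\<in>PD D. act (yl q) (W q)) - vec D (Suc (Suc r)) d (unc F))"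
    unfolding 1 act_scV vs.scale_sum_right[symmetric] vs.scale_right_diff_distrib of_nat_Suc[of "Suc r"] vs.scale_left_distrib
    by (simp del: vec.simps of_nat_Suc)
  then show ?case using CC_add[OF 2 CC_scale[OF 3, of "of_nat (Suc r)"]] by (simp only:)
qed

lemma vec_sym: "vec D r d u - scV (1 / fact r) (vec D r d (sym r u)) \<in> CC r d"
proof (induction r arbitrary: d u)
  case 0
  show ?case by (simp add: CC_0)
next
  case (Suc r)
  define F where "F q = sym r (\<lambda>v. u (q # v))" for q
  have 1: "vec D (Suc r) d u - vec D (Suc r) d (unc (\<lambda>q w. 1 / fact r * F q w)) \<in> CC (Suc r) d"
    unfolding vec.simps unc_simps
  proof (rule CC_sum_diff)
    fix q assume q: "q \<in> PD D"
    from CC_yl[OF q Suc.IH[of "d - dg q" "\<lambda>v. u (q # v)"]]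
    show "act (yl q) (vec D r (d - dg q) (\<lambda>w. u (q # w))) - act (yl q) (vec D r (d - dg q) (\<lambda>w. 1 / fact r * F q w)) \<in> CC (Suc r) d"
      by (simp only: F_def vec_scale act_diff act_scV)
  qed
  have 2: "vec D (Suc r) d (unc (\<lambda>q w. 1 / fact r * F q w)) = scV (1 / fact r) (vec D (Suc r) d (unc F))"
    by (simp only: vec.simps unc_simps vec_scale act_scV vs.scale_sum_right)
  have 3: "scV (1 / fact (Suc r)) (vec D (Suc r) d (pk F)) - scV (1 / fact r) (vec D (Suc r) d (unc F)) \<in> CC (Suc r) d"
  proof -
    have "(1 / fact (Suc r)) * of_nat (Suc r) = (1 / fact r :: complex)" by (simp del: of_nat_Suc)
    then show ?thesis
      using CC_scale[OF vec_pk[of F D r d], of "1 / fact (Suc r)"] sym_ssym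
      by (simp only: F_def vs.scale_right_diff_distrib vs.scale_scale)
  qed
  have F: "F = (\<lambda>q. sym r (\<lambda>v. u (q # v)))" by (intro ext) (simp only: F_def)
  have 4: "pk F = sym (Suc r) u" by (intro ext) (simp only: F sym.simps)
  show ?case
    using CC_diff[OF 1[unfolded 2] 3[unfolded 4]] by (simp del: vec.simps sym.simps fact_Suc)
qed

lemma vec_cong: "(\<And>w. w \<in> Ls D r d \<Longrightarrow> b w = b' w) \<Longrightarrow> vec D r d b = vec D r d b'"
proof (induction r arbitrary: d b b')
  case 0
  then show ?case by (auto simp: Ls_def)
next
  case (Suc r)
  have "vec D r (d - dg q) (\<lambda>w. b (q # w)) = vec D r (d - dg q) (\<lambda>w. b' (q # w))" if "q \<in> PD D" for q
    by (rule Suc.IH) (use Suc.prems that Ls_Cons in auto)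
  then show ?case by simp
qed

lemma zl_Zt: "p \<in> PD D \<Longrightarrow> Zt (2 * D) (zl (4 * D) p)"
proof -
  assume pD: "p \<in> PD D"
  obtain s i t j where p: "p = (s, i, t, j)" by (cases p) auto
  have b: "i < 0" "0 \<le> j" "j - i \<le> D" using pD by (auto simp: p PD_def)
  have "poly (lagr {- (4 * D)..4 * D} i) (of_int l) = 0"
    if "- (2 * D) \<le> l" "l \<le> 2 * D" "\<not> (l < 0 \<and> 0 \<le> l + (j - i))" for l
    using zl_lagr[of "4 * D" l i] that b by auto
  then show ?thesis by (simp add: p)
qed

text \<open>Diagonal dominance at an entry of largest modulus. Contraction yields an equation only
  modulo shorter words; the induction hypothesis, applied to the contracted tensor, turns it into an
  equation between supersymmetrized coefficients, where moduli can be compared.\<close>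

lemma sym_zero_of_short:
  assumes nz: "\<phi>0 \<noteq> 0" and c: "cmod c = of_nat n"
  shows "r \<le> n \<Longrightarrow> d \<le> D \<Longrightarrow> vec D r d u \<in> Ul 1 0 r d \<Longrightarrow> w \<in> Ls D r d \<Longrightarrow> sym r u w = 0"
proof (induction r arbitrary: d u w)
  case 0
  have "CW 1 0 0 d = {}" by (auto simp: CW_def)
  then have "vec D 0 d u = 0" using 0 by (simp add: Ul_def)
  moreover have "d = 0" "w = []" using 0 by (auto simp: Ls_def)
  ultimately show ?case using nz by (simp add: vs.scale_eq_0_iff)
next
  case (Suc r)
  \<comment> \<open>The cutoff to the finite set \<open>Ls\<close> guarantees a maximal entry;
    \<open>vec\<close> does not see the entries outside.\<close>
  define b where "b w = (if w \<in> Ls D (Suc r) d then sym (Suc r) u w else 0)" for w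
  have b: "ssym b"
  proof (rule ssymI)
    fix u' x y v
    show "b (u' @ x # y # v) = sgp x y * b (u' @ y # x # v)"
      using Ls_swap[of u' x y v] ssymD[OF sym_ssym[of "Suc r" u], of u' x y v] by (simp only: b_def) simp
  qed
  have "vec D (Suc r) d b \<in> Ul 1 0 (Suc r) d"
  proof -
    have "vec D (Suc r) d b = vec D (Suc r) d (sym (Suc r) u)"
      by (rule vec_cong) (simp only: b_def if_True)
    moreover have "vec D (Suc r) d u - scV (1 / fact (Suc r)) (vec D (Suc r) d (sym (Suc r) u)) \<in> Ul 1 0 (Suc r) d"
      using vec_sym CC_Ul by blast
    from Ul_scale[OF Ul_diff[OF Suc.prems(3) this], of "fact (Suc r)"]
    have "scV (fact (Suc r) * (1 / fact (Suc r))) (vec D (Suc r) d (sym (Suc r) u)) \<in> Ul 1 0 (Suc r) d"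
      by (simp only: diff_diff_eq2 add_diff_cancel_left' vs.scale_scale)
    then have "vec D (Suc r) d (sym (Suc r) u) \<in> Ul 1 0 (Suc r) d"
      by (simp del: fact_Suc vec.simps sym.simps)
    ultimately show ?thesis by simp
  qed
  note vb = this
  define M where "M = Max (cmod ` b ` Ls D (Suc r) d)"
  have fin: "finite (cmod ` b ` Ls D (Suc r) d)" using finite_Ls by blast
  have le: "cmod (b v) \<le> M" if "v \<in> Ls D (Suc r) d" for v
    unfolding M_def using fin that by (intro Max_ge) auto
  have M0: "0 \<le> M" using le[OF Suc.prems(4)] norm_ge_zero order_trans by blast
  have bM: "cmod (b v) \<le> M" for v
    using le[of v] M0 by (cases "v \<in> Ls D (Suc r) d") (auto simp: b_def)
  have "M \<in> cmod ` b ` Ls D (Suc r) d"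
    unfolding M_def using fin Suc.prems(4) by (intro Max_in) auto
  then obtain w0 where w0: "w0 \<in> Ls D (Suc r) d" "cmod (b w0) = M" by auto
  obtain p v where pv: "w0 = p # v" using w0 by (cases w0) (auto simp: Ls_def)
  have pD: "p \<in> PD D" and vL: "v \<in> Ls D r (d - dg p)" using w0(1) by (auto simp: pv Ls_Cons)
  obtain s i t j where p: "p = (s, i, t, j)" by (cases p) auto
  obtain c' where c': "\<And>w. cmod (c' w) \<le> of_nat (Suc r) * of_nat r * M"
    "act (zl (4 * D) p) (vec D (Suc r) d b) - scV (of_nat (Suc r) * c * stra t) (vec D r (d - dg p) (\<lambda>w. b (p # w)))
      - vec D r (d - dg p) c' \<in> Ul 1 0 r (d - dg p)"
    using contraction[OF p pD refl Suc.prems(2) M0 bM b, of "Suc r"] unfolding diff_Suc_1 by blast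
  have "act (zl (4 * D) p) (vec D (Suc r) d b) \<in> Ul 1 0 r (wx 1 0 (zl (4 * D) p) + d)"
    by (rule Zt_Ul[OF zl_Zt[OF pD] vb]) (use Suc.prems(2) pD in \<open>auto simp: p PD_def\<close>)
  then have z: "act (zl (4 * D) p) (vec D (Suc r) d b) \<in> Ul 1 0 r (d - dg p)"
    by (simp only: wx_zl) (simp add: algebra_simps del: vec.simps)
  let ?C = "of_nat (Suc r) * c * stra t"
  have "vec D r (d - dg p) (\<lambda>w. ?C * b (p # w) + 1 * c' w) \<in> Ul 1 0 r (d - dg p)"
    using Ul_diff[OF z c'(2)] unfolding vec_lin by (simp add: algebra_simps del: vec.simps of_nat_Suc)
  moreover have "d - dg p \<le> D" using Suc.prems(2) PD_dg(1)[OF pD] by simp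
  ultimately have "sym r (\<lambda>w. ?C * b (p # w) + 1 * c' w) v = 0"
    using Suc.IH[OF _ _ _ vL] Suc.prems(1) by simp
  then have e: "?C * (fact r * b (p # v)) = - sym r c' v"
    using sym_of_ssym[OF ssym_Cons[OF b, of p], of v r] vL unfolding sym_lin
    by (simp add: Ls_def eq_neg_iff_add_eq_0 del: of_nat_Suc)
  \<comment> \<open>Main term against corrections: weight \<open>(r + 1) * n\<close> on the left,
    \<open>(r + 1) * r\<close> on the right, both with the factor \<open>fact r\<close> from the
    symmetrization.\<close>
  have "of_nat (Suc r) * of_nat n * (fact r * M) = cmod (?C * (fact r * b (p # v)))"
    using w0(2) by (simp add: norm_mult c stra_def pv del: of_nat_Suc)
  also have "\<dots> \<le> fact r * (of_nat (Suc r) * of_nat r * M)"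
    unfolding e norm_minus_cancel by (rule sym_bound) (use c'(1) vL in \<open>auto simp: Ls_def\<close>)
  finally have "(of_nat (Suc r) * fact r) * (of_nat n * M) \<le> (of_nat (Suc r) * fact r) * (of_nat r * M)"
    by (simp only: mult_ac)
  then have "of_nat n * M \<le> of_nat r * M"
    by (subst (asm) mult_le_cancel_left_pos) auto
  moreover have "of_nat r < (of_nat n :: real)" using Suc.prems(1) by simp
  ultimately have "M = 0" using M0 by (metis mult_less_cancel_right not_le order_less_le)
  then have "b w = 0" using bM[of w] by simp
  then show ?case using Suc.prems(4) by (simp only: b_def if_True)
qed

text \<open>Interpolation at \<open>0, ..., - r - 1\<close> expands every creation letter in the
  letters \<open>yl\<close>.\<close>

lemma word_vec:
  assumes "\<And>x. x \<in> set w \<Longrightarrow> cre x" "wxs 1 0 w \<le> D"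
  shows "\<exists>u. acts w \<phi>0 = vec D (length w) (wxs 1 0 w) u"
  using assms
proof (induction w)
  case Nil
  show ?case by (intro exI[of _ "\<lambda>_. 1"]) simp
next
  case (Cons x w)
  obtain r a f where x: "x = (r, a, f)" by (cases x) auto
  have m: "int (degree f) < - r" using Cons.prems(1)[of x] by (simp add: x)
  have w0: "wxs 1 0 w \<ge> 0" using cre_degs Cons.prems(1) by simp
  obtain u where u: "acts w \<phi>0 = vec D (length w) (wxs 1 0 w) u"
    using Cons.IH Cons.prems w0 m by (auto simp: x)
  let ?q = "\<lambda>j. (rw a, j + r, cl a, j) :: pind"
  define F where "F q v = (if \<exists>j\<in>{0..<- r}. q = ?q j then poly f (of_int (snd (snd (snd q)))) * u v else 0)" for q v
  have inj: "inj_on ?q {0..<- r}" by (auto simp: inj_on_def)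
  have sub: "?q ` {0..<- r} \<subseteq> PD D"
    using Cons.prems(2) w0 by (auto simp: PD_def x)
  have yq: "yl (?q j) = (r, a, lagr {0..<- r} j)" "dg (?q j) = - r" for j by simp_all
  have "act x (acts w \<phi>0) = (\<Sum>j\<in>{0..<- r}. scV (poly f (of_int j)) (act (r, a, lagr {0..<- r} j) (acts w \<phi>0)))"
    unfolding x by (subst interpolate[OF m]) (rule act_poly_sum[OF lie_acts])
  also have "\<dots> = (\<Sum>j\<in>{0..<- r}. act (yl (?q j)) (vec D (length w) (wxs 1 0 (x # w) - dg (?q j)) (F (?q j))))"
  proof (rule sum.cong[OF refl])
    fix j assume j: "j \<in> {0..<- r}"
    have "F (?q j) = (\<lambda>v. poly f (of_int j) * u v)" using j by (auto simp: F_def)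
    then show "scV (poly f (of_int j)) (act (r, a, lagr {0..<- r} j) (acts w \<phi>0))
      = act (yl (?q j)) (vec D (length w) (wxs 1 0 (x # w) - dg (?q j)) (F (?q j)))"
      unfolding yq by (simp add: vec_scale act_scV u x)
  qed
  also have "\<dots> = (\<Sum>q\<in>?q ` {0..<- r}. act (yl q) (vec D (length w) (wxs 1 0 (x # w) - dg q) (F q)))"
    by (subst sum.reindex[OF inj]) simp
  also have "\<dots> = (\<Sum>q\<in>PD D. act (yl q) (vec D (length w) (wxs 1 0 (x # w) - dg q) (F q)))"
  proof (rule sum.mono_neutral_left[OF finite_PD sub])
    show "\<forall>q\<in>PD D - ?q ` {0..<- r}. act (yl q) (vec D (length w) (wxs 1 0 (x # w) - dg q) (F q)) = 0"
    proof
      fix q assume "q \<in> PD D - ?q ` {0..<- r}"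
      then have "\<not> (\<exists>j\<in>{0..<- r}. q = ?q j)" by blast
      then have "F q = (\<lambda>v. 0)" by (intro ext) (simp only: F_def if_False)
      then show "act (yl q) (vec D (length w) (wxs 1 0 (x # w) - dg q) (F q)) = 0" by (simp add: vec_zero act_0)
    qed
  qed
  also have "\<dots> = vec D (length (x # w)) (wxs 1 0 (x # w)) (unc F)" by simp
  finally show ?case unfolding acts_Cons by blast
qed

lemma CC_top:
  assumes "\<psi> \<in> CC (Suc r) d" "2 \<le> r"
  shows "\<exists>u. \<psi> - vec d r d u \<in> CC r d"
  using assms(1) unfolding CC_def[of "Suc r"]
proof (induction rule: vs.span_induct_alt)
  case base
  show ?case by (rule exI[of _ "\<lambda>_. 0"]) (simp add: vec_zero CC_0)
next
  case (step p \<psi> \<chi>)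
  then obtain u where u: "\<chi> - vec d r d u \<in> CC r d" by blast
  have "\<exists>v. \<psi> - vec d r d v \<in> CC r d"
  proof -
    from step(1) consider w where "\<psi> = acts w \<phi>0" "2 \<le> length w" "length w < Suc r" "\<forall>x\<in>set w. cre x" "wxs 1 0 w = d"
      | x where "\<psi> = act x \<phi>0" "der x" "wx 1 0 x = d"
      unfolding CCg_def by blast
    then show ?thesis
    proof cases
      case 1
      show ?thesis
      proof (cases "length w = r")
        case True
        from word_vec[of w d] 1 obtain v where "acts w \<phi>0 = vec d (length w) (wxs 1 0 w) v" by auto
        then show ?thesis using True 1 by (intro exI[of _ v]) (simp add: CC_0)
      next
        case False
        then have "\<psi> \<in> CC r d" using 1 CC_word[of w r d] by auto
        then show ?thesis by (intro exI[of _ "\<lambda>_. 0"]) (simp add: vec_zero)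
      qed
    next
      case 2
      then have "\<psi> \<in> CC r d" using CC_der assms(2) by blast
      then show ?thesis by (intro exI[of _ "\<lambda>_. 0"]) (simp add: vec_zero)
    qed
  qed
  then obtain v where v: "\<psi> - vec d r d v \<in> CC r d" by blast
  have "scV p \<psi> + \<chi> - vec d r d (\<lambda>w. p * v w + 1 * u w) \<in> CC r d"
    using CC_add[OF CC_scale[OF v, of p] u] unfolding vec_lin by (simp add: vs.scale_right_diff_distrib algebra_simps)
  then show ?case by blast
qed

text \<open>As \<open>Y\<close> has length at most one, the top part of its decomposable expression
  equals a combination of shorter words, so its symmetrized tensor vanishes and the top part is
  decomposable of smaller length. The descent ends at \<open>CC 2 d\<close>, which contains
  derivatives only.\<close>

lemma CC_down:
  assumes nz: "\<phi>0 \<noteq> 0" and c: "cmod c = of_nat n" and Y: "Y \<in> Ul 1 0 2 d"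
  shows "Y \<in> CC (Suc r) d \<Longrightarrow> 1 \<le> r \<Longrightarrow> r \<le> n \<Longrightarrow> Y \<in> CC 2 d"
proof (induction r)
  case (Suc r)
  show ?case
  proof (cases "r = 0")
    case True
    then show ?thesis using Suc.prems by (simp add: numeral_2_eq_2)
  next
    case False
    then have r: "2 \<le> Suc r" by simp
    from CC_top[OF Suc.prems(1) r] obtain u where u: "Y - vec d (Suc r) d u \<in> CC (Suc r) d" by blast
    have "Y - (Y - vec d (Suc r) d u) \<in> Ul 1 0 (Suc r) d"
      by (rule Ul_diff[OF Ul_up[OF Y r]]) (use u CC_Ul in blast)
    then have "vec d (Suc r) d u \<in> Ul 1 0 (Suc r) d" by (simp only: diff_diff_eq2 add_diff_cancel_left')
    then have "sym (Suc r) u w = 0" if "w \<in> Ls d (Suc r) d" for w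
      using sym_zero_of_short[OF nz c Suc.prems(3) order_refl _ that] by blast
    then have "vec d (Suc r) d (sym (Suc r) u) = vec d (Suc r) d (\<lambda>_. 0)"
      by (rule vec_cong)
    then have "vec d (Suc r) d u \<in> CC (Suc r) d"
      using vec_sym[of d "Suc r" d u] by (simp only: vec_zero vs.scale_zero_right diff_0_right)
    from CC_add[OF u this] have "Y \<in> CC (Suc r) d" by (simp only: diff_add_cancel)
    then show ?thesis using Suc False by simp
  qed
qed simp

definition AL :: "mtyp set" where "AL = {M0, M1, Mp, Mm}"

lemma AL [simp]: "a \<in> AL" "finite AL"
  by (cases a; simp add: AL_def) (simp add: AL_def)

lemma CC2_single:
  assumes "\<psi> \<in> CC 2 d"
  shows "\<exists>G. (\<forall>a. G a = 0 \<or> int (degree (G a)) + 1 < d) \<and> \<psi> = (\<Sum>a\<in>AL. act (- d, a, G a) \<phi>0)"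
  using assms unfolding CC_def
proof (induction rule: vs.span_induct_alt)
  case base
  show ?case by (rule exI[of _ "\<lambda>_. 0"]) (simp add: act_poly_0[OF lie])
next
  case (step p \<psi> \<chi>)
  then obtain G where G: "\<And>a. G a = 0 \<or> int (degree (G a)) + 1 < d" "\<chi> = (\<Sum>a\<in>AL. act (- d, a, G a) \<phi>0)" by blast
  from step(1) obtain x where x: "\<psi> = act x \<phi>0" "der x" "wx 1 0 x = d" unfolding CCg_def by auto
  then obtain a f where xf: "x = (- d, a, f)" "int (degree f) + 1 < d" by (cases x) auto
  define H where "H b = smult p (if b = a then f else 0) + smult 1 (G b)" for b
  have "H b = 0 \<or> int (degree (H b)) + 1 < d" for b
  proof -
    have "degree (smult p (if b = a then f else 0)) \<le> degree f" "degree (smult 1 (G b)) \<le> degree (G b)"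
      using degree_smult_le[of p f] by auto
    moreover have "degree (H b) \<le> max (degree (smult p (if b = a then f else 0))) (degree (smult 1 (G b)))"
      unfolding H_def by (rule degree_add_le_max)
    ultimately show ?thesis using xf(2) G(1)[of b] by (cases "G b = 0") auto
  qed
  moreover have "scV p \<psi> + \<chi> = (\<Sum>b\<in>AL. act (- d, b, H b) \<phi>0)"
  proof -
    have "(\<Sum>b\<in>AL. act (- d, b, if b = a then f else 0) \<phi>0) = (\<Sum>b\<in>AL. if b = a then act (- d, a, f) \<phi>0 else 0)"
      by (rule sum.cong) (simp_all add: act_poly_0[OF lie])
    then have "\<psi> = (\<Sum>b\<in>AL. act (- d, b, if b = a then f else 0) \<phi>0)"
      by (simp add: x(1) xf(1))
    then show ?thesis
      unfolding H_def act_poly[OF lie] sum.distrib by (simp add: G(2) vs.scale_sum_right[symmetric])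
  qed
  ultimately show ?case by blast
qed

text \<open>After the descent both sides are single letters. Annihilation letters read off the
  values of their polynomials at \<open>0, ..., m - 1\<close> through the central term, as
  \<open>c\<close> is nonzero. These values determine polynomials of degree below \<open>m\<close>,
  and derivatives have no term of degree \<open>m - 1\<close>.\<close>

lemma generators_independent:
  assumes nz: "\<phi>0 \<noteq> 0" and c: "cmod c = of_nat n" and m: "1 \<le> m" "m \<le> n"
    and F: "\<And>a. degree (F a) < m"
    and Y: "(\<Sum>a\<in>AL. act (- int m, a, F a) \<phi>0) \<in> CC (Suc m) (int m)"
  shows "coeff (F a) (m - 1) = 0"
proof -
  let ?Y = "\<Sum>a\<in>AL. act (- int m, a, F a) \<phi>0"
  have "?Y \<in> Ul 1 0 2 (int m)"
  proof (rule Ul_sum)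
    fix a
    show "act (- int m, a, F a) \<phi>0 \<in> Ul 1 0 2 (int m)"
      using Ul_base[of "[(- int m, a, F a)]" 2 1 0 "int m"] F[of a] by (simp add: act_def)
  qed
  from CC_down[OF nz c this Y m] obtain G where
    G: "\<And>a. G a = 0 \<or> int (degree (G a)) + 1 < int m" "?Y = (\<Sum>a\<in>AL. act (- int m, a, G a) \<phi>0)"
    using CC2_single by blast
  define H where "H a = smult 1 (F a) + smult (- 1) (G a)" for a
  have H0: "(\<Sum>b\<in>AL. act (- int m, b, H b) \<phi>0) = 0"
    unfolding H_def act_poly[OF lie] sum.distrib using G(2) by (simp add: sum_negf)
  have "poly (H a) (of_int j) = 0" if j: "0 \<le> j" "j < int m" for j
  proof -
    let ?z = "(int m, mk (cl a) (rw a), lagr {- int m..- 1} (j - int m))"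
    have z: "act ?z (act (- int m, b, H b) \<phi>0) = scV (if b = a then c * stra (cl a) * poly (H a) (of_int j) else 0) \<phi>0" for b
    proof -
      have "(\<Sum>l\<in>{- int m..- 1}. poly (lagr {- int m..- 1} (j - int m)) (of_int l) * poly (H b) (of_int (l + int m)))
        = (\<Sum>l\<in>{- int m..- 1}. if l = j - int m then poly (H b) (of_int j) else 0)"
        by (rule sum.cong) (simp_all add: poly_lagr)
      also have "\<dots> = poly (H b) (of_int j)" using j by simp
      finally have s: "(\<Sum>l\<in>{- int m..- 1}. poly (lagr {- int m..- 1} (j - int m)) (of_int l) * poly (H b) (of_int (l + int m))) = poly (H b) (of_int j)" .
      have "cen ?z (- int m, b, H b) = (if b = a then stra (cl a) * poly (H a) (of_int j) else 0)"
        unfolding cen.simps trp_def s using m by (cases a; cases b; simp)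
      moreover have "spx ?z" "spx (br1 ?z (- int m, b, H b))" "spx (br2 ?z (- int m, b, H b))" by auto
      ultimately show ?thesis
        by (subst act_br[OF lie]) (simp only: spx_act act_0 vs.scale_zero_right add_0_left mult.assoc split: if_split, simp)
    qed
    have "0 = act ?z (\<Sum>b\<in>AL. act (- int m, b, H b) \<phi>0)" unfolding H0 by (simp add: act_0)
    also have "\<dots> = (\<Sum>b\<in>AL. if b = a then scV (c * stra (cl a) * poly (H a) (of_int j)) \<phi>0 else 0)"
      unfolding act_sum z by (rule sum.cong) auto
    finally have "c * stra (cl a) * poly (H a) (of_int j) = 0"
      using nz by (simp add: vs.scale_eq_0_iff)
    moreover have "c \<noteq> 0" using c m by auto
    ultimately show ?thesis by (auto simp: stra_def split: if_splits)
  qed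
  moreover have "degree (H a) < m"
  proof -
    have "degree (smult (- 1) (G a)) < m" using G(1)[of a] m(1) degree_smult_le[of "- 1" "G a"] by auto
    then show ?thesis unfolding H_def using F[of a] by (intro degree_add_less) auto
  qed
  ultimately have "H a = 0"
    by (subst interpolate[of "H a" "int m"]) auto
  then have "F a = G a" by (simp add: H_def)
  then show ?thesis using G(1)[of a] m(1) by (cases "G a = 0") (auto simp: coeff_eq_0)
qed

end

section \<open>Strong generation from decoupling\<close>

text \<open>The letter that creates the \<open>i\<close>-th derivative of \<open>j^{a,k}\<close>,
  without the scalar \<open>- fact i\<close>.\<close>

fun jl :: "mtyp \<times> nat \<times> nat \<Rightarrow> xl" where
  "jl (a, k, i) = (- 1 - int i - int k, a, ffp k)"

lemma jl_cre: "cre (jl p)"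
  by (cases p) (auto simp: degree_ffp)

lemma ffp_Suc: "ffp (Suc k) = ffp k * [:- of_nat k, 1:]"
  by (simp add: ffp_def)

lemma ffp_Suc': "ffp (Suc k) = [:0, 1:] * psh (- 1) (ffp k)"
proof (induction k)
  case (Suc k)
  have "ffp (Suc (Suc k)) = [:0, 1:] * psh (- 1) (ffp k) * [:- of_nat (Suc k), 1:]"
    by (simp only: ffp_Suc[of "Suc k"] Suc)
  moreover have "psh (- 1) (ffp (Suc k)) = psh (- 1) (ffp k) * [:- of_nat (Suc k), 1:]"
    by (simp add: psh_def ffp_Suc pcompose_mult pcompose_pCons algebra_simps del: mult_pCons_right)
  ultimately show ?case by (simp only: mult.assoc)
qed (simp add: ffp_def psh_def pcompose_1)

lemma ffp_expansion: "degree f < m \<Longrightarrow> \<exists>e. f = (\<Sum>k<m. smult (e k) (ffp k))"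
proof (induction m arbitrary: f)
  case (Suc m)
  let ?e = "coeff f m / lead_coeff (ffp m)"
  let ?g = "f - smult ?e (ffp m)"
  have lc: "coeff (ffp m) m \<noteq> 0" using ffp_nz[of m] degree_ffp[of m] by (metis leading_coeff_0_iff)
  have "coeff ?g i = 0" if "i \<ge> m" for i
  proof (cases "i = m")
    case True
    then show ?thesis using lc by (simp add: degree_ffp)
  next
    case False
    then show ?thesis using that Suc.prems by (simp add: coeff_eq_0 degree_ffp)
  qed
  then have "?g = 0 \<or> degree ?g < m"
    by (metis leading_coeff_0_iff not_le)
  then show ?case
  proof
    assume g: "?g = 0"
    show ?thesis
      by (rule exI[of _ "\<lambda>k. if k = m then ?e else 0"]) (use g in simp)
  next
    assume "degree ?g < m"
    from Suc.IH[OF this] obtain e where e: "?g = (\<Sum>k<m. smult (e k) (ffp k))" by blast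
    have "f = (\<Sum>k<m. smult (e k) (ffp k)) + smult ?e (ffp m)"
      by (simp flip: e)
    also have "(\<Sum>k<m. smult (e k) (ffp k)) = (\<Sum>k<m. smult (if k = m then ?e else e k) (ffp k))"
      by (rule sum.cong) auto
    finally show ?thesis by (intro exI[of _ "\<lambda>k. if k = m then ?e else e k"]) simp
  qed
qed simp

lemma degree_psh_diff: "degree (psh s f - f) \<le> degree f - 1"
proof (cases "degree f = 0")
  case True
  then obtain c where "f = [:c:]" by (rule degree_eq_zeroE)
  then show ?thesis by (simp add: psh_def)
next
  case False
  have "coeff (psh s f) (degree f) = coeff f (degree f)"
    using lead_coeff_comp[of "[:of_int s, 1:]" f] degree_psh[of s f] by (simp add: psh_def)
  then have "coeff (psh s f - f) i = 0" if "i > degree f - 1" for i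
    using that False by (cases "i = degree f") (auto simp: coeff_eq_0 degree_psh)
  then show ?thesis by (intro degree_le) auto
qed

text \<open>A shift of the argument changes only lower terms, so the leading products
  cancel.\<close>

lemma degree_comm:
  assumes "degree p \<ge> 1"
  shows "degree (psh s p * f - psh r f * p) \<le> degree p + degree f - 1"
proof -
  have "psh s p * f - psh r f * p = (psh s p - p) * f + (f - psh r f) * p" by (simp add: algebra_simps)
  moreover have "degree ((psh s p - p) * f) \<le> degree p + degree f - 1"
    using degree_mult_le[of "psh s p - p" f] degree_psh_diff[of s p] assms by linarith
  moreover have "degree ((f - psh r f) * p) \<le> degree p + degree f - 1"
  proof (cases "degree f = 0")
    case True
    then obtain c where "f = [:c:]" by (rule degree_eq_zeroE)
    then show ?thesis by (simp add: psh_def)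
  next
    case False
    have "degree (f - psh r f) \<le> degree f - 1"
      using degree_psh_diff[of r f] degree_minus[of "psh r f - f"] by simp
    then show ?thesis using degree_mult_le[of "f - psh r f" p] False by linarith
  qed
  ultimately show ?thesis by (simp add: degree_add_le)
qed

text \<open>The operator \<open>t^r p(D)\<close> times the identity matrix: it is even, and
  commuting with it keeps the matrix unit of a letter.\<close>

definition actI :: "int \<Rightarrow> complex poly \<Rightarrow> (xl list \<Rightarrow> complex) \<Rightarrow> xl list \<Rightarrow> complex" where
  "actI r p \<phi> = act (r, M0, p) \<phi> + act (r, M1, p) \<phi>"

lemma actI_comm:
  assumes "\<phi> \<in> lieF c" "r + s \<noteq> 0"
  shows "actI r p (act (s, b, f) \<phi>) = act (s, b, f) (actI r p \<phi>) + act (r + s, b, psh s p * f - psh r f * p) \<phi>"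
proof -
  note z = act_poly_0[OF assms(1)]
  have d: "act (r + s, b, psh s p * f - psh r f * p) \<phi> = act (r + s, b, psh s p * f) \<phi> + act (r + s, b, - (psh r f * p)) \<phi>"
    using act_poly_add[OF assms(1), of "r + s" b "psh s p * f" "- (psh r f * p)"] by simp
  have s2: "s2 (r, M0, p) (s, b, f) = 1" "s2 (r, M1, p) (s, b, f) = 1"
    by (simp_all add: s2_def sgn2_def oda_def)
  show ?thesis
    unfolding actI_def act_br[OF assms(1), of "(r, M0, p)"] act_br[OF assms(1), of "(r, M1, p)"] s2 d
    using assms(2) by (cases b) (simp_all add: z act_add sgn2_def oda_def algebra_simps)
qed

section \<open>Modes that preserve the decomposable vectors\<close>

context vacuum
begin

text \<open>Creation letters have degree at least one, so the length bound excludes no product of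
  degree \<open>d\<close>.\<close>

definition CA :: "int \<Rightarrow> (xl list \<Rightarrow> complex) set" where
  "CA d = CC (Suc (nat d)) d"

lemma cre_length: "(\<And>x. x \<in> set w \<Longrightarrow> cre x) \<Longrightarrow> int (length w) \<le> wxs 1 0 w"
proof (induction w)
  case (Cons x w)
  then show ?case using cre_deg[of x] by fastforce
qed simp

lemma CA_word: "2 \<le> length w \<Longrightarrow> (\<And>x. x \<in> set w \<Longrightarrow> cre x) \<Longrightarrow> wxs 1 0 w = d \<Longrightarrow> acts w \<phi>0 \<in> CA d"
  unfolding CA_def by (rule CC_word) (use cre_length[of w] in auto)

lemma CA_der: "der x \<Longrightarrow> wx 1 0 x = d \<Longrightarrow> act x \<phi>0 \<in> CA d"
proof -
  assume x: "der x" "wx 1 0 x = d"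
  obtain r a f where "x = (r, a, f)" by (cases x) auto
  then show ?thesis using x unfolding CA_def by (intro CC_der) auto
qed

lemma CA_subspace: "vs.subspace (CA d)" unfolding CA_def by (rule CC_subspace)

lemmas CA_add = vs.subspace_add[OF CA_subspace]
  and CA_scale = vs.subspace_scale[OF CA_subspace]
  and CA_0 = vs.subspace_0[OF CA_subspace]
  and CA_diff = vs.subspace_diff[OF CA_subspace]

lemma CA_into:
  assumes lin: "\<And>p \<psi> \<chi>. O' (scV p \<psi> + \<chi>) = scV p (O' \<psi>) + O' \<chi>" "O' 0 = 0" and Y: "vs.subspace Y"
    and w: "\<And>w. 2 \<le> length w \<Longrightarrow> (\<And>x. x \<in> set w \<Longrightarrow> cre x) \<Longrightarrow> wxs 1 0 w = d \<Longrightarrow> O' (acts w \<phi>0) \<in> Y"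
    and s: "\<And>x. der x \<Longrightarrow> wx 1 0 x = d \<Longrightarrow> O' (act x \<phi>0) \<in> Y"
    and "\<psi> \<in> CA d"
  shows "O' \<psi> \<in> Y"
  using assms(6) unfolding CA_def CC_def
proof (induction rule: vs.span_induct_alt)
  case base
  show ?case using lin(2) vs.subspace_0[OF Y] by simp
next
  case (step p \<psi> \<chi>)
  from step(1) have "O' \<psi> \<in> Y" unfolding CCg_def using w s by blast
  then show ?case unfolding lin(1) using step(2) vs.subspace_add[OF Y] vs.subspace_scale[OF Y] by blast
qed

text \<open>An operator that kills the vacuum and whose commutators keep creation letters and
  derivatives within their classes replaces one letter at a time, hence preserves products as well
  as derivatives. The letters \<open>y1\<close> and \<open>y2\<close> stand for the two halves of a
  bracket.\<close>

lemma CA_normalizer: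
  assumes lin: "\<And>p \<psi> \<chi>. O' (scV p \<psi> + \<chi>) = scV p (O' \<psi>) + O' \<chi>" "O' 0 = 0" "O' \<phi>0 = 0"
    and comm: "\<And>w y. cre y \<Longrightarrow> O' (act y (acts w \<phi>0)) = scV (\<epsilon> y) (act y (O' (acts w \<phi>0))) + act (y1 y) (acts w \<phi>0) + act (y2 y) (acts w \<phi>0)"
    and y12: "\<And>y. cre y \<Longrightarrow> cre (y1 y) \<and> cre (y2 y) \<and> wx 1 0 (y1 y) = wx 1 0 y + e \<and> wx 1 0 (y2 y) = wx 1 0 y + e"
    and der: "\<And>y. der y \<Longrightarrow> der (y1 y) \<and> der (y2 y)"
    and "\<psi> \<in> CA d"
  shows "O' \<psi> \<in> CA (d + e)"
proof (rule CA_into[OF lin(1,2) CA_subspace _ _ assms(7)])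
  fix x assume "der x" "wx 1 0 x = d"
  then show "O' (act x \<phi>0) \<in> CA (d + e)"
    using comm[of x "[]"] der_cre[of x] y12[of x] der[of x] by (auto simp: lin(3) act_0 intro!: CA_add CA_der)
next
  define X where "X l d = {acts w \<phi>0 | w. length w = l \<and> (\<forall>x\<in>set w. cre x) \<and> wxs 1 0 w = d}" for l d
  have main: "O' (acts w \<phi>0) \<in> vs.span (X (length w) (wxs 1 0 w + e))" if "\<And>x. x \<in> set w \<Longrightarrow> cre x" for w
    using that
  proof (induction w)
    case Nil
    show ?case by (simp add: lin(3) vs.span_zero)
  next
    case (Cons y w)
    have cy: "cre y" and cw: "\<And>x. x \<in> set w \<Longrightarrow> cre x" using Cons.prems by auto
    have 1: "act y (O' (acts w \<phi>0)) \<in> vs.span (X (length (y # w)) (wxs 1 0 (y # w) + e))"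
    proof (rule act_span_into[OF _ vs.subspace_span Cons.IH[OF cw]])
      fix \<psi> assume "\<psi> \<in> X (length w) (wxs 1 0 w + e)"
      then obtain v where v: "\<psi> = acts v \<phi>0" "length v = length w" "\<forall>x\<in>set v. cre x" "wxs 1 0 v = wxs 1 0 w + e"
        unfolding X_def by blast
      have "act y \<psi> = acts (y # v) \<phi>0" by (simp add: v acts_Cons)
      then show "act y \<psi> \<in> vs.span (X (length (y # w)) (wxs 1 0 (y # w) + e))"
        unfolding X_def using v cy by (intro vs.span_base) force
    qed
    have 2: "act z (acts w \<phi>0) \<in> vs.span (X (length (y # w)) (wxs 1 0 (y # w) + e))"
      if "cre z" "wx 1 0 z = wx 1 0 y + e" for z
    proof -
      have "act z (acts w \<phi>0) = acts (z # w) \<phi>0" by (simp add: acts_Cons)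
      then show ?thesis unfolding X_def using that cw by (intro vs.span_base) force
    qed
    show ?case
      unfolding acts_Cons[of y w] comm[OF cy] using y12[OF cy] by (intro vs.span_add vs.span_scale 1 2) simp_all
  qed
  fix w assume w: "2 \<le> length w" "\<And>x. x \<in> set w \<Longrightarrow> cre x" "wxs 1 0 w = d"
  have "vs.span (X (length w) (d + e)) \<subseteq> CA (d + e)"
    by (rule vs.span_minimal[OF _ CA_subspace]) (use w in \<open>auto simp: X_def intro: CA_word\<close>)
  then show "O' (acts w \<phi>0) \<in> CA (d + e)" using main[OF w(2)] w(3) by auto
qed

definition Dec :: "mtyp \<Rightarrow> nat \<Rightarrow> bool" where
  "Dec a k \<longleftrightarrow> act (jl (a, k, 0)) \<phi>0 \<in> CA (int k + 1)"

lemma cen_off: "fst x + fst y \<noteq> 0 \<Longrightarrow> cen x y = 0"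
  by (cases x; cases y) simp

lemma zero_mode:
  assumes "\<psi> \<in> CA d"
  shows "act (0, b, 1) \<psi> \<in> CA d"
proof -
  let ?x = "(0, b, 1) :: xl"
  have p: "psh s 1 = 1" for s by (simp add: psh_def pcompose_1)
  have d: "degree (smult q (psh r f)) \<le> degree f" for q r f
    using degree_smult_le[of q "psh r f"] by (simp add: degree_psh)
  have "act ?x \<psi> \<in> CA (d + 0)"
  proof (rule CA_normalizer[where O' = "act ?x" and \<epsilon> = "s2 ?x" and ?y1.0 = "br1 ?x" and ?y2.0 = "br2 ?x"])
    show "act ?x \<phi>0 = 0" by (rule spx_act) auto
    show "act ?x (act y (acts w \<phi>0)) = scV (s2 ?x y) (act y (act ?x (acts w \<phi>0))) + act (br1 ?x y) (acts w \<phi>0) + act (br2 ?x y) (acts w \<phi>0)"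
      if "cre y" for w y
    proof -
      have "cen ?x y = 0" by (rule cen_off) (use that in \<open>cases y; auto\<close>)
      then show ?thesis using act_br[OF lie_acts, of ?x y w] by simp
    qed
    have b: "\<exists>b1 f1 b2 f2. br1 ?x (s, a, f) = (s, b1, f1) \<and> br2 ?x (s, a, f) = (s, b2, f2) \<and> degree f1 \<le> degree f \<and> degree f2 \<le> degree f"
      for s a f using d[of _ 0 f] by (simp add: p)
    show "cre (br1 ?x y) \<and> cre (br2 ?x y) \<and> wx 1 0 (br1 ?x y) = wx 1 0 y + 0 \<and> wx 1 0 (br2 ?x y) = wx 1 0 y + 0"
      if "cre y" for y
    proof -
      obtain s a f where y: "y = (s, a, f)" by (cases y) auto
      from b[of s a f] obtain b1 f1 b2 f2 where "br1 ?x y = (s, b1, f1)" "br2 ?x y = (s, b2, f2)" "degree f1 \<le> degree f" "degree f2 \<le> degree f"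
        unfolding y by blast
      then show ?thesis using that by (simp add: y del: br1.simps br2.simps)
    qed
    show "der (br1 ?x y) \<and> der (br2 ?x y)" if "der y" for y
    proof -
      obtain s a f where y: "y = (s, a, f)" by (cases y) auto
      from b[of s a f] obtain b1 f1 b2 f2 where "br1 ?x y = (s, b1, f1)" "br2 ?x y = (s, b2, f2)" "degree f1 \<le> degree f" "degree f2 \<le> degree f"
        unfolding y by blast
      then show ?thesis using that by (simp add: y del: br1.simps br2.simps)
    qed
  qed (use assms in \<open>simp_all add: act_add act_scV act_0\<close>)
  then show ?thesis by simp
qed

text \<open>The constant matrices act by the adjoint action: from \<open>M0\<close> they reach the
  odd units, and the bracket of \<open>Mm\<close> with \<open>Mp\<close> yields
  \<open>M0 + M1\<close>.\<close>

lemma Dec_types: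
  assumes "Dec M0 k"
  shows "Dec a k"
proof -
  let ?J = "\<lambda>a. act (jl (a, k, 0)) \<phi>0"
  have m: "act (0, b, 1) (?J a) = act (br1 (0, b, 1) (jl (a, k, 0))) \<phi>0 + act (br2 (0, b, 1) (jl (a, k, 0))) \<phi>0" for a b
  proof -
    have "act (0, b, 1) \<phi>0 = 0" by (rule spx_act) auto
    then show ?thesis using act_br[OF lie, of "(0, b, 1)" "jl (a, k, 0)"] by (simp add: act_0)
  qed
  have M0: "?J M0 \<in> CA (int k + 1)" using assms by (simp add: Dec_def)
  have p1: "psh 0 f = f" "psh s 1 = 1" for f s by (simp_all add: psh_def pcompose_idR pcompose_1)
  have neg: "act (r, a, - f) \<phi>0 = scV (- 1) (act (r, a, f) \<phi>0)" for r a f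
    using act_poly_smult[OF lie, of r a "- 1" f] by simp
  have Mp: "?J Mp \<in> CA (int k + 1)"
    using CA_scale[OF zero_mode[OF M0, of Mp], of "- 1"] unfolding m
    by (simp add: act_poly_0[OF lie] p1 sgn2_def oda_def neg)
  have Mm: "?J Mm \<in> CA (int k + 1)"
    using zero_mode[OF M0, of Mm] unfolding m by (simp add: act_poly_0[OF lie] p1 sgn2_def oda_def neg)
  have "?J M1 + ?J M0 \<in> CA (int k + 1)"
    using zero_mode[OF Mp, of Mm] unfolding m by (simp add: act_poly_0[OF lie] p1 sgn2_def oda_def neg)
  from CA_diff[OF this M0] have "?J M1 \<in> CA (int k + 1)" by simp
  then show ?thesis using M0 Mp Mm by (cases a) (simp_all add: Dec_def)
qed

text \<open>The mode \<open>t^(-1) D (D - 1)\<close> times the identity. The root at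
  \<open>0\<close> puts it into \<open>SP\<close>; having degree two, it raises the degree of a
  polynomial by one while it lowers the power of \<open>t\<close> by one, which leads from
  \<open>j^{a,k}\<close> to \<open>j^{a,k+1}\<close>.\<close>

abbreviation (input) pW :: "complex poly" where "pW \<equiv> [:0, - 1, 1:]"

lemma actI_vac: "(\<And>b. spx (r, b, p)) \<Longrightarrow> actI r p \<phi>0 = 0"
  by (simp add: actI_def del: spx.simps)

lemma spxW: "spx (- 1, b, pW)" and spxT: "spx (- 1, b, [:0, 1:])"
  by auto

text \<open>The factor \<open>- (k + 2)\<close> never vanishes, and the second term belongs to a
  derivative of \<open>j^{a,k}\<close>; so decoupling propagates from \<open>k\<close> to
  \<open>k + 1\<close>.\<close>

lemma ffp_W: "psh (- 1 - int k) pW * ffp k - psh (- 1) (ffp k) * pW = smult (- of_nat (k + 2)) (ffp (Suc k)) + smult 2 (ffp k)"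
proof -
  have 1: "psh (- 1 - int k) pW = [:of_nat ((k + 1) * (k + 2)), - of_nat (2 * k + 3), 1:]"
    by (simp add: psh_def pcompose_pCons algebra_simps)
  have 2: "psh (- 1) (ffp k) * pW = ffp k * ([:- of_nat k, 1:] * [:- 1, 1:])"
  proof -
    have "psh (- 1) (ffp k) * pW = ([:0, 1:] * psh (- 1) (ffp k)) * [:- 1, 1:]"
      by (simp add: algebra_simps)
    then show ?thesis by (simp only: ffp_Suc'[symmetric] ffp_Suc mult.assoc)
  qed
  have 3: "[:of_nat ((k + 1) * (k + 2)), - of_nat (2 * k + 3), 1 :: complex:] - [:- of_nat k, 1:] * [:- 1, 1:]
     = smult (- of_nat (k + 2)) [:- of_nat k, 1:] + [:2:]"
    by (simp add: algebra_simps)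
  have "psh (- 1 - int k) pW * ffp k - psh (- 1) (ffp k) * pW
     = ffp k * ([:of_nat ((k + 1) * (k + 2)), - of_nat (2 * k + 3), 1 :: complex:] - [:- of_nat k, 1:] * [:- 1, 1:])"
    unfolding 1 2 right_diff_distrib by (simp only: mult.commute)
  also have "\<dots> = smult (- of_nat (k + 2)) (ffp k * [:- of_nat k, 1:]) + ffp k * [:2:]"
    by (subst 3) (simp only: distrib_left mult_smult_right)
  finally show ?thesis by (simp only: ffp_Suc) simp
qed

lemma W_mode:
  assumes p: "\<And>b. spx (- 1, b, p)" "degree p = 2" and "\<psi> \<in> CA d"
  shows "actI (- 1) p \<psi> \<in> CA (d + 1)"
proof -
  define y1 :: "xl \<Rightarrow> xl" where "y1 y = (case y of (s, b, f) \<Rightarrow> (- 1 + s, b, psh s p * f - psh (- 1) f * p))" for y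
  define y2 :: "xl \<Rightarrow> xl" where "y2 y = (case y of (s, b, f) \<Rightarrow> (- 1 + s, b, 0))" for y
  have deg: "degree (psh s p * f - psh (- 1) f * p) \<le> degree f + 1" for s f
    using degree_comm[of p s f "- 1"] p(2) by simp
  show ?thesis
  proof (rule CA_normalizer[where O' = "actI (- 1) p" and \<epsilon> = "\<lambda>_. 1" and ?y1.0 = y1 and ?y2.0 = y2, OF _ _ _ _ _ _ assms(3)])
    show "actI (- 1) p \<phi>0 = 0" by (rule actI_vac) (rule p)
    show "actI (- 1) p (act y (acts w \<phi>0)) = scV 1 (act y (actI (- 1) p (acts w \<phi>0))) + act (y1 y) (acts w \<phi>0) + act (y2 y) (acts w \<phi>0)"
      if "cre y" for w y
    proof -
      obtain s b f where y: "y = (s, b, f)" by (cases y) auto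
      have "- 1 + s \<noteq> 0" using that by (simp add: y)
      then show ?thesis unfolding y y1_def y2_def case_prod_conv act_poly_0[OF lie_acts] actI_comm[OF lie_acts \<open>- 1 + s \<noteq> 0\<close>] by simp
    qed
    show "cre (y1 y) \<and> cre (y2 y) \<and> wx 1 0 (y1 y) = wx 1 0 y + 1 \<and> wx 1 0 (y2 y) = wx 1 0 y + 1" if "cre y" for y
    proof -
      obtain s b f where y: "y = (s, b, f)" by (cases y) auto
      show ?thesis using that deg[of s f] by (simp add: y y1_def y2_def)
    qed
    show "der (y1 y) \<and> der (y2 y)" if "der y" for y
    proof -
      obtain s b f where y: "y = (s, b, f)" by (cases y) auto
      show ?thesis using that deg[of s f] by (simp add: y y1_def y2_def)
    qed
  qed (simp_all add: actI_def act_add act_scV act_0 vs.scale_right_distrib)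
qed

lemma Dec_Suc:
  assumes "Dec a k"
  shows "Dec a (Suc k)"
proof -
  have "actI (- 1) pW (act (jl (a, k, 0)) \<phi>0) \<in> CA (int k + 2)"
    using W_mode[OF spxW _ assms[unfolded Dec_def]] by (simp add: add.assoc)
  moreover have "actI (- 1) pW (act (jl (a, k, 0)) \<phi>0)
     = scV (- of_nat (k + 2)) (act (jl (a, Suc k, 0)) \<phi>0) + scV 2 (act (jl (a, k, 1)) \<phi>0)"
  proof -
    have "actI (- 1) pW (act (jl (a, k, 0)) \<phi>0) = act (- 2 - int k, a, psh (- 1 - int k) pW * ffp k - psh (- 1) (ffp k) * pW) \<phi>0"
      using actI_comm[OF lie, of "- 1" "- 1 - int k" pW a "ffp k"] actI_vac[OF spxW]
      by (simp add: act_0 del: mult_pCons_right)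
    then show ?thesis unfolding ffp_W act_poly[OF lie] by simp
  qed
  moreover have "scV 2 (act (jl (a, k, 1)) \<phi>0) \<in> CA (int k + 2)"
    by (intro CA_scale CA_der) (simp_all add: degree_ffp)
  ultimately have "scV (- of_nat (k + 2)) (act (jl (a, Suc k, 0)) \<phi>0) \<in> CA (int k + 2)"
    using CA_diff by (metis add_diff_cancel_right')
  from CA_scale[OF this, of "- 1 / of_nat (k + 2)"] have "act (jl (a, Suc k, 0)) \<phi>0 \<in> CA (int k + 2)"
    by (simp del: of_nat_add of_nat_Suc jl.simps add: field_simps)
  then show ?thesis by (simp add: Dec_def add.commute)
qed

lemma Dec_all: "n \<le> k \<Longrightarrow> Dec M0 n \<Longrightarrow> Dec a k"
proof -
  have "Dec M0 n \<Longrightarrow> Dec M0 k" if "n \<le> k"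
    using that by (induction k rule: dec_induct) (auto intro: Dec_Suc)
  then show "n \<le> k \<Longrightarrow> Dec M0 n \<Longrightarrow> Dec a k" by (blast intro: Dec_types)
qed

end

section \<open>Reduction of words to monomials in the first generators\<close>

context vacuum
begin

definition MonoG :: "nat \<Rightarrow> int \<Rightarrow> (xl list \<Rightarrow> complex) set" where
  "MonoG n d = vs.span {acts (map jl ps) \<phi>0 | ps. (\<forall>(a, k, i)\<in>set ps. k < n) \<and> wxs 1 0 (map jl ps) = d}"

lemma MonoG_base: "(\<And>a k i. (a, k, i) \<in> set ps \<Longrightarrow> k < n) \<Longrightarrow> wxs 1 0 (map jl ps) = d \<Longrightarrow> acts (map jl ps) \<phi>0 \<in> MonoG n d"
  unfolding MonoG_def by (rule vs.span_base) blast

lemma MonoG_subspace: "vs.subspace (MonoG n d)"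
  unfolding MonoG_def by simp

lemmas MonoG_add = vs.subspace_add[OF MonoG_subspace]
  and MonoG_scale = vs.subspace_scale[OF MonoG_subspace]
  and MonoG_0 = vs.subspace_0[OF MonoG_subspace]
  and MonoG_sum = vs.subspace_sum[OF MonoG_subspace]

lemma MonoG_act_into:
  assumes "\<And>ps. (\<And>a k i. (a, k, i) \<in> set ps \<Longrightarrow> k < n) \<Longrightarrow> wxs 1 0 (map jl ps) = d \<Longrightarrow> act x (acts (map jl ps) \<phi>0) \<in> Y"
    and "vs.subspace Y" "\<psi> \<in> MonoG n d"
  shows "act x \<psi> \<in> Y"
  using assms(3) unfolding MonoG_def
proof (rule act_span_into[rotated 2])
  fix \<psi> assume "\<psi> \<in> {acts (map jl ps) \<phi>0 | ps. (\<forall>(a, k, i)\<in>set ps. k < n) \<and> wxs 1 0 (map jl ps) = d}"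
  then obtain ps where ps: "\<psi> = acts (map jl ps) \<phi>0" "\<forall>(a, k, i)\<in>set ps. k < n" "wxs 1 0 (map jl ps) = d" by blast
  show "act x \<psi> \<in> Y" unfolding ps(1) by (rule assms(1)) (use ps in auto)
qed (rule assms(2))

lemma MonoG_prepend:
  assumes "k < n" "\<psi> \<in> MonoG n d"
  shows "act (jl (a, k, i)) \<psi> \<in> MonoG n (wx 1 0 (jl (a, k, i)) + d)"
proof (rule MonoG_act_into[OF _ MonoG_subspace assms(2)])
  fix ps :: "(mtyp \<times> nat \<times> nat) list"
  assume ps: "\<And>a k i. (a, k, i) \<in> set ps \<Longrightarrow> k < n" "wxs 1 0 (map jl ps) = d"
  have "acts (map jl ((a, k, i) # ps)) \<phi>0 \<in> MonoG n (wx 1 0 (jl (a, k, i)) + d)"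
    by (rule MonoG_base) (use assms(1) ps in auto)
  then show "act (jl (a, k, i)) (acts (map jl ps) \<phi>0) \<in> MonoG n (wx 1 0 (jl (a, k, i)) + d)"
    by (simp only: list.map acts_Cons)
qed

text \<open>\<open>t^(-1) D\<close> is \<open>d/dt\<close>, whose commutators differentiate the
  fields up to the scalar \<open>- (i + 1)\<close>.\<close>

abbreviation (input) "translation \<equiv> actI (- 1) [:0, 1:]"

lemma translation_jl: "translation (act (jl (a, k, i)) (acts w \<phi>0)) = act (jl (a, k, i)) (translation (acts w \<phi>0)) + scV (- of_nat (Suc i)) (act (jl (a, k, Suc i)) (acts w \<phi>0))"
proof -
  let ?s = "- 1 - int i - int k"
  have "psh ?s [:0, 1:] * ffp k - psh (- 1) (ffp k) * [:0, 1:] = ffp k * (psh ?s [:0, 1:] - [:- of_nat k, 1:])"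
    using ffp_Suc'[of k] unfolding ffp_Suc by (simp only: right_diff_distrib mult.commute)
  also have "psh ?s [:0, 1:] - [:- of_nat k, 1 :: complex:] = [:- of_nat (Suc i):]"
    by (simp add: psh_def pcompose_pCons)
  finally have p: "psh ?s [:0, 1:] * ffp k - psh (- 1) (ffp k) * [:0, 1:] = smult (- of_nat (Suc i)) (ffp k)"
    by simp
  have s: "- 1 + ?s = - 1 - int (Suc i) - int k" and nz: "- 1 + ?s \<noteq> 0" by simp_all
  show ?thesis
    unfolding jl.simps actI_comm[OF lie_acts nz] p act_poly_smult[OF lie_acts] s ..
qed

lemma translation_vac: "translation \<phi>0 = 0"
  by (rule actI_vac[OF spxT])

lemma translation_MonoG:
  assumes "\<psi> \<in> MonoG n d"
  shows "translation \<psi> \<in> MonoG n (d + 1)"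
proof -
  have main: "translation (acts (map jl ps) \<phi>0) \<in> MonoG n (wxs 1 0 (map jl ps) + 1)"
    if "\<And>a k i. (a, k, i) \<in> set ps \<Longrightarrow> k < n" for ps
    using that
  proof (induction ps)
    case Nil
    show ?case by (simp add: translation_vac MonoG_0)
  next
    case (Cons p ps)
    obtain a k i where p: "p = (a, k, i)" by (cases p) auto
    have ps: "\<And>a k i. (a, k, i) \<in> set ps \<Longrightarrow> k < n" and k: "k < n"
      using Cons.prems by (auto simp: p)
    have IH: "translation (acts (map jl ps) \<phi>0) \<in> MonoG n (wxs 1 0 (map jl ps) + 1)"
      by (rule Cons.IH) (rule ps)
    have 1: "act (jl (a, k, i)) (translation (acts (map jl ps) \<phi>0)) \<in> MonoG n (wxs 1 0 (map jl (p # ps)) + 1)"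
      using MonoG_prepend[OF k IH, of a i] by (simp add: p algebra_simps)
    have 2: "act (jl (a, k, Suc i)) (acts (map jl ps) \<phi>0) \<in> MonoG n (wxs 1 0 (map jl (p # ps)) + 1)"
    proof -
      have "acts (map jl ps) \<phi>0 \<in> MonoG n (wxs 1 0 (map jl ps))" by (rule MonoG_base) (use ps in auto)
      from MonoG_prepend[OF k this, of a "Suc i"] show ?thesis by (simp add: p algebra_simps)
    qed
    show ?case
      unfolding list.map p acts_Cons translation_jl using 1 2 by (intro MonoG_add MonoG_scale) (simp_all only: list.map p)
  qed
  show ?thesis
    using assms unfolding MonoG_def[of n d]
  proof (induction rule: vs.span_induct_alt)
    case base
    show ?case by (simp add: actI_def act_0 MonoG_0)
  next
    case (step q \<psi> \<chi>)
    then obtain ps where ps: "\<psi> = acts (map jl ps) \<phi>0" "\<forall>(a, k, i)\<in>set ps. k < n" "wxs 1 0 (map jl ps) = d"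
      by blast
    have "translation \<psi> \<in> MonoG n (d + 1)"
      unfolding ps(1) ps(3)[symmetric] by (rule main) (use ps(2) in auto)
    moreover have "translation (scV q \<psi> + \<chi>) = scV q (translation \<psi>) + translation \<chi>"
      by (simp add: actI_def act_add act_scV vs.scale_right_distrib)
    ultimately show ?case using step(2) by (simp add: MonoG_add MonoG_scale)
  qed
qed

lemma letter_expansion:
  assumes "degree f < m"
  shows "\<exists>e. \<forall>w. act (- int m, a, f) (acts w \<phi>0) = (\<Sum>k<m. scV (e k) (act (jl (a, k, m - 1 - k)) (acts w \<phi>0)))"
proof -
  obtain e where e: "f = (\<Sum>k<m. smult (e k) (ffp k))" using ffp_expansion[OF assms] by blast
  show ?thesis
  proof (rule exI[of _ e], rule allI)
    fix w
    have "act (- int m, a, f) (acts w \<phi>0) = (\<Sum>k<m. scV (e k) (act (- int m, a, ffp k) (acts w \<phi>0)))"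
      unfolding e by (rule act_poly_sum[OF lie_acts])
    also have "\<dots> = (\<Sum>k<m. scV (e k) (act (jl (a, k, m - 1 - k)) (acts w \<phi>0)))"
      by (rule sum.cong) auto
    finally show "act (- int m, a, f) (acts w \<phi>0) = (\<Sum>k<m. scV (e k) (act (jl (a, k, m - 1 - k)) (acts w \<phi>0)))" .
  qed
qed

text \<open>Derivatives come from the translation operator in the degree below, products from moving
  a letter into a monomial. A single generator with \<open>k \<ge> n\<close> is left for last, since
  \<open>dec\<close> rewrites it by derivatives and products of the same degree.\<close>

lemma strong_generation_step:
  assumes IH: "\<And>e r. e < d \<Longrightarrow> Ul 1 0 r e \<subseteq> MonoG n e"
    and dec: "\<And>a k. n \<le> k \<Longrightarrow> Dec a k"
    and w: "\<And>x. x \<in> set w \<Longrightarrow> cre x" "wxs 1 0 w = d"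
  shows "acts w \<phi>0 \<in> MonoG n d"
proof -
  have B1: "act (jl (a, k, i)) \<phi>0 \<in> MonoG n d" if "i > 0" "1 + int i + int k = d" for a k i
  proof -
    obtain i' where i: "i = Suc i'" using \<open>i > 0\<close> by (cases i) auto
    have "act (jl (a, k, i')) \<phi>0 \<in> Ul 1 0 2 (d - 1)"
      unfolding act_def by (rule Ul_base) (use that(2) in \<open>auto simp: i degree_ffp\<close>)
    then have "act (jl (a, k, i')) \<phi>0 \<in> MonoG n (d - 1)" using IH[of "d - 1" 2] by auto
    from translation_MonoG[OF this] have "scV (- of_nat i) (act (jl (a, k, i)) \<phi>0) \<in> MonoG n d"
      using translation_jl[of a k i' "[]"] by (simp add: translation_vac act_0 i del: jl.simps)
    from MonoG_scale[OF this, of "- 1 / of_nat i"] that(1) show ?thesis by (simp del: jl.simps)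
  qed
  have B: "act x \<phi>0 \<in> MonoG n d" if x: "der x" "wx 1 0 x = d" for x
  proof -
    obtain r a f where xr: "x = (r, a, f)" by (cases x) auto
    have "degree f < nat (d - 1)" using x by (simp add: xr)
    then have "\<exists>e. f = (\<Sum>k<nat (d - 1). smult (e k) (ffp k))" by (rule ffp_expansion)
    then obtain e where e: "f = (\<Sum>k<nat (d - 1). smult (e k) (ffp k))" by blast
    have rd: "- d = r" using x by (simp add: xr)
    have "act x \<phi>0 = (\<Sum>k<nat (d - 1). scV (e k) (act (r, a, ffp k) \<phi>0))"
      unfolding xr e by (rule act_poly_sum[OF lie])
    also have "\<dots> \<in> MonoG n d"
    proof (intro MonoG_sum MonoG_scale)
      fix k assume k: "k \<in> {..<nat (d - 1)}"
      have "act (jl (a, k, nat (d - 1) - k)) \<phi>0 \<in> MonoG n d"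
        by (rule B1) (use k x in \<open>auto simp: xr\<close>)
      then show "act (r, a, ffp k) \<phi>0 \<in> MonoG n d" using k x by (simp add: xr of_nat_diff rd)
    qed
    finally show ?thesis .
  qed
  \<comment> \<open>The first letter of the monomial is moved to the front. What then stands behind
    it has smaller degree, and the bracket is a derivative letter in front of a shorter
    monomial.\<close>
  have A: "act x (acts (map jl ps) \<phi>0) \<in> MonoG n d"
    if "ps \<noteq> []" "\<And>a k i. (a, k, i) \<in> set ps \<Longrightarrow> k < n" "cre x" "wx 1 0 x + wxs 1 0 (map jl ps) = d" for x ps
    using that
  proof (induction ps arbitrary: x)
    case (Cons p ps)
    obtain a k i where p: "p = (a, k, i)" by (cases p) auto
    have ps: "\<And>a k i. (a, k, i) \<in> set ps \<Longrightarrow> k < n" and k: "k < n"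
      using Cons.prems by (auto simp: p)
    define v where "v = acts (map jl ps) \<phi>0"
    have vl: "v \<in> lieF c" unfolding v_def by simp
    have any: "act y v \<in> MonoG n d" if "der y" "wx 1 0 y + wxs 1 0 (map jl ps) = d" for y
    proof (cases "ps = []")
      case True
      then show ?thesis using B[of y] that by (simp add: v_def)
    next
      case False
      show ?thesis unfolding v_def by (rule Cons.IH[OF False ps der_cre]) (use that in auto)
    qed
    have key: "act z (act (jl p) v) \<in> MonoG n d" if z: "cre z" "wx 1 0 z + wxs 1 0 (map jl (p # ps)) = d" for z
    proof -
      obtain r b f where zr: "z = (r, b, f)" by (cases z) auto
      have "act z v \<in> Ul 1 0 (Suc (length (z # map jl ps))) (wxs 1 0 (z # map jl ps))"
        unfolding v_def acts_Cons[symmetric] by (rule word_Ul)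
      moreover have "wxs 1 0 (z # map jl ps) < d" using z(2) by (simp add: p)
      ultimately have "act z v \<in> MonoG n (wxs 1 0 (z # map jl ps))" using IH by blast
      from MonoG_prepend[OF k this, of a i]
      have 1: "act (jl p) (act z v) \<in> MonoG n d" using z(2) by (simp add: p algebra_simps)
      have cp: "cre (jl p)" by (rule jl_cre)
      have 2: "act (br1 z (jl p)) v \<in> MonoG n d" "act (br2 z (jl p)) v \<in> MonoG n d"
        by (rule any; use der_br[OF z(1) cp] z(2) in \<open>simp add: zr p\<close>)+
      have "cen z (jl p) = 0" by (rule cen_off) (use z(1) in \<open>simp add: zr p\<close>)
      then show ?thesis unfolding act_br[OF vl, of z "jl p"] using 1 2 by (simp add: MonoG_add MonoG_scale del: br1.simps br2.simps)
    qed
    show ?case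
      unfolding list.map acts_Cons v_def[symmetric] using key[OF Cons.prems(3,4)] .
  qed simp
  have C: "acts w \<phi>0 \<in> MonoG n d" if w: "2 \<le> length w" "\<And>x. x \<in> set w \<Longrightarrow> cre x" "wxs 1 0 w = d" for w
  proof -
    obtain x y w' where w': "w = x # y # w'" using w(1) by (cases w; cases "tl w") auto
    let ?v = "y # w'"
    have pos: "wx 1 0 x > 0" "wx 1 0 y > 0" "wxs 1 0 w' \<ge> 0"
      using w(2) cre_deg cre_degs[of w'] by (auto simp: w' simp del: wx.simps)
    have "acts ?v \<phi>0 \<in> MonoG n (wxs 1 0 ?v)"
      using word_Ul[of ?v 1 0] IH[of "wxs 1 0 ?v"] w(3) pos by (auto simp: w' simp del: wx.simps)
    then show ?thesis
      unfolding w' acts_Cons[of x]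
    proof (rule MonoG_act_into[OF _ MonoG_subspace, rotated])
      fix ps :: "(mtyp \<times> nat \<times> nat) list"
      assume ps: "\<And>a k i. (a, k, i) \<in> set ps \<Longrightarrow> k < n" "wxs 1 0 (map jl ps) = wxs 1 0 ?v"
      show "act x (acts (map jl ps) \<phi>0) \<in> MonoG n d"
        by (rule A) (use ps w pos in \<open>auto simp: w' simp del: wx.simps\<close>)
    qed
  qed
  show ?thesis
  proof (cases w)
    case Nil
    then show ?thesis using MonoG_base[of "[]" n d] w by simp
  next
    case (Cons x w')
    show ?thesis
    proof (cases "w' = []")
      case False
      then show ?thesis using C[OF _ w] Cons by (cases w') auto
    next
      case True
      obtain r a f where x: "x = (r, a, f)" by (cases x) auto
      have d: "r = - d" "int (degree f) < d" using w by (auto simp: Cons True x)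
      from d have "degree f < nat d" by simp
      from letter_expansion[OF this] obtain e where e: "\<And>w. act (- int (nat d), a, f) (acts w \<phi>0) = (\<Sum>k<nat d. scV (e k) (act (jl (a, k, nat d - 1 - k)) (acts w \<phi>0)))"
        by blast
      have "act (jl (a, k, nat d - 1 - k)) \<phi>0 \<in> MonoG n d" if k: "k < nat d" for k
      proof (cases "k < n")
        case True
        then show ?thesis using MonoG_base[of "[(a, k, nat d - 1 - k)]" n d] k d(2)
          by (simp add: act_def of_nat_diff)
      next
        case False
        show ?thesis
        proof (cases "nat d - 1 - k > 0")
          case True
          then show ?thesis by (intro B1) (auto simp: of_nat_diff)
        next
          case False
          have kd: "int k + 1 = d" using False k by simp
          from dec[of k a] \<open>\<not> k < n\<close> have "act (jl (a, k, 0)) \<phi>0 \<in> CA d" unfolding Dec_def kd by simp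
          from CA_into[of "\<lambda>\<psi>. \<psi>", OF _ _ MonoG_subspace _ _ this] have "act (jl (a, k, 0)) \<phi>0 \<in> MonoG n d"
            using B C by blast
          then show ?thesis using False by simp
        qed
      qed
      then show ?thesis using e[of "[]"] d(1,2)
        by (auto simp: Cons True x acts_Cons simp del: jl.simps intro!: MonoG_sum MonoG_scale)
    qed
  qed
qed

lemma strong_generation:
  assumes dec: "\<And>a k. n \<le> k \<Longrightarrow> Dec a k"
  shows "Ul 1 0 r d \<subseteq> MonoG n d"
proof (induction "nat d" arbitrary: d r rule: less_induct)
  case less
  have Ul: "Ul 1 0 r d \<subseteq> MonoG n d" if "\<And>w. (\<And>x. x \<in> set w \<Longrightarrow> cre x) \<Longrightarrow> wxs 1 0 w = d \<Longrightarrow> acts w \<phi>0 \<in> MonoG n d" for d r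
    unfolding Ul_def CW_def by (rule vs.span_minimal[OF _ MonoG_subspace]) (use that in auto)
  have np: "Ul 1 0 r d \<subseteq> MonoG n d" if "d \<le> 0" for d r
  proof (rule Ul)
    fix w assume w: "\<And>x. x \<in> set w \<Longrightarrow> cre x" "wxs 1 0 w = d"
    have "int (length w) \<le> wxs 1 0 w" by (rule cre_length) (rule w)
    then have "length w = 0" using w(2) that by linarith
    then show "acts w \<phi>0 \<in> MonoG n d" using MonoG_base[of "[]" n d] w by simp
  qed
  show ?case
  proof (cases "d \<le> 0")
    case False
    show ?thesis
    proof (rule Ul, rule strong_generation_step[OF _ dec])
      fix e :: int and r assume "e < d"
      show "Ul 1 0 r e \<subseteq> MonoG n e"
      proof (cases "e \<le> 0")
        case False
        then show ?thesis using less[of e r] \<open>e < d\<close> by simp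
      qed (rule np)
    qed
  qed (rule np)
qed

lemma strong_generation_words:
  assumes "Dec M0 n"
  shows "acts w \<phi>0 \<in> vs.span {acts (map jl ps) \<phi>0 | ps. \<forall>(a, k, i)\<in>set ps. k < n}"
proof -
  have "acts w \<phi>0 \<in> MonoG n (wxs 1 0 w)"
    using word_Ul[of w 1 0] strong_generation[of n "Suc (length w)" "wxs 1 0 w"] Dec_all[OF _ assms] by blast
  moreover have "MonoG n (wxs 1 0 w) \<subseteq> vs.span {acts (map jl ps) \<phi>0 | ps. \<forall>(a, k, i)\<in>set ps. k < n}"
    unfolding MonoG_def by (rule vs.span_mono) blast
  ultimately show ?thesis by blast
qed

end

section \<open>The decoupling relation\<close>

text \<open>\<open>Qs N \<Phi> ps\<close> evaluates \<open>\<Phi>\<close> on the product of the bilinears \<open>\<Sum>\<^sub>k Ps k i Pd k j\<close> over the pairs \<open>(i, j)\<close> in \<open>ps\<close>.\<close>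

fun Qs :: "nat \<Rightarrow> (osc list \<Rightarrow> complex) \<Rightarrow> (int \<times> int) list \<Rightarrow> complex" where
  "Qs N \<Phi> [] = \<Phi> []"
| "Qs N \<Phi> ((i, j) # ps) = (\<Sum>k<N. Qs N (\<lambda>v. \<Phi> (Ps k False i # Pd k False j # v)) ps)"

text \<open>The action of a letter on a product of colour sums, as a list of terms: one mode of one
  factor is shifted. The coefficients do not involve the number of colours.\<close>

fun Dt :: "int \<Rightarrow> complex poly \<Rightarrow> (int \<times> int) list \<Rightarrow> (complex \<times> (int \<times> int) list) list" where
  "Dt r f [] = []"
| "Dt r f ((i, j) # ps) = (poly f (of_int i), (i + r, j) # ps) # (- poly f (of_int (j - r)), (i, j - r) # ps)
     # map (\<lambda>(c, q). (c, (i, j) # q)) (Dt r f ps)"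

lemma Qs_lin: "Qs N (\<lambda>v. a * \<Phi> v + b * \<Psi> v) ps = a * Qs N \<Phi> ps + b * Qs N \<Psi> ps"
proof (induction ps arbitrary: \<Phi> \<Psi>)
  case (Cons p ps)
  then show ?case by (cases p) (simp add: sum.distrib sum_distrib_left)
qed simp

lemma Qs_0: "Qs N (\<lambda>v. 0) ps = 0"
  using Qs_lin[of N 0 "\<lambda>v. 0" 0 "\<lambda>v. 0" ps] by simp

lemma Qs_sum_list: "(\<Sum>k\<in>K. (\<Sum>(c, q)\<leftarrow>cs. c * F k q)) = (\<Sum>(c, q)\<leftarrow>cs. c * (\<Sum>k\<in>K. F k q :: complex))"
  by (induction cs) (auto simp: sum.distrib sum_distrib_left)

lemma Qs_Dop: "Qs N (Dop (r, M0, f) \<Phi>) ps = (\<Sum>(c, q)\<leftarrow>Dt r f ps. c * Qs N \<Phi> q)"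
proof (induction ps arbitrary: \<Phi>)
  case (Cons p ps)
  obtain i j where p: "p = (i, j)" by (cases p) auto
  let ?y = "(r, M0, f)"
  let ?\<Phi> = "\<lambda>k v. \<Phi> (Ps k False i # Pd k False j # v)"
  have "Qs N (\<lambda>v. Dop ?y \<Phi> (Ps k False i # Pd k False j # v)) ps
     = poly f (of_int i) * Qs N (\<lambda>v. \<Phi> (Ps k False (i + r) # Pd k False j # v)) ps
      - poly f (of_int (j - r)) * Qs N (\<lambda>v. \<Phi> (Ps k False i # Pd k False (j - r) # v)) ps
      + (\<Sum>(c, q)\<leftarrow>Dt r f ps. c * Qs N (?\<Phi> k) q)" for k
  proof -
    have e: "Dop ?y \<Phi> (Ps k False i # Pd k False j # v) =
       1 * (poly f (of_int i) * \<Phi> (Ps k False (i + r) # Pd k False j # v)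
       + (- poly f (of_int (j - r))) * \<Phi> (Ps k False i # Pd k False (j - r) # v)) + 1 * Dop ?y (?\<Phi> k) v" for v
      by (simp add: sx_def sgn2_def oda_def)
    show ?thesis unfolding e Qs_lin Cons.IH by simp
  qed
  then have "Qs N (Dop ?y \<Phi>) (p # ps) = poly f (of_int i) * Qs N \<Phi> ((i + r, j) # ps)
      - poly f (of_int (j - r)) * Qs N \<Phi> ((i, j - r) # ps)
      + (\<Sum>(c, q)\<leftarrow>Dt r f ps. c * Qs N \<Phi> ((i, j) # q))"
    by (simp add: p sum.distrib sum_subtractf sum_distrib_left Qs_sum_list del: Dop.simps)
  then show ?case by (simp add: p o_def case_prod_unfold del: Dop.simps)
qed simp

lemma Qs_Qop:
  assumes "valid (False, i, False, j)"
  shows "Qs N (\<lambda>v. Qop N (yl (False, i, False, j)) (\<lambda>z. \<Phi> (v @ z))) ps = Qs N \<Phi> (ps @ [(i, j)])"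
proof (induction ps arbitrary: \<Phi>)
  case Nil
  have "(\<Sum>l\<in>{0..<j - i}. poly (lagr {0..<j - i} j) (of_int l) * \<Phi> [Ps k False (l + (i - j)), Pd k False l])
     = (\<Sum>l\<in>{0..<j - i}. if l = j then \<Phi> [Ps k False i, Pd k False j] else 0)" for k
    by (rule sum.cong) (auto simp: poly_lagr)
  then show ?case using assms by simp
next
  case (Cons p ps)
  obtain k l where p: "p = (k, l)" by (cases p) auto
  have "Qs N (\<lambda>v. Qop N (yl (False, i, False, j)) (\<lambda>z. \<Phi> (Ps c False k # Pd c False l # v @ z))) ps
    = Qs N (\<lambda>v. \<Phi> (Ps c False k # Pd c False l # v)) (ps @ [(i, j)])" for c
    using Cons.IH[of "\<lambda>v. \<Phi> (Ps c False k # Pd c False l # v)"] by simp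
  then show ?case by (simp only: p Qs.simps append_Cons)
qed

lemma Qs_op:
  assumes "valid (False, i, False, j)"
  shows "Qs N (op N (yl (False, i, False, j)) \<Phi>) ps = Qs N \<Phi> (ps @ [(i, j)])
     + (\<Sum>(c, q)\<leftarrow>Dt (i - j) (lagr {0..<j - i} j) ps. c * Qs N \<Phi> q)"
proof -
  let ?y = "yl (False, i, False, j)"
  have sw: "sw ?y w = 1" for w by (simp add: sw_def sgn2_def oda_def)
  have e: "op N ?y \<Phi> w = 1 * Dop ?y \<Phi> w + 1 * Qop N ?y (\<lambda>z. \<Phi> (w @ z))" for w
    unfolding op_def sw by simp
  have "Qs N (op N ?y \<Phi>) ps = Qs N (Dop ?y \<Phi>) ps + Qs N (\<lambda>w. Qop N ?y (\<lambda>z. \<Phi> (w @ z))) ps"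
    unfolding e[abs_def] Qs_lin by simp
  then show ?thesis unfolding Qs_Qop[OF assms] using Qs_Dop[of N "i - j" "lagr {0..<j - i} j" \<Phi> ps] by simp
qed

definition dp :: "(int \<times> int) list \<Rightarrow> int" where
  "dp ps = (\<Sum>(i, j)\<leftarrow>ps. j - i)"

definition vp :: "(int \<times> int) list \<Rightarrow> bool" where
  "vp ps \<longleftrightarrow> (\<forall>(i, j)\<in>set ps. i < 0 \<and> 0 \<le> j)"

lemma Dt_props: "(c, q) \<in> set (Dt r f ps) \<Longrightarrow> vp ps \<Longrightarrow> r < 0 \<Longrightarrow> length q = length ps \<and> vp q \<and> dp q = dp ps - r"
proof (induction ps arbitrary: c q)
  case (Cons p ps)
  obtain i j where p: "p = (i, j)" by (cases p) auto
  from Cons.prems(1) consider "q = (i + r, j) # ps" | "q = (i, j - r) # ps" | q' where "q = (i, j) # q'" "(c, q') \<in> set (Dt r f ps)"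
    by (auto simp: p)
  then show ?case
  proof cases
    case 3
    then show ?thesis using Cons.IH[OF 3(2)] Cons.prems(2,3) by (auto simp: p vp_def dp_def)
  qed (use Cons.prems(2,3) in \<open>auto simp: p vp_def dp_def\<close>)
qed simp

definition M0w :: "int \<Rightarrow> xl list \<Rightarrow> bool" where
  "M0w d w \<longleftrightarrow> (\<forall>x\<in>set w. cre x \<and> fst (snd x) = M0) \<and> wxs 1 0 w = d"

text \<open>Realization of a functional, uniformly in the number of colours, by a formal combination of words.\<close>

definition Rz :: "int \<Rightarrow> nat \<Rightarrow> (nat \<Rightarrow> (osc list \<Rightarrow> complex) \<Rightarrow> complex) \<Rightarrow> bool" where
  "Rz d l G \<longleftrightarrow> (\<exists>u. (\<forall>(c, w)\<in>set u. M0w d w \<and> length w < l) \<and> (\<forall>N \<Phi>. G N \<Phi> = (\<Sum>(c, w)\<leftarrow>u. c * ow N \<Phi> w [])))"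

lemma Rz_word: "M0w d w \<Longrightarrow> length w < l \<Longrightarrow> Rz d l (\<lambda>N \<Phi>. ow N \<Phi> w [])"
  unfolding Rz_def by (rule exI[of _ "[(1, w)]"]) auto

lemma Rz_add: assumes "Rz d l G" "Rz d l H" shows "Rz d l (\<lambda>N \<Phi>. G N \<Phi> + H N \<Phi>)"
proof -
  obtain u v where u: "\<forall>(c, w)\<in>set u. M0w d w \<and> length w < l" "\<forall>N \<Phi>. G N \<Phi> = (\<Sum>(c, w)\<leftarrow>u. c * ow N \<Phi> w [])"
    and v: "\<forall>(c, w)\<in>set v. M0w d w \<and> length w < l" "\<forall>N \<Phi>. H N \<Phi> = (\<Sum>(c, w)\<leftarrow>v. c * ow N \<Phi> w [])"
    using assms unfolding Rz_def by blast
  show ?thesis unfolding Rz_def by (rule exI[of _ "u @ v"]) (use u v in auto)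
qed

lemma Rz_scale: assumes "Rz d l G" shows "Rz d l (\<lambda>N \<Phi>. a * G N \<Phi>)"
proof -
  obtain u where u: "\<forall>(c, w)\<in>set u. M0w d w \<and> length w < l" "\<forall>N \<Phi>. G N \<Phi> = (\<Sum>(c, w)\<leftarrow>u. c * ow N \<Phi> w [])"
    using assms unfolding Rz_def by blast
  show ?thesis unfolding Rz_def
    by (rule exI[of _ "map (\<lambda>(c, w). (a * c, w)) u"]) (use u in \<open>auto simp: o_def case_prod_unfold sum_list_const_mult mult.assoc\<close>)
qed

lemma Rz_0: "Rz d l (\<lambda>N \<Phi>. 0)"
  unfolding Rz_def by (rule exI[of _ "[]"]) auto

lemma Rz_sum_list:
  assumes "\<And>c q. (c, q) \<in> set cs \<Longrightarrow> Rz d l (G q)"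
  shows "Rz d l (\<lambda>N \<Phi>. \<Sum>(c, q)\<leftarrow>cs. c * G q N \<Phi>)"
  using assms
proof (induction cs)
  case (Cons p cs)
  obtain c q where p: "p = (c, q)" by (cases p) auto
  have "Rz d l (\<lambda>N \<Phi>. \<Sum>(c, q)\<leftarrow>cs. c * G q N \<Phi>)" by (rule Cons.IH) (use Cons.prems in auto)
  moreover have "Rz d l (G q)" by (rule Cons.prems[of c]) (simp add: p)
  ultimately show ?case by (simp add: p Rz_add Rz_scale)
qed (simp add: Rz_0)

lemma Rz_cong: "Rz d l G \<Longrightarrow> (\<And>N \<Phi>. G N \<Phi> = H N \<Phi>) \<Longrightarrow> Rz d l H"
  unfolding Rz_def by simp

lemma Rz_mono: "Rz d l G \<Longrightarrow> l \<le> l' \<Longrightarrow> Rz d l' G"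
  unfolding Rz_def by fastforce

lemma Rz_op:
  assumes "Rz d l G" "cre y" "fst (snd y) = M0" "d' = wx 1 0 y + d"
  shows "Rz d' (Suc l) (\<lambda>N \<Phi>. G N (op N y \<Phi>))"
proof -
  obtain u where u: "\<forall>(c, w)\<in>set u. M0w d w \<and> length w < l" "\<forall>N \<Phi>. G N \<Phi> = (\<Sum>(c, w)\<leftarrow>u. c * ow N \<Phi> w [])"
    using assms(1) unfolding Rz_def by blast
  show ?thesis unfolding Rz_def
    by (rule exI[of _ "map (\<lambda>(c, w). (c, y # w)) u"])
      (use u assms(2-) in \<open>auto simp: o_def case_prod_unfold M0w_def simp del: wx.simps cre.simps\<close>)
qed

abbreviation (input) y0 :: "int \<times> int \<Rightarrow> xl" where
  "y0 p \<equiv> yl (False, fst p, False, snd p)"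

text \<open>A letter in front of a product of bilinears creates one further bilinear at the vacuum,
  plus terms with as many bilinears as before; solving for the longer product expresses it by words
  uniformly in \<open>N\<close>. The newest bilinear stands last while its letter stands first,
  hence \<open>rev\<close>.\<close>

lemma realize: "vp ps \<Longrightarrow> Rz (dp ps) (length ps) (\<lambda>N \<Phi>. Qs N \<Phi> ps - ow N \<Phi> (map y0 (rev ps)) [])"
proof (induction "length ps" arbitrary: ps)
  case 0
  then show ?case by (simp add: Rz_0)
next
  case (Suc l)
  then obtain ps' p where ps: "ps = ps' @ [p]" by (cases ps rule: rev_cases) auto
  obtain i j where p: "p = (i, j)" by (cases p) auto
  let ?y = "y0 p"
  let ?D = "Dt (i - j) (lagr {0..<j - i} j) ps'"
  have v: "vp ps'" "valid (False, i, False, j)" "i < 0" "0 \<le> j" and l: "l = length ps'"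
    using Suc.prems Suc.hyps(2) by (auto simp: ps p vp_def)
  have y: "cre ?y" "fst (snd ?y) = M0" "dp ps = wx 1 0 ?y + dp ps'"
    using yl_cre[OF v(2)] by (simp_all add: p ps dp_def del: cre.simps)
  have top: "M0w (dp q) (map y0 (rev q))" if "vp q" for q
  proof -
    have "\<forall>x\<in>set q. cre (y0 x)"
    proof
      fix x assume "x \<in> set q"
      then have "valid (False, fst x, False, snd x)" using that by (auto simp: vp_def)
      then show "cre (y0 x)" by (rule yl_cre)
    qed
    moreover have "wxs 1 0 (map y0 (rev q)) = dp q"
      by (induction q) (auto simp: dp_def)
    ultimately show ?thesis by (auto simp: M0w_def simp del: cre.simps)
  qed
  have 1: "Rz (dp ps) (length ps) (\<lambda>N \<Phi>. Qs N (op N ?y \<Phi>) ps' - ow N \<Phi> (map y0 (rev ps)) [])"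
    using Rz_op[OF Suc.hyps(1)[OF l v(1)] y] by (simp add: ps)
  have 2: "Rz (dp ps) (length ps) (\<lambda>N \<Phi>. \<Sum>(c, q)\<leftarrow>?D. c * Qs N \<Phi> q)"
  proof (rule Rz_sum_list[where G = "\<lambda>q N \<Phi>. Qs N \<Phi> q"])
    fix c q assume "(c, q) \<in> set ?D"
    from Dt_props[OF this v(1)] v(3,4) have q: "length q = length ps'" "vp q" "dp q = dp ps' - (i - j)" by auto
    have dq: "dp q = dp ps" using q(3) by (simp add: ps p dp_def)
    have "Rz (dp ps) (length ps) (\<lambda>N \<Phi>. Qs N \<Phi> q - ow N \<Phi> (map y0 (rev q)) [])"
      using Rz_mono[OF Suc.hyps(1)[of q]] q(1,2) l by (simp add: ps dq)
    moreover have "Rz (dp ps) (length ps) (\<lambda>N \<Phi>. ow N \<Phi> (map y0 (rev q)) [])"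
      by (rule Rz_word) (use top[OF q(2)] q(1) in \<open>simp_all add: dq ps\<close>)
    ultimately show "Rz (dp ps) (length ps) (\<lambda>N \<Phi>. Qs N \<Phi> q)"
      by (rule Rz_cong[OF Rz_add]) simp
  qed
  show ?case
    by (rule Rz_cong[OF Rz_add[OF 1 Rz_scale[OF 2, of "- 1"]]])
      (use Qs_op[OF v(2)] in \<open>simp add: p ps\<close>)
qed

text \<open>The fermionic mode anticommutes to its second copy, and its square is zero.\<close>

lemma exch_repeat:
  assumes "exch \<Phi>" and A: "\<And>b. b \<in> set v \<Longrightarrow> cc a b = 0 \<and> so a b = - 1" "cc a a = 0 \<and> so a a = - 1"
  shows "\<Phi> (u @ a # v @ a # w) = 0"
  using A(1)
proof (induction v arbitrary: u)
  case Nil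
  show ?case using exchD[OF assms(1), of u a a w] A(2) by simp
next
  case (Cons b v)
  have "\<Phi> ((u @ [b]) @ a # v @ a # w) = 0" by (rule Cons.IH) (use Cons.prems in auto)
  then show ?case using exchD[OF assms(1), of u a b "v @ a # w"] Cons.prems[of b] by simp
qed

text \<open>The bilinear is a sum over \<open>N\<close> colours of elements of square zero.\<close>

lemma Qs_pigeonhole:
  assumes "exch \<Phi>"
  shows "K \<subseteq> {..<N} \<Longrightarrow> (\<forall>k\<in>K. Ps k False (- 1) \<in> set pre) \<Longrightarrow> (\<forall>a\<in>set pre. \<exists>k. a = Ps k False (- 1) \<or> a = Pd k False 0)
    \<Longrightarrow> N < card K + m \<Longrightarrow> Qs N (\<lambda>v. \<Phi> (pre @ v)) (replicate m (- 1, 0)) = 0"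
proof (induction m arbitrary: K pre)
  case 0
  then show ?case using card_mono[of "{..<N}" K] by simp
next
  case (Suc m)
  have "Qs N (\<lambda>v. \<Phi> (pre @ Ps k False (- 1) # Pd k False 0 # v)) (replicate m (- 1, 0)) = 0" if k: "k < N" for k
  \<comment> \<open>A colour that was used before repeats a fermionic mode; a new colour enlarges
    \<open>K\<close>.\<close>
  proof (cases "k \<in> K")
    case True
    let ?a = "Ps k False (- 1)"
    obtain u v where pre: "pre = u @ ?a # v" using Suc.prems(2) True by (meson split_list)
    have "\<Phi> (u @ ?a # v @ ?a # w) = 0" for w
    proof (rule exch_repeat[OF assms])
      fix b assume "b \<in> set v"
      then obtain k' where "b = Ps k' False (- 1) \<or> b = Pd k' False 0" using Suc.prems(3) by (auto simp: pre)
      then show "cc ?a b = 0 \<and> so ?a b = - 1" by (auto simp: cc_PsPd so_def sgn2_def)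
    qed (simp add: so_def sgn2_def)
    then show ?thesis by (simp add: pre Qs_0)
  next
    case False
    have "Qs N (\<lambda>v. \<Phi> ((pre @ [Ps k False (- 1), Pd k False 0]) @ v)) (replicate m (- 1, 0)) = 0"
    proof (rule Suc.IH[of "insert k K"])
      have "finite K" using Suc.prems(1) by (rule finite_subset) simp
      then show "N < card (insert k K) + m" using Suc.prems(4) False by simp
    qed (use Suc.prems k in auto)
    then show ?thesis by simp
  qed
  then show ?case by simp
qed

text \<open>The value at \<open>0\<close> of the \<open>(m - 1)\<close>-st difference of
  \<open>f\<close>: for \<open>degree f < m\<close> a nonzero multiple of the coefficient of degree
  \<open>m - 1\<close>. It is the scalar that survives \<open>m\<close> commutators with
  \<open>t\<close>.\<close>

fun bet :: "nat \<Rightarrow> complex poly \<Rightarrow> complex" where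
  "bet 0 f = 0"
| "bet (Suc 0) f = coeff f 0"
| "bet (Suc (Suc m)) f = bet (Suc m) (f - psh 1 f)"

lemma psh_diff_lin: "smult a f + smult b g - psh s (smult a f + smult b g) = smult a (f - psh s f) + smult b (g - psh s g)"
  by (simp add: psh_add psh_smult smult_diff_right)

lemma bet_lin: "bet m (smult a f + smult b g) = a * bet m f + b * bet m g"
  by (induction m f arbitrary: g rule: bet.induct) (simp_all add: psh_diff_lin)

lemma bet_0: "bet m 0 = 0"
  using bet_lin[of m 0 0 0 0] by simp

lemma bet_small: "degree f + 1 < m \<Longrightarrow> bet m f = 0"
proof (induction m f rule: bet.induct)
  case (3 m f)
  show ?case
  proof (cases "degree f = 0")
    case True
    then obtain c where "f = [:c:]" by (rule degree_eq_zeroE)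
    then show ?thesis by (simp add: psh_def bet_0)
  next
    case False
    have "degree (f - psh 1 f) \<le> degree f - 1"
      using degree_psh_diff[of 1 f] degree_minus[of "psh 1 f - f"] by simp
    then show ?thesis using 3 False by simp
  qed
qed auto

abbreviation (input) h1 :: xl where "h1 \<equiv> (1, M0, 1)"

text \<open>The scalar by which the full power of \<open>h1\<close> brings a word back to the
  vacuum, apart from one factor \<open>c\<close> per letter. The binomial coefficient counts which
  of the factors \<open>h1\<close> are spent on the first letter.\<close>

fun chi :: "xl list \<Rightarrow> complex" where
  "chi [] = 1"
| "chi ((r, a, f) # w) = of_nat ((nat (- r) + nat (wxs 1 0 w)) choose nat (- r)) * bet (nat (- r)) f * chi w"

lemma acts_replicate: "acts (replicate (Suc d) x) \<phi> = acts (replicate d x) (act x \<phi>)"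
  by (simp add: act_def flip: acts_append replicate_append_same)

context vacuum
begin

lemma Ul_below: "e < 0 \<Longrightarrow> \<psi> \<in> Ul 1 0 r e \<Longrightarrow> \<psi> = 0"
proof -
  assume "e < 0" "\<psi> \<in> Ul 1 0 r e"
  moreover have "CW 1 0 r e = {}" if "e < 0" for e
    unfolding CW_def using cre_degs that by fastforce
  ultimately show ?thesis unfolding Ul_def by simp
qed

text \<open>Each commutator with \<open>h1\<close> replaces \<open>f\<close> by a difference and
  shifts the power of \<open>t\<close>, until the \<open>m\<close>-th one is a scalar. Splitting off
  one \<open>h1\<close> gives Pascal's rule.\<close>

lemma h1_creation:
  "degree f < m \<Longrightarrow> v \<in> Ul 1 0 r (int e) \<Longrightarrow>
   acts (replicate (m + e) h1) (act (- int m, M0, f) v) = scV (c * of_nat ((m + e) choose m) * bet m f) (acts (replicate e h1) v)"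
proof (induction "m + e" arbitrary: m e f v)
  case (Suc D)
  let ?y = "(- int m, M0, f) :: xl"
  have lv: "v \<in> lieF c" by (rule Ul_lie[OF Suc.prems(2)])
  have dg: "degree (f - psh 1 f) \<le> degree f - 1"
    using degree_psh_diff[of 1 f] degree_minus[of "psh 1 f - f"] by simp
  have br: "act h1 (act ?y v) = act ?y (act h1 v) + act (1 - int m, M0, f - psh 1 f) v + scV (c * (if m = 1 then coeff f 0 else 0)) v"
  proof -
    have "act (br1 h1 ?y) v + act (br2 h1 ?y) v = act (1 - int m, M0, f - psh 1 f) v"
    proof -
      have "act (1 - int m, M0, f) v + act (1 - int m, M0, - psh 1 f) v = act (1 - int m, M0, f + - psh 1 f) v"
        by (rule act_poly_add[OF lv, symmetric])
      then show ?thesis by (simp add: psh_def pcompose_1 sgn2_def oda_def)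
    qed
    moreover have "cen h1 ?y = (if m = 1 then coeff f 0 else 0)"
      by (auto simp: trp_def stra_def poly_0_coeff_0)
    moreover have "s2 h1 ?y = 1" by (simp add: s2_def sgn2_def oda_def)
    ultimately show ?thesis unfolding act_br[OF lv, of h1 ?y] by (simp add: add.assoc)
  qed
  have h1v: "act h1 v \<in> Ul 1 0 r (int e - 1)"
    using Ul_spx[OF _ Suc.prems(2), of h1] by simp
  have 1: "acts (replicate D h1) (act ?y (act h1 v)) = scV (c * of_nat (D choose m) * bet m f) (acts (replicate e h1) v)"
  proof (cases e)
    case 0
    then have "act h1 v = 0" using Ul_below[OF _ h1v] by simp
    moreover have "D choose m = 0" using Suc.hyps(2) 0 by simp
    ultimately show ?thesis by (simp add: act_0 acts_0)
  next
    case (Suc e')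
    have D: "D = m + e'" using \<open>Suc D = m + e\<close> Suc by simp
    have "act h1 v \<in> Ul 1 0 r (int e')" using h1v Suc by simp
    from Suc.hyps(1)[OF D Suc.prems(1) this] show ?thesis unfolding Suc acts_replicate D .
  qed
  have m0: "m > 0" using Suc.prems(1) by simp
  show ?case
  proof (cases "m = 1")
    case True
    then have "degree f = 0" using Suc.prems(1) by simp
    then obtain a where f: "f = [:a:]" by (rule degree_eq_zeroE)
    have De: "D = e" using Suc.hyps(2) True by simp
    have "act (1 - int m, M0, f - psh 1 f) v = 0"
      using act_poly_0[OF lv] by (simp add: f psh_def)
    then have "acts (replicate (m + e) h1) (act ?y v) = acts (replicate D h1) (act ?y (act h1 v)) + scV (c * a) (acts (replicate D h1) v)"
      unfolding Suc.hyps(2)[symmetric] acts_replicate br by (simp add: True f acts_add acts_scV)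
    then show ?thesis unfolding 1 by (simp add: True De f algebra_simps flip: vs.scale_left_distrib)
  next
    case False
    then obtain m' where m: "m = Suc (Suc m')" using m0 by (cases m; cases "m - 1") auto
    have D: "D = Suc m' + e" using Suc.hyps(2) m by simp
    have "degree (f - psh 1 f) < Suc m'" using dg Suc.prems(1) m by simp
    from Suc.hyps(1)[OF D this Suc.prems(2)]
    have 2: "acts (replicate D h1) (act (1 - int m, M0, f - psh 1 f) v) = scV (c * of_nat (D choose Suc m') * bet m f) (acts (replicate e h1) v)"
      unfolding D by (simp add: m)
    have "acts (replicate (m + e) h1) (act ?y v) = acts (replicate D h1) (act ?y (act h1 v)) + acts (replicate D h1) (act (1 - int m, M0, f - psh 1 f) v)"
      unfolding Suc.hyps(2)[symmetric] acts_replicate br using False by (simp add: acts_add)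
    also have "\<dots> = scV (c * of_nat (Suc D choose m) * bet m f) (acts (replicate e h1) v)"
      unfolding 1 2 by (simp add: m algebra_simps flip: vs.scale_left_distrib)
    finally show ?thesis unfolding Suc.hyps(2) .
  qed
qed simp

lemma h1_word:
  "M0w (int d) w \<Longrightarrow> acts (replicate d h1) (acts w \<phi>0) = scV (c ^ length w * chi w) \<phi>0"
proof (induction w arbitrary: d)
  case Nil
  then show ?case by (simp add: M0w_def)
next
  case (Cons x w)
  obtain r f where x: "x = (r, M0, f)" using Cons.prems by (cases x) (auto simp: M0w_def)
  have w: "\<And>x. x \<in> set w \<Longrightarrow> cre x" and cx: "int (degree f) < - r" using Cons.prems by (auto simp: M0w_def x)
  define m where "m = nat (- r)"
  define e where "e = nat (wxs 1 0 w)"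
  have e: "int e = wxs 1 0 w" using cre_degs[OF w] by (simp add: e_def)
  have m: "r = - int m" "degree f < m" using cx by (auto simp: m_def)
  have d: "d = m + e" using Cons.prems e m by (simp add: M0w_def x)
  have IH: "acts (replicate e h1) (acts w \<phi>0) = scV (c ^ length w * chi w) \<phi>0"
    by (rule Cons.IH) (use Cons.prems e in \<open>auto simp: M0w_def\<close>)
  have "acts w \<phi>0 \<in> Ul 1 0 (Suc (length w)) (int e)" unfolding e by (rule word_Ul)
  from h1_creation[OF m(2) this] show ?case
    unfolding acts_Cons x m(1) d IH by (simp add: e_def algebra_simps)
qed

lemma act_M0_decomp:
  assumes "degree F = n" "F \<noteq> 0" "act (- 1 - int n, M0, F) \<phi>0 \<in> CA (int n + 1)"
  shows "Dec M0 n"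
proof -
  let ?L = "coeff (ffp n) n"
  have L: "?L \<noteq> 0" using ffp_nz[of n] degree_ffp[of n] by (metis leading_coeff_0_iff)
  define \<alpha> where "\<alpha> = coeff F n / ?L"
  have \<alpha>: "\<alpha> \<noteq> 0" using L assms(1,2) by (auto simp: \<alpha>_def)
  define g where "g = F - smult \<alpha> (ffp n)"
  have "coeff g i = 0" if "i \<ge> n" for i
    using that L assms(1) by (cases "i = n") (simp_all add: g_def \<alpha>_def coeff_eq_0 degree_ffp)
  then have "g = 0 \<or> degree g < n" by (metis leading_coeff_0_iff not_le)
  then have "act (- 1 - int n, M0, g) \<phi>0 \<in> CA (int n + 1)"
  proof
    assume "degree g < n"
    then show ?thesis by (intro CA_der) auto
  qed (simp add: act_poly_0[OF lie] CA_0)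
  moreover have "act (- 1 - int n, M0, F) \<phi>0 = scV \<alpha> (act (- 1 - int n, M0, ffp n) \<phi>0) + act (- 1 - int n, M0, g) \<phi>0"
    using act_poly[OF lie, of "- 1 - int n" M0 \<alpha> "ffp n" 1 g] by (simp add: g_def)
  ultimately have "scV \<alpha> (act (- 1 - int n, M0, ffp n) \<phi>0) \<in> CA (int n + 1)"
    using CA_diff[OF assms(3)] by (metis add_diff_cancel_right')
  from CA_scale[OF this, of "1 / \<alpha>"] \<alpha> show ?thesis by (simp add: Dec_def)
qed

text \<open>The single letters of a combination are gathered into one polynomial \<open>F\<close>;
  \<open>bet\<close> of \<open>F\<close> is the linear coefficient of the combination as a
  polynomial in the central charge.\<close>

lemma single_part:
  assumes "\<forall>(p, w)\<in>set U. M0w (int n + 1) w"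
  shows "\<exists>F. degree F \<le> n \<and> bet (Suc n) F = (\<Sum>(p, w)\<leftarrow>U. if length w = 1 then p * chi w else 0)
    \<and> act (- 1 - int n, M0, F) \<phi>0 - (\<Sum>(p, w)\<leftarrow>U. scV p (acts w \<phi>0)) \<in> CA (int n + 1)"
  using assms
proof (induction U)
  case Nil
  show ?case by (rule exI[of _ 0]) (simp add: bet_0 act_poly_0[OF lie] CA_0)
next
  case (Cons pw U)
  obtain p w where pw: "pw = (p, w)" by (cases pw) auto
  have w: "M0w (int n + 1) w" using Cons.prems by (auto simp: pw)
  obtain F where F: "degree F \<le> n" "bet (Suc n) F = (\<Sum>(p, w)\<leftarrow>U. if length w = 1 then p * chi w else 0)"
    "act (- 1 - int n, M0, F) \<phi>0 - (\<Sum>(p, w)\<leftarrow>U. scV p (acts w \<phi>0)) \<in> CA (int n + 1)"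
    using Cons.IH Cons.prems by auto
  show ?case
  proof (cases "length w = 1")
    case True
    then obtain x where "w = [x]" by (cases w) auto
    then obtain f where f: "w = [(- 1 - int n, M0, f)]" "degree f \<le> n"
      using w by (cases x) (auto simp: M0w_def)
    have nn: "nat (1 + int n) = Suc n" "nat (int n + 1) = Suc n" by simp_all
    have "chi w = bet (Suc n) f" by (simp add: f(1) nn del: bet.simps)
    moreover have "act (- 1 - int n, M0, smult 1 F + smult p f) \<phi>0 = act (- 1 - int n, M0, F) \<phi>0 + scV p (acts w \<phi>0)"
      unfolding act_poly[OF lie] by (simp add: f(1) acts_Cons)
    moreover have "degree (smult 1 F + smult p f) \<le> n"
      using F(1) f(2) degree_smult_le[of p f] by (intro degree_add_le) auto
    ultimately show ?thesis using F(2,3) True bet_lin[of "Suc n" 1 F p f]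
      by (intro exI[of _ "smult 1 F + smult p f"]) (simp add: pw algebra_simps del: bet.simps)
  next
    case False
    have "w \<noteq> []" using w by (auto simp: M0w_def)
    with False have "2 \<le> length w" by (cases w; cases "tl w") auto
    then have "acts w \<phi>0 \<in> CA (int n + 1)" by (rule CA_word) (use w in \<open>auto simp: M0w_def\<close>)
    from CA_diff[OF F(3) CA_scale[OF this, of p]] F(1,2) False show ?thesis
      by (intro exI[of _ F]) (simp add: pw algebra_simps del: bet.simps)
  qed
qed

end

text \<open>A functional of the form \<open>\<Sum> c N\<^bsup>length w\<^esup> chi w\<close> is a polynomial in the central charge; it vanishes
  at \<open>0, \<dots>, n\<close> but has degree \<open>n + 1\<close>, so its linear coefficient does not vanish.\<close>

lemma linear_coeff_nz:
  fixes p :: "complex poly"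
  assumes "degree p = Suc n" "\<And>N. N \<le> n \<Longrightarrow> poly p (of_nat N) = 0"
  shows "coeff p 1 \<noteq> 0"
proof
  assume c1: "coeff p 1 = 0"
  obtain a q where p: "p = pCons a q" by (cases p)
  have a: "a = 0" using assms(2)[of 0] by (simp add: p)
  have q0: "q \<noteq> 0" using assms(1) by (auto simp: p a)
  have dq: "degree q = n" using assms(1) q0 by (simp add: p)
  have "poly q (of_nat N) = 0" if "N \<le> n" for N
  proof (cases "N = 0")
    case True
    then show ?thesis using c1 by (simp add: p poly_0_coeff_0)
  next
    case False
    then show ?thesis using assms(2)[OF that] by (simp add: p a)
  qed
  then have "of_nat ` {..n} \<subseteq> {x. poly q x = 0}" by auto
  then have "card ((of_nat :: nat \<Rightarrow> complex) ` {..n}) \<le> card {x. poly q x = 0}"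
    by (rule card_mono[OF poly_roots_finite[OF q0]])
  moreover have "card ((of_nat :: nat \<Rightarrow> complex) ` {..n}) = Suc n"
    by (subst card_image) (auto simp: inj_on_def)
  ultimately show False using card_poly_roots_bound[OF q0] dq by simp
qed

lemma decoupling: "vacuum.Dec (vev n) M0 n"
proof -
  \<comment> \<open>The relation is evaluated at all \<open>N \<le> n\<close>, whereas the
    conclusion concerns \<open>N = n\<close>; one and the same formal combination of words serves
    them all.\<close>
  interpret V: vacuum "of_nat N" "vev N" for N by (rule vacuum_vev)
  let ?ps = "replicate (Suc n) (- 1 :: int, 0 :: int)"
  let ?y = "(- 1, M0, 1) :: xl"
  have dp: "dp ?ps = int n + 1" by (simp add: dp_def sum_list_replicate del: replicate_Suc)
  have y: "y0 (- 1, 0) = ?y"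
  proof -
    have e: "{0..<1} - {0 :: int} = {}" by auto
    show ?thesis by (simp add: lagr_def e)
  qed
  have top: "map y0 (rev ?ps) = replicate (Suc n) ?y"
    by (simp only: rev_replicate map_replicate y)
  have "vp ?ps" by (auto simp: vp_def)
  from realize[OF this] obtain u where u: "\<forall>(c, w)\<in>set u. M0w (int n + 1) w \<and> length w < Suc n"
    "\<And>N \<Phi>. Qs N \<Phi> ?ps - ow N \<Phi> (replicate (Suc n) ?y) [] = (\<Sum>(c, w)\<leftarrow>u. c * ow N \<Phi> w [])"
    unfolding Rz_def dp top length_replicate by blast
  define U where "U = (1, replicate (Suc n) ?y) # u"
  have wtop: "wxs 1 0 (replicate l ?y) = int l" for l by (induction l) auto
  have U: "\<forall>(c, w)\<in>set U. M0w (int n + 1) w"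
    using u(1) wtop[of "Suc n"] by (auto simp: U_def M0w_def simp del: replicate_Suc)
  have rel: "(\<Sum>(c, w)\<leftarrow>U. c * vev N (v @ w)) = 0" if "N \<le> n" for N v
  proof -
    have "exch (ow N Wick v)" using good_ow[OF exch_Wick rvac_Wick] by blast
    from Qs_pigeonhole[OF this, of "{}" N "[]" "Suc n"] that have "Qs N (ow N Wick v) ?ps = 0" by simp
    then show ?thesis using u(2)[of N "ow N Wick v"] by (simp add: U_def vev_def add_eq_0_iff del: replicate_Suc)
  qed
  \<comment> \<open>The result of applying \<open>h1\<close> to the relation \<open>n + 1\<close>
    times, as a polynomial in the central charge; the exponent belonging to a word is its
    length.\<close>
  define p where "p = (\<Sum>(c, w)\<leftarrow>U. monom (c * chi w) (length w))"
  have coeff_p: "coeff (\<Sum>(c, w)\<leftarrow>U. monom (c * chi w) (length w)) k = (\<Sum>(c, w)\<leftarrow>U. if length w = k then c * chi w else 0)" for k U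
    by (induction U) auto
  have z0: "(\<Sum>(c, w)\<leftarrow>V. if length w = k then c * chi w else 0) = 0" if "\<forall>(c, w)\<in>set V. length w \<noteq> k" for V k
    using that by (induction V) auto
  have poly_p: "poly (\<Sum>(c, w)\<leftarrow>U. monom (c * chi w) (length w)) x = (\<Sum>(c, w)\<leftarrow>U. c * (x ^ length w * chi w))" for x U
    by (induction U) (auto simp: poly_monom algebra_simps)
  have "chi (replicate l ?y) \<noteq> 0" for l
    by (induction l) (use wtop in \<open>auto simp flip: of_nat_Suc simp del: of_nat_Suc\<close>)
  moreover have "coeff p (Suc n) = chi (replicate (Suc n) ?y)"
  proof -
    have "(\<Sum>(c, w)\<leftarrow>u. if length w = Suc n then c * chi w else 0) = 0"
      by (rule z0) (use u(1) in auto)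
    then show ?thesis unfolding p_def coeff_p by (simp add: U_def del: replicate_Suc)
  qed
  moreover have "coeff p k = 0" if "k > Suc n" for k
    unfolding p_def coeff_p by (rule z0) (use u(1) that in \<open>auto simp: U_def\<close>)
  ultimately have dp: "degree p = Suc n"
    by (metis coeff_eq_0 degree_le le_antisym le_degree not_le)
  have "poly p (of_nat N) = 0" if "N \<le> n" for N
  proof -
    have e: "vev N (replicate (Suc n) (1, M0, 1) @ w) = of_nat N ^ length w * chi w" if "(c, w) \<in> set U" for c w
    proof -
      have "M0w (int (Suc n)) w" using U that by (auto simp: add.commute)
      from fun_cong[OF V.h1_word[OF this, of N], of "[]"] show ?thesis
        by (simp add: acts_apply fun_apply del: replicate_Suc)
    qed
    then have "(\<Sum>(c, w)\<leftarrow>U. c * (of_nat N ^ length w * chi w)) = (\<Sum>(c, w)\<leftarrow>U. c * vev N (replicate (Suc n) (1, M0, 1) @ w))"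
      by (intro arg_cong[of _ _ sum_list] map_cong) (auto simp: e simp del: replicate_Suc)
    then show ?thesis unfolding p_def poly_p rel[OF that] .
  qed
  from linear_coeff_nz[OF dp this] have p1: "(\<Sum>(c, w)\<leftarrow>U. if length w = 1 then c * chi w else 0) \<noteq> 0"
    unfolding p_def coeff_p by blast
  obtain F where F: "degree F \<le> n" "bet (Suc n) F = (\<Sum>(c, w)\<leftarrow>U. if length w = 1 then c * chi w else 0)"
    "act (- 1 - int n, M0, F) (vev n) - (\<Sum>(c, w)\<leftarrow>U. scV c (acts w (vev n))) \<in> V.CA n (int n + 1)"
    using V.single_part[OF U] by blast
  have "(\<Sum>(c, w)\<leftarrow>U. scV c (acts w (vev n))) v = (\<Sum>(c, w)\<leftarrow>U. c * vev n (v @ w))" for v U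
    by (induction U) (auto simp: fun_apply acts_apply)
  then have "(\<Sum>(c, w)\<leftarrow>U. scV c (acts w (vev n))) = 0"
    using rel[of n] by (simp add: fun_eq_iff fun_apply)
  then have "act (- 1 - int n, M0, F) (vev n) \<in> V.CA n (int n + 1)" using F(3) by simp
  moreover have nz: "bet (Suc n) F \<noteq> 0" using F(2) p1 by simp
  then have "\<not> degree F + 1 < Suc n" using bet_small by blast
  then have "degree F = n" using F(1) by simp
  moreover have "F \<noteq> 0" using nz bet_0 by blast
  ultimately show ?thesis using V.act_M0_decomp by blast
qed

section \<open>Pairing words with functionals\<close>

definition Lv :: "(sidx list \<Rightarrow> complex) \<Rightarrow> telt \<Rightarrow> complex" where
  "Lv k f = (\<Sum>w | f w \<noteq> 0. f w * k w)"

lemma Tfin_iff: "f \<in> Tfin \<longleftrightarrow> finite {w. f w \<noteq> 0}"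
  by (simp add: Tfin_def)

lemma Lv_alt: "finite W \<Longrightarrow> {w. f w \<noteq> 0} \<subseteq> W \<Longrightarrow> Lv k f = (\<Sum>w\<in>W. f w * k w)"
  unfolding Lv_def by (rule sum.mono_neutral_left) auto

lemma Tfin_wd: "wd u \<in> Tfin" by (simp add: Tfin_iff wd_def)

lemma Tfin_add: assumes "f \<in> Tfin" "g \<in> Tfin" shows "f \<oplus> g \<in> Tfin"
  unfolding Tfin_iff by (rule finite_subset[of _ "{w. f w \<noteq> 0} \<union> {w. g w \<noteq> 0}"]) (use assms in \<open>auto simp: Tfin_iff tadd_def\<close>)

lemma Tfin_sub: assumes "f \<in> Tfin" "g \<in> Tfin" shows "f \<ominus> g \<in> Tfin"
  unfolding Tfin_iff by (rule finite_subset[of _ "{w. f w \<noteq> 0} \<union> {w. g w \<noteq> 0}"]) (use assms in \<open>auto simp: Tfin_iff tsub_def\<close>)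

lemma Tfin_scl: assumes "f \<in> Tfin" shows "scl c f \<in> Tfin"
  unfolding Tfin_iff by (rule finite_subset[of _ "{w. f w \<noteq> 0}"]) (use assms in \<open>auto simp: Tfin_iff scl_def\<close>)

lemma Tfin_wcomp: assumes "f \<in> Tfin" shows "wcomp d f \<in> Tfin"
  unfolding Tfin_iff by (rule finite_subset[of _ "{w. f w \<noteq> 0}"]) (use assms in \<open>auto simp: Tfin_iff wcomp_def\<close>)

lemma conv_nz: "(f \<star> g) w \<noteq> 0 \<Longrightarrow> \<exists>u v. w = u @ v \<and> f u \<noteq> 0 \<and> g v \<noteq> 0"
proof -
  assume "(f \<star> g) w \<noteq> 0"
  then obtain i where "f (take i w) * g (drop i w) \<noteq> 0"
    unfolding conv_def by (meson sum.neutral)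
  then show ?thesis by (intro exI[of _ "take i w"] exI[of _ "drop i w"]) auto
qed

lemma Tfin_conv: assumes "f \<in> Tfin" "g \<in> Tfin" shows "f \<star> g \<in> Tfin"
proof -
  have "{w. (f \<star> g) w \<noteq> 0} \<subseteq> (\<lambda>(u, v). u @ v) ` ({w. f w \<noteq> 0} \<times> {w. g w \<noteq> 0})"
    using conv_nz[of f g] by force
  then show ?thesis using assms unfolding Tfin_iff by (elim finite_subset) auto
qed

lemma Lv_add: assumes "f \<in> Tfin" "g \<in> Tfin" shows "Lv k (f \<oplus> g) = Lv k f + Lv k g"
proof -
  let ?W = "{w. f w \<noteq> 0} \<union> {w. g w \<noteq> 0}"
  have W: "finite ?W" using assms by (simp add: Tfin_iff)
  have s: "{w. (f \<oplus> g) w \<noteq> 0} \<subseteq> ?W" by (auto simp: tadd_def)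
  show ?thesis
    using Lv_alt[OF W, of f] Lv_alt[OF W, of g] Lv_alt[OF W, of "f \<oplus> g" k, OF s]
    by (auto simp: tadd_def sum.distrib distrib_right)
qed

lemma Lv_scl: assumes "f \<in> Tfin" shows "Lv k (scl c f) = c * Lv k f"
proof -
  have W: "finite {w. f w \<noteq> 0}" using assms by (simp add: Tfin_iff)
  show ?thesis using Lv_alt[OF W, of "scl c f" k] Lv_alt[OF W, of f k]
    by (auto simp: scl_def sum_distrib_left mult.assoc)
qed

lemma Lv_sub: assumes "f \<in> Tfin" "g \<in> Tfin" shows "Lv k (f \<ominus> g) = Lv k f - Lv k g"
proof -
  have "f \<ominus> g = f \<oplus> scl (- 1) g" by (simp add: tsub_def tadd_def scl_def)
  then show ?thesis using Lv_add[OF assms(1) Tfin_scl[OF assms(2)]] Lv_scl[OF assms(2)] by simp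
qed

lemma Lv_wd: "Lv k (wd u) = k u"
  using Lv_alt[of "{u}" "wd u" k] by (auto simp: wd_def)

lemma Lv_lin: "Lv (\<lambda>w. a * k w + b * k' w) f = a * Lv k f + b * Lv k' f"
  by (simp add: Lv_def sum.distrib sum_distrib_left algebra_simps)

lemma Lv_scale: "Lv (\<lambda>w. a * k w) f = a * Lv k f"
  using Lv_lin[of a k 0 k] by simp

lemma Lv_ksum: "Lv (\<lambda>w. \<Sum>j\<in>I. k j w) f = (\<Sum>j\<in>I. Lv (k j) f)"
  unfolding Lv_def sum_distrib_left by (rule sum.swap)

lemma Lv_conv:
  assumes "f \<in> Tfin" "g \<in> Tfin"
  shows "Lv k (f \<star> g) = Lv (\<lambda>u. Lv (\<lambda>v. k (u @ v)) g) f"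
proof -
  let ?F = "{w. f w \<noteq> 0}" and ?G = "{w. g w \<noteq> 0}"
  let ?W = "(\<lambda>(u, v). u @ v) ` (?F \<times> ?G)"
  have fin: "finite ?F" "finite ?G" using assms by (simp_all add: Tfin_iff)
  have W: "finite ?W" using fin by simp
  have "{w. (f \<star> g) w \<noteq> 0} \<subseteq> ?W" using conv_nz[of f g] by force
  from Lv_alt[OF W this, of k] have "Lv k (f \<star> g) = (\<Sum>w\<in>?W. \<Sum>i\<le>length w. f (take i w) * g (drop i w) * k w)"
    by (simp add: conv_def sum_distrib_right)
  also have "\<dots> = (\<Sum>(w, i)\<in>Sigma ?W (\<lambda>w. {..length w}). f (take i w) * g (drop i w) * k w)"
    by (rule sum.Sigma) (use W in auto)
  also have "\<dots> = (\<Sum>(w, i)\<in>{(w, i). i \<le> length w \<and> take i w \<in> ?F \<and> drop i w \<in> ?G}. f (take i w) * g (drop i w) * k w)"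
  proof (rule sum.mono_neutral_right)
    show "{(w, i). i \<le> length w \<and> take i w \<in> ?F \<and> drop i w \<in> ?G} \<subseteq> Sigma ?W (\<lambda>w. {..length w})"
    proof clarsimp
      fix w i assume "f (take i w) \<noteq> 0" "g (drop i w) \<noteq> 0"
      then show "w \<in> ?W" by (intro image_eqI[of _ _ "(take i w, drop i w)"]) auto
    qed
  qed (use W in auto)
  also have "\<dots> = (\<Sum>(u, v)\<in>?F \<times> ?G. f u * g v * k (u @ v))"
    by (rule sum.reindex_bij_witness[where i = "\<lambda>(u, v). (u @ v, length u)" and j = "\<lambda>(w, i). (take i w, drop i w)"]) auto
  also have "\<dots> = (\<Sum>u\<in>?F. \<Sum>v\<in>?G. f u * g v * k (u @ v))"
    by (rule sum.cartesian_product[symmetric])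
  finally show ?thesis by (simp add: Lv_def sum_distrib_left mult.assoc)
qed

section \<open>Polynomial letters in the tensor algebra\<close>

definition pl :: "int \<Rightarrow> mtyp \<Rightarrow> complex poly \<Rightarrow> sidx \<Rightarrow> complex" where
  "pl q a p z = (case z of Mon q' b j \<Rightarrow> if q' = q \<and> b = a then coeff p j else 0 | Cen \<Rightarrow> 0)"

text \<open>Linear substitution of \<open>t^q p(D)\<close> times a matrix unit into a slot that
  expects a basis letter.\<close>

fun sl :: "(sidx list \<Rightarrow> complex) \<Rightarrow> xl \<Rightarrow> complex" where
  "sl g (q, a, p) = (\<Sum>j\<le>degree p. coeff p j * g [Mon q a j])"

lemma sl_alt: "degree p \<le> n \<Longrightarrow> sl g (q, a, p) = (\<Sum>j\<le>n. coeff p j * g [Mon q a j])"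
  unfolding sl.simps by (rule sum.mono_neutral_left) (auto simp: coeff_eq_0)

lemma sl_lin: "sl g (q, a, smult x f + smult y h) = x * sl g (q, a, f) + y * sl g (q, a, h)"
proof -
  let ?n = "max (degree f) (degree h)"
  have "degree (smult x f + smult y h) \<le> ?n"
    using degree_smult_le[of x f] degree_smult_le[of y h] by (intro degree_add_le) linarith+
  then show ?thesis
    using sl_alt[of f ?n g q a] sl_alt[of h ?n g q a] sl_alt[of "smult x f + smult y h" ?n g q a]
    by (simp add: sum.distrib sum_distrib_left algebra_simps)
qed

lemma sl_glin: "sl (\<lambda>z. a * g z + b * h z) x = a * sl g x + b * sl h x"
  by (cases x) (simp add: sum.distrib sum_distrib_left algebra_simps)

lemma sl_monom: "sl g (q, a, monom 1 j) = g [Mon q a j]"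
proof -
  have "sl g (q, a, monom 1 j) = (\<Sum>i\<le>j. if i = j then g [Mon q a j] else 0)"
    unfolding sl_alt[OF degree_monom_le] by (rule sum.cong) auto
  then show ?thesis by simp
qed

lemma letters_pl: "letters (pl q a p) \<in> Tfin" "Lv g (letters (pl q a p)) = sl g (q, a, p)"
proof -
  let ?W = "(\<lambda>j. [Mon q a j]) ` {..degree p}"
  have W: "finite ?W" by simp
  have s: "{w. letters (pl q a p) w \<noteq> 0} \<subseteq> ?W"
  proof
    fix w assume "w \<in> {w. letters (pl q a p) w \<noteq> 0}"
    then obtain j where "w = [Mon q a j]" "coeff p j \<noteq> 0"
      by (auto simp: letters_def pl_def split: list.splits sidx.splits if_splits)
    then show "w \<in> ?W" using le_degree by auto
  qed
  then show "letters (pl q a p) \<in> Tfin" unfolding Tfin_iff using W by (rule finite_subset)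
  have "Lv g (letters (pl q a p)) = (\<Sum>w\<in>?W. letters (pl q a p) w * g w)"
    by (rule Lv_alt[OF W s])
  also have "\<dots> = (\<Sum>j\<le>degree p. coeff p j * g [Mon q a j])"
    by (subst sum.reindex) (auto simp: inj_on_def letters_def pl_def)
  finally show "Lv g (letters (pl q a p)) = sl g (q, a, p)" by simp
qed

lemma Jel_pl: "Jel a k n = letters (pl n a (- ffp k))"
  by (auto simp: Jel_def pl_def fun_eq_iff letters_def split: list.splits sidx.splits)

fun ml :: "sidx \<Rightarrow> xl" where
  "ml (Mon r a k) = (r, a, monom 1 k)" | "ml Cen = (0, M0, 0)"

lemma psh_monom: "psh s (monom 1 k) = shpow s k"
proof (induction k)
  case 0
  then show ?case by (simp add: psh_def shpow_def pcompose_1)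
next
  case (Suc k)
  have "monom 1 (Suc k) = [:0, 1:] * (monom 1 k :: complex poly)"
    by (simp add: monom_Suc)
  then have "psh s (monom 1 (Suc k)) = [:of_int s, 1:] * psh s (monom 1 k)"
    by (simp add: psh_def pcompose_mult pcompose_pCons)
  then show ?case by (simp add: Suc shpow_def)
qed

lemma mmul_Some: "mmul a b = Some d \<longleftrightarrow> cl a = rw b \<and> d = mk (rw a) (cl b)"
  by (cases a; cases b; cases d) auto

lemma strprod_eq: "strprod a b = (if cl a = rw b \<and> cl b = rw a then stra (rw a) else 0)"
  by (cases a; cases b) (auto simp: strprod_def stra_def)

lemma ssign_eq: "(- 1) ^ (mpar a * mpar b) = sgn2 (oda a) (oda b)"
  by (cases a; cases b) (auto simp: sgn2_def oda_def)

lemma psi_cen: "psi r a k s b l = cen (r, a, monom 1 k) (s, b, monom 1 l)"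
  by (simp add: psi_def psi0_def trp_def strprod_eq ssign_eq poly_monom sum_distrib_left mult.assoc sum_negf)

lemma brk_eq:
  defines "x \<equiv> (\<lambda>r a k. (r, a, monom 1 k) :: xl)"
  shows "letters (brk (Mon r a k) (Mon s b l)) =
    letters (pl (r + s) (mk (rw a) (cl b)) (snd (snd (br1 (x r a k) (x s b l)))))
    \<oplus> letters (pl (r + s) (mk (rw b) (cl a)) (snd (snd (br2 (x r a k) (x s b l)))))
    \<oplus> scl (psi r a k s b l) (wd [Cen])"
proof
  fix w
  show "letters (brk (Mon r a k) (Mon s b l)) w =
    (letters (pl (r + s) (mk (rw a) (cl b)) (snd (snd (br1 (x r a k) (x s b l)))))
    \<oplus> letters (pl (r + s) (mk (rw b) (cl a)) (snd (snd (br2 (x r a k) (x s b l)))))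
    \<oplus> scl (psi r a k s b l) (wd [Cen])) w"
  proof (cases "\<exists>z. w = [z]")
    case True
    then obtain z where w: "w = [z]" by blast
    show ?thesis
    proof (cases z)
      case (Mon q d j)
      have c1: "mcoef a b d = (if cl a = rw b then if d = mk (rw a) (cl b) then 1 else 0 else 0)"
        and c2: "mcoef b a d = (if cl b = rw a then if d = mk (rw b) (cl a) then 1 else 0 else 0)"
        by (simp_all add: mcoef_def mmul_Some)
      show ?thesis
        by (simp add: w Mon letters_def tadd_def scl_def wd_def pl_def c1 c2 ssign_eq x_def psh_monom)
    next
      case Cen
      then show ?thesis by (simp add: w letters_def tadd_def scl_def wd_def pl_def)
    qed
  next
    case False
    then show ?thesis by (auto simp: letters_def tadd_def scl_def wd_def split: list.splits)
  qed
qed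

lemma Lv_brk:
  "letters (brk (Mon r a k) (Mon s b l)) \<in> Tfin"
  "Lv g (letters (brk (Mon r a k) (Mon s b l))) = sl g (br1 (ml (Mon r a k)) (ml (Mon s b l)))
     + sl g (br2 (ml (Mon r a k)) (ml (Mon s b l))) + cen (ml (Mon r a k)) (ml (Mon s b l)) * g [Cen]"
  unfolding brk_eq by (simp_all add: Tfin_add Tfin_scl Tfin_wd letters_pl Lv_add Lv_scl Lv_wd psi_cen del: sl.simps cen.simps)

lemma Lv_brk_Cen: "x = Cen \<or> y = Cen \<Longrightarrow> letters (brk x y) = (\<lambda>w. 0)"
  by (cases x; cases y) (auto simp: letters_def fun_eq_iff split: list.splits)

text \<open>The functionals on words that respect the defining relations of the vacuum module.\<close>

definition KL :: "complex \<Rightarrow> (sidx list \<Rightarrow> complex) set" where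
  "KL c = {k. (\<forall>u v x y. k (u @ x # y # v) = ssign x y * k (u @ y # x # v) + Lv (\<lambda>z. k (u @ z @ v)) (letters (brk x y)))
     \<and> (\<forall>u a m n. n + int m \<ge> 0 \<longrightarrow> Lv (\<lambda>z. k (u @ z)) (Jel a m n) = 0)
     \<and> (\<forall>u. k (u @ [Cen]) = c * k u)}"

lemma KL_br: "k \<in> KL c \<Longrightarrow> k (u @ x # y # v) = ssign x y * k (u @ y # x # v) + Lv (\<lambda>z. k (u @ z @ v)) (letters (brk x y))"
  and KL_J: "k \<in> KL c \<Longrightarrow> n + int m \<ge> 0 \<Longrightarrow> Lv (\<lambda>z. k (u @ z)) (Jel a m n) = 0"
  and KL_C: "k \<in> KL c \<Longrightarrow> k (u @ [Cen]) = c * k u"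
  unfolding KL_def by blast+

lemma Lv_const_0: "Lv k (\<lambda>w. 0) = 0" by (simp add: Lv_def)

lemma Tfin_0: "(\<lambda>w. 0) \<in> Tfin" by (simp add: Tfin_iff)

lemma letters_brk_Tfin: "letters (brk x y) \<in> Tfin"
proof (cases "x = Cen \<or> y = Cen")
  case True
  then show ?thesis by (simp add: Lv_brk_Cen Tfin_0)
next
  case False
  then show ?thesis by (cases x; cases y) (auto simp: Lv_brk(1))
qed

lemma Jel_Tfin: "Jel a k n \<in> Tfin"
  unfolding Jel_pl by (rule letters_pl)

lemma Rgen_Tfin: "f \<in> Rgen c \<Longrightarrow> f \<in> Tfin"
  unfolding Rgen_def by (auto intro!: Tfin_conv Tfin_sub Tfin_wd Tfin_scl Jel_Tfin letters_brk_Tfin)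

lemma lspan_Tfin: "f \<in> lspan S \<Longrightarrow> S \<subseteq> Tfin \<Longrightarrow> f \<in> Tfin"
  by (induction rule: lspan.induct) (auto simp: Tfin_0 Tfin_add Tfin_scl)

lemma Krel_Tfin: "f \<in> Krel c \<Longrightarrow> f \<in> Tfin"
  unfolding Krel_def using lspan_Tfin Rgen_Tfin by blast

lemma KL_iff_Rgen: "k \<in> KL c \<longleftrightarrow> (\<forall>f\<in>Rgen c. Lv k f = 0)"
proof -
  let ?b = "\<lambda>x y. wd [x, y] \<ominus> scl (ssign x y) (wd [y, x]) \<ominus> letters (brk x y)"
  have bT: "?b x y \<in> Tfin" for x y by (intro Tfin_sub Tfin_wd Tfin_scl letters_brk_Tfin)
  have "Lv k (wd u \<star> ?b x y \<star> wd v) = k (u @ x # y # v) - ssign x y * k (u @ y # x # v) - Lv (\<lambda>z. k (u @ z @ v)) (letters (brk x y))" for u v x y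
    by (simp add: Lv_conv Tfin_conv Tfin_wd bT Lv_wd Lv_sub Tfin_sub Tfin_scl letters_brk_Tfin Lv_scl)
  then have 1: "Lv k (wd u \<star> ?b x y \<star> wd v) = 0 \<longleftrightarrow> k (u @ x # y # v) = ssign x y * k (u @ y # x # v) + Lv (\<lambda>z. k (u @ z @ v)) (letters (brk x y))" for u v x y
    by (simp only: diff_diff_eq right_minus_eq)
  have 2: "Lv k (wd u \<star> Jel a m n) = Lv (\<lambda>z. k (u @ z)) (Jel a m n)" for u a m n
    by (simp add: Lv_conv Tfin_wd Jel_Tfin Lv_wd)
  have "Lv k (wd u \<star> (wd [Cen] \<ominus> scl c (wd []))) = k (u @ [Cen]) - c * k u" for u
    by (simp add: Lv_conv Tfin_wd Lv_wd Lv_sub Tfin_sub Tfin_scl Lv_scl)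
  then have 3: "Lv k (wd u \<star> (wd [Cen] \<ominus> scl c (wd []))) = 0 \<longleftrightarrow> k (u @ [Cen]) = c * k u" for u
    by auto
  show ?thesis
    unfolding KL_def Rgen_def mem_Collect_eq ball_Un 1[symmetric] 2[symmetric] 3[symmetric] by blast
qed

lemma KL_Krel:
  assumes "k \<in> KL c" "f \<in> Krel c"
  shows "Lv k f = 0"
  using assms(2) unfolding Krel_def
proof (induction rule: lspan.induct)
  case (base f)
  then show ?case using assms(1) KL_iff_Rgen by blast
next
  case (add f g)
  then have "f \<in> Tfin" "g \<in> Tfin" using lspan_Tfin Rgen_Tfin by blast+
  then show ?case using add by (simp add: Lv_add)
next
  case (scale f a)
  then have "f \<in> Tfin" using lspan_Tfin Rgen_Tfin by blast
  then show ?case using scale by (simp add: Lv_scl)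
qed (rule Lv_const_0)

lemma KL_Cen: "k \<in> KL c \<Longrightarrow> k (u @ Cen # v) = c * k (u @ v)"
proof (induction v arbitrary: u)
  case Nil
  then show ?case by (simp add: KL_C)
next
  case (Cons y v)
  have "k (u @ Cen # y # v) = k (u @ y # Cen # v)"
    using KL_br[OF Cons.prems, of u Cen y v] by (simp add: Lv_brk_Cen Lv_const_0 ssign_def)
  also have "\<dots> = c * k (u @ y # v)" using Cons.IH[OF Cons.prems, of "u @ [y]"] by simp
  finally show ?case .
qed

fun cens :: "sidx list \<Rightarrow> nat" where
  "cens [] = 0" | "cens (Cen # w) = Suc (cens w)" | "cens (Mon r a k # w) = cens w"

fun clw :: "sidx list \<Rightarrow> xl list" where
  "clw [] = []" | "clw (Cen # w) = clw w" | "clw (Mon r a k # w) = (r, a, monom 1 k) # clw w"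

lemma cens_append [simp]: "cens (u @ v) = cens u + cens v"
  by (induction u rule: cens.induct) auto

lemma clw_append [simp]: "clw (u @ v) = clw u @ clw v"
  by (induction u rule: clw.induct) auto

text \<open>Pulls a functional on polynomial letters back to basis words, with each central letter
  evaluated to \<open>c\<close>.\<close>

definition wk :: "complex \<Rightarrow> (xl list \<Rightarrow> complex) \<Rightarrow> sidx list \<Rightarrow> complex" where
  "wk c \<phi> w = c ^ cens w * \<phi> (clw w)"

lemma poly_expand:
  fixes p :: "complex poly"
  shows "p = (\<Sum>j\<le>degree p. smult (coeff p j) (monom 1 j))"
  by (simp add: smult_monom poly_as_sum_of_monoms)

lemma sl_lieF:
  assumes "\<phi> \<in> lieF c"
  shows "sl (\<lambda>z. wk c' \<phi> (u @ z @ v)) (q, a, p) = c' ^ (cens u + cens v) * \<phi> (clw u @ (q, a, p) # clw v)"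
proof -
  have "act (q, a, p) (acts (clw v) \<phi>) = (\<Sum>j\<le>degree p. scV (coeff p j) (act (q, a, monom 1 j) (acts (clw v) \<phi>)))"
    by (subst (1) poly_expand[of p], rule act_poly_sum[OF acts_lieF[OF assms]])
  from fun_cong[OF this, of "clw u"]
  have "\<phi> (clw u @ (q, a, p) # clw v) = (\<Sum>j\<le>degree p. coeff p j * \<phi> (clw u @ (q, a, monom 1 j) # clw v))"
    by (simp add: act_apply acts_apply sum_fun_apply fun_apply)
  then show ?thesis by (simp add: wk_def sum_distrib_left mult.left_commute)
qed

lemma wk_KL:
  assumes "vacuum c \<phi>"
  shows "wk c \<phi> \<in> KL c"
proof -
  interpret vacuum c \<phi> by (rule assms)
  have br: "wk c \<phi> (u @ x # y # v) = ssign x y * wk c \<phi> (u @ y # x # v) + Lv (\<lambda>z. wk c \<phi> (u @ z @ v)) (letters (brk x y))" for u v x y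
  proof (cases "x = Cen \<or> y = Cen")
    case True
    then show ?thesis
      by (cases x; cases y) (auto simp: Lv_brk_Cen Lv_const_0 ssign_def wk_def)
  next
    case False
    then obtain r a k s b l where xy: "x = Mon r a k" "y = Mon s b l" by (cases x; cases y) auto
    have s: "ssign x y = s2 (ml x) (ml y)"
      by (simp add: xy ssign_def s2_def ssign_eq)
    have sl': "sl (\<lambda>z. wk c \<phi> (u @ z @ v)) z = c ^ (cens u + cens v) * \<phi> (clw u @ z # clw v)" for z
      by (cases z) (simp only: sl_lieF[OF lie])
    show ?thesis
      unfolding s unfolding xy Lv_brk(2) sl'
      using lieF_br[OF lie, of "clw u" "ml x" "ml y" "clw v"]
      by (simp add: xy wk_def power_add algebra_simps del: br1.simps br2.simps cen.simps)
  qed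
  have J: "Lv (\<lambda>z. wk c \<phi> (u @ z)) (Jel a m n) = 0" if "n + int m \<ge> 0" for u a m n
  proof -
    have "spx (n, a, - ffp m)"
    proof -
      have "poly (ffp m) (of_int j) = 0" if "0 \<le> j" "j < - n" for j
        using poly_ffp_0[of "nat j" m] that \<open>n + int m \<ge> 0\<close> by simp
      then show ?thesis by simp
    qed
    then show ?thesis
      unfolding Jel_pl letters_pl(2) using sl_lieF[OF lie, of c u "[]" n a "- ffp m"] spx_vac by simp
  qed
  have C: "wk c \<phi> (u @ [Cen]) = c * wk c \<phi> u" for u by (simp add: wk_def)
  show ?thesis unfolding KL_def mem_Collect_eq by (intro conjI allI impI br J C)
qed

text \<open>\<open>sh x k\<close> substitutes the letter \<open>x\<close> into the first slot of \<open>k\<close>; \<open>ex k\<close> is the multilinear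
  extension of \<open>k\<close>.\<close>

definition sh :: "xl \<Rightarrow> (sidx list \<Rightarrow> complex) \<Rightarrow> sidx list \<Rightarrow> complex" where
  "sh x k v = sl (\<lambda>z. k (z @ v)) x"

definition ex :: "(sidx list \<Rightarrow> complex) \<Rightarrow> xl list \<Rightarrow> sidx list \<Rightarrow> complex" where
  "ex k w = foldl (\<lambda>k x. sh x k) k w"

lemma ex_simps [simp]: "ex k [] = k" "ex k (x # w) = ex (sh x k) w" "ex k (u @ v) = ex (ex k u) v"
  by (simp_all add: ex_def)

lemma sh_glin: "sh x (\<lambda>v. a * k v + b * k' v) = (\<lambda>v. a * sh x k v + b * sh x k' v)"
  by (simp add: sh_def sl_glin fun_eq_iff)

lemma ex_lin: "ex (\<lambda>v. a * k v + b * k' v) w = (\<lambda>v. a * ex k w v + b * ex k' w v)"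
  by (induction w arbitrary: k k') (simp_all add: sh_glin)

lemma sh_lin: "sh (r, a, smult p f + smult q g) k = (\<lambda>v. p * sh (r, a, f) k v + q * sh (r, a, g) k v)"
  by (simp only: sh_def sl_lin fun_eq_iff) simp

lemma sh_KL:
  assumes k: "k \<in> KL c"
  shows "sh x k \<in> KL c"
proof -
  obtain q a p where x: "x = (q, a, p)" by (cases x) auto
  let ?M = "\<lambda>j. Mon q a j"
  have sh: "sh x k = (\<lambda>v. \<Sum>j\<le>degree p. coeff p j * k (?M j # v))"
    by (simp add: sh_def x fun_eq_iff)
  have 1: "(\<Sum>j\<le>degree p. coeff p j * k (?M j # u @ y # z # v))
     = ssign y z * (\<Sum>j\<le>degree p. coeff p j * k (?M j # u @ z # y # v))
      + Lv (\<lambda>w. \<Sum>j\<le>degree p. coeff p j * k (?M j # u @ w @ v)) (letters (brk y z))" for u v y z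
    using KL_br[OF k, of "?M j # u" y z v for j]
    by (simp add: Lv_ksum Lv_scale sum_distrib_left sum.distrib[symmetric] algebra_simps)
  have 2: "Lv (\<lambda>z. \<Sum>j\<le>degree p. coeff p j * k (?M j # u @ z)) (Jel b m n) = 0" if "n + int m \<ge> 0" for u b m n
    using KL_J[OF k that, of "?M j # u" b for j] by (simp add: Lv_ksum Lv_scale)
  have 3: "(\<Sum>j\<le>degree p. coeff p j * k (?M j # u @ [Cen])) = c * (\<Sum>j\<le>degree p. coeff p j * k (?M j # u))" for u
    using KL_C[OF k, of "?M j # u" for j] by (simp add: sum_distrib_left mult.left_commute)
  show ?thesis unfolding KL_def sh mem_Collect_eq by (intro conjI allI impI 1 2 3)
qed

lemma ex_KL: "k \<in> KL c \<Longrightarrow> ex k w \<in> KL c"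
  by (induction w arbitrary: k) (auto intro: sh_KL)

lemma linear_zero:
  fixes F :: "complex poly \<Rightarrow> complex"
  assumes lin: "\<And>p f q g. F (smult p f + smult q g) = p * F f + q * F g" and mono: "\<And>k. F (monom 1 k) = 0"
  shows "F f = 0"
proof -
  have "F (\<Sum>j\<in>J. smult (coeff f j) (monom 1 j)) = 0" if "finite J" for J
    using that
  proof (induction J)
    case empty
    show ?case using lin[of 0 0 0 0] by simp
  next
    case (insert j J)
    then show ?case
      using lin[of "coeff f j" "monom 1 j" 1 "\<Sum>j\<in>J. smult (coeff f j) (monom 1 j)"] by (simp add: mono)
  qed
  then show ?thesis using poly_expand[of f] by (metis finite_atMost)
qed

lemma br_lin:
  "br1 (r, a, smult p f + smult q f') (s, b, g) = (r + s, mk (rw a) (cl b),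
     smult p (snd (snd (br1 (r, a, f) (s, b, g)))) + smult q (snd (snd (br1 (r, a, f') (s, b, g)))))"
  "br2 (r, a, smult p f + smult q f') (s, b, g) = (r + s, mk (rw b) (cl a),
     smult p (snd (snd (br2 (r, a, f) (s, b, g)))) + smult q (snd (snd (br2 (r, a, f') (s, b, g)))))"
  "br1 (r, a, f) (s, b, smult p g + smult q g') = (r + s, mk (rw a) (cl b),
     smult p (snd (snd (br1 (r, a, f) (s, b, g)))) + smult q (snd (snd (br1 (r, a, f) (s, b, g')))))"
  "br2 (r, a, f) (s, b, smult p g + smult q g') = (r + s, mk (rw b) (cl a),
     smult p (snd (snd (br2 (r, a, f) (s, b, g)))) + smult q (snd (snd (br2 (r, a, f) (s, b, g')))))"
  by (simp_all add: psh_add psh_smult distrib_left distrib_right smult_add_right mult.commute)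

lemma trp_lin:
  "trp r a (smult p f + smult q f') s b g = p * trp r a f s b g + q * trp r a f' s b g"
  "trp r a f s b (smult p g + smult q g') = p * trp r a f s b g + q * trp r a f s b g'"
  by (simp_all add: trp_def sum.distrib sum_distrib_left algebra_simps)

lemma cen_lin:
  "cen (r, a, smult p f + smult q f') y = p * cen (r, a, f) y + q * cen (r, a, f') y"
  "cen x (s, b, smult p g + smult q g') = p * cen x (s, b, g) + q * cen x (s, b, g')"
  by (cases y; simp add: trp_lin algebra_simps) (cases x; simp add: trp_lin algebra_simps)

text \<open>For monomials this is the defining relation of \<open>KL\<close>; both sides are
  bilinear in the two polynomials.\<close>

lemma sh_bracket:
  assumes k: "k \<in> KL c"
  shows "sh y (sh x k) v = s2 x y * sh x (sh y k) v + sh (br1 x y) k v + sh (br2 x y) k v + c * cen x y * k v"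
proof -
  obtain r a f where x: "x = (r, a, f)" by (cases x) auto
  obtain s b g where y: "y = (s, b, g)" by (cases y) auto
  define F where "F f g = sh (s, b, g) (sh (r, a, f) k) v - (s2 (r, a, f) (s, b, g) * sh (r, a, f) (sh (s, b, g) k) v
     + sh (br1 (r, a, f) (s, b, g)) k v + sh (br2 (r, a, f) (s, b, g)) k v + c * cen (r, a, f) (s, b, g) * k v)" for f g
  have b: "br1 (r, a, f) (s, b, g) = (r + s, mk (rw a) (cl b), snd (snd (br1 (r, a, f) (s, b, g))))"
     "br2 (r, a, f) (s, b, g) = (r + s, mk (rw b) (cl a), snd (snd (br2 (r, a, f) (s, b, g))))" for f g
    by simp_all
  have s2: "s2 (r, a, f) (s, b, g) = s2 (r, a, 0) (s, b, 0)" for f g by (simp add: s2_def)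
  have l1: "F (smult p f + smult q f') g = p * F f g + q * F f' g" for p f q f' g
    unfolding F_def s2[of "smult p f + smult q f'"] s2[of f] s2[of f'] br_lin(1,2) sh_lin sh_glin cen_lin
      b(1)[of f g, symmetric] b(2)[of f g, symmetric] b(1)[of f' g, symmetric] b(2)[of f' g, symmetric]
    by (simp only: algebra_simps)
  have l2: "F f (smult p g + smult q g') = p * F f g + q * F f g'" for p f q g g'
    unfolding F_def s2[of f "smult p g + smult q g'"] s2[of f g] s2[of f g'] br_lin(3,4) sh_lin sh_glin cen_lin
    by (simp only: b[symmetric]) (simp only: algebra_simps)
  have m: "F (monom 1 i) (monom 1 j) = 0" for i j
  proof -
    have "ssign (Mon r a i) (Mon s b j) = s2 (r, a, monom 1 i) (s, b, monom 1 j)"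
      by (simp add: ssign_def s2_def ssign_eq)
    moreover have "k (Mon r a i # Mon s b j # v) = ssign (Mon r a i) (Mon s b j) * k (Mon s b j # Mon r a i # v)
       + (sl (\<lambda>z. k (z @ v)) (br1 (r, a, monom 1 i) (s, b, monom 1 j)) + sl (\<lambda>z. k (z @ v)) (br2 (r, a, monom 1 i) (s, b, monom 1 j))
       + cen (r, a, monom 1 i) (s, b, monom 1 j) * (c * k v))"
      using KL_br[OF k, of "[]" "Mon r a i" "Mon s b j" v] KL_Cen[OF k, of "[]" v] unfolding Lv_brk(2)
      by (simp del: br1.simps br2.simps cen.simps)
    ultimately show ?thesis
      unfolding F_def sh_def sl_monom by (simp del: br1.simps br2.simps cen.simps sl.simps)
  qed
  have "F f g = 0"
  proof (rule linear_zero[of "\<lambda>f. F f g"])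
    show "F (monom 1 i) g = 0" for i by (rule linear_zero[of "F (monom 1 i)"]) (rule l2 m)+
  qed (rule l1)
  then show ?thesis by (simp add: F_def x y del: br1.simps br2.simps cen.simps)
qed

text \<open>Evaluation at \<open>0, 1, 2, ...\<close> is triangular in the basis of falling
  factorials, so the coefficients vanish one after the other.\<close>

lemma ffp_coeffs_0:
  assumes "\<And>j. j < R \<Longrightarrow> poly (\<Sum>m<M. smult (e m) (ffp m)) (of_nat j) = 0" "m < M" "m < R"
  shows "e m = 0"
  using assms(2,3)
proof (induction m rule: less_induct)
  case (less m)
  have "poly (\<Sum>m<M. smult (e m) (ffp m)) (of_nat m) = (\<Sum>l<M. if l = m then e m * poly (ffp m) (of_nat m) else 0)"
    unfolding poly_sum
  proof (rule sum.cong[OF refl])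
    fix l assume l: "l \<in> {..<M}"
    show "poly (smult (e l) (ffp l)) (of_nat m) = (if l = m then e m * poly (ffp m) (of_nat m) else 0)"
    proof (cases l m rule: linorder_cases)
      case less
      then show ?thesis using less.IH l \<open>m < R\<close> by simp
    next
      case greater
      then show ?thesis by (simp add: poly_ffp_0)
    qed simp
  qed
  then have "e m * poly (ffp m) (of_nat m) = 0" using assms(1)[OF less.prems(2)] less.prems(1) by simp
  moreover have "poly (ffp m) (of_nat m) \<noteq> 0" by (auto simp: ffp_def poly_prod)
  ultimately show ?case by simp
qed

text \<open>Vanishing at \<open>0, ..., - r - 1\<close> leaves only falling factorials
  \<open>ffp m\<close> with \<open>r + m \<ge> 0\<close>, and these belong to the modes that span
  \<open>SP\<close>.\<close>

lemma sl_spx: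
  assumes k: "k \<in> KL c" and "spx x"
  shows "sl k x = 0"
proof -
  obtain r a f where x: "x = (r, a, f)" by (cases x) auto
  obtain e where e: "f = (\<Sum>m<Suc (degree f). smult (e m) (ffp m))" using ffp_expansion[of f "Suc (degree f)"] by auto
  have J: "sl k (r, a, ffp m) = 0" if "r + int m \<ge> 0" for m
  proof -
    have "sl k (r, a, - ffp m) = 0"
      using KL_J[OF k that, of "[]" a] unfolding Jel_pl letters_pl(2) by simp
    then show ?thesis using sl_lin[of k r a "- 1" "- ffp m" 0 0] by simp
  qed
  have z: "e m * sl k (r, a, ffp m) = 0" if "m < Suc (degree f)" for m
  proof (cases "r + int m \<ge> 0")
    case False
    have "e m = 0"
    proof (rule ffp_coeffs_0[of "nat (- r)"])
      fix j assume "j < nat (- r)"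
      then show "poly (\<Sum>m<Suc (degree f). smult (e m) (ffp m)) (of_nat j) = 0"
        unfolding e[symmetric] using assms(2) by (auto simp: x dest: spec[of _ "int j"])
    qed (use that False in auto)
    then show ?thesis by simp
  qed (simp add: J del: sl.simps)
  have "sl k (r, a, \<Sum>m\<in>I. smult (e m) (ffp m)) = (\<Sum>m\<in>I. e m * sl k (r, a, ffp m))" if "finite I" for I
    using that
  proof (induction I)
    case (insert i I)
    then show ?case using sl_lin[of k r a "e i" "ffp i" 1 "\<Sum>m\<in>I. smult (e m) (ffp m)"] by (simp del: sl.simps)
  qed simp
  from this[of "{..<Suc (degree f)}"] have "sl k (r, a, f) = (\<Sum>m<Suc (degree f). e m * sl k (r, a, ffp m))"
    unfolding e[symmetric] by simp
  then show ?thesis using z by (simp add: x del: sl.simps sum.lessThan_Suc)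
qed

lemma vacuum_ex:
  assumes k: "k \<in> KL c"
  shows "vacuum c (\<lambda>w. ex k w [])"
proof
  show "(\<lambda>w. ex k w []) \<in> lieF c"
  proof (rule lieF_I)
    show "ex k (u @ (r, a, smult p f + smult q g) # v) [] = p * ex k (u @ (r, a, f) # v) [] + q * ex k (u @ (r, a, g) # v) []"
      for u v r a p f q g
      by (simp add: sh_lin ex_lin)
    show "ex k (u @ x # y # v) [] = s2 x y * ex k (u @ y # x # v) [] + ex k (u @ br1 x y # v) []
       + ex k (u @ br2 x y # v) [] + c * cen x y * ex k (u @ v) []" for u v x y
    proof -
      let ?k = "ex k u"
      have "sh y (sh x ?k) = (\<lambda>w. s2 x y * sh x (sh y ?k) w + 1 *
          ((\<lambda>w. 1 * sh (br1 x y) ?k w + 1 * (\<lambda>w. 1 * sh (br2 x y) ?k w + c * cen x y * ?k w) w) w))"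
        using sh_bracket[OF ex_KL[OF k], where x = x and y = y] by (simp add: fun_eq_iff)
      then have "ex (sh y (sh x ?k)) v = (\<lambda>w. s2 x y * ex (sh x (sh y ?k)) v w + 1 *
          ((\<lambda>w. 1 * ex (sh (br1 x y) ?k) v w + 1 * (\<lambda>w. 1 * ex (sh (br2 x y) ?k) v w + c * cen x y * ex ?k v w) w) w))"
        by (simp only: ex_lin)
      then show ?thesis by simp
    qed
  qed
  show "ex k (u @ [x]) [] = 0" if "spx x" for u x
    using sl_spx[OF ex_KL[OF k] that, of u] by (simp add: sh_def)
qed

text \<open>Every functional on the vacuum module comes from one on polynomial letters, so the
  results of the locale \<open>vacuum\<close> apply to all of them.\<close>

lemma wk_ex: "k \<in> KL c \<Longrightarrow> k u = wk c (\<lambda>w. ex k w []) u"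
proof (induction u arbitrary: k rule: clw.induct)
  case 1
  then show ?case by (simp add: wk_def)
next
  case (2 w)
  then show ?case using KL_Cen[OF 2(2), of "[]" w] by (simp add: wk_def)
next
  case (3 r a j w)
  have "k (Mon r a j # w) = sh (r, a, monom 1 j) k w"
    unfolding sh_def sl_monom by simp
  also have "\<dots> = wk c (\<lambda>w. ex (sh (r, a, monom 1 j) k) w []) w"
    by (rule 3(1)[OF sh_KL[OF 3(2)]])
  finally show ?case by (simp add: wk_def)
qed

section \<open>The simple quotient\<close>

text \<open>The linear map that sends a word to its vector, with central letters evaluated to
  \<open>c\<close>; for \<open>\<phi> = vev n\<close> it is the projection to the simple
  quotient.\<close>

definition th :: "complex \<Rightarrow> (xl list \<Rightarrow> complex) \<Rightarrow> telt \<Rightarrow> xl list \<Rightarrow> complex" where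
  "th c \<phi> f u = Lv (wk c (\<lambda>v. \<phi> (u @ v))) f"

lemma th_add: "f \<in> Tfin \<Longrightarrow> g \<in> Tfin \<Longrightarrow> th c \<phi> (f \<oplus> g) = th c \<phi> f + th c \<phi> g"
  and th_sub: "f \<in> Tfin \<Longrightarrow> g \<in> Tfin \<Longrightarrow> th c \<phi> (f \<ominus> g) = th c \<phi> f - th c \<phi> g"
  and th_scl: "f \<in> Tfin \<Longrightarrow> th c \<phi> (scl a f) = scV a (th c \<phi> f)"
  by (simp_all add: th_def fun_eq_iff fun_apply Lv_add Lv_sub Lv_scl)

lemma th_0: "th c \<phi> (\<lambda>w. 0) = 0"
  by (simp add: th_def fun_eq_iff fun_apply Lv_const_0)

lemma th_wd: "th c \<phi> (wd w) = scV (c ^ cens w) (acts (clw w) \<phi>)"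
  by (simp add: th_def fun_eq_iff fun_apply Lv_wd wk_def acts_apply)

lemma th_alt: "th c \<phi> f = (\<Sum>w | f w \<noteq> 0. scV (f w * c ^ cens w) (acts (clw w) \<phi>))"
  by (simp add: th_def Lv_def wk_def fun_eq_iff fun_apply sum_fun_apply acts_apply mult.assoc)

lemma th_wd_conv: "f \<in> Tfin \<Longrightarrow> th c \<phi> (wd u \<star> f) v = c ^ cens u * th c \<phi> f (v @ clw u)"
  by (simp add: th_def Lv_conv Tfin_wd Lv_wd wk_def[abs_def] power_add mult.assoc Lv_scale)

lemma vacuum_prefix:
  assumes "vacuum c \<phi>"
  shows "vacuum c (\<lambda>v. \<phi> (u @ v))"
proof -
  interpret vacuum c \<phi> by (rule assms)
  show ?thesis
  proof
    show "(\<lambda>v. \<phi> (u @ v)) \<in> lieF c"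
    proof (rule lieF_I)
      show "\<phi> (u @ u' @ (r, a, smult p f + smult q g) # v) = p * \<phi> (u @ u' @ (r, a, f) # v) + q * \<phi> (u @ u' @ (r, a, g) # v)"
        for u' v r a p f q g
        using lieF_lin[OF lie, of "u @ u'" r a p f q g v] by simp
      show "\<phi> (u @ u' @ x # y # v) = s2 x y * \<phi> (u @ u' @ y # x # v) + \<phi> (u @ u' @ br1 x y # v)
         + \<phi> (u @ u' @ br2 x y # v) + c * cen x y * \<phi> (u @ u' @ v)" for u' v x y
        using lieF_br[OF lie, of "u @ u'" x y v] by simp
    qed
    show "\<phi> (u @ u' @ [x]) = 0" if "spx x" for u' x
      using spx_vac[OF that, of "u @ u'"] by simp
  qed
qed

lemma th_Krel: "vacuum c \<phi> \<Longrightarrow> f \<in> Krel c \<Longrightarrow> th c \<phi> f = 0"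
  using KL_Krel[OF wk_KL[OF vacuum_prefix]] by (simp add: th_def fun_eq_iff fun_apply)

lemma wwt_wxs: "wwt w = wxs 2 (- 1) (clw w)"
proof (induction w rule: clw.induct)
  case (3 r a k w)
  then show ?case by (cases a) (auto simp: wwt_def chg_def)
qed (auto simp: wwt_def)

lemma Lv_wcomp:
  assumes "f \<in> Tfin"
  shows "Lv k (wcomp d f) = Lv (\<lambda>w. if wwt w = d then k w else 0) f"
proof -
  have "Lv k (wcomp d f) = (\<Sum>w | f w \<noteq> 0. wcomp d f w * k w)"
    by (rule Lv_alt) (use assms in \<open>auto simp: wcomp_def Tfin_iff\<close>)
  also have "\<dots> = Lv (\<lambda>w. if wwt w = d then k w else 0) f"
    unfolding Lv_def by (rule sum.cong) (auto simp: wcomp_def)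
  finally show ?thesis .
qed

lemma th_wcomp:
  assumes "f \<in> Tfin"
  shows "th c (vev n) (wcomp d f) u = (if wxs 2 (- 1) u + d = 0 then th c (vev n) f u else 0)"
proof -
  have "(if wwt w = d then wk c (\<lambda>v. vev n (u @ v)) w else 0) = (if wxs 2 (- 1) u + d = 0 then wk c (\<lambda>v. vev n (u @ v)) w else 0)" for w
    using vev_graded[of n "u @ clw w" 2 "- 1"] by (auto simp: wk_def wwt_wxs)
  then have "th c (vev n) (wcomp d f) u = Lv (\<lambda>w. if wxs 2 (- 1) u + d = 0 then wk c (\<lambda>v. vev n (u @ v)) w else 0) f"
    unfolding th_def Lv_wcomp[OF assms] by simp
  then show ?thesis by (simp add: th_def Lv_def)
qed

text \<open>The kernel of \<open>th\<close> is itself a graded submodule that omits the vacuum,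
  hence a member of the union that defines \<open>SI\<close>.\<close>

lemma th_null_in_SI:
  assumes "f \<in> Tfin" "th (of_nat n) (vev n) f = 0"
  shows "f \<in> SI (of_nat n)"
proof -
  let ?c = "of_nat n :: complex"
  define N where "N = {f \<in> Tfin. th ?c (vev n) f = 0}"
  have "graded_submod ?c N"
    unfolding graded_submod_def
  proof (intro conjI ballI allI)
    show "Krel ?c \<subseteq> N" using th_Krel[OF vacuum_vev] Krel_Tfin by (auto simp: N_def)
    show "f \<oplus> g \<in> N" if "f \<in> N" "g \<in> N" for f g using that by (simp add: N_def Tfin_add th_add)
    show "scl a f \<in> N" if "f \<in> N" for f a using that by (simp add: N_def Tfin_scl th_scl)
    show "wd [x] \<star> f \<in> N" if "f \<in> N" for f x
      using that th_wd_conv[of f ?c "vev n" "[x]"] by (simp add: N_def Tfin_conv Tfin_wd fun_eq_iff fun_apply)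
    show "wcomp d f \<in> N" if "f \<in> N" for f d
      using that th_wcomp[of f ?c n d] by (simp add: N_def Tfin_wcomp fun_eq_iff fun_apply)
  qed (auto simp: N_def)
  moreover have "wd [] \<notin> N"
  proof
    assume "wd [] \<in> N"
    then have "th ?c (vev n) (wd []) [] = 0" by (simp add: N_def fun_apply)
    then show False by (simp add: th_wd fun_apply)
  qed
  moreover have "f \<in> N" using assms by (simp add: N_def)
  ultimately show ?thesis unfolding SI_def by blast
qed

lemma conv_wd: "(wd u \<star> f) w = (if take (length u) w = u then f (drop (length u) w) else 0)"
proof -
  have t: "i \<le> length w \<Longrightarrow> take i w = u \<Longrightarrow> i = length u" for i by auto
  have "(wd u \<star> f) w = (\<Sum>i\<le>length w. if i = length u then (if take (length u) w = u then f (drop (length u) w) else 0) else 0)"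
    unfolding conv_def
  proof (rule sum.cong[OF refl])
    fix i assume i: "i \<in> {..length w}"
    show "wd u (take i w) * f (drop i w) = (if i = length u then (if take (length u) w = u then f (drop (length u) w) else 0) else 0)"
    proof (cases "i = length u")
      case False
      then have "take i w \<noteq> u" using t[of i] i by blast
      then show ?thesis using False by (simp add: wd_def)
    qed (simp add: wd_def)
  qed
  also have "\<dots> = (if length u \<le> length w then (if take (length u) w = u then f (drop (length u) w) else 0) else 0)"
    by simp
  finally show ?thesis by auto
qed

lemma wd_Cons_conv: "wd [x] \<star> (wd u \<star> f) = wd (x # u) \<star> f"
proof
  fix w
  show "(wd [x] \<star> (wd u \<star> f)) w = (wd (x # u) \<star> f) w"
    by (cases w) (auto simp: conv_wd)
qed

lemma submod_wd: "graded_submod c N \<Longrightarrow> f \<in> N \<Longrightarrow> wd u \<star> f \<in> N"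
proof (induction u)
  case Nil
  have "wd [] \<star> f = f" by (simp add: conv_wd fun_eq_iff)
  then show ?case using Nil by simp
next
  case (Cons x u)
  then have "wd [x] \<star> (wd u \<star> f) \<in> N" by (simp add: graded_submod_def)
  then show ?case by (simp add: wd_Cons_conv)
qed

lemma zero_on_monomials:
  assumes "\<phi> \<in> lieF c" "\<And>u. cens u = 0 \<Longrightarrow> \<phi> (clw u) = 0"
  shows "\<phi> = 0"
proof -
  have "\<phi> (clw u @ v) = 0" if "cens u = 0" for u v
    using that
  proof (induction v arbitrary: u)
    case (Cons x v)
    obtain r a p where x: "x = (r, a, p)" by (cases x) auto
    have "act x (acts v \<phi>) = (\<Sum>j\<le>degree p. scV (coeff p j) (act (r, a, monom 1 j) (acts v \<phi>)))"
      unfolding x by (subst (1) poly_expand[of p], rule act_poly_sum[OF acts_lieF[OF assms(1)]])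
    from fun_cong[OF this, of "clw u"]
    have "\<phi> (clw u @ x # v) = (\<Sum>j\<le>degree p. coeff p j * \<phi> (clw (u @ [Mon r a j]) @ v))"
      by (simp add: act_apply acts_apply sum_fun_apply fun_apply)
    also have "\<dots> = 0" using Cons.IH[of "u @ [Mon r a j]" for j] Cons.prems by simp
    finally show ?case .
  qed (simp add: assms(2))
  from this[of "[]"] show ?thesis by (simp add: fun_eq_iff fun_apply)
qed

lemma separating_functional:
  assumes N: "vs.subspace N" and v: "v \<notin> N"
  shows "\<exists>\<kappa>. \<kappa> v = (1 :: complex) \<and> (\<forall>f\<in>N. \<kappa> f = 0) \<and> (\<forall>a f g. \<kappa> (scV a f + g) = a * \<kappa> f + \<kappa> g)"
proof -
  obtain B where B: "B \<subseteq> N" "vs.independent B" "N \<subseteq> vs.span B"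
    using vs.maximal_independent_subset by blast
  have sp: "vs.span B = N" using B(1,3) vs.span_minimal[OF B(1) N] by blast
  define E where "E = vs.extend_basis (insert v B)"
  have iB: "vs.independent (insert v B)" using B(2) v sp by (intro vs.independent_insertI) auto
  have E: "vs.independent E" "vs.span E = UNIV" "insert v B \<subseteq> E"
    unfolding E_def using vs.independent_extend_basis[OF iB] vs.span_extend_basis[OF iB] vs.extend_basis_superset[OF iB] by auto
  define \<kappa> where "\<kappa> f = vs.representation E f v" for f
  have lin: "\<kappa> (scV a f + g) = a * \<kappa> f + \<kappa> g" for a f g
    unfolding \<kappa>_def using E by (simp add: vs.representation_add vs.representation_scale)
  have b: "\<kappa> x = (if v = x then 1 else 0)" if "x \<in> insert v B" for x
    unfolding \<kappa>_def using vs.representation_basis[OF E(1)] E(3) that by auto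
  have "\<kappa> f = 0" if "f \<in> vs.span B" for f
    using that
  proof (induction rule: vs.span_induct_alt)
    case base
    show ?case using lin[of 0 0 0] lin[of 1 0 0] by simp
  next
    case (step c x y)
    have "x \<noteq> v" using step(1) B(1) v by blast
    then show ?case using step b[of x] by (simp add: lin)
  qed
  then show ?thesis using b[of v] lin sp by (intro exI[of _ \<kappa>]) auto
qed

text \<open>A functional that vanishes on the submodule and is \<open>1\<close> on the vacuum must
  agree with \<open>vev n\<close> in weight zero. If \<open>f\<close> had a nonzero image, the
  weight-zero part of some \<open>wd u \<star> f\<close> would lie in the submodule and still have a
  nonzero expectation value.\<close>

lemma SI_in_th_null:
  assumes "f \<in> SI (of_nat n)"
  shows "th (of_nat n) (vev n) f = 0"
proof (rule ccontr)
  let ?c = "of_nat n :: complex"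
  assume nz: "th ?c (vev n) f \<noteq> 0"
  obtain N where N: "graded_submod ?c N" "wd [] \<notin> N" "f \<in> N" using assms unfolding SI_def by blast
  have NT: "N \<subseteq> Tfin" and NK: "Krel ?c \<subseteq> N" and Nw: "\<And>f d. f \<in> N \<Longrightarrow> wcomp d f \<in> N"
    using N(1) by (auto simp: graded_submod_def)
  have sub: "vs.subspace N"
  proof (rule vs.subspaceI)
    have "(\<lambda>w. 0) \<in> N" using NK by (auto simp: Krel_def intro: lspan.zero)
    moreover have "(\<lambda>w. 0) = (0 :: telt)" by (simp add: fun_eq_iff fun_apply)
    ultimately show "0 \<in> N" by simp
    show "g + h \<in> N" if "g \<in> N" "h \<in> N" for g h
    proof -
      have "g \<oplus> h = g + h" by (simp add: tadd_def fun_eq_iff fun_apply)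
      then show ?thesis using N(1) that by (metis graded_submod_def)
    qed
    show "scV a g \<in> N" if "g \<in> N" for a g
    proof -
      have "scl a g = scV a g" by (simp add: scl_def fun_eq_iff fun_apply)
      then show ?thesis using N(1) that by (metis graded_submod_def)
    qed
  qed
  obtain \<kappa> where \<kappa>: "\<kappa> (wd []) = (1 :: complex)" "\<And>f. f \<in> N \<Longrightarrow> \<kappa> f = 0" "\<And>a f g. \<kappa> (scV a f + g) = a * \<kappa> f + \<kappa> g"
    using separating_functional[OF sub N(2)] by blast
  define k where "k u = \<kappa> (wd u)" for u
  have \<kappa>L: "\<kappa> g = Lv k g" if "g \<in> Tfin" for g
  proof -
    have "\<kappa> (\<Sum>w\<in>W. scV (g w) (wd w)) = (\<Sum>w\<in>W. g w * k w)" if "finite W" for W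
      using that
    proof (induction W)
      case empty
      show ?case using \<kappa>(3)[of 0 0 0] \<kappa>(3)[of 1 0 0] by simp
    next
      case (insert w W)
      then show ?case by (simp add: \<kappa>(3) k_def)
    qed
    moreover have "g = (\<Sum>w | g w \<noteq> 0. scV (g w) (wd w))"
    proof
      fix w
      have "(\<Sum>w' | g w' \<noteq> 0. g w' * (if w = w' then 1 else 0)) = (\<Sum>w' | g w' \<noteq> 0. if w' = w then g w else 0)"
        by (rule sum.cong) auto
      also have "\<dots> = g w" using that by (auto simp: Tfin_iff sum.delta)
      finally show "g w = (\<Sum>w | g w \<noteq> 0. scV (g w) (wd w)) w"
        by (simp add: sum_fun_apply fun_apply wd_def)
    qed
    ultimately show ?thesis using that unfolding Lv_def Tfin_iff by metis
  qed
  have k: "k \<in> KL ?c"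
    unfolding KL_iff_Rgen
  proof
    fix g assume g: "g \<in> Rgen ?c"
    then have "g \<in> N" using NK by (auto simp: Krel_def intro: lspan.base)
    then show "Lv k g = 0" using \<kappa>(2) \<kappa>L[OF Rgen_Tfin[OF g]] by simp
  qed
  \<comment> \<open>The conditions on a vacuum functional are linear, so the difference is one
    again; it vanishes on the empty word.\<close>
  define \<psi> where "\<psi> = (\<lambda>w. ex k w []) - vev n"
  interpret K: vacuum ?c "\<lambda>w. ex k w []" by (rule vacuum_ex[OF k])
  interpret V: vacuum ?c "vev n" by (rule vacuum_vev)
  interpret P: vacuum ?c \<psi>
  proof
    show "\<psi> \<in> lieF ?c" unfolding \<psi>_def by (rule vs.subspace_diff[OF subspace_lieF K.lie V.lie])
    show "\<psi> (u @ [x]) = 0" if "spx x" for u x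
      using K.spx_vac[OF that] V.spx_vac[OF that] by (simp add: \<psi>_def fun_apply del: ex_simps(3))
  qed
  have \<psi>0: "\<psi> [] = 0" by (simp add: \<psi>_def fun_apply k_def \<kappa>(1))
  have \<psi>w: "\<psi> w = 0" if "wxs 2 (- 1) w = 0" for w
  proof -
    have pos: "wx 2 (- 1) x > 0" if "cre x" for x
      using that by (cases x) (auto simp: chg_def)
    \<comment> \<open>In weight zero the word acts by a scalar, so its value is that scalar times
      \<open>\<psi> []\<close>, which is zero.\<close>
    have "acts w \<psi> \<in> vs.span {\<psi>}"
      using P.word_Ul[of w 2 "- 1"] P.Ul_neg[of 2 "- 1", OF pos] that by auto
    then obtain a where "acts w \<psi> = scV a \<psi>" by (auto simp: vs.span_singleton)
    from fun_cong[OF this, of "[]"] show ?thesis by (simp add: acts_apply fun_apply \<psi>0)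
  qed
  have kv: "k w = wk ?c (vev n) w" if "wwt w = 0" for w
  proof -
    have "ex k (clw w) [] = vev n (clw w)"
      using \<psi>w[of "clw w"] that by (simp add: wwt_wxs \<psi>_def fun_apply)
    then show ?thesis unfolding wk_ex[OF k, of w] by (simp add: wk_def)
  qed
  have fT: "f \<in> Tfin" using N(3) NT by blast
  have "th ?c (vev n) f \<in> lieF ?c"
    unfolding th_alt by (intro vs.subspace_sum[OF subspace_lieF] vs.subspace_scale[OF subspace_lieF] V.lie_acts)
  from zero_on_monomials[OF this] nz obtain u where u: "cens u = 0" "th ?c (vev n) f (clw u) \<noteq> 0" by blast
  define h where "h = wcomp 0 (wd u \<star> f)"
  have gT: "wd u \<star> f \<in> Tfin" by (rule Tfin_conv[OF Tfin_wd fT])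
  have hN: "h \<in> N" unfolding h_def by (rule Nw[OF submod_wd[OF N(1,3)]])
  have hT: "h \<in> Tfin" using hN NT by blast
  have "Lv k h = Lv (wk ?c (vev n)) h"
    unfolding Lv_def by (rule sum.cong) (auto simp: h_def wcomp_def kv split: if_splits)
  then have "Lv (wk ?c (vev n)) h = 0" using \<kappa>L[OF hT] \<kappa>(2)[OF hN] by simp
  then have "th ?c (vev n) h [] = 0" by (simp add: th_def)
  then have "th ?c (vev n) (wd u \<star> f) [] = 0" by (simp add: h_def th_wcomp[OF gT])
  then show False using u by (simp add: th_wd_conv[OF fT])
qed

lemma SI_iff: "f \<in> Tfin \<Longrightarrow> f \<in> SI (of_nat n) \<longleftrightarrow> th (of_nat n) (vev n) f = 0"
  using SI_in_th_null th_null_in_SI by blast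

section \<open>Strong generation and minimality\<close>

lemma th_Jel:
  assumes "vacuum c \<phi>" "g \<in> Tfin"
  shows "th c \<phi> (scl b (Jel a k n) \<star> g) = scV (- b) (act (n, a, ffp k) (th c \<phi> g))"
proof
  fix u
  interpret vacuum c \<phi> by (rule assms)
  have 1: "Lv (\<lambda>v. wk c (\<lambda>v. \<phi> (u @ v)) (z @ v)) g = (\<Sum>w | g w \<noteq> 0. g w * wk c (\<lambda>v. \<phi> (u @ v)) (z @ w))" for z
    by (simp add: Lv_def)
  have 2: "sl (\<lambda>z. wk c (\<lambda>v. \<phi> (u @ v)) (z @ w)) (n, a, p) = c ^ cens w * \<phi> (u @ (n, a, p) # clw w)" for w p
    using sl_lieF[OF vacuum.lie[OF vacuum_prefix[OF assms(1)]], of c u "[]" w n a p] by simp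
  have "sl (\<lambda>z. \<Sum>w | g w \<noteq> 0. g w * wk c (\<lambda>v. \<phi> (u @ v)) (z @ w)) (n, a, p)
      = (\<Sum>w | g w \<noteq> 0. g w * sl (\<lambda>z. wk c (\<lambda>v. \<phi> (u @ v)) (z @ w)) (n, a, p))" for p
    unfolding sl.simps sum_distrib_left by (subst sum.swap) (simp add: mult.left_commute)
  note e = this
  have 3: "Lv (\<lambda>z. Lv (\<lambda>v. wk c (\<lambda>v. \<phi> (u @ v)) (z @ v)) g) (Jel a k n) = (\<Sum>w | g w \<noteq> 0. g w * (c ^ cens w * \<phi> (u @ (n, a, - ffp k) # clw w)))"
    unfolding Jel_pl letters_pl(2) 1 e 2 ..
  have 4: "\<phi> (u @ (n, a, - ffp k) # w) = - \<phi> (u @ (n, a, ffp k) # w)" for w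
    using lieF_lin[OF lie, of u n a "- 1" "ffp k" 0 0 w] by simp
  have "th c \<phi> (scl b (Jel a k n) \<star> g) u = b * Lv (\<lambda>z. Lv (\<lambda>v. wk c (\<lambda>v. \<phi> (u @ v)) (z @ v)) g) (Jel a k n)"
    by (simp add: th_def Lv_conv Tfin_scl Jel_Tfin assms(2) Lv_scl)
  also have "\<dots> = scV (- b) (act (n, a, ffp k) (th c \<phi> g)) u"
    unfolding 3 4 by (simp add: fun_apply act_apply th_def Lv_def wk_def sum_negf)
  finally show "th c \<phi> (scl b (Jel a k n) \<star> g) u = scV (- b) (act (n, a, ffp k) (th c \<phi> g)) u" .
qed

lemma th_nmono:
  assumes "vacuum c \<phi>"
  shows "nmono ms \<in> Tfin \<and> (\<exists>s. s \<noteq> 0 \<and> th c \<phi> (nmono ms) = scV s (acts (map jl ms) \<phi>))"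
proof (induction ms)
  case Nil
  show ?case by (auto simp: Tfin_wd th_wd intro!: exI[of _ 1])
next
  case (Cons m ms)
  obtain a k i where m: "m = (a, k, i)" by (cases m) auto
  from Cons obtain s where s: "nmono ms \<in> Tfin" "s \<noteq> 0" "th c \<phi> (nmono ms) = scV s (acts (map jl ms) \<phi>)" by blast
  have "th c \<phi> (nmono (m # ms)) = scV (- fact i * s) (acts (map jl (m # ms)) \<phi>)"
    unfolding m nmono.simps th_Jel[OF assms s(1)] s(3) list.map acts_Cons act_scV by simp
  moreover have "nmono (m # ms) \<in> Tfin"
    unfolding m nmono.simps by (intro Tfin_conv Tfin_scl Jel_Tfin s(1))
  ultimately show ?case using s(2) by (intro conjI exI[of _ "- fact i * s"]) auto
qed

context
  fixes S :: "telt set" and c :: complex and \<phi> :: "xl list \<Rightarrow> complex"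
  assumes S: "S \<subseteq> Tfin"
begin

lemma th_lspan: "g \<in> lspan S \<Longrightarrow> th c \<phi> g \<in> vs.span (th c \<phi> ` S)"
proof (induction rule: lspan.induct)
  case (add f g)
  then show ?case using lspan_Tfin[OF _ S] by (simp add: th_add vs.span_add)
next
  case (scale f a)
  then show ?case using lspan_Tfin[OF _ S] by (simp add: th_scl vs.span_scale)
qed (auto simp: th_0 vs.span_zero intro: vs.span_base)

lemma span_th: "\<psi> \<in> vs.span (th c \<phi> ` S) \<Longrightarrow> \<exists>g\<in>lspan S. \<psi> = th c \<phi> g"
proof (induction rule: vs.span_induct_alt)
  case base
  show ?case by (rule bexI[OF _ lspan.zero]) (simp add: th_0)
next
  case (step a x y)
  then obtain f g where fg: "f \<in> S" "x = th c \<phi> f" "g \<in> lspan S" "y = th c \<phi> g" by blast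
  have T: "f \<in> Tfin" "g \<in> Tfin" using fg S lspan_Tfin by auto
  show ?case
    by (rule bexI[of _ "scl a f \<oplus> g"])
      (simp_all add: fg(2,4) T th_add th_scl Tfin_scl lspan.add[OF lspan.scale[OF lspan.base[OF fg(1)]] fg(3)])
qed

end

lemma nmonos_span:
  assumes "vacuum c \<phi>"
  shows "vs.span (th c \<phi> ` ({wd []} \<union> nmonos S)) = vs.span {acts (map jl ms) \<phi> | ms. \<forall>(a, k, i)\<in>set ms. (a, k) \<in> S}"
    and "{wd []} \<union> nmonos S \<subseteq> Tfin"
proof -
  let ?X = "{acts (map jl ms) \<phi> | ms. \<forall>(a, k, i)\<in>set ms. (a, k) \<in> S}"
  have e: "{wd []} \<union> nmonos S = nmono ` {ms. \<forall>(a, k, i)\<in>set ms. (a, k) \<in> S}"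
  proof -
    have "wd [] = nmono []" by simp
    then show ?thesis unfolding nmonos_def by (auto simp del: nmono.simps)
  qed
  show "{wd []} \<union> nmonos S \<subseteq> Tfin" unfolding e using th_nmono[OF assms] by blast
  show "vs.span (th c \<phi> ` ({wd []} \<union> nmonos S)) = vs.span ?X"
  proof
    show "vs.span (th c \<phi> ` ({wd []} \<union> nmonos S)) \<subseteq> vs.span ?X"
    proof (rule vs.span_minimal)
      show "th c \<phi> ` ({wd []} \<union> nmonos S) \<subseteq> vs.span ?X"
        unfolding e
      proof clarify
        fix ms :: "(mtyp \<times> nat \<times> nat) list" assume ms: "\<forall>(a, k, i)\<in>set ms. (a, k) \<in> S"
        obtain s where s: "th c \<phi> (nmono ms) = scV s (acts (map jl ms) \<phi>)" using th_nmono[OF assms] by blast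
        show "th c \<phi> (nmono ms) \<in> vs.span ?X" unfolding s by (intro vs.span_scale vs.span_base) (use ms in blast)
      qed
    qed simp
    show "vs.span ?X \<subseteq> vs.span (th c \<phi> ` ({wd []} \<union> nmonos S))"
    proof (rule vs.span_minimal)
      show "?X \<subseteq> vs.span (th c \<phi> ` ({wd []} \<union> nmonos S))"
      proof clarify
        fix ms :: "(mtyp \<times> nat \<times> nat) list" assume ms: "\<forall>(a, k, i)\<in>set ms. (a, k) \<in> S"
        obtain s where s: "s \<noteq> 0" "th c \<phi> (nmono ms) = scV s (acts (map jl ms) \<phi>)" using th_nmono[OF assms] by blast
        have "th c \<phi> (nmono ms) \<in> vs.span (th c \<phi> ` ({wd []} \<union> nmonos S))"
          unfolding e by (rule vs.span_base) (use ms in blast)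
        from vs.span_scale[OF this, of "1 / s"] show "acts (map jl ms) \<phi> \<in> vs.span (th c \<phi> ` ({wd []} \<union> nmonos S))"
          using s by simp
      qed
    qed simp
  qed
qed

lemma strongly_generates_iff:
  "strongly_generates (of_nat n) S \<longleftrightarrow>
     (\<forall>f\<in>Tfin. th (of_nat n) (vev n) f \<in> vs.span {acts (map jl ms) (vev n) | ms. \<forall>(a, k, i)\<in>set ms. (a, k) \<in> S})"
proof -
  let ?th = "th (of_nat n) (vev n)" and ?G = "{wd []} \<union> nmonos S"
  note G = nmonos_span(2)[OF vacuum_vev, of S] and sp = nmonos_span(1)[OF vacuum_vev[of n], of S, symmetric]
  have "(\<exists>g\<in>lspan ?G. f \<ominus> g \<in> SI (of_nat n)) \<longleftrightarrow> ?th f \<in> vs.span (?th ` ?G)" if f: "f \<in> Tfin" for f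
  proof -
    have "f \<ominus> g \<in> SI (of_nat n) \<longleftrightarrow> ?th f = ?th g" if "g \<in> lspan ?G" for g
      using SI_iff[OF Tfin_sub[OF f lspan_Tfin[OF that G]]] th_sub[OF f lspan_Tfin[OF that G]] by simp
    then have "(\<exists>g\<in>lspan ?G. f \<ominus> g \<in> SI (of_nat n)) \<longleftrightarrow> (\<exists>g\<in>lspan ?G. ?th f = ?th g)" by blast
    also have "\<dots> \<longleftrightarrow> ?th f \<in> vs.span (?th ` ?G)" using th_lspan[OF G] span_th[OF G] by metis
    finally show ?thesis .
  qed
  then show ?thesis unfolding strongly_generates_def sp by simp
qed

lemma generates: "strongly_generates (of_nat n) {(a, k). k < n}"
  unfolding strongly_generates_iff
proof
  fix f assume "f \<in> Tfin"
  let ?X = "{acts (map jl ms) (vev n) | ms. \<forall>(a, k, i)\<in>set ms. (a, k) \<in> {(a, k). k < n}}"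
  have "acts w (vev n) \<in> vs.span ?X" for w
  proof -
    interpret V: vacuum "of_nat n" "vev n" by (rule vacuum_vev)
    show ?thesis using V.strong_generation_words[OF decoupling, of w] by simp
  qed
  then show "th (of_nat n) (vev n) f \<in> vs.span ?X"
    unfolding th_alt by (intro vs.span_sum vs.span_scale)
qed

text \<open>\<open>vev n\<close> pairs only opposite degrees, so the component of degree
  \<open>d\<close> of a vector is its restriction to the words of degree \<open>- d\<close>.\<close>

lemma degree_projection:
  assumes "\<psi> \<in> vs.span {acts w (vev n) | w. P w}"
  shows "(\<lambda>u. if wxs 1 0 u = - d then \<psi> u else 0) \<in> vs.span {acts w (vev n) | w. P w \<and> wxs 1 0 w = d}"
    (is "?\<pi> \<psi> \<in> vs.span ?Y")
  using assms
proof (induction rule: vs.span_induct_alt)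
  case base
  have "?\<pi> 0 = 0" by (auto simp: fun_eq_iff fun_apply)
  then show ?case by (simp add: vs.span_zero)
next
  case (step a x y)
  then obtain w where w: "x = acts w (vev n)" "P w" by blast
  have "?\<pi> x \<in> vs.span ?Y"
  proof (cases "wxs 1 0 w = d")
    case True
    have "?\<pi> x = x" using vev_graded[of n _ 1 0] True by (fastforce simp: fun_eq_iff w acts_apply)
    then show ?thesis using w True by (auto intro: vs.span_base)
  next
    case False
    have "?\<pi> x = 0" using vev_graded[of n _ 1 0] False by (fastforce simp: fun_eq_iff fun_apply w acts_apply)
    then show ?thesis by (simp add: vs.span_zero)
  qed
  moreover have "?\<pi> (scV a x + y) = scV a (?\<pi> x) + ?\<pi> y" by (auto simp: fun_eq_iff fun_apply)
  ultimately show ?case using step(2) by (simp add: vs.span_add vs.span_scale)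
qed

text \<open>The missing generator has degree \<open>k0 + 1 \<le> n\<close>, which is the range of
  \<open>generators_independent\<close>.\<close>

lemma not_generates:
  assumes "k0 < n" "(a0, k0) \<notin> S"
  shows "\<not> strongly_generates (of_nat n) S"
proof
  interpret V: vacuum "of_nat n" "vev n" by (rule vacuum_vev)
  let ?P = "\<lambda>w. \<exists>ms. w = map jl ms \<and> (\<forall>(a, k, i)\<in>set ms. (a, k) \<in> S)"
  define m where "m = Suc k0"
  define Y where "Y = act (jl (a0, k0, 0)) (vev n)"
  assume sg: "strongly_generates (of_nat n) S"
  obtain s where s: "nmono [(a0, k0, 0)] \<in> Tfin" "s \<noteq> 0" "th (of_nat n) (vev n) (nmono [(a0, k0, 0)]) = scV s Y"
  proof -
    have "acts (map jl [(a0, k0, 0)]) (vev n) = Y" by (simp add: Y_def act_def)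
    then show ?thesis using th_nmono[OF vacuum_vev[of n], of "[(a0, k0, 0)]"] that by metis
  qed
  have X: "{acts (map jl ms) (vev n) | ms. \<forall>(a, k, i)\<in>set ms. (a, k) \<in> S} = {acts w (vev n) | w. ?P w}" by blast
  have "scV s Y \<in> vs.span {acts w (vev n) | w. ?P w}"
    using bspec[OF sg[unfolded strongly_generates_iff X] s(1)] unfolding s(3) .
  from vs.span_scale[OF this, of "1 / s"] have "Y \<in> vs.span {acts w (vev n) | w. ?P w}" using s(2) by simp
  from degree_projection[OF this, of "int m"]
  have Ym: "Y \<in> vs.span {acts w (vev n) | w. ?P w \<and> wxs 1 0 w = int m}"
  proof -
    have "(\<lambda>u. if wxs 1 0 u = - int m then Y u else 0) = Y"
      using vev_graded[of n _ 1 0] by (fastforce simp: fun_eq_iff Y_def act_apply m_def)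
    then show ?thesis using degree_projection[OF \<open>Y \<in> _\<close>, of "int m"] by simp
  qed
  \<comment> \<open>Decomposable up to single letters whose \<open>a0\<close> part has no term of
    degree \<open>k0\<close>. The monomials of degree \<open>m\<close> over \<open>S\<close> have
    this property: a single letter of type \<open>a0\<close> among them has
    \<open>k < k0\<close>.\<close>
  define Q where "Q \<psi> \<longleftrightarrow> (\<exists>F. (\<forall>a. degree (F a) < m) \<and> coeff (F a0) (m - 1) = 0
     \<and> \<psi> - (\<Sum>a\<in>V.AL. act (- int m, a, F a) (vev n)) \<in> V.CA (int m))" for \<psi>
  have CA0: "\<psi> \<in> V.CA (int m) \<Longrightarrow> Q \<psi>" for \<psi>
    unfolding Q_def by (rule exI[of _ "\<lambda>_. 0"]) (simp add: act_poly_0[OF V.lie] m_def)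
  have gen: "Q (acts (map jl ms) (vev n))" if ms: "\<forall>(a, k, i)\<in>set ms. (a, k) \<in> S" "wxs 1 0 (map jl ms) = int m" for ms
  proof (cases "length ms \<ge> 2")
    case True
    have "\<forall>x\<in>set (map jl ms). cre x" using jl_cre by (auto simp del: cre.simps jl.simps)
    then show ?thesis using True ms(2) by (intro CA0 V.CA_word) auto
  next
    case False
    then obtain a k i where ms1: "ms = [(a, k, i)]"
      using ms(2) by (cases ms; cases "tl ms") (auto simp: m_def)
    have k: "1 + i + k = m" and aS: "(a, k) \<in> S" using ms by (auto simp: ms1)
    define F where "F b = (if b = a then ffp k else 0)" for b
    have "(\<Sum>b\<in>V.AL. act (- int m, b, F b) (vev n)) = (\<Sum>b\<in>V.AL. if b = a then act (- int m, a, ffp k) (vev n) else 0)"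
      by (rule sum.cong) (auto simp: F_def act_poly_0[OF V.lie])
    also have "\<dots> = act (- int m, a, ffp k) (vev n)" by (subst sum.delta) simp_all
    also have "\<dots> = acts (map jl ms) (vev n)"
    proof -
      have "- int m = - 1 - int i - int k" using k by simp
      then show ?thesis by (simp add: ms1 act_def)
    qed
    finally have "(\<Sum>b\<in>V.AL. act (- int m, b, F b) (vev n)) = acts (map jl ms) (vev n)" .
    moreover have "degree (F b) < m" for b using k by (auto simp: F_def degree_ffp)
    moreover have "coeff (F a0) (m - 1) = 0"
    proof (cases "a = a0")
      case True
      then have "k \<noteq> k0" using aS assms(2) by auto
      then show ?thesis using k by (auto simp: F_def m_def degree_ffp intro!: coeff_eq_0)
    qed (simp add: F_def)
    ultimately show ?thesis unfolding Q_def by (intro exI[of _ F]) (simp add: V.CA_0)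
  qed
  have "Q Y"
    using Ym
  proof (induction rule: vs.span_induct_alt)
    case base
    show ?case by (rule CA0) (rule V.CA_0)
  next
    case (step b x y)
    from step(1) have "Q x" using gen by blast
    then obtain F where F: "\<And>a. degree (F a) < m" "coeff (F a0) (m - 1) = 0"
      "x - (\<Sum>a\<in>V.AL. act (- int m, a, F a) (vev n)) \<in> V.CA (int m)" unfolding Q_def by blast
    from step(2) obtain G where G: "\<And>a. degree (G a) < m" "coeff (G a0) (m - 1) = 0"
      "y - (\<Sum>a\<in>V.AL. act (- int m, a, G a) (vev n)) \<in> V.CA (int m)" unfolding Q_def by blast
    have "(\<Sum>a\<in>V.AL. act (- int m, a, smult b (F a) + smult 1 (G a)) (vev n))
      = scV b (\<Sum>a\<in>V.AL. act (- int m, a, F a) (vev n)) + (\<Sum>a\<in>V.AL. act (- int m, a, G a) (vev n))"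
      unfolding act_poly[OF V.lie] by (simp add: sum.distrib vs.scale_sum_right)
    then have e: "scV b x + y - (\<Sum>a\<in>V.AL. act (- int m, a, smult b (F a) + smult 1 (G a)) (vev n))
       = scV b (x - (\<Sum>a\<in>V.AL. act (- int m, a, F a) (vev n))) + (y - (\<Sum>a\<in>V.AL. act (- int m, a, G a) (vev n)))"
      by (simp only: vs.scale_right_diff_distrib add_diff_add)
    have dg: "degree (smult b (F a) + smult 1 (G a)) < m" for a
      using F(1)[of a] G(1)[of a] degree_smult_le[of b "F a"] by (intro degree_add_less) auto
    show ?case unfolding Q_def
    proof (intro exI[of _ "\<lambda>a. smult b (F a) + smult 1 (G a)"] conjI allI)
      show "scV b x + y - (\<Sum>a\<in>V.AL. act (- int m, a, smult b (F a) + smult 1 (G a)) (vev n)) \<in> V.CA (int m)"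
        unfolding e by (intro V.CA_add V.CA_scale F(3) G(3))
    qed (use dg F(2) G(2) in simp_all)
  qed
  then obtain F where F: "\<And>a. degree (F a) < m" "coeff (F a0) (m - 1) = 0"
    "Y - (\<Sum>a\<in>V.AL. act (- int m, a, F a) (vev n)) \<in> V.CA (int m)" unfolding Q_def by blast
  \<comment> \<open>The generator minus the single letters of its supposed expression. Its
    coefficient of degree \<open>k0\<close> has to vanish, yet it is the leading coefficient of
    \<open>ffp k0\<close>.\<close>
  define G where "G a = smult (if a = a0 then 1 else 0) (ffp k0) + smult (- 1) (F a)" for a
  have "(\<Sum>a\<in>V.AL. act (- int m, a, G a) (vev n)) = Y - (\<Sum>a\<in>V.AL. act (- int m, a, F a) (vev n))"
  proof -
    have "(\<Sum>a\<in>V.AL. scV (if a = a0 then 1 else 0) (act (- int m, a, ffp k0) (vev n))) = (\<Sum>a\<in>V.AL. if a = a0 then Y else 0)"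
      by (rule sum.cong) (auto simp: Y_def m_def)
    then show ?thesis
      unfolding G_def act_poly[OF V.lie] by (simp add: sum_subtractf)
  qed
  then have "(\<Sum>a\<in>V.AL. act (- int m, a, G a) (vev n)) \<in> V.CC (Suc m) (int m)"
    using F(3) unfolding V.CA_def by simp
  moreover have "degree (G a) < m" for a
    using F(1)[of a] degree_smult_le[of "if a = a0 then 1 else 0" "ffp k0"] unfolding G_def
    by (intro degree_add_less) (auto simp: degree_ffp m_def)
  moreover have "vev n \<noteq> 0"
  proof
    assume "vev n = 0"
    then have "vev n [] = 0" by (simp add: fun_apply)
    then show False by simp
  qed
  ultimately have "coeff (G a0) (m - 1) = 0"
    using assms(1) by (intro V.generators_independent[of n m G a0]) (auto simp: m_def)
  then have "coeff (ffp k0) k0 = 0" using F(2) by (simp add: G_def m_def)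
  then show False using ffp_nz[of k0] degree_ffp[of k0] by (metis leading_coeff_0_iff)
qed

theorem mainTheorem5:
  fixes n :: nat
  assumes "n \<ge> 1"
  shows "strongly_generates (of_nat n) {(a, k). k < n}
         \<and> (\<forall>S'. S' \<subset> {(a, k). k < n} \<longrightarrow> \<not> strongly_generates (of_nat n) S')"
proof (intro conjI allI impI)
  fix S' :: "(mtyp \<times> nat) set" assume "S' \<subset> {(a, k). k < n}"
  then obtain a k where "k < n" "(a, k) \<notin> S'" by blast
  then show "\<not> strongly_generates (of_nat n) S'" by (rule not_generates)
qed (rule generates)

end
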